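(* Assume $\mu\le H^2$ and $p\ge\frac{2+\alpha_+}{\alpha_+}$. If $u\in C(\overline\Omega\setminus\Sigma)$ is a nonnegative solution of $$-L_\mu u+|u|^{p-1}u=0\quad\text{in }\Omega\setminus\Sigma$$ in the sense of distributions in $\Omega\setminus\Sigma$ such that $$\lim_{x\in\Omega\setminus\Sigma,\ x\to\xi}\frac{u(x)}{\tilde W(x)}=0\qquad\forall\,\xi\in\partial\Omega,$$ locally uniformly in $\partial\Omega$, then $u\equiv0$.
   Context: $N\ge3$; $\Omega\subset\mathbb R^N$ is a $C^2$ bounded domain; $\Sigma\subset\Omega$ is a compact $C^2$ submanifold without boundary of dimension $k$, $0\le k<N-2$ (if $k=0$, $\Sigma=\{0\}$). $d_\Sigma(x)=\mathrm{dist}(x,\Sigma)$, $H=\frac{N-k-2}{2}$, $\mu\le H^2$, $\alpha_\pm=H\pm\sqrt{H^2-\mu}$, $L_\mu=\Delta+\mu d_\Sigma^{-2}$ in $\Omega\setminus\Sigma$. Let $\lambda_\mu=\inf\{\int_\Omega(|\nabla u|^2-\mu d_\Sigma^{-2}u^2)\,dx: u\in C^1_c(\Omega),\int_\Omega u^2dx=1\}$; it is assumed that $\lambda_\mu>0$. Weight $\tilde W$. $\Sigma_\beta=\{x\in\mathbb R^N\setminus\Sigma: d_\Sigma(x)<\beta\}$; $\beta_0>0$ is a fixed small constant depending on $\Omega,\Sigma$ (with $\Sigma_{6\beta_0}\Subset\Omega$, unique nearest points on $\Sigma$ in $\Sigma_{6\beta_0}$, $d_\Sigma\in C^2(\Sigma_{4\beta_0})$).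 $\eta_{\beta_0}$ is smooth, $0\le\eta_{\beta_0}\le1$, $\eta_{\beta_0}=1$ in $\overline\Sigma_{\beta_0/4}$, $\mathrm{supp}\,\eta_{\beta_0}\subset\Sigma_{\beta_0/2}$. $W=d_\Sigma^{-\alpha_+}$ if $\mu<H^2$, $W=d_\Sigma^{-H}|\ln d_\Sigma|$ if $\mu=H^2$; $\tilde W=1-\eta_{\beta_0}+\eta_{\beta_0}W$ in $\Omega\setminus\Sigma$. *)

theory Defs
  imports "HOL-Analysis.Analysis"
begin

section \<open>Differentiability classes\<close>

text \<open>Membership in the class \<open>C\<^sup>n\<close>, for functions on an open subset of a finite-dimensional
  space, by recursion through the directional derivatives.\<close>

primrec Ck_on :: "nat \<Rightarrow> 'a::euclidean_space set \<Rightarrow> ('a \<Rightarrow> 'b::real_normed_vector) \<Rightarrow> bool" where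
  "Ck_on 0 S f \<longleftrightarrow> continuous_on S f"
| "Ck_on (Suc n) S f \<longleftrightarrow>
     (\<forall>x\<in>S. f differentiable (at x)) \<and> (\<forall>v. Ck_on n S (\<lambda>x. frechet_derivative f (at x) v))"

definition smooth_fun :: "('a::euclidean_space \<Rightarrow> 'b::real_normed_vector) \<Rightarrow> bool" where
  "smooth_fun f \<longleftrightarrow> (\<forall>n. Ck_on n UNIV f)"

definition supp :: "('a::topological_space \<Rightarrow> real) \<Rightarrow> 'a set" where
  "supp f = closure {x. f x \<noteq> 0}"

text \<open>Compactly supported functions on an open set \<open>U\<close> are represented by their extension
  by zero to the whole space.\<close>

definition C1c :: "'a::euclidean_space set \<Rightarrow> ('a \<Rightarrow> real) set" where
  "C1c U = {f. Ck_on 1 UNIV f \<and> compact (supp f) \<and> supp f \<subseteq> U}"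

definition test_functions :: "'a::euclidean_space set \<Rightarrow> ('a \<Rightarrow> real) set" where
  "test_functions U = {f. smooth_fun f \<and> compact (supp f) \<and> supp f \<subseteq> U}"

definition partial :: "'a::euclidean_space \<Rightarrow> ('a \<Rightarrow> real) \<Rightarrow> 'a \<Rightarrow> real" where
  "partial b f x = frechet_derivative f (at x) b"

definition grad_norm_sq :: "('a::euclidean_space \<Rightarrow> real) \<Rightarrow> 'a \<Rightarrow> real" where
  "grad_norm_sq f x = (\<Sum>b\<in>Basis. (partial b f x)\<^sup>2)"

definition laplacian :: "('a::euclidean_space \<Rightarrow> real) \<Rightarrow> 'a \<Rightarrow> real" where
  "laplacian f x = (\<Sum>b\<in>Basis. partial b (partial b f) x)"

section \<open>The domain and the singular set\<close>

text \<open>Near each boundary point the domain is the region above a \<open>C\<^sup>2\<close> graph over a hyperplane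
  orthogonal to some unit vector \<open>\<nu>\<close>.  The graph function is composed with the
  orthogonal projection, so that it is a function on the whole space.\<close>

definition C2_boundary :: "'a::euclidean_space set \<Rightarrow> bool" where
  "C2_boundary \<Omega> \<longleftrightarrow>
     (\<forall>\<xi>\<in>frontier \<Omega>. \<exists>r>0. \<exists>\<nu> \<gamma>. norm \<nu> = 1 \<and> Ck_on 2 UNIV (\<gamma> :: 'a \<Rightarrow> real) \<and>
        \<Omega> \<inter> ball \<xi> r = {x \<in> ball \<xi> r. x \<bullet> \<nu> > \<gamma> (x - (x \<bullet> \<nu>) *\<^sub>R \<nu>)})"

definition C2_bounded_domain :: "'a::euclidean_space set \<Rightarrow> bool" where
  "C2_bounded_domain \<Omega> \<longleftrightarrow>
     open \<Omega> \<and> connected \<Omega> \<and> \<Omega> \<noteq> {} \<and> bounded \<Omega> \<and> C2_boundary \<Omega>"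

text \<open>Embedded submanifolds by means of slice charts: locally, a \<open>C\<^sup>2\<close> diffeomorphism of open
  subsets of the ambient space carries the set to a \<open>k\<close>-dimensional linear subspace.
  Such a set has no boundary as a manifold.\<close>

definition C2_submanifold :: "nat \<Rightarrow> 'a::euclidean_space set \<Rightarrow> bool" where
  "C2_submanifold k M \<longleftrightarrow>
     (\<forall>p\<in>M. \<exists>U V \<Phi> \<Psi> (S :: 'a set).
        open U \<and> p \<in> U \<and> open V \<and> homeomorphism U V \<Phi> \<Psi> \<and> Ck_on 2 U \<Phi> \<and> Ck_on 2 V \<Psi> \<and>
        subspace S \<and> dim S = k \<and> \<Phi> ` (M \<inter> U) = V \<inter> S)"

text \<open>The singular set is nonempty, so that \<open>infdist x \<Sigma>\<close> is the distance to it
  (\<open>infdist x {} = 0\<close> by convention).\<close>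

definition singular_set :: "nat \<Rightarrow> 'a::euclidean_space set \<Rightarrow> 'a set \<Rightarrow> bool" where
  "singular_set k \<Omega> \<Sigma> \<longleftrightarrow>
     \<Sigma> \<noteq> {} \<and> \<Sigma> \<subseteq> \<Omega> \<and> compact \<Sigma> \<and> C2_submanifold k \<Sigma> \<and> (k = 0 \<longrightarrow> \<Sigma> = {0})"

section \<open>The Hardy operator\<close>

definition Hconst :: "nat \<Rightarrow> nat \<Rightarrow> real" where
  "Hconst N k = (real N - real k - 2) / 2"

definition alpha_plus :: "nat \<Rightarrow> nat \<Rightarrow> real \<Rightarrow> real" where
  "alpha_plus N k \<mu> = Hconst N k + sqrt ((Hconst N k)\<^sup>2 - \<mu>)"

definition L_op :: "'a::euclidean_space set \<Rightarrow> real \<Rightarrow> ('a \<Rightarrow> real) \<Rightarrow> 'a \<Rightarrow> real" where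
  "L_op \<Sigma> \<mu> f x = laplacian f x + \<mu> / (infdist x \<Sigma>)\<^sup>2 * f x"

text \<open>The infimum is taken in the extended reals, so that it is meaningful irrespective of
  any lower bound.\<close>

definition lambda_hardy :: "'a::euclidean_space set \<Rightarrow> 'a set \<Rightarrow> real \<Rightarrow> ereal" where
  "lambda_hardy \<Omega> \<Sigma> \<mu> =
     (INF u \<in> {u \<in> C1c \<Omega>. (LINT x:\<Omega>|lborel. (u x)\<^sup>2) = 1}.
        ereal (LINT x:\<Omega>|lborel. grad_norm_sq u x - \<mu> / (infdist x \<Sigma>)\<^sup>2 * (u x)\<^sup>2))"

text \<open>Distributional solutions in \<open>U\<close> of \<open>-L_\<mu> u + |u|\<^sup>p\<^sup>-\<^sup>1 u = 0\<close>, for \<open>u\<close> continuous on \<open>U\<close>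
  (so that both integrands below are integrable).  The operator is formally self-adjoint.\<close>

definition distributional_solution ::
  "'a::euclidean_space set \<Rightarrow> 'a set \<Rightarrow> real \<Rightarrow> real \<Rightarrow> ('a \<Rightarrow> real) \<Rightarrow> bool" where
  "distributional_solution U \<Sigma> \<mu> p u \<longleftrightarrow>
     (\<forall>\<phi> \<in> test_functions U.
        - (LINT x:U|lborel. u x * L_op \<Sigma> \<mu> \<phi> x)
        + (LINT x:U|lborel. \<bar>u x\<bar> powr (p - 1) * u x * \<phi> x) = 0)"

section \<open>The weight\<close>

definition tube :: "'a::euclidean_space set \<Rightarrow> real \<Rightarrow> 'a set" where
  "tube \<Sigma> \<beta> = {x. x \<notin> \<Sigma> \<and> infdist x \<Sigma> < \<beta>}"

definition admissible_radius :: "'a::euclidean_space set \<Rightarrow> 'a set \<Rightarrow> real \<Rightarrow> bool" where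
  "admissible_radius \<Omega> \<Sigma> \<beta> \<longleftrightarrow>
     \<beta> > 0 \<and>
     compact (closure (tube \<Sigma> (6 * \<beta>))) \<and> closure (tube \<Sigma> (6 * \<beta>)) \<subseteq> \<Omega> \<and>
     (\<forall>x \<in> tube \<Sigma> (6 * \<beta>). \<exists>!y. y \<in> \<Sigma> \<and> dist x y = infdist x \<Sigma>) \<and>
     Ck_on 2 (tube \<Sigma> (4 * \<beta>)) (\<lambda>x. infdist x \<Sigma>)"

text \<open>Since the cut-off function equals 1 on the closure of a tube, which contains \<open>\<Sigma>\<close>, its
  support can only be required to lie in the tube with \<open>\<Sigma>\<close> itself added.\<close>

definition tube_cutoff :: "'a::euclidean_space set \<Rightarrow> real \<Rightarrow> ('a \<Rightarrow> real) \<Rightarrow> bool" where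
  "tube_cutoff \<Sigma> \<beta> \<eta> \<longleftrightarrow>
     smooth_fun \<eta> \<and> (\<forall>x. 0 \<le> \<eta> x \<and> \<eta> x \<le> 1) \<and>
     (\<forall>x \<in> closure (tube \<Sigma> (\<beta> / 4)). \<eta> x = 1) \<and>
     supp \<eta> \<subseteq> \<Sigma> \<union> tube \<Sigma> (\<beta> / 2)"

text \<open>Only used for \<open>\<mu> \<le> H\<^sup>2\<close> and off \<open>\<Sigma>\<close>.\<close>

definition W_weight :: "nat \<Rightarrow> 'a::euclidean_space set \<Rightarrow> real \<Rightarrow> 'a \<Rightarrow> real" where
  "W_weight k \<Sigma> \<mu> x =
     (if \<mu> < (Hconst DIM('a) k)\<^sup>2
      then infdist x \<Sigma> powr (- alpha_plus DIM('a) k \<mu>)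
      else infdist x \<Sigma> powr (- Hconst DIM('a) k) * \<bar>ln (infdist x \<Sigma>)\<bar>)"

definition W_tilde ::
  "nat \<Rightarrow> 'a::euclidean_space set \<Rightarrow> real \<Rightarrow> ('a \<Rightarrow> real) \<Rightarrow> 'a \<Rightarrow> real" where
  "W_tilde k \<Sigma> \<mu> \<eta> x = 1 - \<eta> x + \<eta> x * W_weight k \<Sigma> \<mu> x"

text \<open>\<open>g x\<close> tends to 0 as \<open>x \<in> D\<close> tends to \<open>\<xi>\<close>, for all \<open>\<xi> \<in> B\<close>, locally uniformly in \<open>\<xi>\<close>.\<close>

definition tends_to_zero_loc_unif ::
  "('a::metric_space \<Rightarrow> real) \<Rightarrow> 'a set \<Rightarrow> 'a set \<Rightarrow> bool" where
  "tends_to_zero_loc_unif g D B \<longleftrightarrow>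
     (\<forall>\<xi>\<^sub>0\<in>B. \<exists>r>0. \<forall>\<epsilon>>0. \<exists>\<delta>>0. \<forall>\<xi> \<in> B \<inter> ball \<xi>\<^sub>0 r. \<forall>x\<in>D. dist x \<xi> < \<delta> \<longrightarrow> \<bar>g x\<bar> < \<epsilon>)"

end

theory Submission
  imports Defs
begin

text \<open>The proof tests the equation with \<open>j(u) j'(u) \<zeta>\<^sup>2\<close>, where \<open>j\<close> is a smooth convex truncation of the identity vanishing for small values, hence near the boundary of \<open>\<Omega>\<close>, and \<open>\<zeta>\<close>
  is a cutoff that vanishes near \<open>\<Sigma>\<close>. As the spectrum of \<open>-L\<^sub>\<mu>\<close> is positive, the quadratic form is nonnegative on \<open>j(u) \<zeta>\<close>, and up to an error of the
  size of the truncation level one obtains \<open>\<integral> u\<^bsup>p + 1\<^esup> \<zeta>\<^sup>2 \<le> \<integral> u\<^sup>2 |\<nabla>\<zeta>|\<^sup>2\<close>. If \<open>\<zeta>\<close> rises from 0 to 1 on the shell \<open>{\<tau> \<le> d \<le> 2 \<tau>}\<close>, the right-hand side is bounded by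
  the integral of \<open>u\<^sup>2 / d\<^sup>2\<close> over this shell. So everything reduces to the statement that these integrals tend to zero along a sequence of radii:
  the singularity on \<open>\<Sigma>\<close> is removable.

  This is where the critical exponent enters. Put \<open>\<sigma>\<^sup>2 = H\<^sup>2 - \<mu>\<close>, so that \<open>\<alpha>\<^sub>+ = H + \<sigma>\<close>. In a thin tube around \<open>\<Sigma>\<close> the Hardy inequality holds with the sharp
  constant \<open>H\<^sup>2\<close> (\<open>hardy_tube\<close>), and the same test with a radial cutoff \<open>\<zeta> = G(d)\<close> gives
  \<open>\<integral> u\<^bsup>p + 1\<^esup> G(d)\<^sup>2 + \<integral> u\<^sup>2 (\<sigma>\<^sup>2 G(d)\<^sup>2 / d\<^sup>2 - G'(d)\<^sup>2) \<le> 0\<close>. For \<open>G = d\<^sup>\<sigma>\<close> the second integrand vanishes identically. Cutting this profile off on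
  \<open>{\<tau> \<le> d \<le> 2 \<tau>}\<close> costs an error that is absorbed by Young's inequality; the remainder is bounded uniformly in \<open>\<tau>\<close> for \<open>p \<ge> (2 + \<alpha>\<^sub>+) / \<alpha>\<^sub>+\<close>,
  because the volume of the shell is at most of order \<open>\<tau>\<^bsup>N - k\<^esup>\<close>. Hence \<open>u\<^bsup>p + 1\<^esup> d\<^bsup>2 \<sigma>\<^esup>\<close> is integrable (\<open>energy_bounded\<close>), and the shell integrals of \<open>u\<^sup>2 d\<^bsup>2 \<sigma> - 2\<^esup>\<close>
  tend to zero (\<open>weighted_shells_vanish\<close>). For \<open>\<sigma> > 0\<close> the profile is then replaced by one that is proportional to \<open>d\<^sup>\<sigma>\<close> for \<open>d\<close> much smaller than \<open>\<delta>\<close>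
  and constant beyond; letting first the inner cutoff and then \<open>\<delta>\<close> tend to zero removes the weight (\<open>gradient_shells_vanish\<close>).

  The geometry of \<open>\<Sigma>\<close> is used only through \<open>\<Delta>d \<ge> (N - k - 1) / d - C\<close> in the tube (\<open>laplacian_d_lower\<close>). The derivative of the nearest point map has rank
  at most \<open>k\<close>, and the Hessian of \<open>d\<close> is bounded below because a ball centred on the normal ray touches \<open>\<Sigma>\<close> from outside. This inequality yields the
  Hardy inequality as well as the volume bound (\<open>shell_volume\<close>), both by integrating the divergence of radial fields.

  The solution is only known to be continuous and to satisfy the equation in the sense of distributions. The energy inequality is proved for
  mollifications; the term with their gradients has a sign, so that bounded pointwise convergence of the functions and of their Laplacians is
  enough to pass to the limit (\<open>weak_energy_inequality\<close>).\<close>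

section \<open>Calculus of continuously differentiable functions\<close>

lemma C1_iff:
  "Ck_on 1 S f \<longleftrightarrow> (\<forall>x\<in>S. f differentiable (at x)) \<and>
     (\<forall>v. continuous_on S (\<lambda>x. frechet_derivative f (at x) v))"
  by simp

lemma C1_partial_iff:
  "Ck_on 1 S f \<longleftrightarrow> (\<forall>x\<in>S. f differentiable (at x)) \<and> (\<forall>v. continuous_on S (partial v f))"
  by (simp add: partial_def[abs_def])

lemma C1I:
  assumes "\<And>x. x \<in> S \<Longrightarrow> (f has_derivative D x) (at x)" "\<And>v. continuous_on S (\<lambda>x. D x v)"
  shows "Ck_on 1 S f"
proof -
  have "frechet_derivative f (at x) = D x" if "x \<in> S" for x
    using assms(1)[OF that] frechet_derivative_at by metis
  then show ?thesis
    unfolding C1_iff using assms by (auto simp: differentiable_def cong: continuous_on_cong)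
qed

lemma C1_has_derivative:
  "Ck_on 1 S f \<Longrightarrow> x \<in> S \<Longrightarrow> (f has_derivative (\<lambda>v. partial v f x)) (at x)"
  by (auto simp: C1_iff partial_def frechet_derivative_works)

lemma C1_differentiable: "Ck_on 1 S f \<Longrightarrow> x \<in> S \<Longrightarrow> f differentiable (at x)"
  by (auto simp: C1_iff)

lemma C1_continuous_on: "Ck_on 1 S f \<Longrightarrow> continuous_on S f"
  by (meson C1_differentiable continuous_at_imp_continuous_on differentiable_imp_continuous_within)

lemma C1_continuous_partial: "Ck_on 1 S f \<Longrightarrow> continuous_on S (partial v f)"
  unfolding C1_partial_iff by blast

lemma Ck_mono: "Ck_on n S f \<Longrightarrow> T \<subseteq> S \<Longrightarrow> Ck_on n T f"
  by (induction n arbitrary: f) (auto intro: continuous_on_subset)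

text \<open>The derivatives in \<^const>\<open>Ck_on\<close> are taken with respect to the whole space, so on open sets the property is local
  and can be glued.\<close>

lemma Ck_Un: "open A \<Longrightarrow> open B \<Longrightarrow> Ck_on n A f \<Longrightarrow> Ck_on n B f \<Longrightarrow> Ck_on n (A \<union> B) f"
  by (induction n arbitrary: f) (auto intro: continuous_on_open_Un)

lemma Ck_cong:
  assumes "open S" "\<And>x. x \<in> S \<Longrightarrow> f x = g x" "Ck_on n S f"
  shows "Ck_on n S g"
  using assms(2,3)
proof (induction n arbitrary: f g)
  case 0
  then show ?case using continuous_on_cong[of S S f g] by auto
next
  case (Suc n)
  have D: "(g has_derivative frechet_derivative f (at x)) (at x)" if "x \<in> S" for x
  proof -
    have "(f has_derivative frechet_derivative f (at x)) (at x)"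
      using Suc.prems(2) that by (auto simp: frechet_derivative_works)
    then show ?thesis
      using has_derivative_transform_within_open[OF _ \<open>open S\<close> that] Suc.prems(1) by auto
  qed
  have eq: "frechet_derivative f (at x) = frechet_derivative g (at x)" if "x \<in> S" for x
    using frechet_derivative_at[OF D[OF that]] .
  show ?case
  proof (simp, intro conjI ballI allI)
    fix x assume "x \<in> S" then show "g differentiable (at x)" using D by (auto simp: differentiable_def)
  next
    fix v
    show "Ck_on n S (\<lambda>x. frechet_derivative g (at x) v)"
      by (rule Suc.IH[of "\<lambda>x. frechet_derivative f (at x) v"]) (use eq Suc.prems(2) in auto)
  qed
qed

lemma Ck_zero: "Ck_on n S (\<lambda>x. 0)"
  by (induction n) auto

lemma C1_const: "Ck_on 1 S (\<lambda>x. c)"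
  by (rule C1I[where D="\<lambda>x v. 0"]) auto

lemma Ck_extend_by_zero:
  assumes "open S" "Ck_on n S f" "closed K" "K \<subseteq> S" "\<And>x. x \<notin> K \<Longrightarrow> f x = 0"
  shows "Ck_on n UNIV f"
proof -
  have "Ck_on n (- K) f"
    by (rule Ck_cong[of _ "\<lambda>x. 0"]) (use assms in \<open>auto intro: Ck_zero\<close>)
  then have "Ck_on n (S \<union> - K) f" using assms by (intro Ck_Un) auto
  moreover have "S \<union> - K = UNIV" using assms by auto
  ultimately show ?thesis by simp
qed

lemma continuous_extend_by_zero:
  fixes f :: "'a::euclidean_space \<Rightarrow> 'b::real_normed_vector"
  assumes "open S" "continuous_on S f" "closed K" "K \<subseteq> S" "\<And>x. x \<notin> K \<Longrightarrow> f x = 0"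
  shows "continuous_on UNIV f"
  using Ck_extend_by_zero[of S 0 f K] assms by simp

lemma C1_mult:
  fixes f g :: "'a::euclidean_space \<Rightarrow> real"
  assumes "Ck_on 1 S f" "Ck_on 1 S g" shows "Ck_on 1 S (\<lambda>x. f x * g x)"
proof (rule C1I)
  fix x assume x: "x \<in> S"
  show "((\<lambda>x. f x * g x) has_derivative (\<lambda>v. f x * partial v g x + partial v f x * g x)) (at x)"
    by (rule has_derivative_mult[OF C1_has_derivative[OF assms(1) x] C1_has_derivative[OF assms(2) x]])
next
  fix v
  show "continuous_on S (\<lambda>x. f x * partial v g x + partial v f x * g x)"
    using assms by (intro continuous_intros C1_continuous_on C1_continuous_partial)
qed

lemma C1_comp:
  fixes f :: "'a::euclidean_space \<Rightarrow> real"
  assumes "Ck_on 1 S f" "\<And>x. x \<in> S \<Longrightarrow> f x \<in> T"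
    "\<And>t. t \<in> T \<Longrightarrow> (h has_real_derivative h' t) (at t)" "continuous_on T h'"
  shows "Ck_on 1 S (\<lambda>x. h (f x))"
proof (rule C1I)
  fix x assume x: "x \<in> S"
  show "((\<lambda>x. h (f x)) has_derivative (\<lambda>v. h' (f x) * partial v f x)) (at x)"
    using has_derivative_compose[OF C1_has_derivative[OF assms(1) x], of h "\<lambda>y. h' (f x) * y"]
      assms(3)[OF assms(2)[OF x]] by (simp add: has_field_derivative_def)
next
  fix v
  show "continuous_on S (\<lambda>x. h' (f x) * partial v f x)"
    using assms by (intro continuous_intros C1_continuous_partial continuous_on_compose2[OF assms(4)] C1_continuous_on) auto
qed

lemma partial_eqI: "(f has_derivative D) (at x) \<Longrightarrow> partial v f x = D v"
  unfolding partial_def using frechet_derivative_at by metis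

lemma partial_has_derivative:
  "f differentiable (at x) \<Longrightarrow> (f has_derivative (\<lambda>v. partial v f x)) (at x)"
  by (simp add: partial_def frechet_derivative_works)

lemma partial_mult:
  "f differentiable (at x) \<Longrightarrow> g differentiable (at x) \<Longrightarrow>
     partial v (\<lambda>x. f x * g x) x = f x * partial v g x + partial v f x * g x"
  by (rule partial_eqI[OF has_derivative_mult[OF partial_has_derivative partial_has_derivative]])

lemma partial_comp:
  assumes "f differentiable (at x)" "(h has_real_derivative c) (at (f x))"
  shows "partial v (\<lambda>x. h (f x)) x = c * partial v f x"
  using has_derivative_compose[OF partial_has_derivative[OF assms(1)], of h "\<lambda>y. c * y"] assms(2)
  by (intro partial_eqI) (simp add: has_field_derivative_def)

lemma partial_cong:
  assumes "open S" "x \<in> S" "\<And>y. y \<in> S \<Longrightarrow> f y = g y"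
  shows "partial v f x = partial v g x"
proof -
  have "(f has_derivative D) (at x) \<longleftrightarrow> (g has_derivative D) (at x)" for D
    using has_derivative_transform_within_open[OF _ assms(1,2)] assms(3) by metis
  then show ?thesis unfolding partial_def frechet_derivative_def by simp
qed

lemma partial_const: "partial v (\<lambda>x. c) x = 0"
  by (rule partial_eqI[of _ "\<lambda>v. 0"]) auto

lemma partial_zero_off:
  assumes "closed K" "\<And>x. x \<notin> K \<Longrightarrow> f x = 0" "x \<notin> K" shows "partial v f x = 0"
  using partial_cong[of "- K" x f "\<lambda>x. 0" v] assms by (auto simp: partial_const)

lemma partial_linear:
  assumes "f differentiable (at x)"
  shows "linear (\<lambda>v. partial v f x)"
  using partial_has_derivative[OF assms] has_derivative_linear by blast

lemma partial_expand:
  assumes "f differentiable (at x)"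
  shows "partial v f x = (\<Sum>b\<in>Basis. (v \<bullet> b) * partial b f x)"
proof -
  have "partial v f x = partial (\<Sum>b\<in>Basis. (v \<bullet> b) *\<^sub>R b) f x" by (simp add: euclidean_representation)
  also have "\<dots> = (\<Sum>b\<in>Basis. (v \<bullet> b) * partial b f x)"
    using linear_sum[OF partial_linear[OF assms], of "\<lambda>b. (v \<bullet> b) *\<^sub>R b" Basis] linear_scale[OF partial_linear[OF assms]] by simp
  finally show ?thesis .
qed

lemma partial_has_real_derivative:
  assumes "f differentiable (at (x + t *\<^sub>R v))"
  shows "((\<lambda>t. f (x + t *\<^sub>R v)) has_real_derivative partial v f (x + t *\<^sub>R v)) (at t)"
proof -
  have "((\<lambda>t. x + t *\<^sub>R v) has_derivative (\<lambda>s. s *\<^sub>R v)) (at t)"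
    by (auto intro!: derivative_eq_intros)
  from has_derivative_compose[OF this partial_has_derivative[OF assms]]
  have "((\<lambda>t. f (x + t *\<^sub>R v)) has_derivative (\<lambda>s. s * partial v f (x + t *\<^sub>R v))) (at t)"
    by (simp add: linear_scale[OF partial_linear[OF assms]])
  then show ?thesis by (simp add: has_field_derivative_def mult_commute_abs)
qed

lemma integrable_compact_support:
  fixes f :: "'a::euclidean_space \<Rightarrow> real"
  assumes "continuous_on UNIV f" "compact K" "\<And>x. x \<notin> K \<Longrightarrow> f x = 0"
  shows "integrable lborel f"
proof -
  have "integrable lborel (\<lambda>x. indicator K x *\<^sub>R f x)"
    using borel_integrable_compact[OF assms(2)] assms(1) continuous_on_subset by blast
  moreover have "(\<lambda>x. indicator K x *\<^sub>R f x) = f" using assms(3) by (auto simp: indicator_def fun_eq_iff)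
  ultimately show ?thesis by simp
qed

lemma bounded_compact_support:
  fixes f :: "'a::euclidean_space \<Rightarrow> real"
  assumes "continuous_on UNIV f" "compact K" "\<And>x. x \<notin> K \<Longrightarrow> f x = 0"
  obtains M where "M > 0" "\<And>x. \<bar>f x\<bar> \<le> M"
proof -
  have "compact (f ` K)" using assms compact_continuous_image continuous_on_subset by blast
  then obtain B where "\<And>y. y \<in> f ` K \<Longrightarrow> \<bar>y\<bar> \<le> B"
    by (metis compact_imp_bounded bounded_iff real_norm_def)
  then have "\<bar>f x\<bar> \<le> max B 1" for x using assms(3)[of x] by (cases "x \<in> K") fastforce+
  then show ?thesis by (intro that[of "max B 1"]) auto
qed

lemma uniformly_continuous_compact_support:
  fixes f :: "'a::euclidean_space \<Rightarrow> real"
  assumes "continuous_on UNIV f" "compact K" "\<And>x. x \<notin> K \<Longrightarrow> f x = 0"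
  shows "uniformly_continuous_on UNIV f"
  unfolding uniformly_continuous_on_def
proof (intro allI impI)
  fix e :: real assume "e > 0"
  obtain R where R: "R > 0" "K \<subseteq> ball 0 R"
    using compact_imp_bounded[OF assms(2)] bounded_subset_ballD by blast
  have "uniformly_continuous_on (cball 0 (R+1)) f"
    using compact_uniformly_continuous[of "cball 0 (R+1)" f] assms(1) continuous_on_subset compact_cball by blast
  then obtain d where d: "d > 0" "\<And>x y. x \<in> cball 0 (R+1) \<Longrightarrow> y \<in> cball 0 (R+1) \<Longrightarrow> dist y x < d \<Longrightarrow> dist (f y) (f x) < e"
    using \<open>e > 0\<close> unfolding uniformly_continuous_on_def by metis
  have "dist (f y) (f x) < e" if xy: "dist y x < min d 1" for x y
  proof (cases "x \<in> cball 0 (R+1) \<and> y \<in> cball 0 (R+1)")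
    case True then show ?thesis using d xy by auto
  next
    case False
    have "norm x \<le> norm y + dist y x" "norm y \<le> norm x + dist y x"
      unfolding dist_norm by norm+
    with False xy have "norm x > R" "norm y > R" by (auto simp: not_le)
    then have "x \<notin> K" "y \<notin> K" using R by auto
    then show ?thesis using assms(3) \<open>e > 0\<close> by auto
  qed
  then show "\<exists>d>0. \<forall>x\<in>UNIV. \<forall>x'\<in>UNIV. dist x' x < d \<longrightarrow> dist (f x') (f x) < e"
    using d(1) by (intro exI[of _ "min d 1"]) auto
qed

text \<open>Translation invariance of Lebesgue measure makes the integral of every difference quotient of \<open>F\<close> vanish; the quotients
  are bounded by the maximum of the derivative and supported in a fixed compact set.\<close>

lemma integral_partial_eq_0:
  fixes F :: "'a::euclidean_space \<Rightarrow> real"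
  assumes C1: "Ck_on 1 UNIV F" and K: "compact K" and off: "\<And>x. x \<notin> K \<Longrightarrow> F x = 0"
  shows "integrable lborel (partial v F)" "(LINT x|lborel. partial v F x) = 0"
proof -
  have cF: "continuous_on UNIV F" using C1_continuous_on[OF C1] .
  have cp: "continuous_on UNIV (partial v F)" using C1_continuous_partial[OF C1] .
  have offp: "partial v F x = 0" if "x \<notin> K" for x
    using partial_zero_off[OF compact_imp_closed[OF K] off that] .
  show "integrable lborel (partial v F)" using integrable_compact_support[OF cp K offp] .
  obtain M where M: "M > 0" "\<And>x. \<bar>partial v F x\<bar> \<le> M"
    using bounded_compact_support[OF cp K offp] by blast
  define q where "q n x = real (Suc n) * (F (x + (1 / real (Suc n)) *\<^sub>R v) - F x)" for n x
  have intF: "integrable lborel F" using integrable_compact_support[OF cF K off] .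
  have int_trans: "integrable lborel (\<lambda>x. F (x + w))" "(LINT x|lborel. F (x + w)) = (LINT x|lborel. F x)" for w
  proof -
    have meas: "F \<in> borel_measurable borel" using cF borel_measurable_continuous_onI by blast
    have "integrable (distr lborel borel ((+) w)) F"
      using intF by (simp add: lborel_distr_plus)
    then show "integrable lborel (\<lambda>x. F (x + w))"
      by (subst (asm) integrable_distr_eq) (use meas in \<open>auto simp: add.commute\<close>)
    have "(LINT x|lborel. F x) = (LINT x|distr lborel borel ((+) w). F x)"
      by (simp add: lborel_distr_plus)
    also have "\<dots> = (LINT x|lborel. F (x + w))"
      by (subst integral_distr) (use meas in \<open>auto simp: add.commute\<close>)
    finally show "(LINT x|lborel. F (x + w)) = (LINT x|lborel. F x)" by simp
  qed
  have q0: "(LINT x|lborel. q n x) = 0" for n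
    unfolding q_def using int_trans intF by simp
  have bound: "\<bar>q n x\<bar> \<le> M" for n x
  proof -
    have "\<exists>t::real. 0 < t \<and> t < 1 / real (Suc n) \<and> F (x + (1 / real (Suc n)) *\<^sub>R v) - F (x + 0 *\<^sub>R v) = (1 / real (Suc n) - 0) * partial v F (x + t *\<^sub>R v)"
      by (rule MVT2) (auto intro!: partial_has_real_derivative C1_differentiable[OF C1])
    then obtain t where "q n x = partial v F (x + t *\<^sub>R v)"
      unfolding q_def by (auto simp: field_simps)
    then show ?thesis using M by simp
  qed
  define K' where "K' = {x - s | x s. x \<in> K \<and> s \<in> cball 0 (norm v)}"
  have cK': "compact K'"
    using compact_differences[OF K compact_cball] unfolding K'_def by blast
  have qoff: "q n x = 0" if "x \<notin> K'" for n x
  proof -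
    have "x \<notin> K" using that unfolding K'_def by (force intro: exI[of _ "0::'a"])
    moreover have "x + (1 / real (Suc n)) *\<^sub>R v \<notin> K"
    proof
      assume a: "x + (1 / real (Suc n)) *\<^sub>R v \<in> K"
      have "norm ((1 / real (Suc n)) *\<^sub>R v) \<le> norm v" by (simp add: field_simps)
      then have "x \<in> K'" unfolding K'_def
        using a by (intro CollectI exI[of _ "x + (1 / real (Suc n)) *\<^sub>R v"] exI[of _ "(1 / real (Suc n)) *\<^sub>R v"]) auto
      then show False using that by simp
    qed
    ultimately show ?thesis unfolding q_def using off by simp
  qed
  have lim: "(\<lambda>n. q n x) \<longlonglongrightarrow> partial v F x" for x
  proof -
    have "((\<lambda>t. F (x + t *\<^sub>R v)) has_real_derivative partial v F (x + 0 *\<^sub>R v)) (at 0)"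
      by (rule partial_has_real_derivative) (auto intro: C1_differentiable[OF C1])
    then have "((\<lambda>h. (F (x + h *\<^sub>R v) - F x) / h) \<longlongrightarrow> partial v F x) (at 0)"
      by (simp add: has_field_derivative_iff)
    moreover have "filterlim (\<lambda>n. 1 / real (Suc n)) (at 0) sequentially"
      using LIMSEQ_Suc[OF lim_inverse_n'] by (auto simp: filterlim_at)
    ultimately have "(\<lambda>n. (F (x + (1 / real (Suc n)) *\<^sub>R v) - F x) / (1 / real (Suc n))) \<longlonglongrightarrow> partial v F x"
      by (rule filterlim_compose)
    then show ?thesis unfolding q_def by (simp add: mult.commute)
  qed
  have "(\<lambda>n. LINT x|lborel. q n x) \<longlonglongrightarrow> (LINT x|lborel. partial v F x)"
  proof (rule integral_dominated_convergence[where w="\<lambda>x. M * indicator K' x"])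
    show "partial v F \<in> borel_measurable lborel" using cp by (simp add: borel_measurable_continuous_onI)
    show "q n \<in> borel_measurable lborel" for n
      unfolding q_def using cF by (auto intro!: borel_measurable_continuous_onI continuous_intros continuous_on_compose2[OF cF])
    show "integrable lborel (\<lambda>x. M * indicator K' x)"
      using borel_integrable_compact[OF cK', of "\<lambda>_. M"] by (simp add: mult.commute)
    show "AE x in lborel. (\<lambda>n. q n x) \<longlonglongrightarrow> partial v F x" using lim by auto
    show "AE x in lborel. norm (q n x) \<le> M * indicator K' x" for n
      using bound qoff by (auto simp: indicator_def)
  qed
  then show "(LINT x|lborel. partial v F x) = 0" using q0 by (simp add: LIMSEQ_const_iff)
qed

section \<open>Regularisation by convolution\<close>

definition conv :: "('a::euclidean_space \<Rightarrow> real) \<Rightarrow> ('a \<Rightarrow> real) \<Rightarrow> 'a \<Rightarrow> real" where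
  "conv V \<kappa> x = (LINT y|lborel. V y * \<kappa> (x - y))"

lemma conv_integrable:
  fixes V \<kappa> :: "'a::euclidean_space \<Rightarrow> real"
  assumes V: "integrable lborel V" and c: "continuous_on UNIV \<kappa>" and M: "\<And>z. \<bar>\<kappa> z\<bar> \<le> M"
  shows "integrable lborel (\<lambda>y. V y * \<kappa> (x - y))"
proof (rule Bochner_Integration.integrable_bound)
  show "integrable lborel (\<lambda>y. M * V y)" using V by simp
  have "(\<lambda>y. \<kappa> (x - y)) \<in> borel_measurable borel"
    by (intro borel_measurable_continuous_onI continuous_on_compose2[OF c]) (auto intro!: continuous_intros)
  then show "(\<lambda>y. V y * \<kappa> (x - y)) \<in> borel_measurable lborel" using V by simp
  show "AE y in lborel. norm (V y * \<kappa> (x - y)) \<le> norm (M * V y)"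
  proof (rule AE_I2)
    fix y
    have "\<bar>\<kappa> (x - y)\<bar> \<le> \<bar>M\<bar>" using M[of "x - y"] by linarith
    then show "norm (V y * \<kappa> (x - y)) \<le> norm (M * V y)"
      by (simp add: abs_mult mult.commute[of "\<bar>M\<bar>"] mult_left_mono)
  qed
qed

lemma conv_abs_le:
  fixes V w :: "'a::euclidean_space \<Rightarrow> real"
  assumes V: "integrable lborel V" and w: "\<And>y. \<bar>w y\<bar> \<le> e" and i: "integrable lborel (\<lambda>y. V y * w y)"
  shows "\<bar>LINT y|lborel. V y * w y\<bar> \<le> e * (LINT y|lborel. \<bar>V y\<bar>)"
proof -
  have "norm (LINT y|lborel. V y * w y) \<le> (LINT y|lborel. norm (V y * w y))" by (rule integral_norm_bound)
  also have "\<dots> \<le> (LINT y|lborel. e * \<bar>V y\<bar>)"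
  proof (rule integral_mono)
    show "integrable lborel (\<lambda>y. norm (V y * w y))" using i by simp
    show "norm (V y * w y) \<le> e * \<bar>V y\<bar>" for y
      using w[of y] by (simp add: abs_mult mult.commute[of e] mult_left_mono)
  qed (use V in simp)
  finally show ?thesis by simp
qed

lemma conv_continuous:
  fixes V \<kappa> :: "'a::euclidean_space \<Rightarrow> real"
  assumes V: "integrable lborel V" and c: "continuous_on UNIV \<kappa>" and K: "compact K" and off: "\<And>x. x \<notin> K \<Longrightarrow> \<kappa> x = 0"
  shows "continuous_on UNIV (conv V \<kappa>)"
proof -
  obtain M where M: "\<And>z. \<bar>\<kappa> z\<bar> \<le> M" using bounded_compact_support[OF c K off] by blast
  note int = conv_integrable[OF V c M]
  let ?I = "LINT y|lborel. \<bar>V y\<bar>"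
  have I: "?I \<ge> 0" by simp
  show ?thesis
  proof (subst continuous_on_iff, intro ballI allI impI)
    fix x :: 'a and e :: real assume "e > 0"
    then have e': "e / (?I + 1) > 0" using I by (simp add: add_nonneg_pos)
    obtain d where d: "d > 0" "\<And>x y. dist y x < d \<Longrightarrow> dist (\<kappa> y) (\<kappa> x) < e / (?I + 1)"
      using uniformly_continuous_compact_support[OF c K off] e' unfolding uniformly_continuous_on_def by blast
    have "dist (conv V \<kappa> x') (conv V \<kappa> x) < e" if "dist x' x < d" for x'
    proof -
      have eq: "conv V \<kappa> x' - conv V \<kappa> x = (LINT y|lborel. V y * (\<kappa> (x' - y) - \<kappa> (x - y)))"
        unfolding conv_def using int by (simp add: right_diff_distrib)
      have "\<bar>LINT y|lborel. V y * (\<kappa> (x' - y) - \<kappa> (x - y))\<bar> \<le> e / (?I + 1) * ?I"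
      proof (rule conv_abs_le[OF V])
        show "\<bar>\<kappa> (x' - y) - \<kappa> (x - y)\<bar> \<le> e / (?I + 1)" for y
          using d(2)[of "x' - y" "x - y"] that by (auto simp: dist_norm)
        show "integrable lborel (\<lambda>y. V y * (\<kappa> (x' - y) - \<kappa> (x - y)))"
          using int by (simp add: right_diff_distrib)
      qed
      also have "\<dots> < e" using I \<open>e > 0\<close> by (simp add: divide_less_eq add_nonneg_pos)
      finally show ?thesis using eq by (simp add: dist_norm)
    qed
    then show "\<exists>d>0. \<forall>x'\<in>UNIV. dist x' x < d \<longrightarrow> dist (conv V \<kappa> x') (conv V \<kappa> x) < e" using d by blast
  qed
qed

text \<open>Compact support makes the partial derivatives uniformly continuous, so the linear approximation is uniform in the base
  point. This is what allows differentiation of a convolution with a merely integrable function.\<close>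

lemma C1_uniformly_differentiable:
  fixes \<kappa> :: "'a::euclidean_space \<Rightarrow> real"
  assumes C: "Ck_on 1 UNIV \<kappa>" and K: "compact K" and off: "\<And>x. x \<notin> K \<Longrightarrow> \<kappa> x = 0" and "e > 0"
  obtains d where "d > 0" "\<And>z h. norm h < d \<Longrightarrow> \<bar>\<kappa> (z + h) - \<kappa> z - partial h \<kappa> z\<bar> \<le> e * norm h"
proof -
  have "\<exists>d>0. \<forall>x y. dist y x < d \<longrightarrow> dist (partial b \<kappa> y) (partial b \<kappa> x) < e / DIM('a)" for b
    using uniformly_continuous_compact_support[OF C1_continuous_partial[OF C] K partial_zero_off[OF compact_imp_closed[OF K] off]]
      \<open>e > 0\<close> unfolding uniformly_continuous_on_def by auto
  then obtain D where D: "\<And>b. D b > 0" "\<And>b x y. dist y x < D b \<Longrightarrow> dist (partial b \<kappa> y) (partial b \<kappa> x) < e / DIM('a)"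
    by metis
  define d where "d = Min (D ` Basis)"
  have d: "d > 0" unfolding d_def using D(1) by (subst Min_gr_iff) auto
  have "\<bar>\<kappa> (z + h) - \<kappa> z - partial h \<kappa> z\<bar> \<le> e * norm h" if h: "norm h < d" for z h
  proof -
    have "\<exists>t::real. 0 < t \<and> t < 1 \<and> \<kappa> (z + 1 *\<^sub>R h) - \<kappa> (z + 0 *\<^sub>R h) = (1 - 0) * partial h \<kappa> (z + t *\<^sub>R h)"
      by (rule MVT2) (auto intro!: partial_has_real_derivative C1_differentiable[OF C])
    then obtain t :: real where t: "0 < t" "t < 1" "\<kappa> (z + h) - \<kappa> z = partial h \<kappa> (z + t *\<^sub>R h)" by auto
    have "\<kappa> (z + h) - \<kappa> z - partial h \<kappa> z = (\<Sum>b\<in>Basis. (h \<bullet> b) * (partial b \<kappa> (z + t *\<^sub>R h) - partial b \<kappa> z))"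
      using t(3) C1_differentiable[OF C]
      by (simp add: partial_expand[of \<kappa> _ h] right_diff_distrib sum_subtractf)
    also have "\<bar>\<dots>\<bar> \<le> (\<Sum>b::'a\<in>Basis. norm h * (e / DIM('a)))"
    proof (rule order_trans[OF sum_abs sum_mono])
      fix b :: 'a assume b: "b \<in> Basis"
      have "norm (t *\<^sub>R h) \<le> norm h" using t by (simp add: mult_left_le_one_le)
      then have "norm (t *\<^sub>R h) < D b" using h b unfolding d_def by (auto simp: Min_gr_iff)
      then have "\<bar>partial b \<kappa> (z + t *\<^sub>R h) - partial b \<kappa> z\<bar> \<le> e / DIM('a)"
        using D(2)[of "z + t *\<^sub>R h" z b] by (auto simp: dist_norm)
      then show "\<bar>(h \<bullet> b) * (partial b \<kappa> (z + t *\<^sub>R h) - partial b \<kappa> z)\<bar> \<le> norm h * (e / DIM('a))"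
        using Basis_le_norm[OF b, of h] unfolding abs_mult by (intro mult_mono) auto
    qed
    also have "\<dots> = e * norm h" by simp
    finally show ?thesis .
  qed
  then show ?thesis using that d by blast
qed

lemma conv_has_derivative:
  fixes V \<kappa> :: "'a::euclidean_space \<Rightarrow> real"
  assumes V: "integrable lborel V" and C: "Ck_on 1 UNIV \<kappa>" and K: "compact K" and off: "\<And>x. x \<notin> K \<Longrightarrow> \<kappa> x = 0"
  shows "(conv V \<kappa> has_derivative (\<lambda>h. conv V (partial h \<kappa>) x)) (at x)"
proof -
  have offp: "partial h \<kappa> z = 0" if "z \<notin> K" for h z
    using partial_zero_off[OF compact_imp_closed[OF K] off that] .
  have i: "integrable lborel (\<lambda>y. V y * \<kappa> (z - y))" for z
    using bounded_compact_support[OF C1_continuous_on[OF C] K off] conv_integrable[OF V C1_continuous_on[OF C]] by metis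
  have ip: "integrable lborel (\<lambda>y. V y * partial h \<kappa> (z - y))" for h z
    using bounded_compact_support[OF C1_continuous_partial[OF C] K offp] conv_integrable[OF V C1_continuous_partial[OF C]] by metis
  have L: "linear (\<lambda>h. partial h \<kappa> z)" for z by (rule partial_linear[OF C1_differentiable[OF C]]) simp
  have lin: "linear (\<lambda>h. conv V (partial h \<kappa>) x)"
  proof (rule linearI)
    fix h k show "conv V (partial (h + k) \<kappa>) x = conv V (partial h \<kappa>) x + conv V (partial k \<kappa>) x"
      unfolding conv_def using ip by (simp add: linear_add[OF L] distrib_left)
  next
    fix h c show "conv V (partial (c *\<^sub>R h) \<kappa>) x = c *\<^sub>R conv V (partial h \<kappa>) x"
      unfolding conv_def by (simp add: linear_scale[OF L] mult.left_commute)
  qed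
  let ?I = "LINT y|lborel. \<bar>V y\<bar>"
  have I: "?I \<ge> 0" by simp
  show ?thesis
    unfolding has_derivative_within_alt
  proof (intro conjI allI impI)
    show "bounded_linear (\<lambda>h. conv V (partial h \<kappa>) x)" using lin by (simp add: linear_conv_bounded_linear)
    fix e :: real assume "e > 0"
    then have e': "e / (?I + 1) > 0" using I by (simp add: add_nonneg_pos)
    obtain d where d: "d > 0" "\<And>z h. norm h < d \<Longrightarrow> \<bar>\<kappa> (z + h) - \<kappa> z - partial h \<kappa> z\<bar> \<le> e / (?I + 1) * norm h"
      using C1_uniformly_differentiable[OF C K off e'] by blast
    have "norm (conv V \<kappa> y - conv V \<kappa> x - conv V (partial (y - x) \<kappa>) x) \<le> e * norm (y - x)" if "norm (y - x) < d" for y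
    proof -
      define h where "h = y - x"
      have eq: "conv V \<kappa> y - conv V \<kappa> x - conv V (partial (y - x) \<kappa>) x
          = (LINT w|lborel. V w * (\<kappa> ((x - w) + h) - \<kappa> (x - w) - partial h \<kappa> (x - w)))"
        unfolding conv_def using i ip by (simp add: right_diff_distrib h_def)
      have "\<bar>\<dots>\<bar> \<le> e / (?I + 1) * norm h * ?I"
      proof (rule conv_abs_le[OF V])
        show "\<bar>\<kappa> ((x - w) + h) - \<kappa> (x - w) - partial h \<kappa> (x - w)\<bar> \<le> e / (?I + 1) * norm h" for w
          using d(2) that h_def by blast
        have "(\<lambda>w. V w * (\<kappa> ((x - w) + h) - \<kappa> (x - w) - partial h \<kappa> (x - w))) =
          (\<lambda>w. V w * \<kappa> (y - w) - V w * \<kappa> (x - w) - V w * partial h \<kappa> (x - w))"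
          by (simp add: right_diff_distrib h_def)
        then show "integrable lborel (\<lambda>w. V w * (\<kappa> ((x - w) + h) - \<kappa> (x - w) - partial h \<kappa> (x - w)))"
          using i ip by simp
      qed
      also have "\<dots> = (e * norm h) * (?I / (?I + 1))" by simp
      also have "\<dots> \<le> (e * norm h) * 1"
        using I \<open>e > 0\<close> by (intro mult_left_mono) (auto simp: divide_le_eq_1 add_nonneg_pos)
      finally show ?thesis using eq h_def by simp
    qed
    then show "\<exists>d>0. \<forall>y\<in>UNIV. norm (y - x) < d \<longrightarrow>
        norm (conv V \<kappa> y - conv V \<kappa> x - conv V (partial (y - x) \<kappa>) x) \<le> e * norm (y - x)"
      using d(1) by blast
  qed
qed

lemma conv_C1:
  fixes V \<kappa> :: "'a::euclidean_space \<Rightarrow> real"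
  assumes V: "integrable lborel V" and C: "Ck_on 1 UNIV \<kappa>" and K: "compact K" and off: "\<And>x. x \<notin> K \<Longrightarrow> \<kappa> x = 0"
  shows "Ck_on 1 UNIV (conv V \<kappa>)" "partial v (conv V \<kappa>) = conv V (partial v \<kappa>)"
proof -
  note D = conv_has_derivative[OF V C K off]
  show "Ck_on 1 UNIV (conv V \<kappa>)"
    by (rule C1I[OF D]) (auto intro!: conv_continuous[OF V C1_continuous_partial[OF C] K] partial_zero_off[OF compact_imp_closed[OF K] off])
  show "partial v (conv V \<kappa>) = conv V (partial v \<kappa>)"
    using partial_eqI[OF D] by blast
qed

lemma smooth_C1: "smooth_fun f \<Longrightarrow> Ck_on 1 UNIV f"
  unfolding smooth_fun_def by (erule spec)

lemma smooth_partial: "smooth_fun f \<Longrightarrow> smooth_fun (partial v f)"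
  unfolding smooth_fun_def
proof
  fix n assume "\<forall>n. Ck_on n UNIV f"
  then have "Ck_on (Suc n) UNIV f" by blast
  then show "Ck_on n UNIV (partial v f)" by (simp add: partial_def[abs_def])
qed

lemma partial_affine:
  fixes f :: "'a::euclidean_space \<Rightarrow> real"
  assumes "f differentiable (at (a + c *\<^sub>R x))"
  shows "((\<lambda>x. f (a + c *\<^sub>R x)) has_derivative (\<lambda>v. partial (c *\<^sub>R v) f (a + c *\<^sub>R x))) (at x)"
    "partial v (\<lambda>x. f (a + c *\<^sub>R x)) x = c * partial v f (a + c *\<^sub>R x)"
proof -
  have "((\<lambda>x. a + c *\<^sub>R x) has_derivative (\<lambda>v. c *\<^sub>R v)) (at x)"
    by (auto intro!: derivative_eq_intros)
  from has_derivative_compose[OF this partial_has_derivative[OF assms]]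
  show D: "((\<lambda>x. f (a + c *\<^sub>R x)) has_derivative (\<lambda>v. partial (c *\<^sub>R v) f (a + c *\<^sub>R x))) (at x)" .
  show "partial v (\<lambda>x. f (a + c *\<^sub>R x)) x = c * partial v f (a + c *\<^sub>R x)"
    by (simp add: partial_eqI[OF D] linear_scale[OF partial_linear[OF assms]])
qed

lemma Ck_affine:
  fixes f :: "'a::euclidean_space \<Rightarrow> real"
  assumes "Ck_on n UNIV f" shows "Ck_on n UNIV (\<lambda>x. m * f (a + c *\<^sub>R x))"
  using assms
proof (induction n arbitrary: f m)
  case 0
  then show ?case by (auto intro!: continuous_intros continuous_on_compose2[of UNIV f])
next
  case (Suc n)
  have d: "f differentiable (at x)" for x using Suc.prems by simp
  have D: "((\<lambda>x. m * f (a + c *\<^sub>R x)) has_derivative (\<lambda>v. m * partial (c *\<^sub>R v) f (a + c *\<^sub>R x))) (at x)" for x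
    using partial_affine(1)[OF d] by (rule has_derivative_mult_right)
  have e: "frechet_derivative (\<lambda>x. m * f (a + c *\<^sub>R x)) (at x) v = m * partial (c *\<^sub>R v) f (a + c *\<^sub>R x)" for x v
    using partial_eqI[OF D] by (simp add: partial_def)
  have "Ck_on n UNIV (partial w f)" for w using Suc.prems by (simp add: partial_def[abs_def])
  then show ?case using D Suc.IH by (auto simp: e differentiable_def)
qed

lemma smooth_affine:
  fixes f :: "'a::euclidean_space \<Rightarrow> real"
  shows "smooth_fun f \<Longrightarrow> smooth_fun (\<lambda>x. m * f (a + c *\<^sub>R x))"
  unfolding smooth_fun_def by (intro allI Ck_affine) (erule spec)

lemma supp_zero:
  assumes "x \<notin> supp f" shows "f x = 0"
proof (rule ccontr)
  assume "f x \<noteq> 0"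
  then have "x \<in> closure {x. f x \<noteq> 0}" by (intro subsetD[OF closure_subset]) simp
  then show False using assms by (simp add: supp_def)
qed

lemma supp_subset: "closed K \<Longrightarrow> (\<And>x. x \<notin> K \<Longrightarrow> f x = 0) \<Longrightarrow> supp f \<subseteq> K"
  unfolding supp_def by (rule closure_minimal) auto

lemma C1cI:
  assumes "Ck_on 1 UNIV f" "compact K" "K \<subseteq> U" "\<And>x. x \<notin> K \<Longrightarrow> f x = 0"
  shows "f \<in> C1c U"
proof -
  have "supp f \<subseteq> K" using supp_subset[OF compact_imp_closed[OF assms(2)] assms(4)] .
  moreover have "closed (supp f)" by (simp add: supp_def)
  ultimately have "compact (supp f)" using compact_Int_closed[OF assms(2), of "supp f"] by (simp add: Int_absorb1)
  with \<open>supp f \<subseteq> K\<close> show ?thesis unfolding C1c_def using assms by blast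
qed

lemma C1cD:
  assumes "f \<in> C1c U"
  shows "Ck_on 1 UNIV f" "compact (supp f)" "supp f \<subseteq> U" "\<And>x. x \<notin> supp f \<Longrightarrow> f x = 0"
proof -
  have "Ck_on 1 UNIV f \<and> compact (supp f) \<and> supp f \<subseteq> U"
    using assms unfolding C1c_def by (rule CollectD)
  then show "Ck_on 1 UNIV f" "compact (supp f)" "supp f \<subseteq> U" by blast+
  show "f x = 0" if "x \<notin> supp f" for x using that by (rule supp_zero)
qed

text \<open>Convergence at a point of continuity rests on unit mass and on supports shrinking to the origin.\<close>

definition approximate_identity :: "(nat \<Rightarrow> 'a::euclidean_space \<Rightarrow> real) \<Rightarrow> real \<Rightarrow> bool" where
  "approximate_identity \<rho> R \<longleftrightarrow> (\<forall>n. smooth_fun (\<rho> n) \<and> (\<forall>z. 0 \<le> \<rho> n z) \<and> (LINT z|lborel. \<rho> n z) = 1 \<and>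
     (\<forall>z. norm z > R / real (Suc n) \<longrightarrow> \<rho> n z = 0))"

lemma integral_pos_continuous:
  fixes f :: "'a::euclidean_space \<Rightarrow> real"
  assumes c: "continuous_on UNIV f" and K: "compact K" "\<And>x. x \<notin> K \<Longrightarrow> f x = 0" and nn: "\<And>x. f x \<ge> 0" and x0: "f x0 \<noteq> 0"
  shows "(LINT x|lborel. f x) > 0"
proof (rule ccontr)
  assume "\<not> (LINT x|lborel. f x) > 0"
  moreover have "(LINT x|lborel. f x) \<ge> 0" using nn by simp
  ultimately have "(LINT x|lborel. f x) = 0" by simp
  then have ae: "AE x in lborel. f x = 0"
    using integral_nonneg_eq_0_iff_AE[OF integrable_compact_support[OF c K]] nn by auto
  have "open {x. f x \<noteq> 0}" using c by (simp add: open_Collect_neq)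
  moreover have "{x. f x \<noteq> 0} \<in> null_sets lborel"
  proof -
    have "{x. f x \<noteq> 0} \<in> sets lborel" using \<open>open {x. f x \<noteq> 0}\<close> by simp
    then show ?thesis using ae AE_iff_null[of lborel "\<lambda>x. f x = 0"] by simp
  qed
  ultimately have "{x. f x \<noteq> 0} = {}"
    using open_not_negligible negligible_iff_null_sets null_sets_completionI by blast
  then show False using x0 by auto
qed

text \<open>Any nonnegative smooth function of compact support serves as a mollifier after rescaling and normalisation. In the
  application it is the cutoff function \<open>\<eta>\<close> of the theorem.\<close>

lemma approximate_identity_exists:
  fixes \<eta> :: "'a::euclidean_space \<Rightarrow> real"
  assumes s: "smooth_fun \<eta>" and nn: "\<And>x. 0 \<le> \<eta> x" and K: "compact (supp \<eta>)" and x0: "\<eta> x0 \<noteq> 0"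
  obtains \<rho> :: "nat \<Rightarrow> 'a \<Rightarrow> real" and R where "R > 0" "approximate_identity \<rho> R"
proof -
  obtain R where R: "R > 0" "supp \<eta> \<subseteq> ball 0 R"
    using compact_imp_bounded[OF K] bounded_subset_ballD by blast
  define I where "I n = (LINT z|lborel. \<eta> (0 + real (Suc n) *\<^sub>R z))" for n
  define \<rho> where "\<rho> n z = (1 / I n) * \<eta> (0 + real (Suc n) *\<^sub>R z)" for n z
  have off: "\<eta> (0 + real (Suc n) *\<^sub>R z) = 0" if "norm z > R / real (Suc n)" for n z
  proof -
    have "norm (real (Suc n) *\<^sub>R z) = real (Suc n) * norm z" by (metis norm_scaleR abs_of_nat)
    then have "norm (real (Suc n) *\<^sub>R z) > R" using that by (simp add: divide_less_eq mult.commute)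
    then show ?thesis using R(2) by (intro supp_zero) (auto simp del: of_nat_Suc)
  qed
  have sm: "smooth_fun (\<lambda>z. c * \<eta> (0 + real (Suc n) *\<^sub>R z))" for c n by (rule smooth_affine[OF s])
  have I: "I n > 0" for n unfolding I_def
  proof (rule integral_pos_continuous)
    show "continuous_on UNIV (\<lambda>x. \<eta> (0 + real (Suc n) *\<^sub>R x))"
      using C1_continuous_on[OF smooth_C1[OF sm[of 1 n]]] by simp
    show "compact (cball (0::'a) (R / real (Suc n)))" by simp
    show "\<eta> (0 + real (Suc n) *\<^sub>R x) = 0" if "x \<notin> cball 0 (R / real (Suc n))" for x
      using off that by auto
    show "\<eta> (0 + real (Suc n) *\<^sub>R ((1 / real (Suc n)) *\<^sub>R x0)) \<noteq> 0" using x0 by simp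
  qed (use nn in auto)
  have "approximate_identity \<rho> R" unfolding approximate_identity_def
  proof (intro allI conjI)
    fix n
    show "smooth_fun (\<rho> n)" unfolding \<rho>_def using sm by blast
    show "0 \<le> \<rho> n z" for z unfolding \<rho>_def using I[of n] nn by simp
    show "(LINT z|lborel. \<rho> n z) = 1" unfolding \<rho>_def using I[of n] by (simp add: I_def)
    show "norm z > R / real (Suc n) \<longrightarrow> \<rho> n z = 0" for z
      unfolding \<rho>_def using off by auto
  qed
  then show ?thesis by (rule that[OF R(1)])
qed

lemma integral_reflect_shift:
  fixes f :: "'a::euclidean_space \<Rightarrow> real"
  assumes "continuous_on UNIV f"
  shows "(LINT y|lborel. f (x - y)) = (LINT y|lborel. f y)"
proof -
  have m: "f \<in> borel_measurable borel" using assms borel_measurable_continuous_onI by blast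
  have "lborel = density (distr lborel borel (\<lambda>y. x + (-1) *\<^sub>R y)) (\<lambda>_. \<bar>-1::real\<bar> ^ DIM('a))"
    using lborel_affine[of "-1" x] by simp
  then have e: "(lborel :: 'a measure) = distr lborel borel (\<lambda>y. x - y)"
    by (simp add: density_1)
  have "(LINT y|lborel. f y) = (LINT y|distr lborel borel (\<lambda>y. x - y). f y)" using e by simp
  also have "\<dots> = (LINT y|lborel. f (x - y))"
    by (subst integral_distr) (use m in auto)
  finally show ?thesis by simp
qed

section \<open>An energy inequality for weak solutions\<close>

lemma approximate_identityD:
  assumes "approximate_identity \<rho> R"
  shows "smooth_fun (\<rho> n)" "0 \<le> \<rho> n z" "(LINT z|lborel. \<rho> n z) = 1"
    "norm z > R / real (Suc n) \<Longrightarrow> \<rho> n z = 0" "continuous_on UNIV (\<rho> n)"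
  using assms C1_continuous_on[OF smooth_C1] unfolding approximate_identity_def by blast+

lemma approximate_identity_cball:
  assumes "approximate_identity \<rho> R" "z \<notin> cball 0 (R / real (Suc n))" shows "\<rho> n z = 0"
  using approximate_identityD(4)[OF assms(1)] assms(2) by auto

lemma approximate_identity_bound:
  assumes "approximate_identity \<rho> R" obtains M where "\<And>z. \<bar>\<rho> n z\<bar> \<le> M"
  using bounded_compact_support[OF approximate_identityD(5)[OF assms] compact_cball approximate_identity_cball[OF assms]]
  by metis

lemma approximate_identity_shift:
  assumes "approximate_identity \<rho> R"
  shows "integrable lborel (\<lambda>y. \<rho> n (x - y))" "(LINT y|lborel. \<rho> n (x - y)) = 1"
proof -
  have c: "continuous_on UNIV (\<lambda>y. \<rho> n (x - y))"
    by (intro continuous_on_compose2[OF approximate_identityD(5)[OF assms]]) (auto intro!: continuous_intros)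
  show "integrable lborel (\<lambda>y. \<rho> n (x - y))"
  proof (rule integrable_compact_support[OF c, of "cball x (R / real (Suc n))"])
    show "\<rho> n (x - y) = 0" if "y \<notin> cball x (R / real (Suc n))" for y
      using that by (intro approximate_identity_cball[OF assms]) (auto simp: dist_norm norm_minus_commute)
  qed simp
  show "(LINT y|lborel. \<rho> n (x - y)) = 1"
    using integral_reflect_shift[OF approximate_identityD(5)[OF assms]] approximate_identityD(3)[OF assms] by metis
qed

lemma conv_integrable_approximate_identity:
  assumes "approximate_identity \<rho> R" "integrable lborel V"
  shows "integrable lborel (\<lambda>y. V y * \<rho> n (x - y))"
proof -
  obtain M where "\<And>z. \<bar>\<rho> n z\<bar> \<le> M" using approximate_identity_bound[OF assms(1)] by blast
  then show ?thesis using conv_integrable[OF assms(2) approximate_identityD(5)[OF assms(1)]] by blast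
qed

lemma conv_close:
  assumes ai: "approximate_identity \<rho> R" and V: "integrable lborel V"
    and close: "\<And>y. norm (x - y) \<le> R / real (Suc n) \<Longrightarrow> \<bar>V y - c\<bar> \<le> e"
  shows "\<bar>conv V (\<rho> n) x - c\<bar> \<le> e"
proof -
  note i = conv_integrable_approximate_identity[OF ai V, of n x]
  note s = approximate_identity_shift[OF ai, of n x]
  have "conv V (\<rho> n) x - c = (LINT y|lborel. V y * \<rho> n (x - y)) - (LINT y|lborel. c * \<rho> n (x - y))"
    unfolding conv_def using s by simp
  also have "\<dots> = (LINT y|lborel. (V y - c) * \<rho> n (x - y))"
    using i s by (simp add: left_diff_distrib)
  finally have eq: "conv V (\<rho> n) x - c = (LINT y|lborel. (V y - c) * \<rho> n (x - y))" .
  have i2: "integrable lborel (\<lambda>y. (V y - c) * \<rho> n (x - y))" using i s by (simp add: left_diff_distrib)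
  have "norm (LINT y|lborel. (V y - c) * \<rho> n (x - y)) \<le> (LINT y|lborel. norm ((V y - c) * \<rho> n (x - y)))"
    by (rule integral_norm_bound)
  also have "\<dots> \<le> (LINT y|lborel. e * \<rho> n (x - y))"
  proof (rule integral_mono)
    show "norm ((V y - c) * \<rho> n (x - y)) \<le> e * \<rho> n (x - y)" for y
    proof (cases "norm (x - y) \<le> R / real (Suc n)")
      case True
      then show ?thesis using close[OF True] approximate_identityD(2)[OF ai, of n "x - y"]
        by (simp add: abs_mult mult_right_mono)
    next
      case False
      then show ?thesis using approximate_identityD(4)[OF ai, of n "x - y"] by simp
    qed
  qed (use i2 s in auto)
  also have "\<dots> = e" using s by simp
  finally show ?thesis using eq by simp
qed

lemma conv_tendsto:
  assumes ai: "approximate_identity \<rho> R" and V: "integrable lborel V" and c: "isCont V x"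
  shows "(\<lambda>n. conv V (\<rho> n) x) \<longlonglongrightarrow> V x"
proof (rule LIMSEQ_I)
  fix e :: real assume "e > 0"
  then obtain d where d: "d > 0" "\<And>y. dist y x < d \<Longrightarrow> dist (V y) (V x) < e / 2"
    using c unfolding continuous_at_eps_delta by (metis half_gt_zero)
  have "(\<lambda>n. R / real (Suc n)) \<longlonglongrightarrow> 0"
    using LIMSEQ_Suc[OF lim_const_over_n] by blast
  then have "\<forall>\<^sub>F n in sequentially. R / real (Suc n) < d" using d by (intro order_tendstoD) auto
  then obtain N where N: "\<And>n. n \<ge> N \<Longrightarrow> R / real (Suc n) < d" by (auto simp: eventually_sequentially)
  have "norm (conv V (\<rho> n) x - V x) < e" if "n \<ge> N" for n
  proof -
    have "\<bar>conv V (\<rho> n) x - V x\<bar> \<le> e / 2"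
    proof (rule conv_close[OF ai V])
      fix y assume "norm (x - y) \<le> R / real (Suc n)"
      then show "\<bar>V y - V x\<bar> \<le> e / 2"
        using d(2)[of y] N[OF that] by (auto simp: dist_norm norm_minus_commute)
    qed
    then show ?thesis using \<open>e > 0\<close> by simp
  qed
  then show "\<exists>no. \<forall>n\<ge>no. norm (conv V (\<rho> n) x - V x) < e" by blast
qed

lemma grad_norm_sq_nonneg: "grad_norm_sq f x \<ge> 0"
  unfolding grad_norm_sq_def by (simp add: sum_nonneg)

lemma grad_norm_sq_continuous: "Ck_on 1 S f \<Longrightarrow> continuous_on S (grad_norm_sq f)"
  unfolding grad_norm_sq_def[abs_def] by (intro continuous_intros C1_continuous_partial)

lemma grad_norm_sq_zero_off:
  assumes "closed K" "\<And>x. x \<notin> K \<Longrightarrow> f x = 0" "x \<notin> K" shows "grad_norm_sq f x = 0"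
  unfolding grad_norm_sq_def using partial_zero_off[OF assms] by simp

lemma integral_divergence_eq_0:
  fixes F :: "'a::euclidean_space \<Rightarrow> 'a \<Rightarrow> real"
  assumes "\<And>b. b \<in> Basis \<Longrightarrow> Ck_on 1 UNIV (F b)" "compact K" "\<And>b x. b \<in> Basis \<Longrightarrow> x \<notin> K \<Longrightarrow> F b x = 0"
  shows "integrable lborel (\<lambda>x. \<Sum>b\<in>Basis. partial b (F b) x)" "(LINT x|lborel. (\<Sum>b\<in>Basis. partial b (F b) x)) = 0"
proof -
  have I: "integrable lborel (partial b (F b))" "(LINT x|lborel. partial b (F b) x) = 0" if "b \<in> Basis" for b
    using integral_partial_eq_0[OF assms(1)[OF that] assms(2) assms(3)[OF that]] by auto
  show "integrable lborel (\<lambda>x. \<Sum>b\<in>Basis. partial b (F b) x)"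
    by (rule Bochner_Integration.integrable_sum) (rule I(1))
  show "(LINT x|lborel. (\<Sum>b\<in>Basis. partial b (F b) x)) = 0"
    by (subst Bochner_Integration.integral_sum) (use I in auto)
qed

text \<open>With \<open>w = j(z)\<close>, the pointwise identity
  \<open>|\<nabla>(w \<zeta>)|\<^sup>2 = w\<^sup>2 |\<nabla>\<zeta>|\<^sup>2 + div (j j' \<zeta>\<^sup>2 \<nabla>z) - j j'' \<zeta>\<^sup>2 |\<nabla>z|\<^sup>2 - j j' \<zeta>\<^sup>2 \<Delta>z\<close> holds.
  The divergence integrates to zero and convexity of \<open>j\<close> gives the third term a sign.\<close>

lemma energy_classical:
  fixes z \<zeta> :: "'a::euclidean_space \<Rightarrow> real" and j j1 j2 :: "real \<Rightarrow> real"
  assumes z1: "Ck_on 1 UNIV z" and z2: "\<And>b. b \<in> Basis \<Longrightarrow> Ck_on 1 UNIV (partial b z)" and z0: "\<And>x. 0 \<le> z x"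
    and \<zeta>: "\<zeta> \<in> C1c S" and S: "open S" and P: "continuous_on S P"
    and hardy: "\<And>g. g \<in> C1c S \<Longrightarrow> (LINT x|lborel. P x * (g x)\<^sup>2) \<le> (LINT x|lborel. grad_norm_sq g x)"
    and j: "\<And>t. (j has_real_derivative j1 t) (at t)" "\<And>t. (j1 has_real_derivative j2 t) (at t)" "continuous_on UNIV j2"
    and jnn: "\<And>t. 0 \<le> t \<Longrightarrow> 0 \<le> j t \<and> 0 \<le> j1 t \<and> 0 \<le> j2 t"
  shows "(LINT x|lborel. P x * (j (z x) * \<zeta> x)\<^sup>2) \<le>
    (LINT x|lborel. (j (z x))\<^sup>2 * grad_norm_sq \<zeta> x) - (LINT x|lborel. j (z x) * j1 (z x) * laplacian z x * (\<zeta> x)\<^sup>2)"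
proof -
  let ?K = "supp \<zeta>"
  note \<zeta>D = C1cD[OF \<zeta>]
  have cl: "closed ?K" using \<zeta>D(2) compact_imp_closed by blast
  have cj: "continuous_on UNIV j" "continuous_on UNIV j1"
    using DERIV_isCont[OF j(1)] DERIV_isCont[OF j(2)] by (auto intro: continuous_at_imp_continuous_on)
  have jz: "Ck_on 1 UNIV (\<lambda>x. j (z x))" by (rule C1_comp[OF z1, of UNIV j j1]) (simp_all add: j cj)
  have j1z: "Ck_on 1 UNIV (\<lambda>x. j1 (z x))" by (rule C1_comp[OF z1, of UNIV j1 j2]) (simp_all add: j cj)
  note m = C1_mult
  define g where "g = (\<lambda>x. j (z x) * \<zeta> x)"
  have g: "g \<in> C1c S" unfolding g_def
    by (rule C1cI[OF m[OF jz \<zeta>D(1)] \<zeta>D(2,3)]) (simp add: \<zeta>D(4))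
  define A where "A = (\<lambda>x. (j (z x) * j1 (z x)) * (\<zeta> x * \<zeta> x))"
  define F where "F b = (\<lambda>x. A x * partial b z x)" for b
  have A1: "Ck_on 1 UNIV A" unfolding A_def by (intro m jz j1z \<zeta>D(1))
  have F: "Ck_on 1 UNIV (F b)" if "b \<in> Basis" for b unfolding F_def using m[OF A1 z2[OF that]] .
  have Foff: "F b x = 0" if "x \<notin> ?K" for b x unfolding F_def A_def using \<zeta>D(4)[OF that] by simp
  note d = C1_differentiable
  have pj: "partial b (\<lambda>x. j (z x)) x = j1 (z x) * partial b z x" for b x
    by (rule partial_comp[OF d[OF z1] j(1)]) simp
  have pj1: "partial b (\<lambda>x. j1 (z x)) x = j2 (z x) * partial b z x" for b x
    by (rule partial_comp[OF d[OF z1] j(2)]) simp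
  have pA: "partial b A x = (j (z x) * j1 (z x)) * (2 * \<zeta> x * partial b \<zeta> x) + (j (z x) * j2 (z x) + (j1 (z x))\<^sup>2) * partial b z x * (\<zeta> x)\<^sup>2" for b x
  proof -
    have "partial b A x = (j (z x) * j1 (z x)) * partial b (\<lambda>x. \<zeta> x * \<zeta> x) x + partial b (\<lambda>x. j (z x) * j1 (z x)) x * (\<zeta> x * \<zeta> x)"
      unfolding A_def by (rule partial_mult[OF d[OF m[OF jz j1z]] d[OF m[OF \<zeta>D(1) \<zeta>D(1)]]]) auto
    also have "partial b (\<lambda>x. \<zeta> x * \<zeta> x) x = 2 * \<zeta> x * partial b \<zeta> x"
      using partial_mult[OF d[OF \<zeta>D(1)] d[OF \<zeta>D(1)], of x] by simp
    also have "partial b (\<lambda>x. j (z x) * j1 (z x)) x = (j (z x) * j2 (z x) + (j1 (z x))\<^sup>2) * partial b z x"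
      using partial_mult[OF d[OF jz] d[OF j1z], of x] pj pj1 by (simp add: power2_eq_square algebra_simps)
    finally show ?thesis by (simp add: power2_eq_square algebra_simps)
  qed
  have pF: "partial b (F b) x = A x * partial b (partial b z) x + partial b A x * partial b z x" if "b \<in> Basis" for b x
    unfolding F_def by (rule partial_mult[OF d[OF A1] d[OF z2[OF that]]]) auto
  have pg: "partial b g x = j (z x) * partial b \<zeta> x + j1 (z x) * partial b z x * \<zeta> x" for b x
    unfolding g_def using partial_mult[OF d[OF jz] d[OF \<zeta>D(1)], of x] pj by simp
  have pt: "grad_norm_sq g x \<le> (j (z x))\<^sup>2 * grad_norm_sq \<zeta> x + (\<Sum>b\<in>Basis. partial b (F b) x) - j (z x) * j1 (z x) * laplacian z x * (\<zeta> x)\<^sup>2" for x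
  proof -
    have "grad_norm_sq g x = (\<Sum>b\<in>Basis. (j (z x))\<^sup>2 * (partial b \<zeta> x)\<^sup>2 + partial b (F b) x - j (z x) * j1 (z x) * (\<zeta> x)\<^sup>2 * partial b (partial b z) x
       - j (z x) * j2 (z x) * (partial b z x)\<^sup>2 * (\<zeta> x)\<^sup>2)"
      unfolding grad_norm_sq_def
      by (rule sum.cong[OF refl]) (simp add: pF pA pg, simp add: A_def power2_eq_square algebra_simps)
    also have "\<dots> \<le> (\<Sum>b\<in>Basis. (j (z x))\<^sup>2 * (partial b \<zeta> x)\<^sup>2 + partial b (F b) x - j (z x) * j1 (z x) * (\<zeta> x)\<^sup>2 * partial b (partial b z) x)"
      using jnn[OF z0[of x]] by (intro sum_mono) simp
    also have "\<dots> = (j (z x))\<^sup>2 * grad_norm_sq \<zeta> x + (\<Sum>b\<in>Basis. partial b (F b) x) - j (z x) * j1 (z x) * laplacian z x * (\<zeta> x)\<^sup>2"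
      unfolding grad_norm_sq_def laplacian_def by (simp add: sum.distrib sum_subtractf sum_distrib_left mult_ac)
    finally show ?thesis .
  qed
  have clap: "continuous_on UNIV (laplacian z)"
    unfolding laplacian_def[abs_def] by (intro continuous_intros C1_continuous_partial z2)
  note cont = C1_continuous_on
  have goff: "g x = 0" if "x \<notin> ?K" for x using \<zeta>D(4)[OF that] by (simp add: g_def)
  have i1: "integrable lborel (grad_norm_sq g)"
    by (rule integrable_compact_support[OF grad_norm_sq_continuous[OF C1cD(1)[OF g]] \<zeta>D(2)], rule grad_norm_sq_zero_off[OF cl goff])
  have i2: "integrable lborel (\<lambda>x. (j (z x))\<^sup>2 * grad_norm_sq \<zeta> x)"
  proof (rule integrable_compact_support[OF _ \<zeta>D(2)])
    show "continuous_on UNIV (\<lambda>x. (j (z x))\<^sup>2 * grad_norm_sq \<zeta> x)"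
      by (intro continuous_intros cont[OF jz] grad_norm_sq_continuous[OF \<zeta>D(1)])
    show "(j (z x))\<^sup>2 * grad_norm_sq \<zeta> x = 0" if "x \<notin> ?K" for x
      using grad_norm_sq_zero_off[OF cl \<zeta>D(4) that] by simp
  qed
  have i3: "integrable lborel (\<lambda>x. j (z x) * j1 (z x) * laplacian z x * (\<zeta> x)\<^sup>2)"
  proof (rule integrable_compact_support[OF _ \<zeta>D(2)])
    show "continuous_on UNIV (\<lambda>x. j (z x) * j1 (z x) * laplacian z x * (\<zeta> x)\<^sup>2)"
      by (intro continuous_intros cont[OF jz] cont[OF j1z] cont[OF \<zeta>D(1)] clap)
    show "j (z x) * j1 (z x) * laplacian z x * (\<zeta> x)\<^sup>2 = 0" if "x \<notin> ?K" for x
      using \<zeta>D(4)[OF that] by simp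
  qed
  note dv = integral_divergence_eq_0[of F, OF F \<zeta>D(2) Foff]
  have "(LINT x|lborel. P x * (j (z x) * \<zeta> x)\<^sup>2) \<le> (LINT x|lborel. grad_norm_sq g x)"
    using hardy[OF g] by (simp add: g_def)
  also have "\<dots> \<le> (LINT x|lborel. (j (z x))\<^sup>2 * grad_norm_sq \<zeta> x + (\<Sum>b\<in>Basis. partial b (F b) x) - j (z x) * j1 (z x) * laplacian z x * (\<zeta> x)\<^sup>2)"
    by (rule integral_mono[OF i1 _ pt]) (use i2 i3 dv in auto)
  also have "\<dots> = (LINT x|lborel. (j (z x))\<^sup>2 * grad_norm_sq \<zeta> x) - (LINT x|lborel. j (z x) * j1 (z x) * laplacian z x * (\<zeta> x)\<^sup>2)"
    using i2 i3 dv by simp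
  finally show ?thesis .
qed

lemma integral_tendsto_bounded_weight:
  fixes q :: "'a::euclidean_space \<Rightarrow> real"
  assumes q: "integrable lborel q" and A: "\<And>n. continuous_on UNIV (A n)"
    and lim: "\<And>x. q x \<noteq> 0 \<Longrightarrow> (\<lambda>n. A n x) \<longlonglongrightarrow> B x" and bd: "\<And>n x. q x \<noteq> 0 \<Longrightarrow> \<bar>A n x\<bar> \<le> M"
  shows "(\<lambda>n. LINT x|lborel. A n x * q x) \<longlonglongrightarrow> (LINT x|lborel. B x * q x)"
proof (rule integral_dominated_convergence[where w="\<lambda>x. M * \<bar>q x\<bar>"])
  show m: "(\<lambda>x. A n x * q x) \<in> borel_measurable lborel" for n
    using q borel_measurable_continuous_onI[OF A] by simp
  have l: "(\<lambda>n. A n x * q x) \<longlonglongrightarrow> B x * q x" for x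
    using lim[of x] by (cases "q x = 0") (auto intro!: tendsto_intros)
  then show "AE x in lborel. (\<lambda>n. A n x * q x) \<longlonglongrightarrow> B x * q x" by simp
  show "(\<lambda>x. B x * q x) \<in> borel_measurable lborel" by (rule borel_measurable_LIMSEQ_real[OF l m])
  show "integrable lborel (\<lambda>x. M * \<bar>q x\<bar>)" using q by simp
  have "norm (A n x * q x) \<le> M * \<bar>q x\<bar>" for n x
    using bd[of x n] by (cases "q x = 0") (auto simp: abs_mult mult_right_mono)
  then show "AE x in lborel. norm (A n x * q x) \<le> M * \<bar>q x\<bar>" for n by simp
qed

lemma laplacian_conv:
  assumes V: "integrable lborel V" and s: "smooth_fun \<rho>" and K: "compact K" and off: "\<And>x. x \<notin> K \<Longrightarrow> \<rho> x = 0"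
  shows "Ck_on 1 UNIV (conv V \<rho>)" "Ck_on 1 UNIV (partial b (conv V \<rho>))"
    "laplacian (conv V \<rho>) x = conv V (laplacian \<rho>) x"
proof -
  have o1: "partial b \<rho> z = 0" if "z \<notin> K" for b z
    using partial_zero_off[OF compact_imp_closed[OF K] off that] .
  have 1: "Ck_on 1 UNIV (conv V \<rho>)" "partial v (conv V \<rho>) = conv V (partial v \<rho>)" for v
    by (rule conv_C1[OF V smooth_C1[OF s] K], erule off)+
  have 2: "Ck_on 1 UNIV (conv V (partial b \<rho>))" "partial v (conv V (partial b \<rho>)) = conv V (partial v (partial b \<rho>))" for b v
    by (rule conv_C1[OF V smooth_C1[OF smooth_partial[OF s]] K], erule o1)+
  show "Ck_on 1 UNIV (conv V \<rho>)" using 1(1) .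
  show "Ck_on 1 UNIV (partial b (conv V \<rho>))" unfolding 1(2) using 2(1) .
  have cont: "continuous_on UNIV (partial b (partial b \<rho>))" for b
    by (rule C1_continuous_on[OF smooth_C1[OF smooth_partial[OF smooth_partial[OF s]]]])
  have off2: "partial b (partial b \<rho>) z = 0" if "z \<notin> K" for b z
    by (rule partial_zero_off[OF compact_imp_closed[OF K] o1 that])
  have i: "integrable lborel (\<lambda>y. V y * partial b (partial b \<rho>) (x - y))" for b
    using bounded_compact_support[OF cont K off2] conv_integrable[OF V cont] by metis
  show "laplacian (conv V \<rho>) x = conv V (laplacian \<rho>) x"
    unfolding laplacian_def 1(2) 2(2) unfolding conv_def
    by (simp add: sum_distrib_left Bochner_Integration.integral_sum[OF i])
qed

text \<open>The classical inequality is applied to mollifications \<open>z n\<close> of \<open>v\<close>. Near the support of \<open>\<zeta>\<close> their Laplacians are the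
  mollifications of \<open>f\<close>, and no derivative of \<open>z n\<close> except the Laplacian occurs in the inequality. Hence bounded pointwise
  convergence suffices for the limit.\<close>

lemma weak_energy_inequality:
  fixes v f P \<zeta> \<rho>\<^sub>0 :: "'a::euclidean_space \<Rightarrow> real" and j j1 j2 :: "real \<Rightarrow> real"
  assumes U: "open U" and v: "continuous_on U v" and v0: "\<And>x. x \<in> U \<Longrightarrow> 0 \<le> v x" and f: "continuous_on U f"
    and weak: "\<And>\<phi>. \<phi> \<in> test_functions U \<Longrightarrow> (LINT x:U|lborel. v x * laplacian \<phi> x) = (LINT x:U|lborel. f x * \<phi> x)"
    and bump: "smooth_fun \<rho>\<^sub>0" "\<And>x. 0 \<le> \<rho>\<^sub>0 x" "compact (supp \<rho>\<^sub>0)" "\<rho>\<^sub>0 x0 \<noteq> 0"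
    and \<zeta>: "\<zeta> \<in> C1c S" and S: "open S" "S \<subseteq> U" and P: "continuous_on S P"
    and hardy: "\<And>g. g \<in> C1c S \<Longrightarrow> (LINT x|lborel. P x * (g x)\<^sup>2) \<le> (LINT x|lborel. grad_norm_sq g x)"
    and j: "\<And>t. (j has_real_derivative j1 t) (at t)" "\<And>t. (j1 has_real_derivative j2 t) (at t)" "continuous_on UNIV j2"
    and jnn: "\<And>t. 0 \<le> t \<Longrightarrow> 0 \<le> j t \<and> 0 \<le> j1 t \<and> 0 \<le> j2 t"
  shows "(LINT x|lborel. P x * (j (v x) * \<zeta> x)\<^sup>2) \<le>
    (LINT x|lborel. (j (v x))\<^sup>2 * grad_norm_sq \<zeta> x) - (LINT x|lborel. j (v x) * j1 (v x) * f x * (\<zeta> x)\<^sup>2)"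
proof -
  obtain \<rho> :: "nat \<Rightarrow> 'a \<Rightarrow> real" and R where R: "R > 0" and ai: "approximate_identity \<rho> R"
    using approximate_identity_exists[OF bump] by metis
  let ?K = "supp \<zeta>"
  note \<zeta>D = C1cD[OF \<zeta>]
  have cl: "closed ?K" using \<zeta>D(2) compact_imp_closed by blast
  have KU: "?K \<subseteq> U" using \<zeta>D(3) S by blast
  obtain r where r: "r > 0" "(\<Union>x\<in>?K. cball x r) \<subseteq> U"
    using compact_subset_open_imp_cball_epsilon_subset[OF \<zeta>D(2) U KU] by blast
  define K' where "K' = (\<Union>x\<in>?K. cball x r)"
  have K'U: "K' \<subseteq> U" using r K'_def by simp
  have cK': "compact K'"
  proof -
    have "K' = {x + y | x y. x \<in> ?K \<and> y \<in> cball 0 r}"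
    proof (intro equalityI subsetI)
      fix w assume "w \<in> K'" then obtain x where "x \<in> ?K" "dist x w \<le> r" by (auto simp: K'_def)
      then show "w \<in> {x + y | x y. x \<in> ?K \<and> y \<in> cball 0 r}"
        by (intro CollectI exI[of _ x] exI[of _ "w - x"]) (auto simp: dist_norm norm_minus_commute)
    next
      fix w assume "w \<in> {x + y | x y. x \<in> ?K \<and> y \<in> cball 0 r}"
      then obtain x y where "x \<in> ?K" "norm y \<le> r" "w = x + y" by auto
      then show "w \<in> K'" unfolding K'_def by (intro UN_I[of x]) (auto simp: dist_norm)
    qed
    then show ?thesis by (simp only: compact_sums[OF \<zeta>D(2) compact_cball])
  qed
  \<comment> \<open>Only values within distance \<open>r\<close> of the support of \<open>\<zeta>\<close> matter, so \<open>v\<close> and \<open>f\<close> are cut off there to become integrable.\<close>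
  define V where "V x = indicator K' x * v x" for x
  define F where "F x = indicator K' x * f x" for x
  have iK': "integrable lborel (\<lambda>x. indicator K' x * h x)" if "continuous_on U h" for h :: "'a \<Rightarrow> real"
    using borel_integrable_compact[OF cK' continuous_on_subset[OF that K'U]] by simp
  have V: "integrable lborel V" and F: "integrable lborel F"
    unfolding V_def F_def using iK'[OF v] iK'[OF f] by simp_all
  have bdd: "\<exists>M. \<forall>x. \<bar>indicator K' x * h x\<bar> \<le> M" if "continuous_on U h" for h :: "'a \<Rightarrow> real"
  proof -
    have "compact (h ` K')" using compact_continuous_image[OF continuous_on_subset[OF that K'U] cK'] .
    then obtain B where "\<And>y. y \<in> h ` K' \<Longrightarrow> \<bar>y\<bar> \<le> B" by (metis compact_imp_bounded bounded_iff real_norm_def)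
    then have "\<bar>indicator K' x * h x\<bar> \<le> max B 0" for x by (cases "x \<in> K'") fastforce+
    then show ?thesis by blast
  qed
  obtain MV where MV: "\<And>x. \<bar>V x\<bar> \<le> MV" using bdd[OF v] V_def by auto
  obtain MF where MF: "\<And>x. \<bar>F x\<bar> \<le> MF" using bdd[OF f] F_def by auto
  have V0: "0 \<le> V x" for x unfolding V_def using v0 K'U by (auto simp: indicator_def)
  have intr: "x \<in> interior K'" if "x \<in> ?K" for x
    by (rule interiorI[of "ball x r"]) (use that r in \<open>auto simp: K'_def\<close>)
  have isC: "isCont (\<lambda>x. indicator K' x * h x) x" if "x \<in> ?K" "continuous_on U h" for x and h :: "'a \<Rightarrow> real"
  proof -
    have "isCont h x" using that U KU continuous_on_eq_continuous_at by blast
    moreover have "\<forall>\<^sub>F y in nhds x. indicator K' y * h y = h y"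
      using eventually_nhds_in_open[OF open_interior intr[OF that(1)]]
      by (rule eventually_mono) (use interior_subset in \<open>auto simp: indicator_def\<close>)
    ultimately show ?thesis using isCont_cong by metis
  qed
  define z where "z n = conv V (\<rho> n)" for n
  have lc: "Ck_on 1 UNIV (conv V (\<rho> n))" "Ck_on 1 UNIV (partial b (conv V (\<rho> n)))"
    "laplacian (conv V (\<rho> n)) x = conv V (laplacian (\<rho> n)) x" for n b x
    by (rule laplacian_conv[OF V approximate_identityD(1)[OF ai] compact_cball], erule approximate_identity_cball[OF ai])+
  have z1: "Ck_on 1 UNIV (z n)" for n unfolding z_def using lc(1) .
  have z2: "Ck_on 1 UNIV (partial b (z n))" for n b unfolding z_def using lc(2) .
  have z0: "0 \<le> z n x" for n x
    unfolding z_def conv_def using V0 approximate_identityD(2)[OF ai] by (simp add: integral_nonneg_AE)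
  have zM: "\<bar>z n x\<bar> \<le> MV" for n x
    using conv_close[OF ai V, of x n 0 MV] MV unfolding z_def by simp
  have zlim: "(\<lambda>n. z n x) \<longlonglongrightarrow> v x" if "x \<in> ?K" for x
  proof -
    have "isCont V x" unfolding V_def using isC[OF that v] .
    moreover have "V x = v x" using intr[OF that] interior_subset by (auto simp: V_def indicator_def)
    ultimately show ?thesis using conv_tendsto[OF ai V] unfolding z_def by metis
  qed
  define Fn where "Fn n = conv F (\<rho> n)" for n
  have Fnc: "continuous_on UNIV (Fn n)" for n unfolding Fn_def
    by (rule conv_continuous[OF F approximate_identityD(5)[OF ai] compact_cball approximate_identity_cball[OF ai]])
  have FM: "\<bar>Fn n x\<bar> \<le> MF" for n x
    using conv_close[OF ai F, of x n 0 MF] MF unfolding Fn_def by simp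
  have Flim: "(\<lambda>n. Fn n x) \<longlonglongrightarrow> f x" if "x \<in> ?K" for x
  proof -
    have "isCont F x" unfolding F_def using isC[OF that f] .
    moreover have "F x = f x" using intr[OF that] interior_subset by (auto simp: F_def indicator_def)
    ultimately show ?thesis using conv_tendsto[OF ai F] unfolding Fn_def by metis
  qed
  have lap: "laplacian (z n) x = Fn n x" if "x \<in> ?K" and n: "R / real (Suc n) < r" for n x
  proof -
    define \<phi> where "\<phi> y = 1 * \<rho> n (x + (-1) *\<^sub>R y)" for y
    have sub: "cball x r \<subseteq> K'" using that K'_def by blast
    have off: "\<phi> y = 0" if "y \<notin> cball x r" for y
      unfolding \<phi>_def using approximate_identityD(4)[OF ai, of n "x - y"] n that by (auto simp: dist_norm)
    have s\<phi>: "smooth_fun \<phi>" unfolding \<phi>_def using smooth_affine[OF approximate_identityD(1)[OF ai]] by blast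
    have supp\<phi>: "supp \<phi> \<subseteq> cball x r" by (rule supp_subset[OF closed_cball off])
    have "closed (supp \<phi>)" by (simp add: supp_def)
    then have "compact (supp \<phi>)" using compact_Int_closed[OF compact_cball, of "supp \<phi>" x r] supp\<phi> by (simp add: Int_absorb1)
    then have tf: "\<phi> \<in> test_functions U" unfolding test_functions_def using s\<phi> supp\<phi> sub K'U by blast
    have dd: "\<rho> n differentiable (at y)" "partial b (\<rho> n) differentiable (at y)" for y b
      using approximate_identityD(1)[OF ai] C1_differentiable smooth_C1 smooth_partial by blast+
    have p1: "partial b \<phi> = (\<lambda>y. (-1) * partial b (\<rho> n) (x + (-1) *\<^sub>R y))" for b
    proof
      fix y show "partial b \<phi> y = (-1) * partial b (\<rho> n) (x + (-1) *\<^sub>R y)"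
        unfolding \<phi>_def using partial_affine(2)[OF dd(1), where c="-1" and a=x] by simp
    qed
    have p2: "partial b (partial b \<phi>) y = partial b (partial b (\<rho> n)) (x - y)" for b y
    proof -
      have df: "(\<lambda>y. partial b (\<rho> n) (x + (-1) *\<^sub>R y)) differentiable (at y)"
        using partial_affine(1)[OF dd(2), where c="-1" and a=x] unfolding differentiable_def by blast
      have "partial b (partial b \<phi>) y = (-1) * partial b (\<lambda>y. partial b (\<rho> n) (x + (-1) *\<^sub>R y)) y"
        unfolding p1 using partial_mult[OF differentiable_const df, of b "-1"] by (simp add: partial_const)
      also have "\<dots> = partial b (partial b (\<rho> n)) (x - y)"
        using partial_affine(2)[OF dd(2), where c="-1" and a=x] by simp
      finally show ?thesis .
    qed
    have l\<phi>: "laplacian \<phi> y = laplacian (\<rho> n) (x - y)" for y unfolding laplacian_def by (simp add: p2)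
    have offp: "partial b \<phi> y = 0" if "y \<notin> cball x r" for b y
      using partial_zero_off[OF closed_cball off that] .
    have offl: "laplacian \<phi> y = 0" if "y \<notin> cball x r" for y
      unfolding laplacian_def using partial_zero_off[OF closed_cball offp that] by simp
    have offK: "laplacian \<phi> y = 0" "\<phi> y = 0" if "y \<notin> K'" for y
      using offl[of y] off[of y] that sub by blast+
    have \<phi>: "\<rho> n (x - y) = \<phi> y" for y by (simp add: \<phi>_def)
    have "laplacian (z n) x = (LINT y|lborel. V y * laplacian (\<rho> n) (x - y))"
      unfolding z_def lc(3) by (simp add: conv_def)
    also have "\<dots> = (LINT y:U|lborel. v y * laplacian \<phi> y)"
      unfolding set_lebesgue_integral_def l\<phi>[symmetric]
      by (rule Bochner_Integration.integral_cong) (use K'U in \<open>auto simp: V_def indicator_def offK\<close>)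
    also have "\<dots> = (LINT y:U|lborel. f y * \<phi> y)" by (rule weak[OF tf])
    also have "\<dots> = (LINT y|lborel. F y * \<rho> n (x - y))"
      unfolding set_lebesgue_integral_def \<phi>
      by (rule Bochner_Integration.integral_cong) (use K'U in \<open>auto simp: F_def indicator_def offK\<close>)
    finally show ?thesis unfolding Fn_def conv_def .
  qed
  have cj: "continuous_on UNIV j" "continuous_on UNIV j1"
    using DERIV_isCont[OF j(1)] DERIV_isCont[OF j(2)] by (auto intro: continuous_at_imp_continuous_on)
  have bj: "\<exists>M. \<forall>n x. \<bar>h (z n x)\<bar> \<le> M" if h: "continuous_on UNIV h" for h :: "real \<Rightarrow> real"
  proof -
    have "compact (h ` {-MV..MV})"
      using compact_continuous_image[OF continuous_on_subset[OF h] compact_Icc] by blast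
    then obtain B where B: "\<And>y. y \<in> h ` {-MV..MV} \<Longrightarrow> \<bar>y\<bar> \<le> B" by (metis compact_imp_bounded bounded_iff real_norm_def)
    have "\<bar>h (z n x)\<bar> \<le> B" for n x using zM[of n x] by (intro B) (auto simp: abs_le_iff)
    then show ?thesis by blast
  qed
  have limj: "(\<lambda>n. h (z n x)) \<longlonglongrightarrow> h (v x)" if "continuous_on UNIV h" "x \<in> ?K" for h :: "real \<Rightarrow> real" and x
    using continuous_on_tendsto_compose[OF that(1) zlim[OF that(2)]] by simp
  have zc: "continuous_on UNIV (z n)" for n using C1_continuous_on[OF z1] .
  have cjz: "continuous_on UNIV (\<lambda>x. h (z n x))" if "continuous_on UNIV h" for n and h :: "real \<Rightarrow> real"
    using continuous_on_compose2[OF that zc] by auto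
  note c2 = continuous_on_power[where n=2]
  have q1: "integrable lborel (\<lambda>x. P x * (\<zeta> x)\<^sup>2)"
  proof (rule integrable_compact_support[OF _ \<zeta>D(2)])
    show "continuous_on UNIV (\<lambda>x. P x * (\<zeta> x)\<^sup>2)"
      by (rule continuous_extend_by_zero[OF S(1) _ cl \<zeta>D(3)])
        (use \<zeta>D(4) in \<open>auto intro!: continuous_intros P continuous_on_subset[OF C1_continuous_on[OF \<zeta>D(1)]]\<close>)
  qed (simp add: \<zeta>D(4))
  have gz: "grad_norm_sq \<zeta> x = 0" if "x \<notin> ?K" for x
    by (rule grad_norm_sq_zero_off[OF cl _ that]) (rule \<zeta>D(4))
  have q2: "integrable lborel (grad_norm_sq \<zeta>)"
    by (rule integrable_compact_support[OF grad_norm_sq_continuous[OF \<zeta>D(1)] \<zeta>D(2)]) (rule gz)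
  have q3: "integrable lborel (\<lambda>x. (\<zeta> x)\<^sup>2)"
    by (rule integrable_compact_support[OF _ \<zeta>D(2)]) (auto intro!: continuous_intros C1_continuous_on[OF \<zeta>D(1)] simp: \<zeta>D(4))
  have K1: "x \<in> ?K" if "P x * (\<zeta> x)\<^sup>2 \<noteq> 0" for x using \<zeta>D(4)[of x] that by (cases "x \<in> ?K") auto
  have K2: "x \<in> ?K" if "grad_norm_sq \<zeta> x \<noteq> 0" for x using gz[of x] that by blast
  have K3: "x \<in> ?K" if "(\<zeta> x)\<^sup>2 \<noteq> 0" for x using \<zeta>D(4)[of x] that by (cases "x \<in> ?K") auto
  obtain M1 where M1: "\<And>n x. \<bar>(j (z n x))\<^sup>2\<bar> \<le> M1" using bj[OF c2[OF cj(1)]] by blast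
  obtain M2 where M2: "\<And>n x. \<bar>j (z n x) * j1 (z n x)\<bar> \<le> M2" using bj[OF continuous_on_mult[OF cj]] by blast
  have L1: "(\<lambda>n. LINT x|lborel. (j (z n x))\<^sup>2 * (P x * (\<zeta> x)\<^sup>2)) \<longlonglongrightarrow> (LINT x|lborel. (j (v x))\<^sup>2 * (P x * (\<zeta> x)\<^sup>2))"
    by (rule integral_tendsto_bounded_weight[OF q1 cjz[OF c2[OF cj(1)]] limj[OF c2[OF cj(1)] K1] M1])
  have L2: "(\<lambda>n. LINT x|lborel. (j (z n x))\<^sup>2 * grad_norm_sq \<zeta> x) \<longlonglongrightarrow> (LINT x|lborel. (j (v x))\<^sup>2 * grad_norm_sq \<zeta> x)"
    by (rule integral_tendsto_bounded_weight[OF q2 cjz[OF c2[OF cj(1)]] limj[OF c2[OF cj(1)] K2] M1])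
  have L3: "(\<lambda>n. LINT x|lborel. (j (z n x) * j1 (z n x) * Fn n x) * (\<zeta> x)\<^sup>2) \<longlonglongrightarrow> (LINT x|lborel. (j (v x) * j1 (v x) * f x) * (\<zeta> x)\<^sup>2)"
  proof (rule integral_tendsto_bounded_weight[OF q3])
    show "continuous_on UNIV (\<lambda>x. j (z n x) * j1 (z n x) * Fn n x)" for n
      by (intro continuous_on_mult cjz[OF cj(1)] cjz[OF cj(2)] Fnc)
    show "(\<lambda>n. j (z n x) * j1 (z n x) * Fn n x) \<longlonglongrightarrow> j (v x) * j1 (v x) * f x" if "(\<zeta> x)\<^sup>2 \<noteq> 0" for x
      by (intro tendsto_mult limj[OF cj(1) K3[OF that]] limj[OF cj(2) K3[OF that]] Flim[OF K3[OF that]])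
    show "\<bar>j (z n x) * j1 (z n x) * Fn n x\<bar> \<le> M2 * MF" for n x
      using M2[of n x] FM[of n x] by (simp only: abs_mult[of _ "Fn n x"]) (intro mult_mono, auto)
  qed
  have "(\<lambda>n. R / real (Suc n)) \<longlonglongrightarrow> 0" using LIMSEQ_Suc[OF lim_const_over_n] by blast
  then have ev: "\<forall>\<^sub>F n in sequentially. R / real (Suc n) < r" using r by (intro order_tendstoD) auto
  have "\<forall>\<^sub>F n in sequentially. (LINT x|lborel. (j (z n x))\<^sup>2 * (P x * (\<zeta> x)\<^sup>2)) \<le>
     (LINT x|lborel. (j (z n x))\<^sup>2 * grad_norm_sq \<zeta> x) - (LINT x|lborel. (j (z n x) * j1 (z n x) * Fn n x) * (\<zeta> x)\<^sup>2)"
    using ev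
  proof eventually_elim
    case (elim n)
    have "(LINT x|lborel. P x * (j (z n x) * \<zeta> x)\<^sup>2) \<le>
      (LINT x|lborel. (j (z n x))\<^sup>2 * grad_norm_sq \<zeta> x) - (LINT x|lborel. j (z n x) * j1 (z n x) * laplacian (z n) x * (\<zeta> x)\<^sup>2)"
      by (rule energy_classical[OF z1 z2 z0 \<zeta> S(1) P hardy j jnn])
    moreover have "(LINT x|lborel. j (z n x) * j1 (z n x) * laplacian (z n) x * (\<zeta> x)\<^sup>2) = (LINT x|lborel. (j (z n x) * j1 (z n x) * Fn n x) * (\<zeta> x)\<^sup>2)"
    proof (rule Bochner_Integration.integral_cong[OF refl])
      fix x show "j (z n x) * j1 (z n x) * laplacian (z n) x * (\<zeta> x)\<^sup>2 = (j (z n x) * j1 (z n x) * Fn n x) * (\<zeta> x)\<^sup>2"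
        using lap[OF _ elim, of x] \<zeta>D(4)[of x] by (cases "x \<in> ?K") auto
    qed
    ultimately show ?case by (simp add: power_mult_distrib mult_ac)
  qed
  then have "(LINT x|lborel. (j (v x))\<^sup>2 * (P x * (\<zeta> x)\<^sup>2)) \<le>
     (LINT x|lborel. (j (v x))\<^sup>2 * grad_norm_sq \<zeta> x) - (LINT x|lborel. (j (v x) * j1 (v x) * f x) * (\<zeta> x)\<^sup>2)"
    by (intro tendsto_le[OF _ tendsto_diff[OF L2 L3] L1]) auto
  then show ?thesis by (simp add: power_mult_distrib mult_ac)
qed

section \<open>Second derivatives and traces\<close>

lemma C2_iff: "Ck_on 2 S f \<longleftrightarrow> (\<forall>x\<in>S. f differentiable (at x)) \<and> (\<forall>v. Ck_on 1 S (partial v f))"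
  by (simp add: numeral_2_eq_2 partial_def[abs_def])

lemma C2_partial: "Ck_on 2 S f \<Longrightarrow> Ck_on 1 S (partial v f)"
  by (simp only: C2_iff)

lemma C2_C1: "Ck_on 2 S (f :: 'a::euclidean_space \<Rightarrow> real) \<Longrightarrow> Ck_on 1 S f"
proof -
  assume a: "Ck_on 2 S f"
  have "continuous_on S (partial v f)" for v by (rule C1_continuous_on[OF C2_partial[OF a]])
  moreover have "\<forall>x\<in>S. f differentiable (at x)" using a unfolding C2_iff by (rule conjunct1)
  ultimately show ?thesis unfolding C1_partial_iff by (intro conjI) auto
qed

lemma second_difference:
  fixes f :: "'a::euclidean_space \<Rightarrow> real"
  assumes f: "Ck_on 2 T f" and h: "h > 0"
    and inT0: "\<forall>s\<in>{0..h}. \<forall>t\<in>{0..h}. x + s *\<^sub>R v + t *\<^sub>R w \<in> T"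
  shows "\<exists>s\<in>{0..h}. \<exists>t\<in>{0..h}.
    f (x + h *\<^sub>R v + h *\<^sub>R w) - f (x + h *\<^sub>R v) - f (x + h *\<^sub>R w) + f x = h\<^sup>2 * partial w (partial v f) (x + s *\<^sub>R v + t *\<^sub>R w)"
proof -
  have T: "x + s *\<^sub>R v + t *\<^sub>R w \<in> T" if "0 \<le> s" "s \<le> h" "0 \<le> t" "t \<le> h" for s t
    using inT0 that by auto
  note d1 = C1_differentiable[OF C2_C1[OF f]]
  note d2 = C1_differentiable[OF C2_partial[OF f]]
  define \<phi> where "\<phi> s = f ((x + h *\<^sub>R w) + s *\<^sub>R v) - f (x + s *\<^sub>R v)" for s
  have e: "x + h *\<^sub>R w + s *\<^sub>R v = x + s *\<^sub>R v + h *\<^sub>R w" for s by (simp add: algebra_simps)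
  have inT: "(x + h *\<^sub>R w) + s *\<^sub>R v \<in> T" "x + s *\<^sub>R v \<in> T" if "0 \<le> s" "s \<le> h" for s
    using T[OF that, of h] T[OF that, of 0] h by (auto simp: e)
  have "\<exists>s. 0 < s \<and> s < h \<and> \<phi> h - \<phi> 0 = (h - 0) * (partial v f ((x + h *\<^sub>R w) + s *\<^sub>R v) - partial v f (x + s *\<^sub>R v))"
    unfolding \<phi>_def using h inT by (intro MVT2 DERIV_diff partial_has_real_derivative d1) auto
  then obtain s where s: "0 < s" "s < h" "\<phi> h - \<phi> 0 = h * (partial v f (x + s *\<^sub>R v + h *\<^sub>R w) - partial v f (x + s *\<^sub>R v + 0 *\<^sub>R w))"
    by (auto simp: e)
  have "\<exists>t. 0 < t \<and> t < h \<and> partial v f (x + s *\<^sub>R v + h *\<^sub>R w) - partial v f (x + s *\<^sub>R v + 0 *\<^sub>R w) = (h - 0) * partial w (partial v f) (x + s *\<^sub>R v + t *\<^sub>R w)"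
    using h s T by (intro MVT2 partial_has_real_derivative d2) auto
  then obtain t where t: "0 < t" "t < h" "partial v f (x + s *\<^sub>R v + h *\<^sub>R w) - partial v f (x + s *\<^sub>R v + 0 *\<^sub>R w) = h * partial w (partial v f) (x + s *\<^sub>R v + t *\<^sub>R w)"
    by auto
  show ?thesis
  proof (rule bexI[of _ s], rule bexI[of _ t])
    have "\<phi> h - \<phi> 0 = h * (h * partial w (partial v f) (x + s *\<^sub>R v + t *\<^sub>R w))" using s(3) t(3) by metis
    then show "f (x + h *\<^sub>R v + h *\<^sub>R w) - f (x + h *\<^sub>R v) - f (x + h *\<^sub>R w) + f x = h\<^sup>2 * partial w (partial v f) (x + s *\<^sub>R v + t *\<^sub>R w)"
      unfolding \<phi>_def e by (simp add: power2_eq_square)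
  qed (use s t in auto)
qed

text \<open>Both mixed derivatives are limits of the same symmetric second difference.\<close>

lemma second_partials_commute:
  fixes f :: "'a::euclidean_space \<Rightarrow> real"
  assumes T: "open T" and f: "Ck_on 2 T f" and x: "x \<in> T"
  shows "partial v (partial w f) x = partial w (partial v f) x"
proof (rule ccontr)
  let ?a = "partial v (partial w f)" and ?b = "partial w (partial v f)"
  assume "?a x \<noteq> ?b x"
  define e where "e = \<bar>?a x - ?b x\<bar> / 2"
  have e: "e > 0" using \<open>?a x \<noteq> ?b x\<close> by (simp add: e_def)
  have "isCont ?a x" "isCont ?b x"
    using C1_continuous_partial[OF C2_partial[OF f]] continuous_on_eq_continuous_at[OF T] x by auto
  then have ca: "\<exists>d>0. \<forall>y. dist y x < d \<longrightarrow> dist (?a y) (?a x) < e"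
    and cb: "\<exists>d>0. \<forall>y. dist y x < d \<longrightarrow> dist (?b y) (?b x) < e"
    using e unfolding continuous_at_eps_delta by auto
  obtain da where da: "da > 0" "\<And>y. dist y x < da \<Longrightarrow> dist (?a y) (?a x) < e" using ca by auto
  obtain db where db: "db > 0" "\<And>y. dist y x < db \<Longrightarrow> dist (?b y) (?b x) < e" using cb by auto
  obtain r where r: "r > 0" "ball x r \<subseteq> T" using T x open_contains_ball by blast
  define \<delta> where "\<delta> = min r (min da db)"
  define N where "N = norm v + norm w + 1"
  define h where "h = \<delta> / (2 * N)"
  have \<delta>: "\<delta> > 0" using r da db by (simp add: \<delta>_def)
  have n0: "N > 0" by (simp add: N_def add_nonneg_pos)
  then have h: "h > 0" using \<delta> by (simp add: h_def)
  have close: "norm (s *\<^sub>R v + t *\<^sub>R w) < \<delta>" if "0 \<le> s" "s \<le> h" "0 \<le> t" "t \<le> h" for s t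
  proof -
    have "norm (s *\<^sub>R v + t *\<^sub>R w) \<le> s * norm v + t * norm w" using norm_triangle_ineq[of "s *\<^sub>R v" "t *\<^sub>R w"] that by simp
    also have "\<dots> \<le> h * norm v + h * norm w" using that by (intro add_mono mult_right_mono) auto
    also have "\<dots> \<le> h * N" using h by (simp add: N_def distrib_left)
    also have "\<dots> = \<delta> / 2" using n0 by (simp add: h_def)
    finally show ?thesis using \<delta> by simp
  qed
  have inT: "x + s *\<^sub>R v + t *\<^sub>R w \<in> T" if "0 \<le> s" "s \<le> h" "0 \<le> t" "t \<le> h" for s t
  proof -
    have "dist x (x + s *\<^sub>R v + t *\<^sub>R w) = norm (s *\<^sub>R v + t *\<^sub>R w)"
      by (metis add.assoc add_diff_cancel_left' dist_commute dist_norm)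
    also have "\<dots> < r" using close[OF that] by (simp add: \<delta>_def)
    finally show ?thesis using r(2) by auto
  qed
  obtain s t where st: "0 \<le> s" "s \<le> h" "0 \<le> t" "t \<le> h"
    "f (x + h *\<^sub>R v + h *\<^sub>R w) - f (x + h *\<^sub>R v) - f (x + h *\<^sub>R w) + f x = h\<^sup>2 * ?b (x + s *\<^sub>R v + t *\<^sub>R w)"
    using second_difference[OF f h, of x v w] inT by fastforce
  have inT': "x + s *\<^sub>R w + t *\<^sub>R v \<in> T" if "0 \<le> s" "s \<le> h" "0 \<le> t" "t \<le> h" for s t
    using inT[of t s] that by (simp add: algebra_simps)
  obtain s' t' where st': "0 \<le> s'" "s' \<le> h" "0 \<le> t'" "t' \<le> h"
    "f (x + h *\<^sub>R w + h *\<^sub>R v) - f (x + h *\<^sub>R w) - f (x + h *\<^sub>R v) + f x = h\<^sup>2 * ?a (x + s' *\<^sub>R w + t' *\<^sub>R v)"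
    using second_difference[OF f h, of x w v] inT' by fastforce
  have "x + h *\<^sub>R w + h *\<^sub>R v = x + h *\<^sub>R v + h *\<^sub>R w" by (simp add: algebra_simps)
  then have "h\<^sup>2 * ?a (x + s' *\<^sub>R w + t' *\<^sub>R v) = h\<^sup>2 * ?b (x + s *\<^sub>R v + t *\<^sub>R w)"
    using st(5) st'(5) by (simp only:)
  then have eq: "?a (x + s' *\<^sub>R w + t' *\<^sub>R v) = ?b (x + s *\<^sub>R v + t *\<^sub>R w)" using h by simp
  have "dist (x + s' *\<^sub>R w + t' *\<^sub>R v) x < \<delta>" using close[of t' s'] st' by (simp add: dist_norm add.assoc add.commute)
  then have 1: "dist (?a (x + s' *\<^sub>R w + t' *\<^sub>R v)) (?a x) < e" by (intro da(2)) (simp add: \<delta>_def)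
  have "dist (x + s *\<^sub>R v + t *\<^sub>R w) x < \<delta>" using close[of s t] st by (simp add: dist_norm add.assoc)
  then have 2: "dist (?b (x + s *\<^sub>R v + t *\<^sub>R w)) (?b x) < e" by (intro db(2)) (simp add: \<delta>_def)
  have "\<bar>?a x - ?b x\<bar> < 2 * e" using 1 2 eq unfolding dist_real_def by linarith
  then show False by (simp add: e_def)
qed

lemma partial_sum:
  assumes "finite I" "\<And>i. i \<in> I \<Longrightarrow> f i differentiable (at x)"
  shows "partial v (\<lambda>x. \<Sum>i\<in>I. c i * f i x) x = (\<Sum>i\<in>I. c i * partial v (f i) x)"
  by (rule partial_eqI) (auto intro!: has_derivative_sum has_derivative_mult_right partial_has_derivative assms)

lemma second_partial_expand:
  fixes f :: "'a::euclidean_space \<Rightarrow> real"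
  assumes T: "open T" and f: "Ck_on 2 T f" and x: "x \<in> T"
  shows "partial v (partial w f) x = (\<Sum>b\<in>Basis. (w \<bullet> b) * partial v (partial b f) x)"
proof -
  have "partial v (partial w f) x = partial v (\<lambda>x. \<Sum>b\<in>Basis. (w \<bullet> b) * partial b f x) x"
    by (rule partial_cong[OF T x], rule partial_expand, rule C1_differentiable[OF C2_C1[OF f]])
  also have "\<dots> = (\<Sum>b\<in>Basis. (w \<bullet> b) * partial v (partial b f) x)"
    by (rule partial_sum) (use C1_differentiable[OF C2_partial[OF f]] x in auto)
  finally show ?thesis .
qed

text \<open>Directions orthogonal to the range contribute nothing to the trace, so an orthonormal basis of a space containing the range
  suffices.\<close>

lemma trace_eq_sum_over_range:
  fixes L :: "'a::euclidean_space \<Rightarrow> 'a"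
  assumes L: "linear L" and B: "finite B" "pairwise orthogonal B" "\<And>e. e \<in> B \<Longrightarrow> norm e = 1" and rng: "\<And>v. L v \<in> span B"
  shows "(\<Sum>b\<in>Basis. L b \<bullet> b) = (\<Sum>e\<in>B. L e \<bullet> e)"
proof -
  have "(\<Sum>b\<in>Basis. L b \<bullet> b) = (\<Sum>b\<in>Basis. (\<Sum>e\<in>B. (L b \<bullet> e) *\<^sub>R e) \<bullet> b)"
    using orthonormal_basis_expand[OF B(2,3) rng B(1)] by simp
  also have "\<dots> = (\<Sum>b\<in>Basis. \<Sum>e\<in>B. (L b \<bullet> e) * (e \<bullet> b))" by (simp add: inner_sum_left)
  also have "\<dots> = (\<Sum>e\<in>B. \<Sum>b\<in>Basis. (e \<bullet> b) * (L b \<bullet> e))" by (subst sum.swap) (simp add: mult.commute)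
  also have "\<dots> = (\<Sum>e\<in>B. L (\<Sum>b\<in>Basis. (e \<bullet> b) *\<^sub>R b) \<bullet> e)"
    by (simp add: linear_sum[OF L] linear_scale[OF L] inner_sum_left)
  finally show ?thesis by (simp add: euclidean_representation)
qed

lemma second_derivative_at_min:
  fixes f f' :: "real \<Rightarrow> real"
  assumes r: "r > 0" and d: "\<And>t. \<bar>t\<bar> < r \<Longrightarrow> (f has_real_derivative f' t) (at t)"
    and d2: "(f' has_real_derivative l) (at 0)" and min: "\<And>t. \<bar>t\<bar> < r \<Longrightarrow> f 0 \<le> f t"
  shows "l \<ge> 0"
proof (rule ccontr)
  assume "\<not> l \<ge> 0"
  have f0: "f' 0 = 0"
    by (rule DERIV_local_min[OF d r]) (use r min in auto)
  obtain e where e: "e > 0" "\<And>h. 0 < h \<Longrightarrow> h < e \<Longrightarrow> f' h < f' 0"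
    using DERIV_neg_dec_right[OF d2] \<open>\<not> l \<ge> 0\<close> by auto
  define h where "h = min e r / 2"
  have h: "h > 0" "h < e" "h < r" using e r by (auto simp: h_def)
  have "\<exists>t. 0 < t \<and> t < h \<and> f h - f 0 = (h - 0) * f' t"
    using h by (intro MVT2 d) auto
  then obtain t where t: "0 < t" "t < h" "f h - f 0 = h * f' t" by auto
  have "f' t < 0" using e(2)[of t] t h f0 by simp
  then have "f h - f 0 < 0" using t(3) h by (simp add: mult_pos_neg)
  then show False using min[of h] h by simp
qed

section \<open>The distance to a compact submanifold\<close>

lemma open_tube: "closed \<Sigma> \<Longrightarrow> open (tube \<Sigma> r)"
proof -
  assume "closed \<Sigma>"
  have "tube \<Sigma> r = (- \<Sigma>) \<inter> {x. infdist x \<Sigma> < r}" by (auto simp: tube_def)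
  moreover have "open {x. infdist x \<Sigma> < r}"
    by (intro open_Collect_less continuous_intros)
  ultimately show ?thesis using \<open>closed \<Sigma>\<close> by auto
qed

lemma sequence_difference_quotient:
  assumes "((\<lambda>t. g t) has_real_derivative D) (at (0::real))"
  shows "(\<lambda>n. (g (c / real (Suc n)) - g 0) / (1 / real (Suc n))) \<longlonglongrightarrow> c * D"
proof -
  have "((\<lambda>t. g (c * t)) has_real_derivative D * c) (at 0)"
    using DERIV_chain'[of "\<lambda>t. c * t" c 0 UNIV g D] assms by (auto intro!: derivative_eq_intros)
  then have "((\<lambda>h. (g (c * h) - g 0) / h) \<longlongrightarrow> D * c) (at 0)"
    by (simp add: has_field_derivative_iff)
  moreover have "filterlim (\<lambda>n. 1 / real (Suc n)) (at 0) sequentially"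
    using LIMSEQ_Suc[OF lim_inverse_n'] by (auto simp: filterlim_at)
  ultimately have "(\<lambda>n. (g (c * (1 / real (Suc n))) - g 0) / (1 / real (Suc n))) \<longlonglongrightarrow> D * c"
    by (rule filterlim_compose)
  then show ?thesis by (simp add: mult.commute)
qed

text \<open>All geometric information about the submanifold is extracted in this locale from the regularity of the distance in a tube
  and from the dimension of the slice charts.\<close>

locale smooth_tube =
  fixes \<Sigma> :: "'a::euclidean_space set" and \<beta> :: real and k :: nat
  assumes compact: "compact \<Sigma>" and nonempty: "\<Sigma> \<noteq> {}" and \<beta>: "\<beta> > 0"
    and C2: "Ck_on 2 (tube \<Sigma> (4 * \<beta>)) (\<lambda>x. infdist x \<Sigma>)"
    and submanifold: "C2_submanifold k \<Sigma>"
begin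

definition d :: "'a \<Rightarrow> real" where "d x = infdist x \<Sigma>"

text \<open>The gradient of the distance, that is, the unit vector pointing away from the nearest point.\<close>

definition \<nu> :: "'a \<Rightarrow> 'a" where "\<nu> x = (\<Sum>b\<in>Basis. partial b d x *\<^sub>R b)"

abbreviation T :: "'a set" where "T \<equiv> tube \<Sigma> (4 * \<beta>)"

lemma closed: "closed \<Sigma>" using compact compact_imp_closed by blast

lemma open_T: "open T" using open_tube[OF closed] .

lemma d_C2: "Ck_on 2 T d" using C2 by (simp add: d_def[abs_def])

lemma d_C1: "Ck_on 1 T d" using C2_C1[OF d_C2] .

lemma d_pos_iff: "d x > 0 \<longleftrightarrow> x \<notin> \<Sigma>"
  unfolding d_def using in_closed_iff_infdist_zero[OF closed nonempty, of x] infdist_nonneg[of x \<Sigma>] by linarith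

lemma in_tube_iff: "x \<in> tube \<Sigma> r \<longleftrightarrow> 0 < d x \<and> d x < r"
  using d_pos_iff by (auto simp: tube_def d_def)

lemma d_lipschitz: "\<bar>d x - d y\<bar> \<le> norm (x - y)"
  unfolding d_def using infdist_triangle_abs[of x \<Sigma> y] by (simp add: dist_norm)

lemma d_continuous: "continuous_on S d" unfolding d_def[abs_def] by (intro continuous_intros)

lemma nearest: obtains y where "y \<in> \<Sigma>" "norm (x - y) = d x"
  using infdist_attains_inf[OF closed nonempty, of x] by (metis d_def dist_norm)

lemma d_le: "y \<in> \<Sigma> \<Longrightarrow> d x \<le> norm (x - y)"
  unfolding d_def using infdist_le[of y \<Sigma> x] by (simp add: dist_norm)

lemma \<nu>_inner: "x \<in> T \<Longrightarrow> \<nu> x \<bullet> v = partial v d x"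
proof -
  assume x: "x \<in> T"
  have "\<nu> x \<bullet> v = (\<Sum>b\<in>Basis. partial b d x * (b \<bullet> v))" by (simp add: \<nu>_def inner_sum_left)
  also have "\<dots> = (\<Sum>b\<in>Basis. (v \<bullet> b) * partial b d x)"
    by (rule sum.cong[OF refl]) (simp add: inner_commute)
  also have "\<dots> = partial v d x" by (rule partial_expand[OF C1_differentiable[OF d_C1 x], symmetric])
  finally show ?thesis .
qed

lemma partial_d_le:
  assumes x: "x \<in> T" shows "\<bar>partial v d x\<bar> \<le> norm v"
proof -
  have "d differentiable (at (x + 0 *\<^sub>R v))" using C1_differentiable[OF d_C1 x] by simp
  from partial_has_real_derivative[OF this] have D: "((\<lambda>t. d (x + t *\<^sub>R v)) has_real_derivative partial v d x) (at 0)" by simp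
  note L = tendsto_rabs[OF sequence_difference_quotient[OF D, of 1]]
  have "\<bar>(d (x + (1 / real (Suc n)) *\<^sub>R v) - d (x + 0 *\<^sub>R v)) / (1 / real (Suc n))\<bar> \<le> norm v" for n
  proof -
    have "\<bar>d (x + (1 / real (Suc n)) *\<^sub>R v) - d (x + 0 *\<^sub>R v)\<bar> \<le> norm v * (1 / real (Suc n))"
      using d_lipschitz[of "x + (1 / real (Suc n)) *\<^sub>R v" "x + 0 *\<^sub>R v"] by (simp add: abs_div_pos)
    then have "\<bar>d (x + (1 / real (Suc n)) *\<^sub>R v) - d (x + 0 *\<^sub>R v)\<bar> / (1 / real (Suc n)) \<le> norm v"
      by (subst pos_divide_le_eq) auto
    then show ?thesis by (simp only: abs_divide abs_of_nat abs_one)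
  qed
  then have "\<bar>1 * partial v d x\<bar> \<le> norm v"
    by (intro tendsto_upperbound[OF L]) auto
  then show ?thesis by simp
qed

text \<open>On the segment from \<open>x\<close> to a nearest point the distance decreases with unit speed, while it is 1-Lipschitz in every
  direction. Equality in the Cauchy-Schwarz inequality then identifies the gradient.\<close>

lemma gradient_at_nearest:
  assumes x: "x \<in> T" and y: "y \<in> \<Sigma>" "norm (x - y) = d x"
  shows "norm (\<nu> x) = 1" "x - y = d x *\<^sub>R \<nu> x"
proof -
  have dx: "d x > 0" using x in_tube_iff by blast
  have "d differentiable (at (x + 0 *\<^sub>R (y - x)))" using C1_differentiable[OF d_C1 x] by simp
  from partial_has_real_derivative[OF this]
  have D: "((\<lambda>t. d (x + t *\<^sub>R (y - x))) has_real_derivative partial (y - x) d x) (at 0)" by simp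
  have val: "d (x + t *\<^sub>R (y - x)) = (1 - t) * d x" if "0 \<le> t" "t \<le> 1" for t
  proof (rule antisym)
    have "x + t *\<^sub>R (y - x) - y = (1 - t) *\<^sub>R (x - y)" by (simp add: algebra_simps)
    then have "norm (x + t *\<^sub>R (y - x) - y) = (1 - t) * d x" using that y(2) by simp
    then show "d (x + t *\<^sub>R (y - x)) \<le> (1 - t) * d x" using d_le[OF y(1)] by metis
    have "d x - d (x + t *\<^sub>R (y - x)) \<le> norm (x - (x + t *\<^sub>R (y - x)))" using d_lipschitz abs_le_D1 by blast
    also have "\<dots> = t * d x" using that y(2) by (simp add: norm_minus_commute)
    finally show "(1 - t) * d x \<le> d (x + t *\<^sub>R (y - x))" by (simp add: algebra_simps)
  qed
  have "(d (x + (1 / real (Suc n)) *\<^sub>R (y - x)) - d (x + 0 *\<^sub>R (y - x))) / (1 / real (Suc n)) = - d x" for n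
    using val[of "1 / real (Suc n)"] val[of 0] by (simp add: field_simps)
  then have "(\<lambda>n. - d x) \<longlonglongrightarrow> 1 * partial (y - x) d x"
    using sequence_difference_quotient[OF D, of 1] by simp
  then have p: "partial (y - x) d x = - d x" by (simp add: LIMSEQ_const_iff)
  have 1: "\<nu> x \<bullet> (x - y) = d x" using p \<nu>_inner[OF x, of "y - x"] by (simp add: inner_diff_right)
  have "\<nu> x \<bullet> \<nu> x \<le> norm (\<nu> x)"
    using \<nu>_inner[OF x, of "\<nu> x"] partial_d_le[OF x, of "\<nu> x"] by linarith
  then have sq: "norm (\<nu> x) * norm (\<nu> x) \<le> norm (\<nu> x)"
    using power2_norm_eq_inner[of "\<nu> x"] by (simp add: power2_eq_square)
  have le1: "norm (\<nu> x) \<le> 1"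
  proof (rule ccontr)
    assume "\<not> norm (\<nu> x) \<le> 1"
    then have "norm (\<nu> x) * 1 < norm (\<nu> x) * norm (\<nu> x)" by (intro mult_strict_left_mono) auto
    then show False using sq by simp
  qed
  define a where "a = x - y"
  have "(norm (a - d x *\<^sub>R \<nu> x))\<^sup>2 = (norm a)\<^sup>2 - 2 * d x * (\<nu> x \<bullet> a) + (d x)\<^sup>2 * (norm (\<nu> x))\<^sup>2"
    unfolding power2_norm_eq_inner
    by (simp add: inner_diff_left inner_diff_right inner_commute[of a "\<nu> x"] power2_eq_square algebra_simps)
  also have "\<dots> = (d x)\<^sup>2 * ((norm (\<nu> x))\<^sup>2 - 1)" using 1 y(2) unfolding a_def by (simp add: power2_eq_square algebra_simps)
  also have "\<dots> \<le> 0" using le1 by (intro mult_nonneg_nonpos) (auto simp: power_le_one)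
  finally show eq: "x - y = d x *\<^sub>R \<nu> x" by (simp add: a_def)
  have "norm (x - y) = norm (d x *\<^sub>R \<nu> x)" using eq by (rule arg_cong)
  then have "d x = d x * norm (\<nu> x)" using y(2) dx by simp
  then show "norm (\<nu> x) = 1" using dx by simp
qed

lemma \<nu>_norm: assumes "x \<in> T" shows "norm (\<nu> x) = 1"
proof -
  obtain y where "y \<in> \<Sigma>" "norm (x - y) = d x" by (rule nearest)
  then show ?thesis by (rule gradient_at_nearest(1)[OF assms])
qed

lemma foot_in: assumes "x \<in> T" shows "x - d x *\<^sub>R \<nu> x \<in> \<Sigma>"
proof -
  obtain y where y: "y \<in> \<Sigma>" "norm (x - y) = d x" by (rule nearest)
  have "x - d x *\<^sub>R \<nu> x = y" using gradient_at_nearest(2)[OF assms y] by (simp add: algebra_simps)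
  then show ?thesis using y by simp
qed

lemma sum_partial_sq: assumes "x \<in> T" shows "(\<Sum>b\<in>Basis. (partial b d x)\<^sup>2) = 1"
proof -
  have "(\<Sum>b\<in>Basis. (partial b d x)\<^sup>2) = \<nu> x \<bullet> \<nu> x"
    using \<nu>_inner[OF assms] by (subst euclidean_inner) (simp add: power2_eq_square)
  then show ?thesis using \<nu>_norm[OF assms] by (simp add: norm_eq_1)
qed

text \<open>Differentiating \<open>|\<nabla>d|\<^sup>2 = 1\<close> and using the symmetry of second derivatives.\<close>

lemma hessian_normal:
  assumes x: "x \<in> T" shows "partial (\<nu> x) (partial v d) x = 0"
proof -
  note dd = C1_differentiable[OF C2_partial[OF d_C2] x]
  have "partial v (\<lambda>x. \<Sum>b\<in>Basis. (partial b d x)\<^sup>2) x = partial v (\<lambda>x. 1) x"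
    by (rule partial_cong[OF open_T x]) (rule sum_partial_sq)
  then have z: "partial v (\<lambda>x. \<Sum>b\<in>Basis. (partial b d x)\<^sup>2) x = 0" by (simp add: partial_const)
  have D: "((\<lambda>x. \<Sum>b\<in>Basis. (partial b d x)\<^sup>2) has_derivative (\<lambda>v. \<Sum>b\<in>Basis. 2 * partial b d x * partial v (partial b d) x)) (at x)"
  proof (intro has_derivative_sum)
    fix b :: 'a
    show "((\<lambda>x. (partial b d x)\<^sup>2) has_derivative (\<lambda>v. 2 * partial b d x * partial v (partial b d) x)) (at x)"
      using has_derivative_power[OF partial_has_derivative[OF dd[of b]], of 2] by (simp add: mult_ac)
  qed
  have "(\<Sum>b\<in>Basis. 2 * partial b d x * partial v (partial b d) x) = 0"
    using partial_eqI[OF D, of v] z by (rule trans[OF sym])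
  moreover have "(\<Sum>b\<in>Basis. 2 * partial b d x * partial v (partial b d) x) = 2 * (\<Sum>b\<in>Basis. (\<nu> x \<bullet> b) * partial v (partial b d) x)"
    unfolding sum_distrib_left by (rule sum.cong[OF refl]) (simp add: \<nu>_inner[OF x])
  moreover have "partial v (partial (\<nu> x) d) x = (\<Sum>b\<in>Basis. (\<nu> x \<bullet> b) * partial v (partial b d) x)"
    by (rule second_partial_expand[OF open_T d_C2 x])
  moreover have "partial (\<nu> x) (partial v d) x = partial v (partial (\<nu> x) d) x"
    by (rule second_partials_commute[OF open_T d_C2 x])
  ultimately show ?thesis by linarith
qed

end

section \<open>A lower bound for the Laplacian of the distance\<close>

context smooth_tube begin

text \<open>Along \<open>z + t \<nu>(z)\<close> the gradient of the distance satisfies a linear differential inequality for its deviation from \<open>\<nu>(z)\<close>,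
  because the Hessian annihilates the gradient. A Gronwall argument on a short interval shows that the deviation stays zero.\<close>

lemma distance_along_ray_locally:
  assumes z: "z \<in> T"
  shows "\<exists>h>0. \<forall>t\<in>{0..h}. d (z + t *\<^sub>R \<nu> z) = d z + t"
proof -
  define e where "e = \<nu> z"
  have ne: "norm e = 1" unfolding e_def by (rule \<nu>_norm[OF z])
  obtain \<rho> where \<rho>: "\<rho> > 0" "cball z \<rho> \<subseteq> T" using open_T z open_contains_cball by metis
  note c2 = C1_continuous_partial[OF C2_partial[OF d_C2]]
  define S where "S y = (\<Sum>b\<in>Basis. \<Sum>c\<in>Basis. \<bar>partial c (partial b d) y\<bar>)" for y
  have "continuous_on (cball z \<rho>) S" unfolding S_def
    by (intro continuous_intros continuous_on_subset[OF c2 \<rho>(2)])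
  then have "compact (S ` cball z \<rho>)" by (intro compact_continuous_image compact_cball)
  then obtain M where M: "\<And>y. y \<in> cball z \<rho> \<Longrightarrow> \<bar>S y\<bar> \<le> M"
    by (metis compact_imp_bounded bounded_iff real_norm_def imageI)
  have hM: "\<bar>partial c (partial b d) y\<bar> \<le> M" if "y \<in> cball z \<rho>" "b \<in> Basis" "c \<in> Basis" for b c y
  proof -
    have "\<bar>partial c (partial b d) y\<bar> \<le> (\<Sum>c\<in>Basis. \<bar>partial c (partial b d) y\<bar>)"
      by (rule member_le_sum) (use that in auto)
    also have "\<dots> \<le> S y" unfolding S_def
      by (rule member_le_sum[of b Basis "\<lambda>b. \<Sum>c\<in>Basis. \<bar>partial c (partial b d) y\<bar>"]) (use that in \<open>auto intro: sum_nonneg\<close>)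
    also have "\<dots> \<le> M" using M[OF that(1)] by simp
    finally show ?thesis .
  qed
  have M0: "M \<ge> 0" using M[of z] \<rho> by fastforce
  let ?N = "real DIM('a)"
  \<comment> \<open>The interval is so short that the supremum \<open>m\<close> of the deviation satisfies \<open>m \<le> m / 2\<close>.\<close>
  define h where "h = min \<rho> (1 / (2 * (?N * M + 1)))"
  have pos: "2 * (?N * M + 1) > 0" using M0 by (simp add: add_nonneg_pos)
  then have h: "h > 0" "h \<le> \<rho>" using \<rho> by (auto simp: h_def)
  have "h \<le> 1 / (2 * (?N * M + 1))" by (simp add: h_def)
  then have "h * (2 * (?N * M + 1)) \<le> 1" using pos by (simp only: pos_le_divide_eq)
  moreover have "h * (2 * (?N * M + 1)) = 2 * (h * (?N * M)) + 2 * h" by (simp add: algebra_simps)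
  ultimately have hsmall: "h * (?N * M) \<le> 1 / 2" using h by linarith
  have seg: "z + t *\<^sub>R e \<in> cball z \<rho>" if "0 \<le> t" "t \<le> h" for t
    using that h ne by (simp add: dist_norm)
  then have segT: "z + t *\<^sub>R e \<in> T" if "0 \<le> t" "t \<le> h" for t using that \<rho> by blast
  define m where "m t = (\<Sum>b\<in>Basis. \<bar>partial b d (z + t *\<^sub>R e) - e \<bullet> b\<bar>)" for t
  have "continuous_on {0..h} m" unfolding m_def
    by (intro continuous_intros continuous_on_compose2[OF C1_continuous_partial[OF d_C1]]) (use segT in auto)
  then obtain t0 where t0: "t0 \<in> {0..h}" "\<And>t. t \<in> {0..h} \<Longrightarrow> m t \<le> m t0"
    using continuous_attains_sup[of "{0..h}" m] h by auto
  have m0: "m t0 \<ge> 0" unfolding m_def by (simp add: sum_nonneg)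
  have der: "\<bar>partial e (partial b d) (z + t *\<^sub>R e)\<bar> \<le> M * m t0" if t: "t \<in> {0..h}" and b: "b \<in> Basis" for b t
  proof -
    let ?y = "z + t *\<^sub>R e"
    have yT: "?y \<in> T" using segT t by auto
    have dd: "partial b d differentiable (at ?y)" by (rule C1_differentiable[OF C2_partial[OF d_C2] yT])
    have "partial e (partial b d) ?y = partial e (partial b d) ?y - partial (\<nu> ?y) (partial b d) ?y"
      using hessian_normal[OF yT] by simp
    also have "\<dots> = partial (e - \<nu> ?y) (partial b d) ?y"
      by (rule linear_diff[OF partial_linear[OF dd], symmetric])
    also have "\<dots> = (\<Sum>c\<in>Basis. ((e - \<nu> ?y) \<bullet> c) * partial c (partial b d) ?y)" by (rule partial_expand[OF dd])
    also have "\<bar>\<dots>\<bar> \<le> (\<Sum>c\<in>Basis. \<bar>partial c d ?y - e \<bullet> c\<bar> * M)"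
    proof (rule order_trans[OF sum_abs sum_mono])
      fix c :: 'a assume c: "c \<in> Basis"
      have "\<bar>(e - \<nu> ?y) \<bullet> c\<bar> = \<bar>partial c d ?y - e \<bullet> c\<bar>"
        using \<nu>_inner[OF yT, of c] by (simp add: inner_diff_left abs_minus_commute)
      then show "\<bar>((e - \<nu> ?y) \<bullet> c) * partial c (partial b d) ?y\<bar> \<le> \<bar>partial c d ?y - e \<bullet> c\<bar> * M"
        using hM[OF seg b c] t by (simp add: abs_mult mult_left_mono)
    qed
    also have "\<dots> = M * m t" unfolding m_def by (simp add: sum_distrib_left mult.commute)
    also have "\<dots> \<le> M * m t0" using t0(2)[OF t] M0 by (intro mult_left_mono)
    finally show ?thesis .
  qed
  have start: "partial b d (z + 0 *\<^sub>R e) = e \<bullet> b" for b using \<nu>_inner[OF z, of b] by (simp add: e_def)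
  have each: "\<bar>partial b d (z + t0 *\<^sub>R e) - e \<bullet> b\<bar> \<le> h * (M * m t0)" if b: "b \<in> Basis" for b
  proof (cases "t0 = 0")
    case True
    then show ?thesis using start[of b] h M0 m0 by simp
  next
    case False
    then have tp: "0 < t0" "t0 \<le> h" using t0 by auto
    have "\<exists>t. 0 < t \<and> t < t0 \<and> partial b d (z + t0 *\<^sub>R e) - partial b d (z + 0 *\<^sub>R e) = (t0 - 0) * partial e (partial b d) (z + t *\<^sub>R e)"
      using tp by (intro MVT2 partial_has_real_derivative C1_differentiable[OF C2_partial[OF d_C2]] segT) auto
    then obtain t where t: "0 < t" "t < t0" "partial b d (z + t0 *\<^sub>R e) - e \<bullet> b = t0 * partial e (partial b d) (z + t *\<^sub>R e)"
      using start[of b] by auto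
    have "\<bar>partial b d (z + t0 *\<^sub>R e) - e \<bullet> b\<bar> = t0 * \<bar>partial e (partial b d) (z + t *\<^sub>R e)\<bar>"
      using t(3) tp by (simp add: abs_mult)
    also have "\<dots> \<le> h * (M * m t0)"
      using der[of t b] t tp b by (intro mult_mono) auto
    finally show ?thesis .
  qed
  have "m t0 = (\<Sum>b\<in>Basis. \<bar>partial b d (z + t0 *\<^sub>R e) - e \<bullet> b\<bar>)" by (simp only: m_def)
  also have "\<dots> \<le> (\<Sum>b::'a\<in>Basis. h * (M * m t0))" by (rule sum_mono) (rule each)
  also have "\<dots> = (h * (?N * M)) * m t0" by simp
  also have "\<dots> \<le> 1 / 2 * m t0" using hsmall m0 by (intro mult_right_mono)
  finally have "m t0 = 0" using m0 by simp
  have const: "partial b d (z + t *\<^sub>R e) = e \<bullet> b" if t: "t \<in> {0..h}" and b: "b \<in> Basis" for b t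
  proof -
    have "m t \<le> 0" using t0(2)[OF t] \<open>m t0 = 0\<close> by simp
    moreover have "\<bar>partial b d (z + t *\<^sub>R e) - e \<bullet> b\<bar> \<le> m t" unfolding m_def by (rule member_le_sum) (use b in auto)
    ultimately show ?thesis by simp
  qed
  have one: "partial e d (z + t *\<^sub>R e) = 1" if t: "t \<in> {0..h}" for t
  proof -
    have "z + t *\<^sub>R e \<in> T" using segT t by auto
    then have "partial e d (z + t *\<^sub>R e) = (\<Sum>b\<in>Basis. (e \<bullet> b) * partial b d (z + t *\<^sub>R e))"
      by (rule partial_expand[OF C1_differentiable[OF d_C1]])
    also have "\<dots> = e \<bullet> e" by (subst euclidean_inner) (simp add: const[OF t])
    also have "\<dots> = 1" using ne by (simp add: norm_eq_1)
    finally show ?thesis .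
  qed
  have "d (z + t *\<^sub>R e) = d z + t" if t: "t \<in> {0..h}" for t
  proof (cases "t = 0")
    case False
    have "\<exists>s. 0 < s \<and> s < t \<and> d (z + t *\<^sub>R e) - d (z + 0 *\<^sub>R e) = (t - 0) * partial e d (z + s *\<^sub>R e)"
      using t False by (intro MVT2 partial_has_real_derivative C1_differentiable[OF d_C1] segT) auto
    then obtain s where "0 < s" "s < t" "d (z + t *\<^sub>R e) - d z = t * partial e d (z + s *\<^sub>R e)" by auto
    then show ?thesis using one[of s] t by simp
  qed simp
  then show ?thesis unfolding e_def using h by blast
qed

text \<open>The set of admissible parameters is closed, and the local statement applies at its maximum because the foot point, and
  therefore the gradient, do not change along the ray.\<close>

lemma distance_along_ray:
  assumes x: "x \<in> tube \<Sigma> \<beta>" shows "d (x + \<beta> *\<^sub>R \<nu> x) = d x + \<beta>"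
proof -
  have dx: "0 < d x" "d x < \<beta>" using x by (auto simp: in_tube_iff)
  have xT: "x \<in> T" using dx \<beta> by (simp add: in_tube_iff)
  define S where "S = {s\<in>{0..\<beta>}. d (x + s *\<^sub>R \<nu> x) = d x + s}"
  have "closed {s. d (x + s *\<^sub>R \<nu> x) = d x + s}"
    by (intro closed_Collect_eq continuous_on_compose2[OF d_continuous[of UNIV]] continuous_intros) auto
  moreover have "S = {0..\<beta>} \<inter> {s. d (x + s *\<^sub>R \<nu> x) = d x + s}" by (auto simp: S_def)
  ultimately have "closed S" by (simp add: closed_Int)
  moreover have "bounded S" by (rule bounded_subset[OF bounded_closed_interval[of 0 \<beta>]]) (auto simp: S_def)
  ultimately have "compact S" by (simp add: compact_eq_bounded_closed)
  moreover have "0 \<in> S" using \<beta> by (simp add: S_def)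
  ultimately obtain m where m: "m \<in> S" "\<And>s. s \<in> S \<Longrightarrow> s \<le> m"
    using compact_attains_sup[of S] by blast
  have "m = \<beta>"
  proof (rule ccontr)
    assume "m \<noteq> \<beta>"
    then have mb: "0 \<le> m" "m < \<beta>" and dz: "d (x + m *\<^sub>R \<nu> x) = d x + m" using m(1) by (auto simp: S_def)
    define z where "z = x + m *\<^sub>R \<nu> x"
    have zT: "z \<in> T" unfolding in_tube_iff z_def dz using dx mb by linarith
    obtain y where y: "y \<in> \<Sigma>" "norm (x - y) = d x" by (rule nearest)
    have "z - y = (x - y) + m *\<^sub>R \<nu> x" by (simp add: z_def)
    also have "\<dots> = (d x + m) *\<^sub>R \<nu> x" using gradient_at_nearest(2)[OF xT y] by (simp add: scaleR_left_distrib)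
    finally have zy: "z - y = d z *\<^sub>R \<nu> x" using dz by (simp add: z_def)
    then have "norm (z - y) = d z" using \<nu>_norm[OF xT] zT by (simp add: in_tube_iff)
    from gradient_at_nearest(2)[OF zT y(1) this] have "d z *\<^sub>R \<nu> x = d z *\<^sub>R \<nu> z" using zy by simp
    then have \<nu>z: "\<nu> z = \<nu> x" using zT by (simp add: in_tube_iff)
    obtain h where h: "h > 0" "\<And>t. t \<in> {0..h} \<Longrightarrow> d (z + t *\<^sub>R \<nu> z) = d z + t"
      using distance_along_ray_locally[OF zT] by auto
    define t where "t = min h (\<beta> - m)"
    have t: "0 < t" "t \<le> h" "m + t \<le> \<beta>" using h mb by (auto simp: t_def)
    have "d (x + (m + t) *\<^sub>R \<nu> x) = d z + t" using h(2)[of t] t \<nu>z by (simp add: z_def scaleR_left_distrib add.assoc)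
    then have "m + t \<in> S" using t mb dz by (simp add: S_def z_def)
    then show False using m(2) t by fastforce
  qed
  then show ?thesis using m(1) by (simp add: S_def)
qed

text \<open>With \<open>z = x + \<beta> \<nu>(x)\<close> the function \<open>d(z) - |x' - z|\<close> touches the distance from below at \<open>x\<close>, since \<open>d(z) = d(x) + \<beta>\<close>.
  Replacing the norm by the larger quadratic function \<open>|x' - z|\<^sup>2 / (2 \<beta>) + \<beta> / 2\<close>, which agrees with it at \<open>x\<close>, turns this into a
  second derivative test.\<close>

lemma hessian_lower:
  assumes x: "x \<in> tube \<Sigma> \<beta>" shows "partial v (partial v d) x \<ge> - (norm v)\<^sup>2 / \<beta>"
proof -
  have xT: "x \<in> T" using x \<beta> by (auto simp: in_tube_iff)
  obtain \<rho> where \<rho>: "\<rho> > 0" "ball x \<rho> \<subseteq> T" using open_T xT open_contains_ball by metis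
  define r where "r = \<rho> / (norm v + 1)"
  have nv: "norm v + 1 > 0" by (simp add: add_nonneg_pos)
  have r: "r > 0" using \<rho> nv by (simp add: r_def)
  have inT: "x + t *\<^sub>R v \<in> T" if "\<bar>t\<bar> < r" for t
  proof -
    have "\<bar>t\<bar> * norm v \<le> \<bar>t\<bar> * (norm v + 1)" by (intro mult_left_mono) auto
    also have "\<dots> < \<rho>" using that nv by (simp add: r_def pos_less_divide_eq)
    finally show ?thesis using \<rho>(2) by (intro subsetD[OF \<rho>(2)]) (simp add: dist_norm)
  qed
  define c where "c = v \<bullet> \<nu> x"
  define Q where "Q t = t\<^sup>2 * (norm v)\<^sup>2 - 2 * t * \<beta> * c + \<beta>\<^sup>2" for t
  define f where "f t = d (x + t *\<^sub>R v) + Q t / (2 * \<beta>)" for t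
  define f' where "f' t = partial v d (x + t *\<^sub>R v) + (2 * t * (norm v)\<^sup>2 - 2 * \<beta> * c) / (2 * \<beta>)" for t
  have Qnorm: "Q t = (norm (t *\<^sub>R v - \<beta> *\<^sub>R \<nu> x))\<^sup>2" for t
  proof -
    have "(norm (t *\<^sub>R v - \<beta> *\<^sub>R \<nu> x))\<^sup>2 = t\<^sup>2 * (v \<bullet> v) - 2 * t * \<beta> * c + \<beta>\<^sup>2 * (\<nu> x \<bullet> \<nu> x)"
      unfolding power2_norm_eq_inner c_def
      by (simp add: inner_diff_left inner_diff_right inner_commute[of "\<nu> x" v] power2_eq_square algebra_simps)
    also have "\<nu> x \<bullet> \<nu> x = 1" using \<nu>_norm[OF xT] by (simp add: norm_eq_1)
    finally show ?thesis by (simp add: Q_def power2_norm_eq_inner)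
  qed
  have "partial v (partial v d) x + (norm v)\<^sup>2 / \<beta> \<ge> 0"
  proof (rule second_derivative_at_min[OF r])
    show "(f has_real_derivative f' t) (at t)" if "\<bar>t\<bar> < r" for t
      unfolding f_def f'_def Q_def
      by (rule DERIV_add[OF partial_has_real_derivative[OF C1_differentiable[OF d_C1 inT[OF that]]]])
         (use \<beta> in \<open>auto intro!: derivative_eq_intros simp: field_simps\<close>)
    have "partial v d differentiable (at (x + 0 *\<^sub>R v))"
      using C1_differentiable[OF C2_partial[OF d_C2] xT] by simp
    from partial_has_real_derivative[OF this]
    have "((\<lambda>t. partial v d (x + t *\<^sub>R v)) has_real_derivative partial v (partial v d) x) (at 0)" by simp
    then show "(f' has_real_derivative partial v (partial v d) x + (norm v)\<^sup>2 / \<beta>) (at 0)"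
      unfolding f'_def by (rule DERIV_add) (use \<beta> in \<open>auto intro!: derivative_eq_intros\<close>)
    show "f 0 \<le> f t" if "\<bar>t\<bar> < r" for t
    proof -
      define w where "w = norm (t *\<^sub>R v - \<beta> *\<^sub>R \<nu> x)"
      have "d (x + \<beta> *\<^sub>R \<nu> x) - d (x + t *\<^sub>R v) \<le> w"
        using d_lipschitz[of "x + \<beta> *\<^sub>R \<nu> x" "x + t *\<^sub>R v"] by (simp add: w_def norm_minus_commute)
      then have 1: "d x + \<beta> - w \<le> d (x + t *\<^sub>R v)" using distance_along_ray[OF x] by linarith
      have "2 * \<beta> * w \<le> w\<^sup>2 + \<beta>\<^sup>2" using sum_squares_bound[of w \<beta>] by (simp add: mult_ac)
      then have "w \<le> (w\<^sup>2 + \<beta>\<^sup>2) / (2 * \<beta>)" using \<beta> by (simp add: pos_le_divide_eq mult_ac)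
      also have "\<dots> = Q t / (2 * \<beta>) + \<beta> / 2" using Qnorm[of t] \<beta> by (simp add: w_def add_divide_distrib power2_eq_square)
      finally have "d x + \<beta> / 2 \<le> f t" using 1 by (simp add: f_def)
      moreover have "f 0 = d x + \<beta> / 2" using \<beta> by (simp add: f_def Q_def power2_eq_square)
      ultimately show ?thesis by simp
    qed
  qed
  then show ?thesis by (simp add: minus_divide_left[symmetric])
qed

text \<open>The map \<open>x \<mapsto> x - d(x) \<nu>(x)\<close> sends a neighbourhood into the submanifold, so a slice chart carries the range of its derivative
  \<open>L\<close> into a subspace of dimension \<open>k\<close>.\<close>

lemma foot_derivative_range:
  assumes x: "x \<in> T"
  defines "L \<equiv> \<lambda>v. v - partial v d x *\<^sub>R \<nu> x - d x *\<^sub>R (\<Sum>b\<in>Basis. partial v (partial b d) x *\<^sub>R b)"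
  obtains B where "finite B" "card B \<le> k" "pairwise orthogonal B" "\<And>e. e \<in> B \<Longrightarrow> norm e = 1"
    "\<And>v. L v \<in> span B" "linear L"
proof -
  define \<pi> where "\<pi> y = y - d y *\<^sub>R \<nu> y" for y
  have D\<nu>: "(\<nu> has_derivative (\<lambda>v. \<Sum>b\<in>Basis. partial v (partial b d) x *\<^sub>R b)) (at x)"
    unfolding \<nu>_def
    by (intro has_derivative_sum has_derivative_scaleR_left partial_has_derivative C1_differentiable[OF C2_partial[OF d_C2] x])
  have "(\<pi> has_derivative (\<lambda>v. v - (d x *\<^sub>R (\<Sum>b\<in>Basis. partial v (partial b d) x *\<^sub>R b) + partial v d x *\<^sub>R \<nu> x))) (at x)"
    unfolding \<pi>_def
    by (intro has_derivative_diff has_derivative_ident has_derivative_scaleR partial_has_derivative[OF C1_differentiable[OF d_C1 x]] D\<nu>)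
  moreover have "(\<lambda>v. v - (d x *\<^sub>R (\<Sum>b\<in>Basis. partial v (partial b d) x *\<^sub>R b) + partial v d x *\<^sub>R \<nu> x)) = L"
    by (rule ext) (simp add: L_def algebra_simps)
  ultimately have D\<pi>: "(\<pi> has_derivative L) (at x)" by simp
  have linL: "linear L" by (rule has_derivative_linear[OF D\<pi>])
  have \<pi>\<Sigma>: "\<pi> y \<in> \<Sigma>" if "y \<in> T" for y unfolding \<pi>_def by (rule foot_in[OF that])
  define p where "p = \<pi> x"
  have p: "p \<in> \<Sigma>" unfolding p_def by (rule \<pi>\<Sigma>[OF x])
  obtain U V \<Phi> \<Psi> and S :: "'a set" where chart: "open U" "p \<in> U" "open V" "homeomorphism U V \<Phi> \<Psi>" "Ck_on 2 U \<Phi>" "Ck_on 2 V \<Psi>"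
    "subspace S" "dim S = k" "\<Phi> ` (\<Sigma> \<inter> U) = V \<inter> S"
    using submanifold p unfolding C2_submanifold_def by (elim ballE[of _ _ p]) (blast, blast)
  define A where "A = frechet_derivative \<Phi> (at p)"
  have "\<Phi> differentiable (at p)" using chart(2,5) by (simp add: numeral_2_eq_2)
  then have DA: "(\<Phi> has_derivative A) (at p)" by (simp add: A_def frechet_derivative_works)
  have linA: "linear A" by (rule has_derivative_linear[OF DA])
  have \<Phi>p: "\<Phi> p \<in> V" using chart(2,4) by (auto simp: homeomorphism_def)
  have "\<Psi> differentiable (at (\<Phi> p))" using \<Phi>p chart(6) by (simp add: numeral_2_eq_2)
  then obtain B' where DB: "(\<Psi> has_derivative B') (at (\<Phi> p))" by (auto simp: differentiable_def)
  have "((\<lambda>y. \<Psi> (\<Phi> y)) has_derivative (\<lambda>v. B' (A v))) (at p)" by (rule has_derivative_compose[OF DA DB])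
  moreover have "\<Psi> (\<Phi> y) = y" if "y \<in> U" for y using chart(4) that by (auto simp: homeomorphism_def)
  ultimately have "((\<lambda>y. y) has_derivative (\<lambda>v. B' (A v))) (at p)"
    by (rule has_derivative_transform_within_open[OF _ chart(1,2)])
  then have inv: "(\<lambda>v. B' (A v)) = (\<lambda>v. v)" by (rule has_derivative_unique[OF _ has_derivative_ident])
  have injA: "inj A" by (rule inj_on_inverseI[of _ B']) (use fun_cong[OF inv] in auto)
  have c\<pi>: "continuous_on T \<pi>" unfolding \<pi>_def \<nu>_def
    by (intro continuous_intros d_continuous C1_continuous_partial[OF d_C1])
  define G where "G = T \<inter> \<pi> -` U"
  have G: "open G" unfolding G_def by (rule continuous_open_preimage[OF c\<pi> open_T chart(1)])
  have xG: "x \<in> G" using x chart(2) by (simp add: G_def p_def)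
  have AL: "A (L v) \<in> S" for v
  proof -
    have "n \<bullet> A (L v) = 0" if n: "\<And>s. s \<in> S \<Longrightarrow> n \<bullet> s = 0" for n
    proof -
      have "((\<lambda>y. \<Phi> (\<pi> y)) has_derivative (\<lambda>v. A (L v))) (at x)"
        by (rule has_derivative_compose[OF D\<pi>]) (use DA p_def in simp)
      then have "((\<lambda>y. n \<bullet> \<Phi> (\<pi> y)) has_derivative (\<lambda>v. n \<bullet> A (L v))) (at x)"
        by (rule has_derivative_inner_right)
      then have "partial v (\<lambda>y. n \<bullet> \<Phi> (\<pi> y)) x = n \<bullet> A (L v)" by (rule partial_eqI)
      moreover have "partial v (\<lambda>y. n \<bullet> \<Phi> (\<pi> y)) x = partial v (\<lambda>y. 0) x"
      proof (rule partial_cong[OF G xG])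
        fix y assume "y \<in> G"
        then have "\<Phi> (\<pi> y) \<in> \<Phi> ` (\<Sigma> \<inter> U)" using \<pi>\<Sigma> by (auto simp: G_def)
        then show "n \<bullet> \<Phi> (\<pi> y) = 0" using n chart(9) by auto
      qed
      ultimately show ?thesis by (simp add: partial_const)
    qed
    moreover have "orthogonal_comp (orthogonal_comp S) = S" by (rule orthogonal_comp_self[OF chart(7)])
    ultimately show ?thesis unfolding orthogonal_comp_def orthogonal_def
      by (smt (verit, best) inner_commute mem_Collect_eq)
  qed
  define W where "W = {w. A w \<in> S}"
  have W: "subspace W"
    using chart(7) linA unfolding W_def subspace_def by (auto simp: linear_0 linear_add linear_scale)
  have "dim W = dim (A ` W)"
    by (rule dim_image_eq[OF linA, symmetric]) (rule inj_on_subset[OF injA], simp)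
  also have "\<dots> \<le> dim S" by (rule dim_subset) (auto simp: W_def)
  finally have dimW: "dim W \<le> k" using chart(8) by simp
  obtain B where B: "B \<subseteq> W" "pairwise orthogonal B" "\<And>x. x \<in> B \<Longrightarrow> norm x = 1" "independent B" "card B = dim W" "span B = W"
    by (rule orthonormal_basis_subspace[OF W]) blast
  show ?thesis
  proof (rule that[of B])
    show "finite B" using B(4) by (rule independent_imp_finite)
    show "L v \<in> span B" for v using AL B(6) by (simp add: W_def)
  qed (use B dimW linL in auto)
qed

text \<open>The trace of the derivative \<open>L\<close> of the foot point map is \<open>N - 1 - d \<Delta>d\<close>. As the range of \<open>L\<close> has dimension at most \<open>k\<close> and
  the Hessian of the distance is at least \<open>-1 / \<beta>\<close>, this trace is at most \<open>k (1 + d / \<beta>)\<close>.\<close>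

lemma laplacian_d_lower:
  assumes x: "x \<in> tube \<Sigma> \<beta>"
  shows "laplacian d x \<ge> (real DIM('a) - 1 - real k) / d x - real k / \<beta>"
proof -
  have xT: "x \<in> T" and dx: "d x > 0" using x \<beta> by (auto simp: in_tube_iff)
  define H where "H v = (\<Sum>b\<in>Basis. partial v (partial b d) x *\<^sub>R b)" for v
  define L where "L v = v - partial v d x *\<^sub>R \<nu> x - d x *\<^sub>R H v" for v
  obtain B where B: "finite B" "card B \<le> k" "pairwise orthogonal B" "\<And>e. e \<in> B \<Longrightarrow> norm e = 1"
    "\<And>v. L v \<in> span B" "linear L"
    by (rule foot_derivative_range[OF xT, folded H_def, folded L_def]) blast
  have HB: "H v \<bullet> w = partial v (partial w d) x" for v w
  proof -
    have "H v \<bullet> w = (\<Sum>b\<in>Basis. (w \<bullet> b) * partial v (partial b d) x)"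
      unfolding H_def inner_sum_left by (rule sum.cong[OF refl]) (simp add: inner_commute)
    also have "\<dots> = partial v (partial w d) x" by (rule second_partial_expand[OF open_T d_C2 xT, symmetric])
    finally show ?thesis .
  qed
  have Le: "L e \<bullet> e = e \<bullet> e - (partial e d x)\<^sup>2 - d x * partial e (partial e d) x" for e
    unfolding L_def by (simp add: inner_diff_left \<nu>_inner[OF xT] HB power2_eq_square)
  have "(\<Sum>b\<in>Basis. L b \<bullet> b) = real DIM('a) - 1 - d x * laplacian d x"
    unfolding Le laplacian_def using sum_partial_sq[OF xT]
    by (simp add: sum_subtractf sum_distrib_left inner_Basis)
  moreover have "(\<Sum>b\<in>Basis. L b \<bullet> b) = (\<Sum>e\<in>B. L e \<bullet> e)"
    by (rule trace_eq_sum_over_range[OF B(6,1,3,4,5)])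
  moreover have "(\<Sum>e\<in>B. L e \<bullet> e) \<le> (\<Sum>e\<in>B. 1 + d x / \<beta>)"
  proof (rule sum_mono)
    fix e assume e: "e \<in> B"
    have ee: "e \<bullet> e = 1" "norm e = 1" using B(4)[OF e] by (auto simp: norm_eq_1)
    have "d x * (- 1 / \<beta>) \<le> d x * partial e (partial e d) x"
      using hessian_lower[OF x, of e] ee dx by (intro mult_left_mono) auto
    moreover have "d x * (- 1 / \<beta>) = - (d x / \<beta>)" by simp
    moreover have "(partial e d x)\<^sup>2 \<ge> 0" by simp
    ultimately show "L e \<bullet> e \<le> 1 + d x / \<beta>" unfolding Le using ee(1) by linarith
  qed
  moreover have "(\<Sum>e\<in>B. 1 + d x / \<beta>) \<le> real k * (1 + d x / \<beta>)"
    using B(2) dx \<beta> by (simp add: mult_right_mono)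
  ultimately have "real DIM('a) - 1 - real k - real k * d x / \<beta> \<le> d x * laplacian d x" by (simp add: algebra_simps)
  then have "(real DIM('a) - 1 - real k - real k * d x / \<beta>) / d x \<le> laplacian d x"
    using dx by (simp add: pos_divide_le_eq mult.commute)
  then show ?thesis using dx by (simp add: diff_divide_distrib)
qed

end

section \<open>Cutoff functions of one variable\<close>

lemma DERIV_max_power:
  fixes s :: real
  assumes "m \<ge> 2"
  shows "((\<lambda>s. (max 0 s) ^ m) has_real_derivative real m * (max 0 s) ^ (m - 1)) (at s)"
proof -
  consider "s > 0" | "s < 0" | "s = 0" by linarith
  then show ?thesis
  proof cases
    case 1
    have "((\<lambda>s. s ^ m) has_real_derivative real m * s ^ (m - 1)) (at s)"
      by (auto intro!: derivative_eq_intros)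
    then have "((\<lambda>s. (max 0 s) ^ m) has_real_derivative real m * s ^ (m - 1)) (at s)"
      by (rule has_field_derivative_transform_within_open[of _ _ _ "{0<..}"]) (use 1 in auto)
    then show ?thesis using 1 by simp
  next
    case 2
    have "((\<lambda>s. 0) has_real_derivative 0) (at s)" by simp
    then have "((\<lambda>s. (max 0 s) ^ m) has_real_derivative 0) (at s)"
      by (rule has_field_derivative_transform_within_open[of _ _ _ "{..<0}"]) (use 2 assms in auto)
    moreover have z: "(max 0 s) ^ (m - 1) = 0" using 2 assms by (simp add: power_0_left)
    ultimately show ?thesis by (simp only: z mult_zero_right)
  next
    case 3
    have "((\<lambda>h::real. (max 0 (0 + h) ^ m - max 0 0 ^ m) / h) \<longlongrightarrow> 0) (at 0)"
    proof (rule tendsto_rabs_zero_cancel, rule tendsto_sandwich[of "\<lambda>_. 0"])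
      have "\<bar>(max 0 (0 + h) ^ m - max 0 0 ^ m) / h\<bar> \<le> \<bar>h\<bar> ^ (m - 1)" if "h \<noteq> 0" for h :: real
      proof -
        have "\<bar>max 0 h ^ m\<bar> \<le> \<bar>h\<bar> ^ m" by (simp add: power_mono)
        also have "\<dots> = \<bar>h\<bar> ^ (m - 1) * \<bar>h\<bar>" using assms by (simp add: power_eq_if)
        finally show ?thesis using that assms by (simp add: pos_divide_le_eq power_0_left)
      qed
      then show "\<forall>\<^sub>F h::real in at 0. \<bar>(max 0 (0 + h) ^ m - max 0 0 ^ m) / h\<bar> \<le> \<bar>h\<bar> ^ (m - 1)"
        by (auto simp: eventually_at_filter)
      show "((\<lambda>h::real. \<bar>h\<bar> ^ (m - 1)) \<longlongrightarrow> 0) (at 0)"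
        using assms by (auto intro!: tendsto_eq_intros)
    qed auto
    moreover have z: "real m * (max 0 s) ^ (m - 1) = 0" using 3 assms by (simp add: power_0_left)
    ultimately show ?thesis unfolding z has_field_derivative_iff using 3 by simp
  qed
qed

text \<open>Powers of \<open>ramp\<close> give continuously differentiable steps from 0 at \<open>t = 1\<close> to 1 at \<open>t = 2\<close>. The derivative of \<open>step m\<close> is controlled
  by \<open>ramp ^ (m - 1)\<close>, a slightly smaller power of the step itself; this makes absorption by Young's inequality possible.\<close>

definition ramp :: "real \<Rightarrow> real" where "ramp t = max 0 (1 - (max 0 (2 - t))\<^sup>2)"

definition step :: "nat \<Rightarrow> real \<Rightarrow> real" where "step m t = ramp t ^ m"

definition step' :: "nat \<Rightarrow> real \<Rightarrow> real" where "step' m t = real m * ramp t ^ (m - 1) * (2 * max 0 (2 - t))"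

lemma ramp_bounds: "0 \<le> ramp t" "ramp t \<le> 1"
  unfolding ramp_def by auto

lemma ramp_eq_0: "t \<le> 1 \<Longrightarrow> ramp t = 0"
proof -
  assume "t \<le> 1"
  then have "1\<^sup>2 \<le> (max 0 (2 - t))\<^sup>2" by (intro power_mono) auto
  then show ?thesis by (simp add: ramp_def)
qed

lemma ramp_eq_1: "t \<ge> 2 \<Longrightarrow> ramp t = 1" by (simp add: ramp_def)

lemma step_bounds: "0 \<le> step m t" "step m t \<le> 1"
  unfolding step_def using ramp_bounds by (auto intro: power_le_one)

lemma step_eq_0: "m \<ge> 1 \<Longrightarrow> t \<le> 1 \<Longrightarrow> step m t = 0" by (simp add: step_def ramp_eq_0)

lemma step_eq_1: "t \<ge> 2 \<Longrightarrow> step m t = 1" by (simp add: step_def ramp_eq_1)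

lemma step'_nonneg: "step' m t \<ge> 0" unfolding step'_def using ramp_bounds by simp

lemma step'_eq_0: "m \<ge> 2 \<Longrightarrow> t \<le> 1 \<or> t \<ge> 2 \<Longrightarrow> step' m t = 0"
  unfolding step'_def by (auto simp: ramp_eq_0)

lemma step'_le: assumes "m \<ge> 2" shows "step' m t \<le> 2 * real m * ramp t ^ (m - 1)"
proof (cases "t \<le> 1")
  case True then show ?thesis using step'_eq_0[OF assms] ramp_bounds[of t] by simp
next
  case False
  then have "real m * ramp t ^ (m - 1) * (2 * max 0 (2 - t)) \<le> real m * ramp t ^ (m - 1) * 2"
    using ramp_bounds[of t] by (intro mult_left_mono) auto
  then show ?thesis by (simp add: step'_def mult_ac)
qed

lemma step'_le': assumes "m \<ge> 2" shows "step' m t \<le> 2 * real m"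
proof -
  have "2 * real m * ramp t ^ (m - 1) \<le> 2 * real m * 1"
    using ramp_bounds[of t] by (intro mult_left_mono power_le_one) auto
  then show ?thesis using step'_le[OF assms, of t] by simp
qed

lemma continuous_step': "continuous_on S (step' m)"
  unfolding step'_def[abs_def] ramp_def[abs_def] by (intro continuous_intros)

lemma DERIV_step: assumes "m \<ge> 2" shows "(step m has_real_derivative step' m t) (at t)"
proof -
  have 1: "((\<lambda>t. 1 - (max 0 (2 - t))\<^sup>2) has_real_derivative 2 * max 0 (2 - t)) (at t)"
  proof -
    have "((\<lambda>t. 2 - t) has_real_derivative - 1) (at t)" by (auto intro!: derivative_eq_intros)
    from DERIV_chain2[OF DERIV_max_power[of 2] this]
    have "((\<lambda>t. (max 0 (2 - t))\<^sup>2) has_real_derivative - (2 * max 0 (2 - t))) (at t)" by simp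
    from DERIV_diff[OF DERIV_const this, of 1] show ?thesis by simp
  qed
  have "((\<lambda>t. (max 0 (1 - (max 0 (2 - t))\<^sup>2)) ^ m) has_real_derivative
     real m * (max 0 (1 - (max 0 (2 - t))\<^sup>2)) ^ (m - 1) * (2 * max 0 (2 - t))) (at t)"
    by (rule DERIV_chain2[OF DERIV_max_power[OF assms] 1])
  then show ?thesis by (simp add: step_def[abs_def] step'_def ramp_def)
qed

text \<open>Rises on \<open>[\<tau>, 2 \<tau>]\<close>, equals 1 on \<open>[2 \<tau>, r]\<close> and falls on \<open>[r, 2 r]\<close>.\<close>

definition cutoff :: "nat \<Rightarrow> real \<Rightarrow> real \<Rightarrow> real \<Rightarrow> real" where
  "cutoff m \<tau> r t = step m (t / \<tau>) * (1 - step 2 (t / r))"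

definition cutoff' :: "nat \<Rightarrow> real \<Rightarrow> real \<Rightarrow> real \<Rightarrow> real" where
  "cutoff' m \<tau> r t = step' m (t / \<tau>) / \<tau> * (1 - step 2 (t / r)) - step m (t / \<tau>) * (step' 2 (t / r) / r)"

lemma DERIV_cutoff:
  assumes "m \<ge> 2" "\<tau> > 0" "r > 0"
  shows "(cutoff m \<tau> r has_real_derivative cutoff' m \<tau> r t) (at t)"
proof -
  have q: "((\<lambda>t. t / c) has_real_derivative 1 / c) (at t)" for c :: real
    using DERIV_cdivide[OF DERIV_ident, of c t UNIV] by simp
  note a = DERIV_chain2[OF DERIV_step[OF assms(1)] q[of \<tau>]]
  note b = DERIV_diff[OF DERIV_const[of 1] DERIV_chain2[OF DERIV_step[of 2] q[of r]]]
  have "((\<lambda>t. step m (t / \<tau>) * (1 - step 2 (t / r))) has_real_derivative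
     step' m (t / \<tau>) * (1 / \<tau>) * (1 - step 2 (t / r)) + (0 - step' 2 (t / r) * (1 / r)) * step m (t / \<tau>)) (at t)"
    by (rule DERIV_mult[OF a b]) simp
  then show ?thesis by (simp add: cutoff_def[abs_def] cutoff'_def algebra_simps)
qed

lemma continuous_cutoff': assumes "\<tau> > 0" "r > 0" "m \<ge> 2" shows "continuous_on S (cutoff' m \<tau> r)"
proof -
  have s: "continuous_on UNIV (step m')" if "m' \<ge> 2" for m'
    using DERIV_isCont[OF DERIV_step[OF that]] by (auto intro: continuous_at_imp_continuous_on)
  show ?thesis unfolding cutoff'_def[abs_def]
    by (intro continuous_intros continuous_on_compose2[OF s] continuous_on_compose2[OF continuous_step'[of UNIV]])
       (use assms in auto)
qed

lemma cutoff_bounds: "0 \<le> cutoff m \<tau> r t" "cutoff m \<tau> r t \<le> 1"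
  unfolding cutoff_def using step_bounds[of m "t/\<tau>"] step_bounds[of 2 "t/r"] by (auto intro: mult_le_one)

lemma cutoff_support:
  assumes "\<tau> > 0" "r > 0" "m \<ge> 2" "t \<notin> {\<tau>..2 * r}"
  shows "cutoff m \<tau> r t = 0" "cutoff' m \<tau> r t = 0"
proof -
  have "t / \<tau> \<le> 1 \<or> t / r \<ge> 2" using assms by (auto simp: field_simps)
  then show "cutoff m \<tau> r t = 0" "cutoff' m \<tau> r t = 0"
    using assms by (auto simp: cutoff_def cutoff'_def step_eq_0 step_eq_1 step'_eq_0)
qed

lemma cutoff_inner:
  assumes "\<tau> > 0" "r > 0" "t \<le> r" "m \<ge> 2"
  shows "cutoff m \<tau> r t = step m (t / \<tau>)" "cutoff' m \<tau> r t = step' m (t / \<tau>) / \<tau>"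
proof -
  have "t / r \<le> 1" using assms by simp
  then show "cutoff m \<tau> r t = step m (t / \<tau>)" "cutoff' m \<tau> r t = step' m (t / \<tau>) / \<tau>"
    by (simp_all add: cutoff_def cutoff'_def step_eq_0 step'_eq_0)
qed

lemma cutoff_middle:
  assumes "\<tau> > 0" "r > 0" "2 * \<tau> \<le> t" "t \<le> r" "m \<ge> 2"
  shows "cutoff m \<tau> r t = 1" "cutoff' m \<tau> r t = 0"
proof -
  have "t / \<tau> \<ge> 2" using assms by (simp add: field_simps)
  then show "cutoff m \<tau> r t = 1" "cutoff' m \<tau> r t = 0"
    using cutoff_inner[OF assms(1,2,4,5)] assms(5) by (auto simp: step_eq_1 step'_eq_0)
qed

lemma cutoff_outer:
  assumes "\<tau> > 0" "r > 0" "2 * \<tau> \<le> r" "r \<le> t" "m \<ge> 2"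
  shows "cutoff m \<tau> r t = 1 - step 2 (t / r)" "cutoff' m \<tau> r t = - (step' 2 (t / r) / r)" "\<bar>cutoff' m \<tau> r t\<bar> \<le> 4 / r"
proof -
  have "2 * \<tau> \<le> t" using assms by linarith
  then have "t / \<tau> \<ge> 2" using assms by (simp add: pos_le_divide_eq)
  then show "cutoff m \<tau> r t = 1 - step 2 (t / r)" and c: "cutoff' m \<tau> r t = - (step' 2 (t / r) / r)"
    using assms(5) by (auto simp: cutoff_def cutoff'_def step_eq_1 step'_eq_0)
  show "\<bar>cutoff' m \<tau> r t\<bar> \<le> 4 / r"
    using step'_nonneg[of 2 "t/r"] step'_le'[of 2 "t/r"] assms(2) unfolding c by (simp add: divide_right_mono)
qed

section \<open>Radial functions and the Hardy inequality\<close>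

context smooth_tube begin

text \<open>\<open>M\<close> is the exponent for which the surface area of \<open>{d = t}\<close> grows at most like \<open>t\<^sup>M\<close>; \<open>C\<close> collects the curvature.\<close>

definition M :: real where "M = real DIM('a) - 1 - real k"

definition C :: real where "C = real k / \<beta>"

lemma C_nonneg: "C \<ge> 0" using \<beta> by (simp add: C_def)

lemma laplacian_d: "x \<in> tube \<Sigma> \<beta> \<Longrightarrow> laplacian d x \<ge> M / d x - C"
  using laplacian_d_lower by (simp add: M_def C_def)

lemma tube_subset_T: "r \<le> \<beta> \<Longrightarrow> tube \<Sigma> r \<subseteq> T"
  using \<beta> by (auto simp: in_tube_iff)

lemma d_C1_comp:
  assumes "r \<le> \<beta>" "\<And>t. t > 0 \<Longrightarrow> (h has_real_derivative h' t) (at t)" "continuous_on {0<..} h'"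
  shows "Ck_on 1 (tube \<Sigma> r) (\<lambda>x. h (d x))"
  by (rule C1_comp[OF Ck_mono[OF d_C1 tube_subset_T[OF assms(1)]], of "{0<..}" h h'])
     (use assms in \<open>auto simp: in_tube_iff\<close>)

lemma partial_d_comp:
  assumes "x \<in> T" "(h has_real_derivative c) (at (d x))"
  shows "partial v (\<lambda>x. h (d x)) x = c * partial v d x"
  by (rule partial_comp[OF C1_differentiable[OF d_C1 assms(1)] assms(2)])

definition shell :: "real \<Rightarrow> real \<Rightarrow> 'a set" where "shell a b = {x. a \<le> d x \<and> d x \<le> b}"

lemma compact_shell: "compact (shell a b)"
proof -
  have "closed (shell a b)" unfolding shell_def
    by (intro closed_Collect_conj closed_Collect_le continuous_intros d_continuous)
  moreover have "bounded (shell a b)"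
  proof -
    obtain R where R: "\<And>y. y \<in> \<Sigma> \<Longrightarrow> norm y \<le> R" using compact_imp_bounded[OF compact] by (auto simp: bounded_iff)
    have "norm x \<le> R + b" if "x \<in> shell a b" for x
    proof -
      obtain y where "y \<in> \<Sigma>" "norm (x - y) = d x" by (rule nearest)
      then show ?thesis using R[of y] that norm_triangle_sub[of x y] by (simp add: shell_def)
    qed
    then show ?thesis by (auto simp: bounded_iff)
  qed
  ultimately show ?thesis by (simp add: compact_eq_bounded_closed)
qed

lemma shell_subset_tube: "0 < a \<Longrightarrow> b < r \<Longrightarrow> shell a b \<subseteq> tube \<Sigma> r"
  by (auto simp: shell_def in_tube_iff)

lemma shell_integrable:
  fixes F :: "'a \<Rightarrow> real"
  assumes "continuous_on (shell a b) F" shows "set_integrable lborel (shell a b) F"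
  unfolding set_integrable_def by (rule borel_integrable_compact[OF compact_shell assms])

text \<open>For every vector field \<open>A\<close> one has \<open>|\<nabla>g|\<^sup>2 \<ge> (div A - |A|\<^sup>2) g\<^sup>2\<close> up to a divergence. The choice \<open>A = (H / d + K) \<nabla>d\<close> yields the
  sharp constant \<open>H\<^sup>2\<close>: the extra constant \<open>K\<close> produces a term of order \<open>1 / d\<close> that beats the curvature error.\<close>

lemma hardy_tube:
  assumes H: "H \<ge> 0" and MH: "M = 2 * H + 1"
  obtains r where "0 < r" "r \<le> \<beta>"
    "\<And>g. g \<in> C1c (tube \<Sigma> r) \<Longrightarrow> (LINT x|lborel. H\<^sup>2 / (d x)\<^sup>2 * (g x)\<^sup>2) \<le> (LINT x|lborel. grad_norm_sq g x)"
proof -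
  \<comment> \<open>Makes the coefficient of \<open>1 / d\<close> in \<open>div A - |A|\<^sup>2\<close> equal to 1.\<close>
  define K where "K = H * C + 1"
  have K: "K \<ge> 1" using H C_nonneg by (simp add: K_def)
  define r where "r = min \<beta> (1 / (K * (C + K)))"
  have KC: "K * (C + K) > 0" using K C_nonneg by (intro mult_pos_pos) auto
  have r: "0 < r" "r \<le> \<beta>" using KC \<beta> by (auto simp: r_def)
  define a where "a t = H / t + K" for t :: real
  define a' where "a' t = - H / t\<^sup>2" for t :: real
  have Da: "(a has_real_derivative a' t) (at t)" if "t > 0" for t
    unfolding a_def a'_def using that
    by (auto intro!: derivative_eq_intros simp: power2_eq_square)
  have a: "a t * (M / t - C) + a' t - (a t)\<^sup>2 \<ge> H\<^sup>2 / t\<^sup>2" if t: "0 < t" "t < r" for t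
  proof -
    have "t \<le> 1 / (K * (C + K))" using t by (simp add: r_def)
    then have "K * (C + K) \<le> 1 / t" using t KC by (simp add: field_simps)
    moreover have "a t * (M / t - C) + a' t - (a t)\<^sup>2 = H\<^sup>2 / t\<^sup>2 + (1 / t - K * (C + K))"
      unfolding a_def a'_def MH K_def using t by (simp add: field_simps power2_eq_square)
    ultimately show ?thesis by simp
  qed
  have "(LINT x|lborel. H\<^sup>2 / (d x)\<^sup>2 * (g x)\<^sup>2) \<le> (LINT x|lborel. grad_norm_sq g x)" if g: "g \<in> C1c (tube \<Sigma> r)" for g
  proof -
    note gD = C1cD[OF g]
    let ?K = "supp g"
    have cl: "closed ?K" using gD(2) compact_imp_closed by blast
    have inT: "x \<in> T" if "x \<in> tube \<Sigma> r" for x using that tube_subset_T[OF r(2)] by blast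
    have oT: "open (tube \<Sigma> r)" by (rule open_tube[OF closed])
    define F where "F b x = (g x * g x) * (a (d x) * partial b d x)" for b x
    have ca': "continuous_on {0<..} a'" unfolding a'_def by (intro continuous_intros) auto
    have C1a: "Ck_on 1 (tube \<Sigma> r) (\<lambda>x. a (d x))" by (rule d_C1_comp[OF r(2) Da ca'])
    have C1p: "Ck_on 1 (tube \<Sigma> r) (partial b d)" for b by (rule Ck_mono[OF C2_partial[OF d_C2] tube_subset_T[OF r(2)]])
    have C1g: "Ck_on 1 (tube \<Sigma> r) g" by (rule Ck_mono[OF gD(1)]) simp
    have Foff: "F b x = 0" if "x \<notin> ?K" for b x using gD(4)[OF that] by (simp add: F_def)
    have "Ck_on 1 (tube \<Sigma> r) (F b)" for b unfolding F_def[abs_def] by (intro C1_mult C1g C1a C1p)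
    then have F1: "Ck_on 1 UNIV (F b)" for b
      by (rule Ck_extend_by_zero[OF oT _ cl gD(3)]) (rule Foff)
    note dv = integral_divergence_eq_0[of F, OF F1 gD(2) Foff]
    have goff: "grad_norm_sq g x = 0" if "x \<notin> ?K" for x
      by (rule grad_norm_sq_zero_off[OF cl _ that]) (rule gD(4))
    have Foffp: "partial b (F b) x = 0" if "x \<notin> ?K" for b x
      by (rule partial_zero_off[OF cl _ that]) (rule Foff)
    have pt: "H\<^sup>2 / (d x)\<^sup>2 * (g x)\<^sup>2 \<le> grad_norm_sq g x + (\<Sum>b\<in>Basis. partial b (F b) x)" for x
    proof (cases "x \<in> ?K")
      case False
      then show ?thesis using goff gD(4) Foffp by simp
    next
      case True
      then have xt: "x \<in> tube \<Sigma> r" using gD(3) by blast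
      then have dx: "0 < d x" "d x < r" by (auto simp: in_tube_iff)
      have x\<beta>: "x \<in> tube \<Sigma> \<beta>" using dx r by (auto simp: in_tube_iff)
      have pF: "partial b (F b) x = 2 * g x * a (d x) * (partial b g x * partial b d x)
         + (g x)\<^sup>2 * (a' (d x) * (partial b d x)\<^sup>2 + a (d x) * partial b (partial b d) x)" for b
      proof -
        note D = C1_differentiable[OF C1g xt] C1_differentiable[OF C1a xt] C1_differentiable[OF C1p xt]
          C1_differentiable[OF C1_mult[OF C1g C1g] xt] C1_differentiable[OF C1_mult[OF C1a C1p] xt]
        have "partial b (F b) x = (g x * g x) * partial b (\<lambda>x. a (d x) * partial b d x) x + partial b (\<lambda>x. g x * g x) x * (a (d x) * partial b d x)"
          unfolding F_def by (rule partial_mult[OF D(4) D(5)])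
        moreover have "partial b (\<lambda>x. a (d x) * partial b d x) x = a (d x) * partial b (partial b d) x + partial b (\<lambda>x. a (d x)) x * partial b d x"
          by (rule partial_mult[OF D(2) D(3)])
        moreover have "partial b (\<lambda>x. g x * g x) x = g x * partial b g x + partial b g x * g x"
          by (rule partial_mult[OF D(1) D(1)])
        moreover have "partial b (\<lambda>x. a (d x)) x = a' (d x) * partial b d x"
          by (rule partial_d_comp[OF inT[OF xt] Da[OF dx(1)]])
        ultimately show ?thesis by (simp add: power2_eq_square algebra_simps)
      qed
      have "(\<Sum>b\<in>Basis. partial b (F b) x) = 2 * g x * a (d x) * (\<Sum>b\<in>Basis. partial b g x * partial b d x)
         + (g x)\<^sup>2 * (a' (d x) * (\<Sum>b\<in>Basis. (partial b d x)\<^sup>2) + a (d x) * laplacian d x)"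
        unfolding pF laplacian_def by (simp add: sum.distrib sum_distrib_left algebra_simps)
      then have div: "(\<Sum>b\<in>Basis. partial b (F b) x) = 2 * g x * a (d x) * (\<Sum>b\<in>Basis. partial b g x * partial b d x)
         + (g x)\<^sup>2 * (a' (d x) + a (d x) * laplacian d x)"
        using sum_partial_sq[OF inT[OF xt]] by simp
      have "0 \<le> (\<Sum>b\<in>Basis. (partial b g x + g x * a (d x) * partial b d x)\<^sup>2)" by (simp add: sum_nonneg)
      also have "\<dots> = grad_norm_sq g x + 2 * g x * a (d x) * (\<Sum>b\<in>Basis. partial b g x * partial b d x)
         + (g x)\<^sup>2 * (a (d x))\<^sup>2 * (\<Sum>b\<in>Basis. (partial b d x)\<^sup>2)"
        unfolding grad_norm_sq_def by (simp add: power2_eq_square sum.distrib sum_distrib_left algebra_simps)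
      finally have sq: "0 \<le> grad_norm_sq g x + 2 * g x * a (d x) * (\<Sum>b\<in>Basis. partial b g x * partial b d x) + (g x)\<^sup>2 * (a (d x))\<^sup>2"
        using sum_partial_sq[OF inT[OF xt]] by simp
      have ann: "a (d x) \<ge> 0" using H K dx by (simp add: a_def)
      have "H\<^sup>2 / (d x)\<^sup>2 \<le> a (d x) * (M / d x - C) + a' (d x) - (a (d x))\<^sup>2" by (rule a[OF dx])
      also have "\<dots> \<le> a (d x) * laplacian d x + a' (d x) - (a (d x))\<^sup>2"
        using laplacian_d[OF x\<beta>] ann by (simp add: mult_left_mono)
      finally have "(g x)\<^sup>2 * (H\<^sup>2 / (d x)\<^sup>2) \<le> (g x)\<^sup>2 * (a (d x) * laplacian d x + a' (d x) - (a (d x))\<^sup>2)"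
        by (intro mult_left_mono) auto
      then show ?thesis using sq div by (simp add: algebra_simps)
    qed
    have i1: "integrable lborel (\<lambda>x. H\<^sup>2 / (d x)\<^sup>2 * (g x)\<^sup>2)"
    proof (rule integrable_compact_support[OF _ gD(2)])
      show "continuous_on UNIV (\<lambda>x. H\<^sup>2 / (d x)\<^sup>2 * (g x)\<^sup>2)"
      proof (rule continuous_extend_by_zero[OF oT _ cl gD(3)])
        show "continuous_on (tube \<Sigma> r) (\<lambda>x. H\<^sup>2 / (d x)\<^sup>2 * (g x)\<^sup>2)"
          by (intro continuous_intros d_continuous C1_continuous_on[OF C1g]) (auto simp: in_tube_iff)
      qed (simp add: gD(4))
    qed (simp add: gD(4))
    have i2: "integrable lborel (grad_norm_sq g)"
      by (rule integrable_compact_support[OF grad_norm_sq_continuous[OF gD(1)] gD(2)]) (rule goff)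
    have "(LINT x|lborel. H\<^sup>2 / (d x)\<^sup>2 * (g x)\<^sup>2) \<le> (LINT x|lborel. grad_norm_sq g x + (\<Sum>b\<in>Basis. partial b (F b) x))"
      by (rule integral_mono[OF i1 _ pt]) (use i2 dv in auto)
    also have "\<dots> = (LINT x|lborel. grad_norm_sq g x)" using i2 dv by simp
    finally show ?thesis .
  qed
  then show ?thesis using that r by blast
qed

text \<open>A radial function \<open>G(d(x))\<close> is represented by its profile and the derivative of the profile. The support in \<open>[a, b]\<close> with \<open>a > 0\<close>
  keeps it away from the submanifold, where the distance is not differentiable.\<close>

definition profile :: "real \<Rightarrow> real \<Rightarrow> (real \<Rightarrow> real) \<Rightarrow> (real \<Rightarrow> real) \<Rightarrow> bool" where
  "profile a b G G' \<longleftrightarrow> 0 < a \<and> (\<forall>t>0. (G has_real_derivative G' t) (at t)) \<and> continuous_on {0<..} G' \<and>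
     (\<forall>t. t \<notin> {a..b} \<longrightarrow> G t = 0 \<and> G' t = 0)"

lemma profile_C1c:
  assumes p: "profile a b G G'" and b: "b < r" "r \<le> \<beta>"
  shows "(\<lambda>x. G (d x)) \<in> C1c (tube \<Sigma> r)" "grad_norm_sq (\<lambda>x. G (d x)) x = (G' (d x))\<^sup>2"
    "Ck_on 1 (tube \<Sigma> r) (\<lambda>x. G (d x))"
proof -
  have a: "0 < a" using p by (simp add: profile_def)
  have off: "G (d x) = 0" "G' (d x) = 0" if "x \<notin> shell a b" for x using p that by (auto simp: profile_def shell_def)
  have sub: "shell a b \<subseteq> tube \<Sigma> r" by (rule shell_subset_tube[OF a b(1)])
  have cs: "closed (shell a b)" using compact_shell compact_imp_closed by blast
  show C: "Ck_on 1 (tube \<Sigma> r) (\<lambda>x. G (d x))"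
    by (rule d_C1_comp[OF b(2)]) (use p in \<open>auto simp: profile_def\<close>)
  show "(\<lambda>x. G (d x)) \<in> C1c (tube \<Sigma> r)"
  proof (rule C1cI[OF _ compact_shell sub])
    show "Ck_on 1 UNIV (\<lambda>x. G (d x))"
      by (rule Ck_extend_by_zero[OF open_tube[OF closed] C cs sub]) (rule off)
  qed (rule off)
  show "grad_norm_sq (\<lambda>x. G (d x)) x = (G' (d x))\<^sup>2"
  proof (cases "x \<in> shell a b")
    case True
    then have dx: "d x > 0" and xT: "x \<in> T" using a sub tube_subset_T[OF b(2)] by (auto simp: shell_def)
    have D: "(G has_real_derivative G' (d x)) (at (d x))" using p dx by (simp add: profile_def)
    show ?thesis unfolding grad_norm_sq_def partial_d_comp[OF xT D] power_mult_distrib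
      using sum_partial_sq[OF xT] by (simp add: sum_distrib_left[symmetric])
  next
    case False
    have "grad_norm_sq (\<lambda>x. G (d x)) x = 0"
      by (rule grad_norm_sq_zero_off[OF cs _ False]) (rule off)
    then show ?thesis using off(2)[OF False] by simp
  qed
qed

text \<open>The divergence theorem for the field \<open>G(d) \<nabla>d\<close>, combined with the lower bound on \<open>\<Delta>d\<close>.\<close>

lemma radial_divergence:
  assumes p: "profile a b G G'" and b: "b < \<beta>" and nn: "\<And>t. G t \<ge> 0"
  shows "(LINT x:shell a b|lborel. G' (d x) + G (d x) * (M / d x - C)) \<le> 0"
proof -
  have a: "0 < a" using p by (simp add: profile_def)
  have off: "G (d x) = 0" "G' (d x) = 0" if "x \<notin> shell a b" for x using p that by (auto simp: profile_def shell_def)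
  have sub: "shell a b \<subseteq> tube \<Sigma> \<beta>" by (rule shell_subset_tube[OF a b])
  have cs: "closed (shell a b)" using compact_shell compact_imp_closed by blast
  note C1G = profile_C1c(3)[OF p b order_refl]
  have C1p: "Ck_on 1 (tube \<Sigma> \<beta>) (partial e d)" for e by (rule Ck_mono[OF C2_partial[OF d_C2] tube_subset_T[OF order_refl]])
  define F where "F e x = G (d x) * partial e d x" for e x
  have Foff: "F e x = 0" if "x \<notin> shell a b" for e x using off(1)[OF that] by (simp add: F_def)
  have "Ck_on 1 (tube \<Sigma> \<beta>) (F e)" for e unfolding F_def[abs_def] by (intro C1_mult C1G C1p)
  then have F1: "Ck_on 1 UNIV (F e)" for e
    by (rule Ck_extend_by_zero[OF open_tube[OF closed] _ cs sub]) (rule Foff)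
  note dv = integral_divergence_eq_0[of F, OF F1 compact_shell Foff]
  have Foffp: "partial e (F e) x = 0" if "x \<notin> shell a b" for e x
    by (rule partial_zero_off[OF cs _ that]) (rule Foff)
  have pt: "indicator (shell a b) x *\<^sub>R (G' (d x) + G (d x) * (M / d x - C)) \<le> (\<Sum>e\<in>Basis. partial e (F e) x)" for x
  proof (cases "x \<in> shell a b")
    case False then show ?thesis using Foffp by simp
  next
    case True
    then have xt: "x \<in> tube \<Sigma> \<beta>" using sub by blast
    then have dx: "d x > 0" and xT: "x \<in> T" using tube_subset_T[OF order_refl] by (auto simp: in_tube_iff)
    have D: "(G has_real_derivative G' (d x)) (at (d x))" using p dx by (simp add: profile_def)
    have "partial e (F e) x = G (d x) * partial e (partial e d) x + G' (d x) * (partial e d x)\<^sup>2" for e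
      unfolding F_def partial_mult[OF C1_differentiable[OF C1G xt] C1_differentiable[OF C1p xt]] partial_d_comp[OF xT D]
      by (simp add: power2_eq_square)
    then have "(\<Sum>e\<in>Basis. partial e (F e) x) = G (d x) * laplacian d x + G' (d x) * (\<Sum>e\<in>Basis. (partial e d x)\<^sup>2)"
      unfolding laplacian_def by (simp add: sum.distrib sum_distrib_left)
    also have "\<dots> = G (d x) * laplacian d x + G' (d x)" using sum_partial_sq[OF xT] by simp
    finally show ?thesis using True mult_left_mono[OF laplacian_d[OF xt] nn[of "d x"]] by simp
  qed
  have "continuous_on {0<..} G" by (rule DERIV_continuous_on) (use p in \<open>auto simp: profile_def intro: has_field_derivative_at_within\<close>)
  then have cG: "continuous_on (shell a b) (\<lambda>x. G (d x))" 
    by (rule continuous_on_compose2[OF _ d_continuous]) (use a in \<open>auto simp: shell_def\<close>)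
  have "continuous_on {0<..} G'" using p by (simp add: profile_def)
  then have cG': "continuous_on (shell a b) (\<lambda>x. G' (d x))" 
    by (rule continuous_on_compose2[OF _ d_continuous]) (use a in \<open>auto simp: shell_def\<close>)
  have i: "set_integrable lborel (shell a b) (\<lambda>x. G' (d x) + G (d x) * (M / d x - C))"
    by (rule shell_integrable) (intro continuous_intros cG cG' d_continuous, use a in \<open>auto simp: shell_def\<close>)
  have "(LINT x:shell a b|lborel. G' (d x) + G (d x) * (M / d x - C)) \<le> (LINT x|lborel. (\<Sum>e\<in>Basis. partial e (F e) x))"
    unfolding set_lebesgue_integral_def by (rule integral_mono[OF _ dv(1) pt]) (use i in \<open>simp add: set_integrable_def\<close>)
  then show ?thesis using dv(2) by simp
qed

end

section \<open>Volume of the shells around the submanifold\<close>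

context smooth_tube begin

lemma radial_continuous:
  assumes "continuous_on {0<..} \<phi>" "0 < a"
  shows "continuous_on (shell a b) (\<lambda>x. \<phi> (d x))"
  by (rule continuous_on_compose2[OF assms(1) d_continuous]) (use assms(2) in \<open>auto simp: shell_def\<close>)

lemma shell_sets [measurable]: "shell a b \<in> sets borel"
  using compact_shell compact_imp_closed borel_closed by blast

lemma profileI:
  assumes "0 < a" "\<And>t. t > 0 \<Longrightarrow> (G has_real_derivative G' t) (at t)" "continuous_on {0<..} G'"
    "\<And>t. t \<notin> {a..b} \<Longrightarrow> G t = 0 \<and> G' t = 0"
  shows "profile a b G G'"
  using assms by (simp add: profile_def)

lemma profile_continuous:
  assumes "profile a b G G'" shows "continuous_on {0<..} G" "continuous_on {0<..} G'"
  using assms by (auto simp: profile_def intro: DERIV_continuous_on has_field_derivative_at_within)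

text \<open>With \<open>G(t) = t\<^sup>-\<^sup>M e\<^sup>C\<^sup>t h(t)\<close> the radial divergence inequality becomes \<open>\<integral> d\<^sup>-\<^sup>M e\<^sup>C\<^sup>d h'(d) \<le> 0\<close>: the area density of the distance
  spheres divided by \<open>t\<^sup>M e\<^sup>-\<^sup>C\<^sup>t\<close> is nondecreasing. For \<open>h = k\<close> times a cutoff, the only negative contribution to \<open>h'\<close> comes from the
  fixed region \<open>r \<le> d \<le> 2 r\<close>.\<close>

lemma radial_mass_bound:
  assumes r: "0 < r" "2 * r < \<beta>"
  obtains Cv where "Cv \<ge> 0"
    "\<And>k k' \<tau>. (\<And>t. t > 0 \<Longrightarrow> (k has_real_derivative k' t) (at t)) \<Longrightarrow> continuous_on {0<..} k' \<Longrightarrow>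
       (\<And>t. t > 0 \<Longrightarrow> 0 \<le> k t \<and> 0 \<le> k' t) \<Longrightarrow> 0 < \<tau> \<Longrightarrow> 2 * \<tau> \<le> r \<Longrightarrow>
       (LINT x:shell (2 * \<tau>) r|lborel. d x powr (- M) * k' (d x)) \<le> Cv * k (2 * r)"
proof -
  define w where "w t = t powr (- M) * exp (C * t)" for t :: real
  have cw: "continuous_on {0<..} w" unfolding w_def by (intro continuous_intros) auto
  have w0: "w t \<ge> 0" for t by (simp add: w_def)
  have wge: "t powr (- M) \<le> w t" if "t > 0" for t
  proof -
    have "1 \<le> exp (C * t)" using C_nonneg that by simp
    then have "t powr (- M) * 1 \<le> t powr (- M) * exp (C * t)" by (intro mult_left_mono) auto
    then show ?thesis by (simp add: w_def)
  qed
  have Dw: "(w has_real_derivative (w t * (C - M / t))) (at t)" if "t > 0" for t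
  proof -
    have "((\<lambda>t. t powr (- M)) has_real_derivative - M * t powr (- M - 1)) (at t)"
      by (rule has_real_derivative_powr[OF that])
    moreover have "((\<lambda>t. exp (C * t)) has_real_derivative C * exp (C * t)) (at t)"
      by (auto intro!: derivative_eq_intros)
    ultimately have "(w has_real_derivative (- M * t powr (- M - 1)) * exp (C * t) + (C * exp (C * t)) * t powr (- M)) (at t)"
      unfolding w_def by (rule DERIV_mult)
    moreover have "t powr (- M - 1) = t powr (- M) / t" using that by (simp add: powr_diff)
    ultimately show ?thesis by (simp add: w_def algebra_simps)
  qed
  define Io where "Io = (LINT x:shell r (2 * r)|lborel. w (d x))"
  have Io: "Io \<ge> 0" unfolding Io_def set_lebesgue_integral_def using w0 by (intro integral_nonneg_AE) simp
  show ?thesis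
  proof (rule that[of "4 / r * Io"])
    show "4 / r * Io \<ge> 0" using Io r by simp
    fix k k' :: "real \<Rightarrow> real" and \<tau> :: real
    assume Dk: "\<And>t. t > 0 \<Longrightarrow> (k has_real_derivative k' t) (at t)" and ck': "continuous_on {0<..} k'"
      and kn: "\<And>t. t > 0 \<Longrightarrow> 0 \<le> k t \<and> 0 \<le> k' t" and \<tau>: "0 < \<tau>" "2 * \<tau> \<le> r"
    have kmono: "k t \<le> k (2 * r)" if "0 < t" "t \<le> 2 * r" for t
    proof (rule DERIV_nonneg_imp_nondecreasing[OF that(2)])
      fix s assume "t \<le> s"
      then have "s > 0" using that(1) by simp
      then show "\<exists>y. (k has_real_derivative y) (at s) \<and> 0 \<le> y" using Dk kn by blast
    qed
    let ?c = "cutoff 2 \<tau> r" and ?c' = "cutoff' 2 \<tau> r"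
    define G where "G t = w t * (k t * ?c t)" for t
    define h' where "h' t = k' t * ?c t + k t * ?c' t" for t
    define G' where "G' t = w t * (C - M / t) * (k t * ?c t) + w t * h' t" for t
    have ck: "continuous_on {0<..} k" by (rule DERIV_continuous_on) (use Dk in \<open>auto intro: has_field_derivative_at_within\<close>)
    have cc: "continuous_on S ?c" for S
      by (rule DERIV_continuous_on) (use DERIV_cutoff[of 2 \<tau> r] \<tau> r in \<open>auto intro: has_field_derivative_at_within\<close>)
    have cc': "continuous_on S ?c'" for S by (rule continuous_cutoff') (use \<tau> r in auto)
    have ch': "continuous_on {0<..} h'" unfolding h'_def by (intro continuous_intros ck' cc ck cc')
    have DG: "(G has_real_derivative G' t) (at t)" if t: "t > 0" for t
    proof -
      have "((\<lambda>t. k t * ?c t) has_real_derivative k' t * ?c t + ?c' t * k t) (at t)"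
        by (rule DERIV_mult[OF Dk[OF t] DERIV_cutoff]) (use \<tau> r in auto)
      from DERIV_mult[OF Dw[OF t] this] show ?thesis unfolding G_def G'_def h'_def by (simp add: mult_ac add_ac)
    qed
    have prof: "profile \<tau> (2 * r) G G'"
    proof (rule profileI[OF \<tau>(1) DG])
      show "continuous_on {0<..} G'" unfolding G'_def by (intro continuous_intros cw ck cc ch') auto
      show "G t = 0 \<and> G' t = 0" if "t \<notin> {\<tau>..2 * r}" for t
        using cutoff_support[OF \<tau>(1) r(1) _ that, of 2] by (simp add: G_def G'_def h'_def)
    qed
    have Gn: "G t \<ge> 0" for t
    proof (cases "t > 0")
      case True then show ?thesis using kn w0 cutoff_bounds by (simp add: G_def)
    next
      case False
      then have "t \<notin> {\<tau>..2*r}" using \<tau> by auto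
      then show ?thesis using cutoff_support(1)[OF \<tau>(1) r(1), of 2 t] by (simp add: G_def)
    qed
    have neg: "(LINT x:shell \<tau> (2 * r)|lborel. G' (d x) + G (d x) * (M / d x - C)) \<le> 0"
      by (rule radial_divergence[OF prof r(2) Gn])
    have GG: "G' t + G t * (M / t - C) = w t * h' t" for t unfolding G'_def G_def by (simp add: algebra_simps)
    have neg: "(LINT x:shell \<tau> (2 * r)|lborel. w (d x) * h' (d x)) \<le> 0" using neg unfolding GG .
    have pt: "indicator (shell (2 * \<tau>) r) x *\<^sub>R (d x powr (- M) * k' (d x)) \<le>
      indicator (shell \<tau> (2 * r)) x *\<^sub>R (w (d x) * h' (d x)) + (4 / r * k (2 * r)) * (indicator (shell r (2 * r)) x *\<^sub>R w (d x))" for x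
    proof (cases "x \<in> shell \<tau> (2 * r)")
      case False
      then have "x \<notin> shell (2 * \<tau>) r" "x \<notin> shell r (2 * r)" using \<tau> r by (auto simp: shell_def)
      then show ?thesis using False by simp
    next
      case True
      define t where "t = d x"
      have t: "\<tau> \<le> t" "t \<le> 2 * r" "t > 0" using True \<tau> by (auto simp: shell_def t_def)
      have e: "0 \<le> (4 / r * k (2 * r)) * (indicator (shell r (2 * r)) x *\<^sub>R w (d x))"
        using kn[of "2 * r"] w0 r by (simp add: indicator_def)
      consider "t < 2 * \<tau>" | "2 * \<tau> \<le> t" "t \<le> r" | "r < t" by linarith
      then show ?thesis
      proof cases
        case 1
        have "?c' t = step' 2 (t / \<tau>) / \<tau>" by (rule cutoff_inner) (use 1 \<tau> r in auto)
        then have "h' t \<ge> 0" unfolding h'_def using kn[OF t(3)] cutoff_bounds step'_nonneg \<tau> by simp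
        then show ?thesis using e True 1 w0[of t] by (simp add: shell_def t_def)
      next
        case 2
        have "h' t = k' t" unfolding h'_def using cutoff_middle[OF \<tau>(1) r(1) 2, of 2] by simp
        moreover have "t powr (- M) * k' t \<le> w t * k' t" using wge[OF t(3)] kn[OF t(3)] by (intro mult_right_mono) auto
        ultimately show ?thesis using e True 2 by (simp add: shell_def t_def)
      next
        case 3
        have c: "\<bar>?c' t\<bar> \<le> 4 / r" by (rule cutoff_outer) (use 3 \<tau> r in auto)
        have "0 \<le> k' t * ?c t" using kn[OF t(3)] cutoff_bounds by simp
        moreover have "\<bar>k t * ?c' t\<bar> \<le> k (2 * r) * (4 / r)"
          unfolding abs_mult using c kmono[OF t(3,2)] kn[OF t(3)] kn[of "2 * r"] r by (intro mult_mono) auto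
        ultimately have "- (4 / r * k (2 * r)) \<le> h' t" unfolding h'_def by (simp add: mult.commute)
        then have "w t * (- (4 / r * k (2 * r))) \<le> w t * h' t" using w0 by (intro mult_left_mono) auto
        then show ?thesis using True 3 t by (simp add: shell_def t_def algebra_simps)
      qed
    qed
    have i1: "set_integrable lborel (shell (2 * \<tau>) r) (\<lambda>x. d x powr (- M) * k' (d x))"
    proof (rule shell_integrable)
      have "continuous_on {0<..} (\<lambda>t::real. t powr (- M) * k' t)" by (intro continuous_intros ck') auto
      then show "continuous_on (shell (2 * \<tau>) r) (\<lambda>x. d x powr (- M) * k' (d x))"
        by (rule radial_continuous) (use \<tau> in simp)
    qed
    have i2: "set_integrable lborel (shell \<tau> (2 * r)) (\<lambda>x. w (d x) * h' (d x))"
      by (intro shell_integrable continuous_intros radial_continuous[OF cw \<tau>(1)] radial_continuous[OF ch' \<tau>(1)])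
    have i3: "set_integrable lborel (shell r (2 * r)) (\<lambda>x. w (d x))"
      by (intro shell_integrable radial_continuous[OF cw r(1)])
    note j1 = i1[unfolded set_integrable_def] and j2 = i2[unfolded set_integrable_def]
    have j3: "integrable lborel (\<lambda>x. (4 / r * k (2 * r)) * (indicator (shell r (2 * r)) x *\<^sub>R w (d x)))"
      using i3 unfolding set_integrable_def by (rule integrable_mult_right)
    have "(LINT x:shell (2 * \<tau>) r|lborel. d x powr (- M) * k' (d x)) \<le>
      (LINT x|lborel. indicator (shell \<tau> (2 * r)) x *\<^sub>R (w (d x) * h' (d x)) + (4 / r * k (2 * r)) * (indicator (shell r (2 * r)) x *\<^sub>R w (d x)))"
      unfolding set_lebesgue_integral_def
      by (rule integral_mono[OF j1 Bochner_Integration.integrable_add[OF j2 j3] pt])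
    also have "\<dots> = (LINT x:shell \<tau> (2 * r)|lborel. w (d x) * h' (d x)) + (4 / r * k (2 * r)) * Io"
      unfolding Io_def set_lebesgue_integral_def Bochner_Integration.integral_add[OF j2 j3] integral_mult_right_zero ..
    also have "\<dots> \<le> (4 / r * k (2 * r)) * Io" using neg by simp
    finally show "(LINT x:shell (2 * \<tau>) r|lborel. d x powr (- M) * k' (d x)) \<le> 4 / r * Io * k (2 * r)"
      by (simp add: mult_ac)
  qed
qed

text \<open>Both bounds are instances of the mass bound: \<open>k(t) = t\<^sup>2 / (t\<^sup>2 + \<delta>\<^sup>2)\<close> increases by a fixed amount on \<open>[\<delta>, 2 \<delta>]\<close> and stays below 1, and
  \<open>k(t) = t powr e\<close> gives the integrability of powers of the distance.\<close>

lemma shell_volume: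
  assumes r: "0 < r" "2 * r < \<beta>"
  obtains Cv where "Cv \<ge> 0"
    "\<And>\<delta>. 0 < \<delta> \<Longrightarrow> 2 * \<delta> \<le> r \<Longrightarrow> (LINT x:shell \<delta> (2 * \<delta>)|lborel. d x powr (- (M + 1))) \<le> Cv"
    "\<And>e \<tau>. 0 < e \<Longrightarrow> 0 < \<tau> \<Longrightarrow> \<tau> \<le> r \<Longrightarrow> (LINT x:shell \<tau> r|lborel. d x powr (e - (M + 1))) \<le> Cv * (2 * r) powr e / e"
proof -
  obtain C0 where C0: "C0 \<ge> 0"
    "\<And>k k' \<tau>. (\<And>t. t > 0 \<Longrightarrow> (k has_real_derivative k' t) (at t)) \<Longrightarrow> continuous_on {0<..} k' \<Longrightarrow>
       (\<And>t. t > 0 \<Longrightarrow> 0 \<le> k t \<and> 0 \<le> k' t) \<Longrightarrow> 0 < \<tau> \<Longrightarrow> 2 * \<tau> \<le> r \<Longrightarrow>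
       (LINT x:shell (2 * \<tau>) r|lborel. d x powr (- M) * k' (d x)) \<le> C0 * k (2 * r)"
    by (rule radial_mass_bound[OF r]) blast
  show ?thesis
  proof (rule that[of "8 * C0"])
    show "8 * C0 \<ge> 0" using C0 by simp
  next
    fix \<delta> :: real assume \<delta>: "0 < \<delta>" "2 * \<delta> \<le> r"
    define k where "k t = t\<^sup>2 / (t\<^sup>2 + \<delta>\<^sup>2)" for t :: real
    define k' where "k' t = 2 * t * \<delta>\<^sup>2 / (t\<^sup>2 + \<delta>\<^sup>2)\<^sup>2" for t :: real
    have nz: "t\<^sup>2 + \<delta>\<^sup>2 > 0" for t :: real using \<delta> by (simp add: add_nonneg_pos)
    have Dk: "(k has_real_derivative k' t) (at t)" for t
    proof -
      have "(k has_real_derivative (2 * t * (t\<^sup>2 + \<delta>\<^sup>2) - t\<^sup>2 * (2 * t)) / ((t\<^sup>2 + \<delta>\<^sup>2) * (t\<^sup>2 + \<delta>\<^sup>2))) (at t)"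
        unfolding k_def by (rule DERIV_divide) (use nz[of t] in \<open>auto intro!: derivative_eq_intros\<close>)
      then show ?thesis unfolding k'_def by (simp add: algebra_simps power2_eq_square)
    qed
    have ck': "continuous_on {0<..} k'" unfolding k'_def using nz by (intro continuous_intros) (auto simp: less_imp_neq[symmetric])
    have main: "(LINT x:shell (2 * (\<delta> / 2)) r|lborel. d x powr (- M) * k' (d x)) \<le> C0 * k (2 * r)"
      by (rule C0(2)[OF Dk ck']) (use \<delta> in \<open>auto simp: k_def k'_def\<close>)
    have k1: "k t \<le> 1" for t unfolding k_def using nz[of t] by (simp add: divide_le_eq_1)
    have low: "t powr (- (M + 1)) \<le> 8 * (t powr (- M) * k' t)" if t: "\<delta> \<le> t" "t \<le> 2 * \<delta>" for t
    proof -
      have t0: "t > 0" using t \<delta> by simp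
      have "\<delta>\<^sup>2 \<le> t\<^sup>2" using t \<delta> by (intro power_mono) auto
      then have "(t\<^sup>2 + \<delta>\<^sup>2)\<^sup>2 \<le> (2 * t\<^sup>2)\<^sup>2" by (intro power_mono) auto
      also have "\<dots> = 4 * (t\<^sup>2 * t\<^sup>2)" by (simp add: power2_eq_square)
      also have "\<dots> \<le> 4 * (t\<^sup>2 * (4 * \<delta>\<^sup>2))"
        using power_mono[OF t(2), of 2] t0 by (intro mult_left_mono) (auto simp: power_mult_distrib)
      also have "\<dots> = 8 * t * (2 * t * \<delta>\<^sup>2)" by (simp add: power2_eq_square)
      finally have "1 \<le> 8 * t * k' t" unfolding k'_def using nz[of t] t0 by (simp add: le_divide_eq)
      then have "1 / t \<le> 8 * k' t" using t0 by (simp add: pos_divide_le_eq mult_ac)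
      then have "t powr (- M) * (1 / t) \<le> t powr (- M) * (8 * k' t)" by (intro mult_left_mono) auto
      moreover have "t powr (- (M + 1)) = t powr (- M) * (1 / t)" using powr_diff[of t "- M" 1] t0 by simp
      ultimately show ?thesis by simp
    qed
    have nn: "0 \<le> t powr (- M) * k' t" if "t > 0" for t using that by (simp add: k'_def)
    have ck1: "continuous_on {0<..} (\<lambda>t::real. t powr (- M) * k' t)" by (intro continuous_intros ck') auto
    have ck2: "continuous_on {0<..} (\<lambda>t::real. t powr (- (M + 1)))" by (intro continuous_intros) auto
    have "(LINT x:shell \<delta> (2 * \<delta>)|lborel. d x powr (- (M + 1))) \<le> (LINT x|lborel. 8 * (indicator (shell \<delta> r) x *\<^sub>R (d x powr (- M) * k' (d x))))"
      unfolding set_lebesgue_integral_def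
    proof (rule integral_mono)
      show "integrable lborel (\<lambda>x. indicator (shell \<delta> (2 * \<delta>)) x *\<^sub>R d x powr (- (M + 1)))"
        using shell_integrable[OF radial_continuous[OF ck2 \<delta>(1)]] by (simp add: set_integrable_def)
      show "integrable lborel (\<lambda>x. 8 * (indicator (shell \<delta> r) x *\<^sub>R (d x powr (- M) * k' (d x))))"
        using shell_integrable[OF radial_continuous[OF ck1 \<delta>(1)]] unfolding set_integrable_def by (rule integrable_mult_right)
      show "indicator (shell \<delta> (2 * \<delta>)) x *\<^sub>R d x powr (- (M + 1)) \<le> 8 * (indicator (shell \<delta> r) x *\<^sub>R (d x powr (- M) * k' (d x)))" for x
        using low[of "d x"] nn[of "d x"] \<delta> by (auto simp: indicator_def shell_def)
    qed
    also have "\<dots> = 8 * (LINT x:shell (2 * (\<delta> / 2)) r|lborel. d x powr (- M) * k' (d x))"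
      unfolding set_lebesgue_integral_def by simp
    also have "\<dots> \<le> 8 * (C0 * k (2 * r))" using main by simp
    also have "\<dots> \<le> 8 * C0" using C0(1) k1[of "2 * r"] by (simp add: mult_left_le)
    finally show "(LINT x:shell \<delta> (2 * \<delta>)|lborel. d x powr (- (M + 1))) \<le> 8 * C0" .
  next
    fix e \<tau> :: real assume e: "0 < e" and \<tau>: "0 < \<tau>" "\<tau> \<le> r"
    have "(LINT x:shell (2 * (\<tau> / 2)) r|lborel. d x powr (- M) * (e * d x powr (e - 1))) \<le> C0 * (2 * r) powr e"
    proof (rule C0(2))
      show "((\<lambda>t. t powr e) has_real_derivative e * t powr (e - 1)) (at t)" if "t > 0" for t
        by (rule has_real_derivative_powr[OF that])
      show "continuous_on {0<..} (\<lambda>t::real. e * t powr (e - 1))" by (intro continuous_intros) auto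
    qed (use e \<tau> in auto)
    also have "(LINT x:shell (2 * (\<tau> / 2)) r|lborel. d x powr (- M) * (e * d x powr (e - 1))) = e * (LINT x:shell \<tau> r|lborel. d x powr (e - (M + 1)))"
    proof -
      have "d x powr (- M) * (e * d x powr (e - 1)) = e * d x powr (e - (M + 1))" for x
        using powr_add[of "d x" "- M" "e - 1"] by (simp add: algebra_simps)
      then have "(\<lambda>x. d x powr (- M) * (e * d x powr (e - 1))) = (\<lambda>x. e * d x powr (e - (M + 1)))" by (rule ext)
      moreover have "2 * (\<tau> / 2) = \<tau>" by simp
      ultimately show ?thesis by (simp only: set_integral_mult_right)
    qed
    finally have "(LINT x:shell \<tau> r|lborel. d x powr (e - (M + 1))) \<le> C0 * (2 * r) powr e / e"
      using e by (simp add: pos_le_divide_eq mult.commute)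
    also have "\<dots> \<le> 8 * C0 * (2 * r) powr e / e" using e C0(1) by (intro divide_right_mono mult_right_mono) auto
    finally show "(LINT x:shell \<tau> r|lborel. d x powr (e - (M + 1))) \<le> 8 * C0 * (2 * r) powr e / e" .
  qed
qed

end

section \<open>Radial weights of critical growth\<close>

text \<open>Young's inequality with exponents \<open>(p + 1) / 2\<close> and its conjugate, proved by comparing \<open>A V\<^sup>p\<^sup>-\<^sup>1 \<rho>\<^sup>2\<close> with \<open>1 / D\<^sup>2\<close>. The two powers of \<open>\<rho>\<close>
  lost on the left are what differentiation of a cutoff \<open>\<rho> ^ m\<close> costs.\<close>

lemma young_dichotomy:
  fixes V D \<rho> A p :: real
  assumes V: "V \<ge> 0" and D: "D > 0" and \<rho>: "0 \<le> \<rho>" "\<rho> \<le> 1" and A: "A > 0" and p: "p > 1"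
    and m: "m \<ge> 2" "2 * real m - 2 \<ge> 4 / (p - 1)"
  shows "V\<^sup>2 / D\<^sup>2 * \<rho> ^ (2 * m - 2) \<le> A * (V powr (p + 1) * \<rho> ^ (2 * m)) + A powr (- 2 / (p - 1)) * D powr (- 2 - 4 / (p - 1))"
proof (cases "V = 0 \<or> \<rho> = 0")
  case True
  then show ?thesis
  proof
    assume "V = 0" then show ?thesis using A by simp
  next
    assume "\<rho> = 0"
    then have z: "\<rho> ^ (2 * m - 2) = 0" "\<rho> ^ (2 * m) = 0" using m(1) by (auto simp: power_0_left)
    show ?thesis unfolding z using A by simp
  qed
next
  case False
  then have V: "V > 0" and \<rho>0: "\<rho> > 0" using V \<rho> by auto
  have pm: "\<rho> ^ (2 * m) = \<rho> ^ (2 * m - 2) * \<rho>\<^sup>2"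
  proof -
    have "2 * m = (2 * m - 2) + 2" using m(1) by arith
    then show ?thesis using power_add[of \<rho> "2 * m - 2" 2] by metis
  qed
  have Vp: "V powr (p + 1) = V powr (p - 1) * V\<^sup>2"
    using powr_add[of V "p - 1" 2] V by (simp add: add.commute)
  show ?thesis
  proof (cases "A * V powr (p - 1) * \<rho>\<^sup>2 \<ge> 1 / D\<^sup>2")
    case True
    have "V\<^sup>2 / D\<^sup>2 * \<rho> ^ (2 * m - 2) = (1 / D\<^sup>2) * (V\<^sup>2 * \<rho> ^ (2 * m - 2))" by simp
    also have "\<dots> \<le> (A * V powr (p - 1) * \<rho>\<^sup>2) * (V\<^sup>2 * \<rho> ^ (2 * m - 2))"
      using True \<rho> by (intro mult_right_mono) auto
    also have "\<dots> = A * (V powr (p + 1) * \<rho> ^ (2 * m))" unfolding pm Vp by simp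
    finally show ?thesis by (simp add: add_increasing2)
  next
    case False
    define X where "X = A powr (- 2 / (p - 1)) * D powr (- 4 / (p - 1))"
    have "V powr (p - 1) * (A * \<rho>\<^sup>2) \<le> D powr (- 2)"
      using False D by (simp add: powr_minus powr_numeral inverse_eq_divide mult_ac)
    then have "V powr (p - 1) \<le> D powr (- 2) / (A * \<rho>\<^sup>2)" using A \<rho>0 by (subst pos_le_divide_eq) auto
    then have "(V powr (p - 1)) powr (2 / (p - 1)) \<le> (D powr (- 2) / (A * \<rho>\<^sup>2)) powr (2 / (p - 1))"
      using p by (intro powr_mono2) auto
    moreover have "(V powr (p - 1)) powr (2 / (p - 1)) = V\<^sup>2"
    proof -
      have "(p - 1) * (2 / (p - 1)) = 2" using p by (intro nonzero_mult_div_cancel_left[of "p - 1" 2, unfolded times_divide_eq_right[symmetric]]) simp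
      then show ?thesis using V by (simp only: powr_powr powr_numeral)
    qed
    moreover have "(D powr (- 2) / (A * \<rho>\<^sup>2)) powr (2 / (p - 1)) = X * \<rho> powr (- 4 / (p - 1))"
    proof -
      have "\<rho>\<^sup>2 = \<rho> powr 2" using \<rho>0 by (simp add: powr_numeral)
      then have e: "D powr (- 2) / (A * \<rho>\<^sup>2) = A powr (- 1) * D powr (- 2) * \<rho> powr (- 2)"
        using A by (simp add: powr_minus divide_inverse)
      have g: "(A powr a * D powr b * \<rho> powr c) powr s = A powr (a * s) * D powr (b * s) * \<rho> powr (c * s)" for a b c s
        by (simp add: powr_mult powr_powr)
      have e2: "(- 1) * (2 / (p - 1)) = - 2 / (p - 1)" "(- 2) * (2 / (p - 1)) = - 4 / (p - 1)" by simp_all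
      show ?thesis unfolding e X_def g e2 ..
    qed
    ultimately have V2: "V\<^sup>2 \<le> X * \<rho> powr (- 4 / (p - 1))" by simp
    have "\<rho> ^ (2 * m - 2) = \<rho> powr (2 * real m - 2)"
      using \<rho>0 m(1) by (simp add: powr_realpow[symmetric] of_nat_diff)
    also have "\<dots> \<le> \<rho> powr (4 / (p - 1))" using \<rho>0 \<rho>(2) m(2) by (intro powr_mono') auto
    finally have "V\<^sup>2 * \<rho> ^ (2 * m - 2) \<le> (X * \<rho> powr (- 4 / (p - 1))) * \<rho> powr (4 / (p - 1))"
      using V2 \<rho> by (intro mult_mono) (auto simp: X_def)
    also have "\<dots> = X" using \<rho>0 by (simp add: mult.assoc powr_add[symmetric])
    finally have "V\<^sup>2 * \<rho> ^ (2 * m - 2) / D\<^sup>2 \<le> X / D\<^sup>2" by (intro divide_right_mono) auto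
    also have "X / D\<^sup>2 = A powr (- 2 / (p - 1)) * D powr (- 2 - 4 / (p - 1))"
    proof -
      have "D powr (- 2 - 4 / (p - 1)) = D powr (- 4 / (p - 1)) / D\<^sup>2"
      proof -
        have "- 2 - 4 / (p - 1) = - 4 / (p - 1) - 2" by simp
        then show ?thesis using D by (simp only: powr_diff powr_numeral)
      qed
      then show ?thesis by (simp add: X_def)
    qed
    finally show ?thesis using A V \<rho>0 by (simp add: add_increasing)
  qed
qed

text \<open>The profile \<open>t\<^sup>\<sigma>\<close>, for which \<open>\<sigma>\<^sup>2 G\<^sup>2 / t\<^sup>2 - G'\<^sup>2\<close> vanishes identically, is bent into the constant 1 beyond \<open>\<delta>\<close>. Its logarithmic derivative is
  \<open>\<sigma> / t\<close> times the factor \<open>defect\<close>, which drops from 1 to 0, so the quadratic expression becomes strictly positive for \<open>t \<ge> \<delta>\<close>.\<close>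

definition weight :: "real \<Rightarrow> real \<Rightarrow> real \<Rightarrow> real" where
  "weight \<sigma> \<delta> t = (t\<^sup>2 / (t\<^sup>2 + \<delta>\<^sup>2)) powr (\<sigma> / 2)"

definition defect :: "real \<Rightarrow> real \<Rightarrow> real" where "defect \<delta> t = \<delta>\<^sup>2 / (t\<^sup>2 + \<delta>\<^sup>2)"

lemma weight_sq: "(weight \<sigma> \<delta> t)\<^sup>2 = (t\<^sup>2 / (t\<^sup>2 + \<delta>\<^sup>2)) powr \<sigma>"
  unfolding weight_def power2_eq_square[of "_ powr _"] by (simp add: powr_add[symmetric])

lemma weight_nonneg: "weight \<sigma> \<delta> t \<ge> 0" by (simp add: weight_def)

lemma weight_le_1:
  assumes "\<sigma> \<ge> 0" shows "weight \<sigma> \<delta> t \<le> 1"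
proof -
  have "t\<^sup>2 / (t\<^sup>2 + \<delta>\<^sup>2) \<le> 1" using sum_power2_ge_zero[of t \<delta>] by (auto simp: divide_le_eq_1 le_less)
  then have "weight \<sigma> \<delta> t \<le> 1 powr (\<sigma> / 2)" unfolding weight_def using assms by (intro powr_mono2) auto
  then show ?thesis by simp
qed

lemma weight_sq_le:
  assumes "\<sigma> \<ge> 0" "\<delta> > 0" "t > 0"
  shows "(weight \<sigma> \<delta> t)\<^sup>2 \<le> \<delta> powr (- 2 * \<sigma>) * t powr (2 * \<sigma>)"
proof -
  have "t\<^sup>2 / (t\<^sup>2 + \<delta>\<^sup>2) \<le> t\<^sup>2 / \<delta>\<^sup>2" using assms by (intro divide_left_mono) (auto intro!: mult_pos_pos add_nonneg_pos)
  then have "(weight \<sigma> \<delta> t)\<^sup>2 \<le> (t\<^sup>2 / \<delta>\<^sup>2) powr \<sigma>" unfolding weight_sq using assms by (intro powr_mono2) auto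
  also have "t\<^sup>2 / \<delta>\<^sup>2 = \<delta> powr (- 2) * t powr 2" using assms by (simp add: powr_minus powr_numeral divide_inverse mult.commute)
  also have "\<dots> powr \<sigma> = \<delta> powr (- 2 * \<sigma>) * t powr (2 * \<sigma>)"
    by (subst powr_mult) (simp_all add: powr_powr del: powr_numeral)
  finally show ?thesis .
qed

lemma weight_sq_ge:
  assumes "\<sigma> \<ge> 0" "0 < \<delta>" "\<delta> \<le> t" shows "(weight \<sigma> \<delta> t)\<^sup>2 \<ge> (1 / 2) powr \<sigma>"
proof -
  have "\<delta>\<^sup>2 \<le> t\<^sup>2" using assms by (intro power_mono) auto
  then have "1 / 2 \<le> t\<^sup>2 / (t\<^sup>2 + \<delta>\<^sup>2)" using assms by (subst le_divide_eq) (auto simp: add_pos_pos)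
  then show ?thesis unfolding weight_sq using assms by (intro powr_mono2) auto
qed

lemma weight_sq_ge':
  assumes "\<sigma> \<ge> 0" "0 < t" "t \<le> 1" shows "(weight \<sigma> 1 t)\<^sup>2 \<ge> (1 / 2) powr \<sigma> * t powr (2 * \<sigma>)"
proof -
  have "t\<^sup>2 \<le> 1" using assms by (simp add: power_le_one)
  then have "t\<^sup>2 / 2 \<le> t\<^sup>2 / (t\<^sup>2 + 1\<^sup>2)" using assms by (intro divide_left_mono) (auto intro!: mult_pos_pos add_nonneg_pos)
  then have "(1 / 2 * t powr 2) powr \<sigma> \<le> (weight \<sigma> 1 t)\<^sup>2"
    unfolding weight_sq using assms by (intro powr_mono2) (auto simp: powr_numeral)
  moreover have "(1 / 2 * t powr 2) powr \<sigma> = (1 / 2) powr \<sigma> * t powr (2 * \<sigma>)"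
    by (subst powr_mult) (simp_all add: powr_powr del: powr_numeral)
  ultimately show ?thesis by simp
qed

lemma defect_bounds: assumes "\<delta> > 0" shows "0 \<le> defect \<delta> t" "defect \<delta> t \<le> 1"
proof -
  have "t\<^sup>2 + \<delta>\<^sup>2 > 0" using assms by (simp add: add_nonneg_pos)
  then show "0 \<le> defect \<delta> t" "defect \<delta> t \<le> 1" by (simp_all add: defect_def divide_le_eq_1)
qed

lemma DERIV_weight:
  assumes "\<delta> > 0" "t > 0"
  shows "(weight \<sigma> \<delta> has_real_derivative \<sigma> * defect \<delta> t * weight \<sigma> \<delta> t / t) (at t)"
proof -
  define u where "u t = t\<^sup>2 / (t\<^sup>2 + \<delta>\<^sup>2)" for t :: real
  have nz: "t\<^sup>2 + \<delta>\<^sup>2 > 0" using assms by (simp add: add_nonneg_pos)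
  have u0: "u t > 0" unfolding u_def using assms nz by simp
  have "(u has_real_derivative (2 * t * (t\<^sup>2 + \<delta>\<^sup>2) - t\<^sup>2 * (2 * t)) / ((t\<^sup>2 + \<delta>\<^sup>2) * (t\<^sup>2 + \<delta>\<^sup>2))) (at t)"
    unfolding u_def by (rule DERIV_divide) (use nz in \<open>auto intro!: derivative_eq_intros\<close>)
  moreover have "(2 * t * (t\<^sup>2 + \<delta>\<^sup>2) - t\<^sup>2 * (2 * t)) / ((t\<^sup>2 + \<delta>\<^sup>2) * (t\<^sup>2 + \<delta>\<^sup>2)) = 2 * defect \<delta> t * u t / t"
    unfolding defect_def u_def using nz assms by (simp add: divide_simps) (simp add: algebra_simps power2_eq_square)
  ultimately have Du: "(u has_real_derivative 2 * defect \<delta> t * u t / t) (at t)" by simp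
  have "((\<lambda>t. u t powr (\<sigma> / 2)) has_real_derivative (\<sigma> / 2 * u t powr (\<sigma> / 2 - 1)) * (2 * defect \<delta> t * u t / t)) (at t)"
    by (rule DERIV_chain2[OF has_real_derivative_powr[OF u0] Du])
  then have D: "((\<lambda>t. u t powr (\<sigma> / 2)) has_real_derivative \<sigma> * defect \<delta> t * u t powr (\<sigma> / 2) / t) (at t)"
    by (rule DERIV_cong) (use u0 in \<open>simp add: powr_diff\<close>)
  have w: "weight \<sigma> \<delta> = (\<lambda>t. u t powr (\<sigma> / 2))" by (simp add: weight_def u_def fun_eq_iff)
  show ?thesis unfolding w by (rule D)
qed

lemma continuous_weight:
  assumes "\<delta> > 0" shows "continuous_on {0<..} (weight \<sigma> \<delta>)" "continuous_on {0<..} (defect \<delta>)"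
proof -
  have nz: "t\<^sup>2 + \<delta>\<^sup>2 \<noteq> 0" for t using assms by (simp add: sum_power2_eq_zero_iff)
  show "continuous_on {0<..} (weight \<sigma> \<delta>)"
    by (rule DERIV_continuous_on[of _ _ "\<lambda>t. \<sigma> * defect \<delta> t * weight \<sigma> \<delta> t / t"])
      (use DERIV_weight[OF assms] in \<open>auto intro: has_field_derivative_at_within\<close>)
  show "continuous_on {0<..} (defect \<delta>)" unfolding defect_def[abs_def] by (intro continuous_intros) (use nz in auto)
qed

definition prof :: "real \<Rightarrow> real \<Rightarrow> nat \<Rightarrow> real \<Rightarrow> real \<Rightarrow> real \<Rightarrow> real" where
  "prof \<sigma> \<delta> m \<tau> r t = weight \<sigma> \<delta> t * cutoff m \<tau> r t"

definition prof' :: "real \<Rightarrow> real \<Rightarrow> nat \<Rightarrow> real \<Rightarrow> real \<Rightarrow> real \<Rightarrow> real" where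
  "prof' \<sigma> \<delta> m \<tau> r t = weight \<sigma> \<delta> t * (\<sigma> * defect \<delta> t * cutoff m \<tau> r t / t + cutoff' m \<tau> r t)"

lemma prof_middle:
  assumes "\<delta> > 0" "0 < \<tau>" "2 * \<tau> \<le> t" "t \<le> r" "m \<ge> 2" 
  shows "\<sigma>\<^sup>2 * (prof \<sigma> \<delta> m \<tau> r t)\<^sup>2 / t\<^sup>2 - (prof' \<sigma> \<delta> m \<tau> r t)\<^sup>2 = \<sigma>\<^sup>2 * (weight \<sigma> \<delta> t)\<^sup>2 / t\<^sup>2 * (1 - (defect \<delta> t)\<^sup>2)"
proof -
  have r: "r > 0" using assms by linarith
  show ?thesis unfolding prof_def prof'_def cutoff_middle[OF assms(2) r assms(3,4,5)]
    by (simp add: power_mult_distrib power_divide right_diff_distrib)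
qed

lemma prof_outer:
  assumes "\<delta> > 0" "0 < \<tau>" "2 * \<tau> \<le> r" "r \<le> t" "m \<ge> 2" "\<sigma> \<ge> 0"
  shows "\<sigma>\<^sup>2 * (prof \<sigma> \<delta> m \<tau> r t)\<^sup>2 / t\<^sup>2 - (prof' \<sigma> \<delta> m \<tau> r t)\<^sup>2 \<ge> - ((\<sigma> + 4) / r)\<^sup>2"
proof -
  have r: "r > 0" "t > 0" using assms by linarith+
  have a1: "\<bar>\<sigma> * defect \<delta> t * cutoff m \<tau> r t / t\<bar> \<le> \<sigma> / r"
  proof -
    have "\<sigma> * (defect \<delta> t * cutoff m \<tau> r t) \<le> \<sigma> * 1"
      using defect_bounds[OF assms(1)] cutoff_bounds assms(6) by (intro mult_left_mono mult_le_one) auto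
    then have "\<sigma> * (defect \<delta> t * cutoff m \<tau> r t) / t \<le> \<sigma> / r"
      using r assms(4,6) by (intro frac_le) auto
    moreover have "0 \<le> \<sigma> * defect \<delta> t * cutoff m \<tau> r t / t"
      using defect_bounds[OF assms(1)] cutoff_bounds assms(6) r by simp
    ultimately show ?thesis by (simp add: mult.assoc)
  qed
  have a2: "\<bar>cutoff' m \<tau> r t\<bar> \<le> 4 / r" by (rule cutoff_outer) (use assms r in auto)
  have "\<bar>\<sigma> * defect \<delta> t * cutoff m \<tau> r t / t + cutoff' m \<tau> r t\<bar> \<le> (\<sigma> + 4) / r"
    unfolding add_divide_distrib using a1 a2 by linarith
  then have "\<bar>weight \<sigma> \<delta> t\<bar> * \<bar>\<sigma> * defect \<delta> t * cutoff m \<tau> r t / t + cutoff' m \<tau> r t\<bar> \<le> 1 * ((\<sigma> + 4) / r)"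
    using weight_le_1[OF assms(6), of \<delta> t] weight_nonneg[of \<sigma> \<delta> t] by (intro mult_mono) auto
  then have "\<bar>prof' \<sigma> \<delta> m \<tau> r t\<bar> \<le> \<bar>(\<sigma> + 4) / r\<bar>" unfolding prof'_def abs_mult using assms(6) r by simp
  then have "(prof' \<sigma> \<delta> m \<tau> r t)\<^sup>2 \<le> ((\<sigma> + 4) / r)\<^sup>2" by (rule abs_le_square_iff[THEN iffD1])
  moreover have "0 \<le> \<sigma>\<^sup>2 * (prof \<sigma> \<delta> m \<tau> r t)\<^sup>2 / t\<^sup>2" by simp
  ultimately show ?thesis by linarith
qed

text \<open>The product of the derivatives and the square of the cutoff derivative are both of order \<open>ramp ^ (2 m - 2) / t\<^sup>2\<close> because
  \<open>1 / \<tau> \<le> 2 / t\<close> on the transition interval.\<close>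

lemma prof_inner:
  assumes "\<delta> > 0" "0 < \<tau>" "\<tau> \<le> t" "t \<le> 2 * \<tau>" "2 * \<tau> \<le> r" "m \<ge> 2" "\<sigma> \<ge> 0"
  shows "\<sigma>\<^sup>2 * (prof \<sigma> \<delta> m \<tau> r t)\<^sup>2 / t\<^sup>2 - (prof' \<sigma> \<delta> m \<tau> r t)\<^sup>2 \<ge>
    - ((8 * real m * \<sigma> + 16 * (real m)\<^sup>2) * ((weight \<sigma> \<delta> t)\<^sup>2 / t\<^sup>2 * ramp (t / \<tau>) ^ (2 * m - 2)))"
proof -
  define c where "c = cutoff m \<tau> r t"
  define c' where "c' = cutoff' m \<tau> r t"
  define g where "g = weight \<sigma> \<delta> t"
  define q where "q = defect \<delta> t"
  define X where "X = ramp (t / \<tau>) ^ (m - 1)"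
  have t: "t > 0" "r > 0" "t \<le> r" using assms by linarith+
  note ci = cutoff_inner[OF assms(2) t(2,3) assms(6)]
  have X0: "X \<ge> 0" unfolding X_def using ramp_bounds by simp
  have "c = ramp (t / \<tau>) * X" unfolding c_def ci step_def X_def using assms(6) by (simp add: power_eq_if)
  then have c: "0 \<le> c" "c \<le> X" using X0 ramp_bounds[of "t / \<tau>"] by (auto simp: mult_left_le_one_le)
  have c'0: "0 \<le> c'" unfolding c'_def ci using step'_nonneg assms(2) by simp
  have "c' \<le> (2 * real m * X) / \<tau>" unfolding c'_def ci X_def using step'_le[OF assms(6)] assms(2) by (intro divide_right_mono) auto
  also have "\<dots> \<le> 4 * real m * X / t"
  proof -
    have "1 / \<tau> \<le> 2 / t" using assms t by (simp add: field_simps)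
    then have "(2 * real m * X) * (1 / \<tau>) \<le> (2 * real m * X) * (2 / t)" using X0 by (intro mult_left_mono) auto
    then show ?thesis by simp
  qed
  finally have c': "c' \<le> 4 * real m * X / t" .
  have q: "0 \<le> q" "q \<le> 1" unfolding q_def using defect_bounds[OF assms(1)] by auto
  have XX: "ramp (t / \<tau>) ^ (2 * m - 2) = X * X" 
  proof -
    have "2 * m - 2 = (m - 1) + (m - 1)" using assms(6) by arith
    then show ?thesis unfolding X_def by (simp only: power_add)
  qed
  have "(\<sigma> * q * c / t + c')\<^sup>2 = \<sigma>\<^sup>2 * q\<^sup>2 * c\<^sup>2 / t\<^sup>2 + 2 * (\<sigma> * q * c / t) * c' + c' * c'"
    by (simp add: power2_eq_square algebra_simps)
  also have "\<dots> \<le> \<sigma>\<^sup>2 * c\<^sup>2 / t\<^sup>2 + 2 * (\<sigma> * X / t) * (4 * real m * X / t) + (4 * real m * X / t) * (4 * real m * X / t)"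
  proof (intro add_mono)
    have "q\<^sup>2 \<le> 1" using q by (simp add: power_le_one)
    then have "\<sigma>\<^sup>2 * (q\<^sup>2 * c\<^sup>2) \<le> \<sigma>\<^sup>2 * (1 * c\<^sup>2)" by (intro mult_left_mono mult_right_mono) auto
    then show "\<sigma>\<^sup>2 * q\<^sup>2 * c\<^sup>2 / t\<^sup>2 \<le> \<sigma>\<^sup>2 * c\<^sup>2 / t\<^sup>2" by (intro divide_right_mono) (auto simp: mult.assoc)
    have "q * c \<le> 1 * X" using q c by (intro mult_mono) auto
    then have "\<sigma> * (q * c) \<le> \<sigma> * X" using assms(7) by (intro mult_left_mono) auto
    then have "\<sigma> * q * c / t \<le> \<sigma> * X / t" using t by (intro divide_right_mono) (auto simp: mult.assoc)
    then show "2 * (\<sigma> * q * c / t) * c' \<le> 2 * (\<sigma> * X / t) * (4 * real m * X / t)"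
      using c' c'0 X0 assms(7) t q(1) c(1) by (intro mult_mono) (auto intro!: mult_nonneg_nonneg divide_nonneg_nonneg)
    show "c' * c' \<le> (4 * real m * X / t) * (4 * real m * X / t)" using c' c'0 X0 t by (intro mult_mono) auto
  qed
  also have "\<dots> = \<sigma>\<^sup>2 * c\<^sup>2 / t\<^sup>2 + (8 * real m * \<sigma> + 16 * (real m)\<^sup>2) * (X * X / t\<^sup>2)"
    using t by (simp add: field_simps power2_eq_square)
  finally have "g\<^sup>2 * (\<sigma> * q * c / t + c')\<^sup>2 \<le> g\<^sup>2 * (\<sigma>\<^sup>2 * c\<^sup>2 / t\<^sup>2 + (8 * real m * \<sigma> + 16 * (real m)\<^sup>2) * (X * X / t\<^sup>2))"
    by (intro mult_left_mono) auto
  then show ?thesis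
    unfolding prof_def prof'_def XX c_def[symmetric] c'_def[symmetric] g_def[symmetric] q_def[symmetric] power_mult_distrib
    by (simp add: algebra_simps)
qed

section \<open>Integral estimates near the singular set\<close>

text \<open>Here \<open>\<sigma>\<^sup>2 = H\<^sup>2 - \<mu>\<close> and \<open>\<alpha>\<^sub>+ = H + \<sigma>\<close>. The assumption \<open>energy\<close> is the weak energy inequality tested with radial functions, after the
  Hardy inequality in the tube has been used. The assumption \<open>pcond\<close> says that \<open>p\<close> is at least the critical exponent.\<close>

locale radial_energy = smooth_tube \<Sigma> \<beta> k for \<Sigma> :: "'a::euclidean_space set" and \<beta> :: real and k :: nat +
  fixes v :: "'a \<Rightarrow> real" and p H \<sigma> r :: real
  assumes MH: "M = 2 * H + 1" and H_pos: "H > 0" and \<sigma>: "0 \<le> \<sigma>" and p: "p > 1" and pcond: "2 / (p - 1) \<le> H + \<sigma>"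
    and r: "0 < r" "2 * r < \<beta>" "r \<le> 1"
    and v_cont: "continuous_on (tube \<Sigma> \<beta>) v" and v_nonneg: "\<And>x. x \<in> tube \<Sigma> \<beta> \<Longrightarrow> 0 \<le> v x"
    and energy: "\<And>a b G G'. profile a b G G' \<Longrightarrow> b \<le> 2 * r \<Longrightarrow>
      (LINT x:shell a b|lborel. v x powr (p + 1) * (G (d x))\<^sup>2 + (v x)\<^sup>2 * (\<sigma>\<^sup>2 * (G (d x))\<^sup>2 / (d x)\<^sup>2 - (G' (d x))\<^sup>2)) \<le> 0"
begin

lemma shell_sub: "0 < a \<Longrightarrow> b \<le> 2 * r \<Longrightarrow> shell a b \<subseteq> tube \<Sigma> \<beta>"
  using shell_subset_tube[of a b \<beta>] r by auto

lemma v_shell: "0 < a \<Longrightarrow> b \<le> 2 * r \<Longrightarrow> continuous_on (shell a b) v"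
  using continuous_on_subset[OF v_cont shell_sub] .

lemma v_shell_powr: "0 < a \<Longrightarrow> b \<le> 2 * r \<Longrightarrow> s > 0 \<Longrightarrow> continuous_on (shell a b) (\<lambda>x. v x powr s)"
  by (intro continuous_on_powr' v_shell continuous_intros) (use shell_sub v_nonneg in auto)

lemma shell_v_nonneg: "0 < a \<Longrightarrow> b \<le> 2 * r \<Longrightarrow> x \<in> shell a b \<Longrightarrow> 0 \<le> v x"
  using shell_sub v_nonneg by blast

text \<open>The density of the nonlinear energy with the critical weight.\<close>

definition E :: "'a \<Rightarrow> real" where "E x = v x powr (p + 1) * d x powr (2 * \<sigma>)"

lemma powr_radial_continuous: "0 < a \<Longrightarrow> continuous_on (shell a b) (\<lambda>x. d x powr s)"
  by (rule radial_continuous) (intro continuous_intros, auto)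

lemma integral_shell_mono:
  fixes F G :: "'a \<Rightarrow> real"
  assumes "continuous_on (shell a b) F" "continuous_on (shell a' b') G" "shell a b \<subseteq> shell a' b'"
    "\<And>x. x \<in> shell a b \<Longrightarrow> F x \<le> G x" "\<And>x. x \<in> shell a' b' \<Longrightarrow> 0 \<le> G x"
  shows "(LINT x:shell a b|lborel. F x) \<le> (LINT x:shell a' b'|lborel. G x)"
  unfolding set_lebesgue_integral_def
  by (rule integral_mono) (use shell_integrable[OF assms(1)] shell_integrable[OF assms(2)] assms(3-) in
    \<open>auto simp: set_integrable_def indicator_def\<close>)

lemma integral_shell_nonneg:
  "(\<And>x. x \<in> shell a b \<Longrightarrow> 0 \<le> F x) \<Longrightarrow> 0 \<le> (LINT x:shell a b|lborel. F x)" for F :: "'a \<Rightarrow> real"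
  unfolding set_lebesgue_integral_def by (intro integral_nonneg_AE) (auto simp: indicator_def)

text \<open>In the middle range the quadratic expression in the weight has a sign. The outer transition contributes a constant that
  depends only on \<open>v\<close> away from the singular set, and the inner one an error on the shell \<open>[\<tau>, 2 \<tau>]\<close>.\<close>

lemma radial_test_inequality:
  assumes \<delta>: "\<delta> > 0" and m: "m \<ge> 2" and \<tau>: "0 < \<tau>" "2 * \<tau> \<le> r"
  shows "(LINT x:shell \<tau> (2 * r)|lborel. v x powr (p + 1) * (prof \<sigma> \<delta> m \<tau> r (d x))\<^sup>2)
    + (LINT x:shell (2 * \<tau>) r|lborel. (v x)\<^sup>2 * (\<sigma>\<^sup>2 * (weight \<sigma> \<delta> (d x))\<^sup>2 / (d x)\<^sup>2 * (1 - (defect \<delta> (d x))\<^sup>2)))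
    \<le> (LINT x:shell r (2 * r)|lborel. (v x)\<^sup>2 * ((\<sigma> + 4) / r)\<^sup>2)
    + (LINT x:shell \<tau> (2 * \<tau>)|lborel. (v x)\<^sup>2 * ((8 * real m * \<sigma> + 16 * (real m)\<^sup>2) * ((weight \<sigma> \<delta> (d x))\<^sup>2 / (d x)\<^sup>2 * ramp (d x / \<tau>) ^ (2 * m - 2))))"
proof -
  let ?G = "prof \<sigma> \<delta> m \<tau> r" and ?G' = "prof' \<sigma> \<delta> m \<tau> r"
  let ?P = "\<lambda>t. \<sigma>\<^sup>2 * (?G t)\<^sup>2 / t\<^sup>2 - (?G' t)\<^sup>2"
  let ?Q = "\<lambda>t. \<sigma>\<^sup>2 * (weight \<sigma> \<delta> t)\<^sup>2 / t\<^sup>2 * (1 - (defect \<delta> t)\<^sup>2)"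
  let ?R = "\<lambda>t. (8 * real m * \<sigma> + 16 * (real m)\<^sup>2) * ((weight \<sigma> \<delta> t)\<^sup>2 / t\<^sup>2 * ramp (t / \<tau>) ^ (2 * m - 2))"
  have cut: "continuous_on S (cutoff m \<tau> r)" "continuous_on S (cutoff' m \<tau> r)" for S
    by (rule DERIV_continuous_on, rule has_field_derivative_at_within, rule DERIV_cutoff[OF m \<tau>(1) r(1)])
       (rule continuous_cutoff'[OF \<tau>(1) r(1) m])
  have cR0: "continuous_on S ramp" for S unfolding ramp_def[abs_def] by (intro continuous_intros)
  note cw = continuous_weight[OF \<delta>]
  have cG1: "continuous_on {0<..} ?G" unfolding prof_def[abs_def] by (intro continuous_intros cut cw)
  have cG2: "continuous_on {0<..} ?G'" unfolding prof'_def[abs_def] by (intro continuous_intros cut cw) auto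
  note cG = cG1 cG2
  have prof: "profile \<tau> (2 * r) ?G ?G'"
  proof (rule profileI[OF \<tau>(1)])
    show "(?G has_real_derivative ?G' t) (at t)" if "t > 0" for t
    proof -
      have "(?G has_real_derivative \<sigma> * defect \<delta> t * weight \<sigma> \<delta> t / t * cutoff m \<tau> r t + cutoff' m \<tau> r t * weight \<sigma> \<delta> t) (at t)"
        unfolding prof_def[abs_def] by (rule DERIV_mult[OF DERIV_weight[OF \<delta> that] DERIV_cutoff[OF m \<tau>(1) r(1)]])
      then show ?thesis by (rule DERIV_cong) (simp add: prof'_def algebra_simps)
    qed
    show "?G t = 0 \<and> ?G' t = 0" if "t \<notin> {\<tau>..2 * r}" for t
      using cutoff_support[OF \<tau>(1) r(1) m that] by (simp add: prof_def prof'_def)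
  qed (rule cG(2))
  have en: "(LINT x:shell \<tau> (2 * r)|lborel. v x powr (p + 1) * (?G (d x))\<^sup>2 + (v x)\<^sup>2 * ?P (d x)) \<le> 0"
    by (rule energy[OF prof]) simp
  note vc = v_shell[OF \<tau>(1) order_refl]
  have cP: "continuous_on {0<..} ?P" by (intro continuous_intros cG) auto
  have cQ: "continuous_on {0<..} ?Q" by (intro continuous_intros cw) auto
  have cR: "continuous_on {0<..} ?R" by (intro continuous_intros cw continuous_on_compose2[OF cR0[of UNIV]]) (use \<tau> in auto)
  have i1: "set_integrable lborel (shell \<tau> (2 * r)) (\<lambda>x. v x powr (p + 1) * (?G (d x))\<^sup>2)"
    using p by (intro shell_integrable continuous_intros v_shell_powr radial_continuous[OF cG(1)]) (use \<tau> in auto)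
  have i2: "set_integrable lborel (shell \<tau> (2 * r)) (\<lambda>x. (v x)\<^sup>2 * ?P (d x))"
    by (intro shell_integrable continuous_on_mult continuous_on_power vc radial_continuous[OF cP \<tau>(1)])
  have i3: "set_integrable lborel (shell (2 * \<tau>) r) (\<lambda>x. (v x)\<^sup>2 * ?Q (d x))"
    using \<tau> r by (intro shell_integrable continuous_on_mult continuous_on_power v_shell radial_continuous[OF cQ]) auto
  have i4: "set_integrable lborel (shell r (2 * r)) (\<lambda>x. (v x)\<^sup>2 * ((\<sigma> + 4) / r)\<^sup>2)"
    using r by (intro shell_integrable continuous_on_mult continuous_on_power v_shell continuous_on_const) auto
  have i5: "set_integrable lborel (shell \<tau> (2 * \<tau>)) (\<lambda>x. (v x)\<^sup>2 * ?R (d x))"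
    using \<tau> r by (intro shell_integrable continuous_on_mult continuous_on_power v_shell radial_continuous[OF cR]) auto
  note J = i1[unfolded set_integrable_def] i2[unfolded set_integrable_def] i3[unfolded set_integrable_def]
    i4[unfolded set_integrable_def] i5[unfolded set_integrable_def]
  have pt: "indicator (shell (2 * \<tau>) r) x *\<^sub>R ((v x)\<^sup>2 * ?Q (d x)) \<le>
    indicator (shell \<tau> (2 * r)) x *\<^sub>R ((v x)\<^sup>2 * ?P (d x)) + indicator (shell r (2 * r)) x *\<^sub>R ((v x)\<^sup>2 * ((\<sigma> + 4) / r)\<^sup>2)
      + indicator (shell \<tau> (2 * \<tau>)) x *\<^sub>R ((v x)\<^sup>2 * ?R (d x))" for x
  proof (cases "x \<in> shell \<tau> (2 * r)")
    case False
    then have "x \<notin> shell (2 * \<tau>) r" "x \<notin> shell r (2 * r)" "x \<notin> shell \<tau> (2 * \<tau>)" using \<tau> r by (auto simp: shell_def)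
    then show ?thesis using False by simp
  next
    case True
    define t where "t = d x"
    have t: "\<tau> \<le> t" "t \<le> 2 * r" "t > 0" using True \<tau> by (auto simp: shell_def t_def)
    have nR: "0 \<le> (v x)\<^sup>2 * ?R t" using ramp_bounds(1)[of "t / \<tau>"] \<sigma> by simp
    have n4: "0 \<le> (v x)\<^sup>2 * ((\<sigma> + 4) / r)\<^sup>2" by simp
    consider "t < 2 * \<tau>" | "2 * \<tau> \<le> t" "t \<le> r" | "r < t" by linarith
    then show ?thesis
    proof cases
      case 1
      have "- ?R t \<le> ?P t" by (rule prof_inner) (use 1 t \<delta> m \<sigma> \<tau> in auto)
      then have "(v x)\<^sup>2 * (- ?R t) \<le> (v x)\<^sup>2 * ?P t" by (intro mult_left_mono) auto
      moreover have "x \<notin> shell (2 * \<tau>) r" "x \<notin> shell r (2 * r)" "x \<in> shell \<tau> (2 * \<tau>)" using 1 t \<tau> by (auto simp: shell_def t_def)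
      ultimately show ?thesis using True unfolding t_def by simp
    next
      case 2
      have "?P t = ?Q t" by (rule prof_middle) (use 2 \<delta> m \<tau> in auto)
      moreover have "x \<in> shell (2 * \<tau>) r" using 2 by (simp add: shell_def t_def)
      ultimately show ?thesis using True nR n4 unfolding t_def by (simp add: indicator_def)
    next
      case 3
      have "- ((\<sigma> + 4) / r)\<^sup>2 \<le> ?P t" by (rule prof_outer) (use 3 \<delta> m \<tau> \<sigma> in auto)
      then have "(v x)\<^sup>2 * (- ((\<sigma> + 4) / r)\<^sup>2) \<le> (v x)\<^sup>2 * ?P t" by (intro mult_left_mono) auto
      moreover have "x \<notin> shell (2 * \<tau>) r" "x \<in> shell r (2 * r)" using 3 t by (auto simp: shell_def t_def)
      ultimately show ?thesis using True nR unfolding t_def by (simp add: indicator_def)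
    qed
  qed
  have "(LINT x:shell (2 * \<tau>) r|lborel. (v x)\<^sup>2 * ?Q (d x)) \<le>
    (LINT x:shell \<tau> (2 * r)|lborel. (v x)\<^sup>2 * ?P (d x)) + (LINT x:shell r (2 * r)|lborel. (v x)\<^sup>2 * ((\<sigma> + 4) / r)\<^sup>2)
      + (LINT x:shell \<tau> (2 * \<tau>)|lborel. (v x)\<^sup>2 * ?R (d x))"
    using integral_mono[OF J(3) Bochner_Integration.integrable_add[OF Bochner_Integration.integrable_add[OF J(2,4)] J(5)] pt]
    unfolding set_lebesgue_integral_def Bochner_Integration.integral_add[OF Bochner_Integration.integrable_add[OF J(2,4)] J(5)]
      Bochner_Integration.integral_add[OF J(2,4)] .
  moreover have "(LINT x:shell \<tau> (2 * r)|lborel. v x powr (p + 1) * (?G (d x))\<^sup>2) + (LINT x:shell \<tau> (2 * r)|lborel. (v x)\<^sup>2 * ?P (d x)) \<le> 0"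
    using en unfolding set_integral_add(2)[OF i1 i2] .
  ultimately show ?thesis by linarith
qed

text \<open>This is the point where the lower bound on \<open>p\<close> enters: it makes the remainder in Young's inequality no worse than the
  reciprocal of the volume of a shell.\<close>

lemma critical_exponent: "0 < t \<Longrightarrow> t \<le> 1 \<Longrightarrow> t powr (2 * \<sigma>) * t powr (- 2 - 4 / (p - 1)) \<le> t powr (- (M + 1))"
proof -
  assume t: "0 < t" "t \<le> 1"
  have "2 * \<sigma> + (- 2 - 4 / (p - 1)) \<ge> - (M + 1)"
    using pcond MH by (simp add: field_simps)
  then have "t powr (2 * \<sigma> + (- 2 - 4 / (p - 1))) \<le> t powr (- (M + 1))" using t by (intro powr_mono') auto
  then show ?thesis using t by (simp add: powr_add)
qed

lemma E_continuous: "0 < a \<Longrightarrow> b \<le> 2 * r \<Longrightarrow> continuous_on (shell a b) E"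
  unfolding E_def using p by (intro continuous_on_mult v_shell_powr powr_radial_continuous) auto

lemma E_nonneg: "0 < a \<Longrightarrow> b \<le> 2 * r \<Longrightarrow> x \<in> shell a b \<Longrightarrow> 0 \<le> E x"
  unfolding E_def by simp

text \<open>The test function with \<open>\<delta> = 1\<close> behaves like \<open>d\<^sup>\<sigma>\<close>. Half of the nonlinear energy absorbs the error of the inner cutoff, and the
  remainder is bounded uniformly in \<open>\<tau>\<close> by the volume of the shells.\<close>

lemma energy_bounded: obtains B where "\<And>\<tau>. 0 < \<tau> \<Longrightarrow> \<tau> \<le> r \<Longrightarrow> (LINT x:shell \<tau> r|lborel. E x) \<le> B"
proof -
  obtain Cv where Cv: "Cv \<ge> 0" "\<And>\<delta>. 0 < \<delta> \<Longrightarrow> 2 * \<delta> \<le> r \<Longrightarrow> (LINT x:shell \<delta> (2 * \<delta>)|lborel. d x powr (- (M + 1))) \<le> Cv"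
    using shell_volume[OF r(1,2)] by metis
  obtain m :: nat where m: "m \<ge> 2" "2 * real m - 2 \<ge> 4 / (p - 1)"
  proof -
    obtain n :: nat where "real n \<ge> 4 / (p - 1)" using real_arch_simple by blast
    then show ?thesis by (intro that[of "n + 2"]) auto
  qed
  define K where "K = 8 * real m * \<sigma> + 16 * (real m)\<^sup>2"
  have K: "K > 0" unfolding K_def using \<sigma> m by (simp add: add_nonneg_pos)
  define A where "A = 1 / (2 * K)"
  have A: "A > 0" "K * A = 1 / 2" using K by (auto simp: A_def)
  define Y where "Y = A powr (- 2 / (p - 1))"
  define Co where "Co = (LINT x:shell r (2 * r)|lborel. (v x)\<^sup>2 * ((\<sigma> + 4) / r)\<^sup>2)"
  have bound: "(LINT x:shell (2 * \<tau>) r|lborel. E x) \<le> 2 powr \<sigma> * (2 * (Co + K * Y * Cv))" if \<tau>: "0 < \<tau>" "2 * \<tau> \<le> r" for \<tau>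
  proof -
    let ?G = "prof \<sigma> 1 m \<tau> r"
    let ?X = "LINT x:shell \<tau> (2 * r)|lborel. v x powr (p + 1) * (?G (d x))\<^sup>2"
    have cG: "continuous_on {0<..} ?G"
      unfolding prof_def[abs_def]
      by (intro continuous_intros continuous_weight DERIV_continuous_on, simp)
         (rule has_field_derivative_at_within, rule DERIV_cutoff[OF m(1) \<tau>(1) r(1)])
    have cR0: "continuous_on S ramp" for S unfolding ramp_def[abs_def] by (intro continuous_intros)
    have cX: "continuous_on (shell a (2 * r)) (\<lambda>x. v x powr (p + 1) * (?G (d x))\<^sup>2)" if "0 < a" for a
      using p that by (intro continuous_on_mult continuous_on_power v_shell_powr radial_continuous[OF cG]) auto
    have cX': "continuous_on (shell a b) (\<lambda>x. v x powr (p + 1) * (?G (d x))\<^sup>2)" if "0 < a" "b \<le> 2 * r" for a b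
      using p that by (intro continuous_on_mult continuous_on_power v_shell_powr radial_continuous[OF cG]) auto
    have cin: "continuous_on (shell \<tau> (2 * \<tau>)) (\<lambda>x. (v x)\<^sup>2 * (K * ((weight \<sigma> 1 (d x))\<^sup>2 / (d x)\<^sup>2 * ramp (d x / \<tau>) ^ (2 * m - 2))))"
    proof -
      have "continuous_on {0<..} (\<lambda>t. K * ((weight \<sigma> 1 t)\<^sup>2 / t\<^sup>2 * ramp (t / \<tau>) ^ (2 * m - 2)))"
        by (intro continuous_intros continuous_weight continuous_on_compose2[OF cR0[of UNIV]]) (use \<tau> in auto)
      note rc = radial_continuous[OF this \<tau>(1)]
      show ?thesis by (rule continuous_on_mult[OF continuous_on_power[OF v_shell] rc]) (use \<tau> r in auto)
    qed
    have "0 \<le> (LINT x:shell (2 * \<tau>) r|lborel. (v x)\<^sup>2 * (\<sigma>\<^sup>2 * (weight \<sigma> 1 (d x))\<^sup>2 / (d x)\<^sup>2 * (1 - (defect 1 (d x))\<^sup>2)))"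
    proof (rule integral_shell_nonneg)
      fix x
      have "(defect 1 (d x))\<^sup>2 \<le> 1" using defect_bounds[of 1 "d x"] by (simp add: power_le_one)
      then show "0 \<le> (v x)\<^sup>2 * (\<sigma>\<^sup>2 * (weight \<sigma> 1 (d x))\<^sup>2 / (d x)\<^sup>2 * (1 - (defect 1 (d x))\<^sup>2))" by simp
    qed
    with radial_test_inequality[of 1 m \<tau>] m \<tau>
    have 1: "?X \<le> Co + (LINT x:shell \<tau> (2 * \<tau>)|lborel. (v x)\<^sup>2 * (K * ((weight \<sigma> 1 (d x))\<^sup>2 / (d x)\<^sup>2 * ramp (d x / \<tau>) ^ (2 * m - 2))))"
      unfolding Co_def K_def by simp
    have "(LINT x:shell \<tau> (2 * \<tau>)|lborel. (v x)\<^sup>2 * (K * ((weight \<sigma> 1 (d x))\<^sup>2 / (d x)\<^sup>2 * ramp (d x / \<tau>) ^ (2 * m - 2))))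
      \<le> (LINT x:shell \<tau> (2 * \<tau>)|lborel. 1 / 2 * (v x powr (p + 1) * (?G (d x))\<^sup>2) + K * Y * d x powr (- (M + 1)))"
    proof (rule integral_shell_mono[OF cin])
      show "continuous_on (shell \<tau> (2 * \<tau>)) (\<lambda>x. 1 / 2 * (v x powr (p + 1) * (?G (d x))\<^sup>2) + K * Y * d x powr (- (M + 1)))"
        using \<tau> r by (intro continuous_on_add continuous_on_mult[OF continuous_on_const] cX' powr_radial_continuous) auto
      show "0 \<le> 1 / 2 * (v x powr (p + 1) * (?G (d x))\<^sup>2) + K * Y * d x powr (- (M + 1))" for x
        using K by (simp add: Y_def)
      fix x assume x: "x \<in> shell \<tau> (2 * \<tau>)"
      define t where "t = d x"
      have t: "0 < t" "t \<le> 1" "t \<le> r" "\<tau> \<le> t" using x \<tau> r by (auto simp: shell_def t_def)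
      have vx: "v x \<ge> 0" by (rule shell_v_nonneg[OF \<tau>(1) _ x]) (use \<tau> r in auto)
      define g where "g = (weight \<sigma> 1 t)\<^sup>2"
      have g: "0 \<le> g" "g \<le> t powr (2 * \<sigma>)" unfolding g_def using weight_sq_le[OF \<sigma>, of 1 t] t by auto
      have Gt: "(?G t)\<^sup>2 = g * ramp (t / \<tau>) ^ (2 * m)"
        unfolding prof_def g_def cutoff_inner(1)[OF \<tau>(1) r(1) t(3) m(1)] step_def by (simp add: power_mult_distrib power_mult[symmetric] mult.commute)
      have "(v x)\<^sup>2 * (K * (g / t\<^sup>2 * ramp (t / \<tau>) ^ (2 * m - 2))) = K * g * ((v x)\<^sup>2 / t\<^sup>2 * ramp (t / \<tau>) ^ (2 * m - 2))" by simp
      also have "\<dots> \<le> K * g * (A * (v x powr (p + 1) * ramp (t / \<tau>) ^ (2 * m)) + Y * t powr (- 2 - 4 / (p - 1)))"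
        unfolding Y_def using K g by (intro mult_left_mono young_dichotomy[OF vx t(1) ramp_bounds A(1) p m]) auto
      also have "\<dots> = K * A * (v x powr (p + 1) * (?G t)\<^sup>2) + K * Y * (g * t powr (- 2 - 4 / (p - 1)))"
        unfolding Gt by (simp add: algebra_simps)
      also have "\<dots> \<le> 1 / 2 * (v x powr (p + 1) * (?G t)\<^sup>2) + K * Y * t powr (- (M + 1))"
      proof -
        have "g * t powr (- 2 - 4 / (p - 1)) \<le> t powr (2 * \<sigma>) * t powr (- 2 - 4 / (p - 1))" using g by (intro mult_right_mono) auto
        also have "\<dots> \<le> t powr (- (M + 1))" by (rule critical_exponent[OF t(1,2)])
        finally show ?thesis unfolding A(2) using K by (intro add_mono mult_left_mono) (auto simp: Y_def)
      qed
      finally show "(v x)\<^sup>2 * (K * ((weight \<sigma> 1 (d x))\<^sup>2 / (d x)\<^sup>2 * ramp (d x / \<tau>) ^ (2 * m - 2)))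
        \<le> 1 / 2 * (v x powr (p + 1) * (?G (d x))\<^sup>2) + K * Y * d x powr (- (M + 1))" unfolding g_def t_def .
    qed simp
    also have "\<dots> = 1 / 2 * (LINT x:shell \<tau> (2 * \<tau>)|lborel. v x powr (p + 1) * (?G (d x))\<^sup>2) + K * Y * (LINT x:shell \<tau> (2 * \<tau>)|lborel. d x powr (- (M + 1)))"
    proof -
      have "set_integrable lborel (shell \<tau> (2 * \<tau>)) (\<lambda>x. 1 / 2 * (v x powr (p + 1) * (?G (d x))\<^sup>2))"
        "set_integrable lborel (shell \<tau> (2 * \<tau>)) (\<lambda>x. K * Y * d x powr (- (M + 1)))"
        using \<tau> r by (intro shell_integrable continuous_on_mult[OF continuous_on_const] cX' powr_radial_continuous; auto)+
      from set_integral_add(2)[OF this] show ?thesis by (simp only: set_integral_mult_right)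
    qed
    also have "\<dots> \<le> 1 / 2 * ?X + K * Y * Cv"
    proof (intro add_mono mult_left_mono Cv(2) \<tau>)
      show "(LINT x:shell \<tau> (2 * \<tau>)|lborel. v x powr (p + 1) * (?G (d x))\<^sup>2) \<le> ?X"
        by (rule integral_shell_mono[OF cX' cX']) (use \<tau> r in \<open>auto simp: shell_def\<close>)
    qed (use K in \<open>auto simp: Y_def\<close>)
    finally have "?X \<le> Co + (1 / 2 * ?X + K * Y * Cv)" using 1 by linarith
    then have X: "?X \<le> 2 * (Co + K * Y * Cv)" by simp
    have "(LINT x:shell (2 * \<tau>) r|lborel. E x) \<le> (LINT x:shell \<tau> (2 * r)|lborel. 2 powr \<sigma> * (v x powr (p + 1) * (?G (d x))\<^sup>2))"
    proof (rule integral_shell_mono)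
      show "continuous_on (shell (2 * \<tau>) r) E" by (rule E_continuous) (use \<tau> r in auto)
      show "continuous_on (shell \<tau> (2 * r)) (\<lambda>x. 2 powr \<sigma> * (v x powr (p + 1) * (?G (d x))\<^sup>2))"
        by (intro continuous_on_mult[OF continuous_on_const] cX' \<tau>) simp
      show "shell (2 * \<tau>) r \<subseteq> shell \<tau> (2 * r)" using \<tau> r by (auto simp: shell_def)
      fix x assume x: "x \<in> shell (2 * \<tau>) r"
      define t where "t = d x"
      have t: "0 < t" "t \<le> 1" "t \<le> r" "2 * \<tau> \<le> t" using x \<tau> r by (auto simp: shell_def t_def)
      have "?G t = weight \<sigma> 1 t" unfolding prof_def cutoff_middle(1)[OF \<tau>(1) r(1) t(4,3) m(1)] by simp
      then have "(1 / 2) powr \<sigma> * t powr (2 * \<sigma>) \<le> (?G t)\<^sup>2" using weight_sq_ge'[OF \<sigma> t(1,2)] by simp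
      then have "2 powr \<sigma> * ((1 / 2) powr \<sigma> * t powr (2 * \<sigma>)) \<le> 2 powr \<sigma> * (?G t)\<^sup>2" by (intro mult_left_mono) auto
      then have "t powr (2 * \<sigma>) \<le> 2 powr \<sigma> * (?G t)\<^sup>2" by (simp add: powr_divide)
      then have "v x powr (p + 1) * t powr (2 * \<sigma>) \<le> v x powr (p + 1) * (2 powr \<sigma> * (?G t)\<^sup>2)" by (intro mult_left_mono) auto
      then show "E x \<le> 2 powr \<sigma> * (v x powr (p + 1) * (?G (d x))\<^sup>2)" unfolding E_def t_def by (simp add: mult_ac)
    qed simp
    also have "\<dots> = 2 powr \<sigma> * ?X" by (simp only: set_integral_mult_right)
    also have "\<dots> \<le> 2 powr \<sigma> * (2 * (Co + K * Y * Cv))" using X by (intro mult_left_mono) auto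
    finally show ?thesis .
  qed
  show ?thesis
  proof (rule that)
    fix \<tau> :: real assume "0 < \<tau>" "\<tau> \<le> r"
    then show "(LINT x:shell \<tau> r|lborel. E x) \<le> 2 powr \<sigma> * (2 * (Co + K * Y * Cv))" using bound[of "\<tau> / 2"] by simp
  qed
qed

text \<open>The factor 4 makes the shells \<open>{\<tau> n \<le> d \<le> 2 \<tau> n}\<close> pairwise disjoint.\<close>

definition \<tau> :: "nat \<Rightarrow> real" where "\<tau> n = r / 4 ^ Suc n"

lemma \<tau>: "0 < \<tau> n" "2 * \<tau> n \<le> r" "\<tau> n \<le> r"
proof -
  have "4 * 1 \<le> (4::real) * 4 ^ n" by (intro mult_left_mono one_le_power) auto
  then have "r / 4 ^ Suc n \<le> r / 4" using r by (intro divide_left_mono) auto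
  then show "2 * \<tau> n \<le> r" "\<tau> n \<le> r" using r by (auto simp: \<tau>_def)
  show "0 < \<tau> n" using r by (simp add: \<tau>_def)
qed

lemma \<tau>_tendsto: "\<tau> \<longlonglongrightarrow> 0"
proof -
  have "(\<lambda>n. r * (1 / 4) ^ Suc n) \<longlonglongrightarrow> r * 0"
    by (intro tendsto_mult tendsto_const LIMSEQ_Suc LIMSEQ_realpow_zero) auto
  then show ?thesis by (simp add: \<tau>_def[abs_def] power_divide)
qed

text \<open>The integrals over disjoint shells are increments of a bounded increasing sequence.\<close>

lemma vanishing_shells:
  fixes F :: "'a \<Rightarrow> real"
  assumes c: "\<And>a. 0 < a \<Longrightarrow> continuous_on (shell a r) F" and nn: "\<And>a x. 0 < a \<Longrightarrow> x \<in> shell a r \<Longrightarrow> 0 \<le> F x"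
    and B: "\<And>a. 0 < a \<Longrightarrow> a \<le> r \<Longrightarrow> (LINT x:shell a r|lborel. F x) \<le> B"
  shows "(\<lambda>n. LINT x:shell (\<tau> n) (2 * \<tau> n)|lborel. F x) \<longlonglongrightarrow> 0"
proof -
  define a where "a n = r / 4 ^ n" for n
  have a0: "a n > 0" "a n \<le> r" for n using r by (auto simp: a_def divide_le_eq mult_le_cancel_left1)
  have a\<tau>: "\<tau> n = a (Suc n)" "2 * \<tau> n < a n" for n using r by (auto simp: a_def \<tau>_def field_simps)
  define I where "I n = (LINT x:shell (a n) r|lborel. F x)" for n
  have step: "(LINT x:shell (\<tau> n) (2 * \<tau> n)|lborel. F x) + I n \<le> I (Suc n)" for n
  proof -
    have "continuous_on (shell (\<tau> n) (2 * \<tau> n)) F"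
      by (rule continuous_on_subset[OF c[OF \<tau>(1)[of n]]]) (use \<tau>[of n] in \<open>auto simp: shell_def\<close>)
    then have i1: "integrable lborel (\<lambda>x. indicator (shell (\<tau> n) (2 * \<tau> n)) x *\<^sub>R F x)"
      using shell_integrable by (simp add: set_integrable_def)
    have i2: "integrable lborel (\<lambda>x. indicator (shell (a n) r) x *\<^sub>R F x)" for n
      using shell_integrable[OF c[OF a0(1)]] by (simp add: set_integrable_def)
    show ?thesis unfolding I_def set_lebesgue_integral_def Bochner_Integration.integral_add[OF i1 i2, symmetric]
    proof (rule integral_mono[OF Bochner_Integration.integrable_add[OF i1 i2] i2])
      fix x
      have "a (Suc n) \<le> a n" using r by (simp add: a_def field_simps)
      then show "indicator (shell (\<tau> n) (2 * \<tau> n)) x *\<^sub>R F x + indicator (shell (a n) r) x *\<^sub>R F x \<le> indicator (shell (a (Suc n)) r) x *\<^sub>R F x"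
        using a\<tau>[of n] \<tau>[of n] nn[of "a (Suc n)" x] a0[of "Suc n"] by (auto simp: indicator_def shell_def)
    qed
  qed
  have S0: "0 \<le> (LINT x:shell (\<tau> n) (2 * \<tau> n)|lborel. F x)" for n
    by (rule integral_shell_nonneg) (use nn[OF \<tau>(1)[of n]] \<tau>[of n] in \<open>auto simp: shell_def\<close>)
  have "I n \<le> I (Suc n)" for n using step[of n] S0[of n] by linarith
  then have "incseq I" by (rule incseq_SucI)
  moreover have "I n \<le> B" for n unfolding I_def by (rule B[OF a0])
  ultimately obtain L where L: "I \<longlonglongrightarrow> L" using incseq_convergent by blast
  have "(\<lambda>n. I (Suc n) - I n) \<longlonglongrightarrow> L - L" by (intro tendsto_diff LIMSEQ_Suc L)
  then have d: "(\<lambda>n. I (Suc n) - I n) \<longlonglongrightarrow> 0" by simp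
  have up: "(LINT x:shell (\<tau> n) (2 * \<tau> n)|lborel. F x) \<le> I (Suc n) - I n" for n using step[of n] by linarith
  show ?thesis
    by (rule tendsto_sandwich[OF _ _ tendsto_const d]) (use S0 up in auto)
qed

lemma shell_continuous_v2: "0 < a \<Longrightarrow> b \<le> 2 * r \<Longrightarrow> continuous_on (shell a b) (\<lambda>x. (v x)\<^sup>2 * d x powr s / (d x)\<^sup>2)"
  by (intro continuous_intros v_shell powr_radial_continuous d_continuous) (auto simp: shell_def)

text \<open>Young's inequality with a large coefficient \<open>A\<close> in front of the nonlinear energy, whose shell integrals tend to zero; the
  other term is uniformly small.\<close>

lemma weighted_shells_vanish:
  "(\<lambda>n. LINT x:shell (\<tau> n) (2 * \<tau> n)|lborel. (v x)\<^sup>2 * d x powr (2 * \<sigma>) / (d x)\<^sup>2) \<longlonglongrightarrow> 0"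
proof -
  obtain B where B: "\<And>\<tau>. 0 < \<tau> \<Longrightarrow> \<tau> \<le> r \<Longrightarrow> (LINT x:shell \<tau> r|lborel. E x) \<le> B"
    by (rule energy_bounded) blast
  have e: "(\<lambda>n. LINT x:shell (\<tau> n) (2 * \<tau> n)|lborel. E x) \<longlonglongrightarrow> 0"
    by (rule vanishing_shells[OF E_continuous E_nonneg B]) (use r in auto)
  obtain Cv where Cv: "Cv \<ge> 0" "\<And>\<delta>. 0 < \<delta> \<Longrightarrow> 2 * \<delta> \<le> r \<Longrightarrow> (LINT x:shell \<delta> (2 * \<delta>)|lborel. d x powr (- (M + 1))) \<le> Cv"
    using shell_volume[OF r(1,2)] by metis
  obtain m :: nat where m: "m \<ge> 2" "2 * real m - 2 \<ge> 4 / (p - 1)"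
  proof -
    obtain n :: nat where "real n \<ge> 4 / (p - 1)" using real_arch_simple by blast
    then show ?thesis by (intro that[of "n + 2"]) auto
  qed
  let ?S = "\<lambda>n. LINT x:shell (\<tau> n) (2 * \<tau> n)|lborel. (v x)\<^sup>2 * d x powr (2 * \<sigma>) / (d x)\<^sup>2"
  have S0: "0 \<le> ?S n" for n by (rule integral_shell_nonneg) simp
  have bound: "?S n \<le> A * (LINT x:shell (\<tau> n) (2 * \<tau> n)|lborel. E x) + A powr (- 2 / (p - 1)) * Cv" if A: "A > 0" for A n
  proof -
    have t2: "2 * \<tau> n \<le> 2 * r" using \<tau>(2)[of n] r by simp
    have c1: "continuous_on (shell (\<tau> n) (2 * \<tau> n)) (\<lambda>x. A * E x)"
      by (intro continuous_on_mult[OF continuous_on_const] E_continuous \<tau>(1) t2)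
    have c2: "continuous_on (shell (\<tau> n) (2 * \<tau> n)) (\<lambda>x. A powr (- 2 / (p - 1)) * d x powr (- (M + 1)))"
      by (intro continuous_on_mult[OF continuous_on_const] powr_radial_continuous \<tau>(1))
    have "?S n \<le> (LINT x:shell (\<tau> n) (2 * \<tau> n)|lborel. A * E x + A powr (- 2 / (p - 1)) * d x powr (- (M + 1)))"
    proof (rule integral_shell_mono[OF shell_continuous_v2[OF \<tau>(1) t2] continuous_on_add[OF c1 c2]])
      show "0 \<le> A * E x + A powr (- 2 / (p - 1)) * d x powr (- (M + 1))" for x using A by (simp add: E_def)
      fix x assume x: "x \<in> shell (\<tau> n) (2 * \<tau> n)"
      have t: "0 < d x" "d x \<le> 1" using x \<tau>[of n] r by (auto simp: shell_def)
      have vx: "0 \<le> v x" by (rule shell_v_nonneg[OF \<tau>(1) t2 x])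
      have "(v x)\<^sup>2 / (d x)\<^sup>2 \<le> A * v x powr (p + 1) + A powr (- 2 / (p - 1)) * d x powr (- 2 - 4 / (p - 1))"
        using young_dichotomy[OF vx t(1) zero_le_one order_refl A p m] by simp
      then have "d x powr (2 * \<sigma>) * ((v x)\<^sup>2 / (d x)\<^sup>2) \<le> d x powr (2 * \<sigma>) * (A * v x powr (p + 1) + A powr (- 2 / (p - 1)) * d x powr (- 2 - 4 / (p - 1)))"
        by (intro mult_left_mono) auto
      also have "\<dots> = A * E x + A powr (- 2 / (p - 1)) * (d x powr (2 * \<sigma>) * d x powr (- 2 - 4 / (p - 1)))"
        unfolding E_def by (simp add: algebra_simps)
      also have "\<dots> \<le> A * E x + A powr (- 2 / (p - 1)) * d x powr (- (M + 1))"
        using critical_exponent[OF t] by (intro add_left_mono mult_left_mono) auto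
      finally show "(v x)\<^sup>2 * d x powr (2 * \<sigma>) / (d x)\<^sup>2 \<le> A * E x + A powr (- 2 / (p - 1)) * d x powr (- (M + 1))"
        by (simp add: mult.commute)
    qed simp
    also have "\<dots> = A * (LINT x:shell (\<tau> n) (2 * \<tau> n)|lborel. E x) + A powr (- 2 / (p - 1)) * (LINT x:shell (\<tau> n) (2 * \<tau> n)|lborel. d x powr (- (M + 1)))"
      using set_integral_add(2)[OF shell_integrable[OF c1] shell_integrable[OF c2]] by (simp only: set_integral_mult_right)
    also have "\<dots> \<le> A * (LINT x:shell (\<tau> n) (2 * \<tau> n)|lborel. E x) + A powr (- 2 / (p - 1)) * Cv"
      using Cv(2)[OF \<tau>(1,2)] by (intro add_left_mono mult_left_mono) auto
    finally show ?thesis .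
  qed
  show ?thesis
  proof (rule LIMSEQ_I)
    fix \<epsilon> :: real assume \<epsilon>: "\<epsilon> > 0"
    \<comment> \<open>Solves \<open>A powr (- 2 / (p - 1)) = \<epsilon> / (2 (Cv + 1))\<close>.\<close>
    define A where "A = (\<epsilon> / (2 * (Cv + 1))) powr (- (p - 1) / 2)"
    have q: "\<epsilon> / (2 * (Cv + 1)) > 0" using \<epsilon> Cv by simp
    have A: "A > 0" unfolding A_def using \<epsilon> Cv(1) by simp
    have e1: "(- (p - 1) / 2) * (- 2 / (p - 1)) = 1" using p by (simp add: field_simps)
    have "A powr (- 2 / (p - 1)) = \<epsilon> / (2 * (Cv + 1))" unfolding A_def powr_powr e1 using q by (intro powr_one) simp
    moreover have "\<epsilon> / (2 * (Cv + 1)) * Cv < \<epsilon> / 2" using \<epsilon> Cv by (simp add: field_simps)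
    ultimately have small: "A powr (- 2 / (p - 1)) * Cv < \<epsilon> / 2" by simp
    have "(\<lambda>n. A * (LINT x:shell (\<tau> n) (2 * \<tau> n)|lborel. E x)) \<longlonglongrightarrow> A * 0" by (intro tendsto_mult tendsto_const e)
    then have "\<forall>\<^sub>F n in sequentially. A * (LINT x:shell (\<tau> n) (2 * \<tau> n)|lborel. E x) < \<epsilon> / 2" using \<epsilon> by (intro order_tendstoD) auto
    then have "\<forall>\<^sub>F n in sequentially. norm (?S n - 0) < \<epsilon>"
    proof eventually_elim
      case (elim n)
      then show ?case using bound[OF A, of n] small S0[of n] by simp
    qed
    then show "\<exists>no. \<forall>n\<ge>no. norm (?S n - 0) < \<epsilon>" by (simp add: eventually_sequentially)
  qed
qed

text \<open>For fixed \<open>\<delta>\<close> the inner cutoff can be removed along the radii \<open>\<tau> n\<close>, since the weight is at most \<open>(d / \<delta>)\<^sup>\<sigma>\<close>. What remains bounds the integral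
  over \<open>d \<ge> \<delta>\<close> by a constant independent of \<open>\<delta>\<close>.\<close>

lemma gradient_energy_bounded:
  assumes "\<sigma> > 0" shows "\<exists>B. \<forall>\<delta>. 0 < \<delta> \<and> \<delta> \<le> r \<longrightarrow> (LINT x:shell \<delta> r|lborel. (v x)\<^sup>2 / (d x)\<^sup>2) \<le> B"
proof -
  define Co where "Co = (LINT x:shell r (2 * r)|lborel. (v x)\<^sup>2 * ((\<sigma> + 4) / r)\<^sup>2)"
  define c where "c = \<sigma>\<^sup>2 * (1 / 2) powr \<sigma> * (3 / 4)"
  have c: "c > 0" using assms by (simp add: c_def)
  define K where "K = 8 * real 2 * \<sigma> + 16 * (real 2)\<^sup>2"
  have K: "K \<ge> 0" using \<sigma> by (simp add: K_def)
  let ?S = "\<lambda>n. LINT x:shell (\<tau> n) (2 * \<tau> n)|lborel. (v x)\<^sup>2 * d x powr (2 * \<sigma>) / (d x)\<^sup>2"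
  have cR0: "continuous_on S ramp" for S unfolding ramp_def[abs_def] by (intro continuous_intros)
  have main: "c * (LINT x:shell \<delta> r|lborel. (v x)\<^sup>2 / (d x)\<^sup>2) \<le> Co" if \<delta>: "0 < \<delta>" "\<delta> \<le> r" for \<delta>
  proof -
    let ?D = "K * \<delta> powr (- 2 * \<sigma>)"
    have "(\<lambda>n. Co + ?D * ?S n) \<longlonglongrightarrow> Co + ?D * 0" by (intro tendsto_intros weighted_shells_vanish)
    then have lim: "(\<lambda>n. Co + ?D * ?S n) \<longlonglongrightarrow> Co" by simp
    have "\<forall>\<^sub>F n in sequentially. \<tau> n < \<delta> / 2" using \<tau>_tendsto \<delta> by (intro order_tendstoD) auto
    then have "\<forall>\<^sub>F n in sequentially. c * (LINT x:shell \<delta> r|lborel. (v x)\<^sup>2 / (d x)\<^sup>2) \<le> Co + ?D * ?S n"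
    proof eventually_elim
      case (elim n)
      then have n: "2 * \<tau> n \<le> \<delta>" by simp
      let ?Q = "\<lambda>t. \<sigma>\<^sup>2 * (weight \<sigma> \<delta> t)\<^sup>2 / t\<^sup>2 * (1 - (defect \<delta> t)\<^sup>2)"
      let ?R = "\<lambda>t. K * ((weight \<sigma> \<delta> t)\<^sup>2 / t\<^sup>2 * ramp (t / \<tau> n) ^ (2 * 2 - 2))"
      note cw = continuous_weight[OF \<delta>(1)]
      have cQ: "continuous_on {0<..} ?Q" by (intro continuous_intros cw) auto
      have cR: "continuous_on {0<..} ?R" by (intro continuous_intros cw continuous_on_compose2[OF cR0[of UNIV]]) (use \<tau>(1)[of n] in auto)
      have dq: "0 \<le> 1 - (defect \<delta> t)\<^sup>2" for t using defect_bounds[OF \<delta>(1), of t] by (simp add: power_le_one)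
      have "c * (LINT x:shell \<delta> r|lborel. (v x)\<^sup>2 / (d x)\<^sup>2) = (LINT x:shell \<delta> r|lborel. c * ((v x)\<^sup>2 / (d x)\<^sup>2))"
        by (simp only: set_integral_mult_right)
      also have "\<dots> \<le> (LINT x:shell (2 * \<tau> n) r|lborel. (v x)\<^sup>2 * ?Q (d x))"
      proof (rule integral_shell_mono)
        show "continuous_on (shell \<delta> r) (\<lambda>x. c * ((v x)\<^sup>2 / (d x)\<^sup>2))"
          using \<delta> r by (intro continuous_intros v_shell d_continuous) (auto simp: shell_def)
        show "continuous_on (shell (2 * \<tau> n) r) (\<lambda>x. (v x)\<^sup>2 * ?Q (d x))"
          using \<tau>[of n] r by (intro continuous_on_mult[OF continuous_on_power[OF v_shell] radial_continuous[OF cQ]]) auto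
        show "shell \<delta> r \<subseteq> shell (2 * \<tau> n) r" using n by (auto simp: shell_def)
        show "0 \<le> (v x)\<^sup>2 * ?Q (d x)" for x using dq by simp
        fix x assume x: "x \<in> shell \<delta> r"
        define t where "t = d x"
        have t: "\<delta> \<le> t" "t > 0" using x \<delta> by (auto simp: shell_def t_def)
        have "\<delta>\<^sup>2 \<le> t\<^sup>2" using t \<delta> by (intro power_mono) auto
        then have "defect \<delta> t \<le> 1 / 2" using t by (simp add: defect_def divide_le_eq add_pos_nonneg)
        then have "(defect \<delta> t)\<^sup>2 \<le> (1 / 2)\<^sup>2" using defect_bounds[OF \<delta>(1), of t] by (intro power_mono) auto
        then have d34: "3 / 4 \<le> 1 - (defect \<delta> t)\<^sup>2" by (simp add: power2_eq_square)
        have "c / t\<^sup>2 = (\<sigma>\<^sup>2 * (1 / 2) powr \<sigma> / t\<^sup>2) * (3 / 4)" by (simp add: c_def)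
        also have "\<dots> \<le> (\<sigma>\<^sup>2 * (weight \<sigma> \<delta> t)\<^sup>2 / t\<^sup>2) * (1 - (defect \<delta> t)\<^sup>2)"
          using weight_sq_ge[OF \<sigma> \<delta>(1) t(1)] d34 by (intro mult_mono divide_right_mono mult_left_mono) auto
        finally have "(v x)\<^sup>2 * (c / t\<^sup>2) \<le> (v x)\<^sup>2 * ?Q t" by (intro mult_left_mono) auto
        then show "c * ((v x)\<^sup>2 / (d x)\<^sup>2) \<le> (v x)\<^sup>2 * ?Q (d x)" by (simp add: t_def mult.commute)
      qed
      also have "\<dots> \<le> Co + (LINT x:shell (\<tau> n) (2 * \<tau> n)|lborel. (v x)\<^sup>2 * ?R (d x))"
      proof -
        have "0 \<le> (LINT x:shell (\<tau> n) (2 * r)|lborel. v x powr (p + 1) * (prof \<sigma> \<delta> 2 (\<tau> n) r (d x))\<^sup>2)"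
          by (rule integral_shell_nonneg) simp
        then show ?thesis using radial_test_inequality[OF \<delta>(1) order_refl \<tau>(1,2), of n] unfolding Co_def K_def by linarith
      qed
      also have "(LINT x:shell (\<tau> n) (2 * \<tau> n)|lborel. (v x)\<^sup>2 * ?R (d x)) \<le> (LINT x:shell (\<tau> n) (2 * \<tau> n)|lborel. ?D * ((v x)\<^sup>2 * d x powr (2 * \<sigma>) / (d x)\<^sup>2))"
      proof (rule integral_shell_mono)
        have t2: "2 * \<tau> n \<le> 2 * r" using \<tau>(2)[of n] r by simp
        show "continuous_on (shell (\<tau> n) (2 * \<tau> n)) (\<lambda>x. (v x)\<^sup>2 * ?R (d x))"
          by (rule continuous_on_mult[OF continuous_on_power[OF v_shell[OF \<tau>(1) t2]] radial_continuous[OF cR \<tau>(1)]])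
        show "continuous_on (shell (\<tau> n) (2 * \<tau> n)) (\<lambda>x. ?D * ((v x)\<^sup>2 * d x powr (2 * \<sigma>) / (d x)\<^sup>2))"
          by (rule continuous_on_mult[OF continuous_on_const shell_continuous_v2[OF \<tau>(1) t2]])
        show "0 \<le> ?D * ((v x)\<^sup>2 * d x powr (2 * \<sigma>) / (d x)\<^sup>2)" for x using K by simp
        fix x assume x: "x \<in> shell (\<tau> n) (2 * \<tau> n)"
        define t where "t = d x"
        have t: "t > 0" using x \<tau>(1)[of n] by (auto simp: shell_def t_def)
        have "(weight \<sigma> \<delta> t)\<^sup>2 / t\<^sup>2 * ramp (t / \<tau> n) ^ (2 * 2 - 2) \<le> (\<delta> powr (- 2 * \<sigma>) * t powr (2 * \<sigma>)) / t\<^sup>2 * 1"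
          using weight_sq_le[OF \<sigma> \<delta>(1) t] ramp_bounds[of "t / \<tau> n"]
          by (intro mult_mono divide_right_mono power_le_one) auto
        then have "(v x)\<^sup>2 * ?R t \<le> (v x)\<^sup>2 * (K * ((\<delta> powr (- 2 * \<sigma>) * t powr (2 * \<sigma>)) / t\<^sup>2 * 1))"
          using K by (intro mult_left_mono) auto
        then show "(v x)\<^sup>2 * ?R (d x) \<le> ?D * ((v x)\<^sup>2 * d x powr (2 * \<sigma>) / (d x)\<^sup>2)" by (simp add: t_def mult_ac)
      qed simp
      also have "\<dots> = ?D * ?S n" by (simp only: set_integral_mult_right)
      finally show ?case by simp
    qed
    then show ?thesis by (intro tendsto_lowerbound[OF lim]) auto
  qed
  then have "(LINT x:shell \<delta> r|lborel. (v x)\<^sup>2 / (d x)\<^sup>2) \<le> Co / c" if "0 < \<delta>" "\<delta> \<le> r" for \<delta>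
    using that c by (simp add: pos_le_divide_eq mult.commute)
  then show ?thesis by blast
qed

text \<open>If \<open>\<sigma> = 0\<close>, the weighted and the unweighted integrals coincide; otherwise the unweighted integral is bounded.\<close>

lemma gradient_shells_vanish:
  "(\<lambda>n. LINT x:shell (\<tau> n) (2 * \<tau> n)|lborel. (v x)\<^sup>2 / (d x)\<^sup>2) \<longlonglongrightarrow> 0"
proof (cases "\<sigma> = 0")
  case True
  have "(LINT x:shell (\<tau> n) (2 * \<tau> n)|lborel. (v x)\<^sup>2 * d x powr (2 * \<sigma>) / (d x)\<^sup>2) = (LINT x:shell (\<tau> n) (2 * \<tau> n)|lborel. (v x)\<^sup>2 / (d x)\<^sup>2)" for n
  proof (rule set_lebesgue_integral_cong)
    have "d x > 0" if "x \<in> shell (\<tau> n) (2 * \<tau> n)" for x using that \<tau>(1)[of n] by (auto simp: shell_def)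
    then show "\<forall>x. x \<in> shell (\<tau> n) (2 * \<tau> n) \<longrightarrow> (v x)\<^sup>2 * d x powr (2 * \<sigma>) / (d x)\<^sup>2 = (v x)\<^sup>2 / (d x)\<^sup>2"
      using True by fastforce
  qed simp
  then show ?thesis using weighted_shells_vanish by simp
next
  case False
  then obtain B where B: "\<And>\<delta>. 0 < \<delta> \<Longrightarrow> \<delta> \<le> r \<Longrightarrow> (LINT x:shell \<delta> r|lborel. (v x)\<^sup>2 / (d x)\<^sup>2) \<le> B"
    using gradient_energy_bounded \<sigma> by force
  show ?thesis
  proof (rule vanishing_shells[OF _ _ B])
    show "continuous_on (shell a r) (\<lambda>x. (v x)\<^sup>2 / (d x)\<^sup>2)" if "0 < a" for a
      using that r by (intro continuous_intros v_shell d_continuous) (auto simp: shell_def)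
  qed auto
qed

text \<open>Either \<open>v\<^sup>p d\<^bsup>2 \<sigma> + 2\<^esup> \<ge> 1\<close>, and the nonlinear energy dominates, or \<open>v\<close> is bounded by a power of the distance that is integrable against
  \<open>d\<^sup>-\<^sup>2\<close>; the latter uses \<open>\<sigma> < H\<close>.\<close>

lemma potential_bounded:
  assumes "\<sigma> < H" shows "\<exists>B. \<forall>\<delta>. 0 < \<delta> \<and> \<delta> \<le> r \<longrightarrow> (LINT x:shell \<delta> r|lborel. v x / (d x)\<^sup>2) \<le> B"
proof -
  obtain B where B: "\<And>\<tau>. 0 < \<tau> \<Longrightarrow> \<tau> \<le> r \<Longrightarrow> (LINT x:shell \<tau> r|lborel. E x) \<le> B"
    by (rule energy_bounded) blast
  obtain Cv where Cv: "Cv \<ge> 0"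
    "\<And>e \<tau>. 0 < e \<Longrightarrow> 0 < \<tau> \<Longrightarrow> \<tau> \<le> r \<Longrightarrow> (LINT x:shell \<tau> r|lborel. d x powr (e - (M + 1))) \<le> Cv * (2 * r) powr e / e"
    using shell_volume[OF r(1,2)] by metis
  define s where "s = (2 * \<sigma> + 2) / p"
  define e where "e = 2 * H - s"
  have e: "e > 0"
  proof -
    have "2 \<le> (p - 1) * (H + \<sigma>)" using pcond p by (simp add: divide_le_eq mult.commute)
    then have "2 + (H + \<sigma>) \<le> p * (H + \<sigma>)" by (simp add: algebra_simps)
    then have "H * (2 + (H + \<sigma>)) \<le> (H * p) * (H + \<sigma>)" using H_pos by (simp add: mult.assoc mult_left_mono)
    moreover have "(\<sigma> + 1) * (H + \<sigma>) < H * (2 + (H + \<sigma>))"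
    proof -
      have "\<sigma> * \<sigma> \<le> H * H" using assms \<sigma> by (intro mult_mono) auto
      then show ?thesis using assms by (simp add: algebra_simps)
    qed
    ultimately have "(\<sigma> + 1) * (H + \<sigma>) < (H * p) * (H + \<sigma>)" by linarith
    then have "\<sigma> + 1 < H * p" using H_pos \<sigma> by (simp add: mult_less_cancel_right)
    then show ?thesis unfolding e_def s_def using p by (simp add: divide_less_eq)
  qed
  have "(LINT x:shell \<delta> r|lborel. v x / (d x)\<^sup>2) \<le> B + Cv * (2 * r) powr e / e" if \<delta>: "0 < \<delta>" "\<delta> \<le> r" for \<delta>
  proof -
    have r2: "r \<le> 2 * r" using r by simp
    note c1 = E_continuous[OF \<delta>(1) r2] and c2 = powr_radial_continuous[OF \<delta>(1), of r "e - (M + 1)"]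
    have "(LINT x:shell \<delta> r|lborel. v x / (d x)\<^sup>2) \<le> (LINT x:shell \<delta> r|lborel. E x + d x powr (e - (M + 1)))"
    proof (rule integral_shell_mono[OF _ continuous_on_add[OF c1 c2]])
      show "continuous_on (shell \<delta> r) (\<lambda>x. v x / (d x)\<^sup>2)"
        using \<delta> by (intro continuous_intros v_shell[OF \<delta>(1) r2] d_continuous) (auto simp: shell_def)
      show "0 \<le> E x + d x powr (e - (M + 1))" for x by (simp add: E_def)
      fix x assume x: "x \<in> shell \<delta> r"
      define t where "t = d x"
      define V where "V = v x"
      have t: "0 < t" using x \<delta> by (auto simp: shell_def t_def)
      have V: "0 \<le> V" unfolding V_def by (rule shell_v_nonneg[OF \<delta>(1) r2 x])
      have "V / t\<^sup>2 \<le> V powr (p + 1) * t powr (2 * \<sigma>) + t powr (e - (M + 1))"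
      proof (cases "V powr p * t powr (2 * \<sigma> + 2) \<ge> 1")
        case True
        then have V0: "V > 0" using V by (cases "V = 0") auto
        have "V / t\<^sup>2 * 1 \<le> V / t\<^sup>2 * (V powr p * t powr (2 * \<sigma> + 2))" using True V by (intro mult_left_mono) auto
        also have "\<dots> = V powr (p + 1) * t powr (2 * \<sigma>)" using V0 t by (simp add: powr_add powr_numeral)
        finally show ?thesis by (simp add: add_increasing2)
      next
        case False
        then have "V powr p \<le> t powr (- (2 * \<sigma> + 2))" using t by (simp only: powr_minus) (simp add: field_simps)
        then have "(V powr p) powr (1 / p) \<le> (t powr (- (2 * \<sigma> + 2))) powr (1 / p)" using p by (intro powr_mono2) auto
        moreover have "(V powr p) powr (1 / p) = V" using p V by (simp add: powr_powr)
        moreover have "- (2 * \<sigma> + 2) * (1 / p) = - s" by (simp add: s_def minus_divide_left)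
        ultimately have "V \<le> t powr (- s)" by (simp only: powr_powr)
        then have "V / t\<^sup>2 \<le> t powr (- s) / t powr 2" using t by (simp add: powr_numeral divide_right_mono)
        also have "\<dots> = t powr (- s - 2)" using powr_diff[of t "- s" 2] by simp
        also have "- s - 2 = e - (M + 1)" unfolding e_def MH by simp
        finally show ?thesis by (simp add: add_increasing)
      qed
      then show "v x / (d x)\<^sup>2 \<le> E x + d x powr (e - (M + 1))" unfolding E_def t_def V_def .
    qed simp
    also have "\<dots> = (LINT x:shell \<delta> r|lborel. E x) + (LINT x:shell \<delta> r|lborel. d x powr (e - (M + 1)))"
      by (rule set_integral_add(2)[OF shell_integrable[OF c1] shell_integrable[OF c2]])
    also have "\<dots> \<le> B + Cv * (2 * r) powr e / e" by (intro add_mono B Cv(2) e \<delta>)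
    finally show ?thesis .
  qed
  then show ?thesis by blast
qed

end

section \<open>Cutoffs and truncations\<close>

lemma C1_add:
  fixes f g :: "'a::euclidean_space \<Rightarrow> real"
  assumes "Ck_on 1 S f" "Ck_on 1 S g" shows "Ck_on 1 S (\<lambda>x. f x + g x)"
proof (rule C1I)
  fix x assume x: "x \<in> S"
  show "((\<lambda>x. f x + g x) has_derivative (\<lambda>v. partial v f x + partial v g x)) (at x)"
    by (rule has_derivative_add[OF C1_has_derivative[OF assms(1) x] C1_has_derivative[OF assms(2) x]])
next
  fix v
  show "continuous_on S (\<lambda>x. partial v f x + partial v g x)"
    using assms by (intro continuous_intros C1_continuous_partial)
qed

lemma C1_sum:
  fixes f :: "'i \<Rightarrow> 'a::euclidean_space \<Rightarrow> real"
  assumes "finite I" "\<And>i. i \<in> I \<Longrightarrow> Ck_on 1 S (f i)" shows "Ck_on 1 S (\<lambda>x. \<Sum>i\<in>I. f i x)"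
  using assms
proof (induction I)
  case empty then show ?case using C1_const[of S "0::real"] by simp
next
  case (insert i I)
  have "Ck_on 1 S (\<lambda>x. f i x + (\<Sum>i\<in>I. f i x))" by (rule C1_add) (use insert in auto)
  then show ?case using insert.hyps by simp
qed

lemma C1_bump:
  fixes x :: "'a::euclidean_space"
  assumes "r > 0"
  obtains b where "Ck_on 1 UNIV b" "\<And>y. 0 \<le> b y" "\<And>y. y \<in> ball x r \<Longrightarrow> b y > 0" "\<And>y. y \<notin> cball x r \<Longrightarrow> b y = (0::real)"
proof -
  define q where "q y = r\<^sup>2 - (y - x) \<bullet> (y - x)" for y
  have q: "Ck_on 1 UNIV q"
  proof (rule C1I)
    show "(q has_derivative (\<lambda>v. - (2 * ((y - x) \<bullet> v)))) (at y)" for y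
      unfolding q_def by (auto intro!: derivative_eq_intros simp: inner_commute)
    show "continuous_on UNIV (\<lambda>y. - (2 * ((y - x) \<bullet> v)))" for v by (intro continuous_intros)
  qed
  have qn: "q y = r\<^sup>2 - (dist x y)\<^sup>2" for y
    unfolding q_def power2_norm_eq_inner[symmetric] dist_norm by (simp add: norm_minus_commute)
  show ?thesis
  proof (rule that)
    show "Ck_on 1 UNIV (\<lambda>y. (max 0 (q y))\<^sup>2)"
      by (rule C1_comp[OF q, of UNIV "\<lambda>s. (max 0 s)\<^sup>2" "\<lambda>s. real 2 * (max 0 s) ^ (2 - 1)"])
         (auto intro: DERIV_max_power[of 2, simplified] intro!: continuous_intros)
    show "0 \<le> (max 0 (q y))\<^sup>2" for y by simp
    show "(max 0 (q y))\<^sup>2 > 0" if "y \<in> ball x r" for y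
    proof -
      have "(dist x y)\<^sup>2 < r\<^sup>2" using that by (intro power_strict_mono) auto
      then show ?thesis by (simp add: qn max_def)
    qed
    show "(max 0 (q y))\<^sup>2 = 0" if "y \<notin> cball x r" for y
    proof -
      have "r\<^sup>2 \<le> (dist x y)\<^sup>2" using that assms by (intro power_mono) auto
      then show ?thesis by (simp add: qn max_def)
    qed
  qed
qed

lemma C1_cutoff_exists:
  fixes K U :: "'a::euclidean_space set"
  assumes K: "compact K" and U: "open U" "K \<subseteq> U"
  obtains \<psi> where "\<psi> \<in> C1c U" "\<And>x. 0 \<le> \<psi> x" "\<And>x. \<psi> x \<le> 1" "\<And>x. x \<in> K \<Longrightarrow> \<psi> x = 1"
proof -
  have "\<exists>r>0. cball x r \<subseteq> U" if "x \<in> K" for x using U that open_contains_cball by blast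
  then obtain r where r: "\<And>x. x \<in> K \<Longrightarrow> 0 < r x \<and> cball x (r x) \<subseteq> U" by metis
  have "\<exists>b. Ck_on 1 UNIV b \<and> (\<forall>y. 0 \<le> b y) \<and> (\<forall>y\<in>ball x (r x). b y > 0) \<and> (\<forall>y. y \<notin> cball x (r x) \<longrightarrow> b y = (0::real))" if "x \<in> K" for x
    by (rule C1_bump[of "r x" x]) (use r[OF that] in auto)
  then obtain b where b: "\<And>x. x \<in> K \<Longrightarrow> Ck_on 1 UNIV (b x)" "\<And>x y. x \<in> K \<Longrightarrow> 0 \<le> b x y"
    "\<And>x y. x \<in> K \<Longrightarrow> y \<in> ball x (r x) \<Longrightarrow> b x y > (0::real)" "\<And>x y. x \<in> K \<Longrightarrow> y \<notin> cball x (r x) \<Longrightarrow> b x y = 0"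
    by metis
  obtain I where I: "I \<subseteq> K" "finite I" "K \<subseteq> (\<Union>x\<in>I. ball x (r x))"
    by (rule compactE_image[OF K, of K "\<lambda>x. ball x (r x)"]) (use r in auto)
  define S where "S y = (\<Sum>x\<in>I. b x y)" for y
  have S1: "Ck_on 1 UNIV S" unfolding S_def by (rule C1_sum[OF I(2)]) (use b I in auto)
  have S0: "0 \<le> S y" for y unfolding S_def by (rule sum_nonneg) (use b I in auto)
  have Spos: "0 < S y" if yK: "y \<in> K" for y
  proof -
    obtain x where x: "x \<in> I" "y \<in> ball x (r x)" using subsetD[OF I(3) yK] by (rule UN_E)
    have "0 < b x y" by (rule b(3)[OF _ x(2)]) (use x I in auto)
    also have "\<dots> \<le> S y" unfolding S_def by (rule member_le_sum[of x I "\<lambda>x. b x y"]) (use x I b in auto)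
    finally show ?thesis .
  qed
  have "\<exists>c>0. \<forall>y\<in>K. c \<le> S y"
  proof (cases "K = {}")
    case True then show ?thesis by (intro exI[of _ 1]) auto
  next
    case False
    have "\<exists>y\<in>K. \<forall>z\<in>K. S y \<le> S z"
      by (rule continuous_attains_inf[OF K False continuous_on_subset[OF C1_continuous_on[OF S1] subset_UNIV]])
    then obtain y where y: "y \<in> K" "\<forall>z\<in>K. S y \<le> S z" by (rule bexE)
    then show ?thesis using Spos[OF y(1)] by (intro exI[of _ "S y"]) simp
  qed
  then obtain c where c: "c > 0" "\<And>y. y \<in> K \<Longrightarrow> c \<le> S y" by auto
  define h where "h s = 1 - (max 0 (1 - s / c))\<^sup>2" for s :: real
  have Dh: "(h has_real_derivative 2 * max 0 (1 - s / c) / c) (at s)" for s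
  proof -
    have "((\<lambda>s. 1 - s / c) has_real_derivative - (1 / c)) (at s)" using c(1) by (auto intro!: derivative_eq_intros)
    from DERIV_chain2[OF DERIV_max_power[of 2] this]
    have "((\<lambda>s. (max 0 (1 - s / c))\<^sup>2) has_real_derivative - (2 * max 0 (1 - s / c) / c)) (at s)" by simp
    from DERIV_diff[OF DERIV_const this, of 1] show ?thesis unfolding h_def by simp
  qed
  have h1: "h s \<le> 1" for s by (simp add: h_def)
  have h0: "0 \<le> h s" if "0 \<le> s" for s
  proof -
    have "(max 0 (1 - s / c))\<^sup>2 \<le> 1\<^sup>2" using that c by (intro power_mono) auto
    then show ?thesis by (simp add: h_def)
  qed
  have hK: "h s = 1" if "c \<le> s" for s
  proof -
    have "1 - s / c \<le> 0" using that c by simp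
    then show ?thesis by (simp add: h_def max_def)
  qed
  define K' where "K' = (\<Union>x\<in>I. cball x (r x))"
  have K': "compact K'" "K' \<subseteq> U" unfolding K'_def using I r by (auto intro!: compact_UN)
  show ?thesis
  proof (rule that[of "\<lambda>y. h (S y)"])
    show "(\<lambda>y. h (S y)) \<in> C1c U"
    proof (rule C1cI[OF _ K'])
      show "Ck_on 1 UNIV (\<lambda>y. h (S y))"
        by (rule C1_comp[OF S1, of UNIV h "\<lambda>s. 2 * max 0 (1 - s / c) / c"]) (use c in \<open>auto intro!: Dh continuous_intros\<close>)
      show "h (S y) = 0" if "y \<notin> K'" for y
      proof -
        have "S y = 0" unfolding S_def by (rule sum.neutral) (use b(4) I that in \<open>auto simp: K'_def subset_eq\<close>)
        then show ?thesis by (simp add: h_def)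
      qed
    qed
  qed (use h0 h1 hK S0 c in auto)
qed

lemma DERIV_half_line:
  fixes F F' :: "real \<Rightarrow> real"
  assumes D: "\<And>s. (F has_real_derivative F' s) (at s)" and z: "F 0 = 0" "F' 0 = 0"
  shows "((\<lambda>s. if s \<le> 0 then 0 else F s) has_real_derivative (if s \<le> 0 then 0 else F' s)) (at s)"
proof -
  let ?G = "\<lambda>s. if s \<le> 0 then 0 else F s"
  consider "s > 0" | "s < 0" | "s = 0" by linarith
  then show ?thesis
  proof cases
    case 1
    have "(?G has_real_derivative F' s) (at s)"
      by (rule has_field_derivative_transform_within_open[OF D, of "{0<..}"]) (use 1 in auto)
    then show ?thesis using 1 by simp
  next
    case 2
    have "((\<lambda>s. 0) has_real_derivative 0) (at s)" by simp
    then have "(?G has_real_derivative 0) (at s)"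
      by (rule has_field_derivative_transform_within_open[of _ _ _ "{..<0}"]) (use 2 in auto)
    then show ?thesis using 2 by simp
  next
    case 3
    have L: "((\<lambda>h. F h / h) \<longlongrightarrow> 0) (at 0)" using D[of 0] z by (simp add: has_field_derivative_iff)
    have "((\<lambda>h. ?G h / h) \<longlongrightarrow> 0) (at 0)"
    proof (rule tendsto_rabs_zero_cancel, rule tendsto_sandwich[OF _ _ tendsto_const tendsto_rabs_zero[OF L]])
      have "\<bar>?G h / h\<bar> \<le> \<bar>F h / h\<bar>" for h
      proof -
        have "?G h / h = 0 \<or> ?G h / h = F h / h" by simp
        then show ?thesis by (elim disjE) (simp_all only: abs_zero abs_ge_zero order_refl)
      qed
      then show "\<forall>\<^sub>F h in at 0. \<bar>?G h / h\<bar> \<le> \<bar>F h / h\<bar>" by (rule always_eventually[OF allI])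
    qed auto
    then have "(?G has_real_derivative 0) (at 0)" by (simp add: has_field_derivative_iff)
    then show ?thesis using 3 by simp
  qed
qed

text \<open>A convex substitute of class \<open>C\<^sup>2\<close> for the positive part of \<open>t - \<epsilon>\<close>, obtained by rescaling \<open>s - arctan s\<close>. It vanishes for \<open>t \<le> \<epsilon>\<close>, hence near
  the boundary of the domain, and it fails to be linear only by \<open>0 \<le> t j' - j \<le> 3 \<epsilon>\<close>.\<close>

definition trunc :: "real \<Rightarrow> real \<Rightarrow> real" where
  "trunc \<epsilon> t = \<epsilon> * (if (t - \<epsilon>) / \<epsilon> \<le> 0 then 0 else (t - \<epsilon>) / \<epsilon> - arctan ((t - \<epsilon>) / \<epsilon>))"

definition trunc' :: "real \<Rightarrow> real \<Rightarrow> real" where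
  "trunc' \<epsilon> t = (if (t - \<epsilon>) / \<epsilon> \<le> 0 then 0 else ((t - \<epsilon>) / \<epsilon>)\<^sup>2 / (1 + ((t - \<epsilon>) / \<epsilon>)\<^sup>2))"

definition trunc'' :: "real \<Rightarrow> real \<Rightarrow> real" where
  "trunc'' \<epsilon> t = 2 * max 0 ((t - \<epsilon>) / \<epsilon>) / (1 + ((t - \<epsilon>) / \<epsilon>)\<^sup>2)\<^sup>2 / \<epsilon>"

lemma one_plus_sq: "1 + s\<^sup>2 > (0::real)" by (simp add: add_pos_nonneg)

lemma DERIV_trunc:
  assumes "\<epsilon> > 0"
  shows "(trunc \<epsilon> has_real_derivative trunc' \<epsilon> t) (at t)" "(trunc' \<epsilon> has_real_derivative trunc'' \<epsilon> t) (at t)"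
    "continuous_on UNIV (trunc'' \<epsilon>)"
proof -
  have q: "((\<lambda>t. (t - \<epsilon>) / \<epsilon>) has_real_derivative 1 / \<epsilon>) (at t)"
    using assms by (auto intro!: derivative_eq_intros)
  have D1: "((\<lambda>s. s - arctan s) has_real_derivative s\<^sup>2 / (1 + s\<^sup>2)) (at s)" for s :: real
  proof -
    have "((\<lambda>s. s - arctan s) has_real_derivative 1 - inverse (1 + s\<^sup>2)) (at s)"
      by (rule DERIV_diff[OF DERIV_ident DERIV_arctan])
    moreover have "1 - inverse (1 + s\<^sup>2) = s\<^sup>2 / (1 + s\<^sup>2)" using one_plus_sq[of s] by (simp add: field_simps)
    ultimately show ?thesis by simp
  qed
  have D2: "((\<lambda>s. s\<^sup>2 / (1 + s\<^sup>2)) has_real_derivative 2 * s / (1 + s\<^sup>2)\<^sup>2) (at s)" for s :: real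
  proof -
    have "((\<lambda>s. s\<^sup>2 / (1 + s\<^sup>2)) has_real_derivative (2 * s * (1 + s\<^sup>2) - s\<^sup>2 * (2 * s)) / ((1 + s\<^sup>2) * (1 + s\<^sup>2))) (at s)"
      by (rule DERIV_divide) (use one_plus_sq[of s] in \<open>auto intro!: derivative_eq_intros\<close>)
    then show ?thesis by (rule DERIV_cong) (simp add: power2_eq_square algebra_simps)
  qed
  have "((\<lambda>t. if (t - \<epsilon>) / \<epsilon> \<le> 0 then 0 else (t - \<epsilon>) / \<epsilon> - arctan ((t - \<epsilon>) / \<epsilon>)) has_real_derivative trunc' \<epsilon> t * (1 / \<epsilon>)) (at t)"
    unfolding trunc'_def by (rule DERIV_chain2[OF DERIV_half_line[OF D1] q]) auto
  from DERIV_cmult[OF this, of \<epsilon>] show "(trunc \<epsilon> has_real_derivative trunc' \<epsilon> t) (at t)"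
    unfolding trunc_def[abs_def] using assms by simp
  have "((\<lambda>t. if (t - \<epsilon>) / \<epsilon> \<le> 0 then 0 else ((t - \<epsilon>) / \<epsilon>)\<^sup>2 / (1 + ((t - \<epsilon>) / \<epsilon>)\<^sup>2)) has_real_derivative
     (if (t - \<epsilon>) / \<epsilon> \<le> 0 then 0 else 2 * ((t - \<epsilon>) / \<epsilon>) / (1 + ((t - \<epsilon>) / \<epsilon>)\<^sup>2)\<^sup>2) * (1 / \<epsilon>)) (at t)"
    by (rule DERIV_chain2[OF DERIV_half_line[OF D2] q]) auto
  then show "(trunc' \<epsilon> has_real_derivative trunc'' \<epsilon> t) (at t)"
    unfolding trunc'_def[abs_def] by (rule DERIV_cong) (simp add: trunc''_def max_def)
  have "1 + ((t - \<epsilon>) / \<epsilon>)\<^sup>2 \<noteq> 0" for t using one_plus_sq[of "(t - \<epsilon>) / \<epsilon>"] by linarith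
  then show "continuous_on UNIV (trunc'' \<epsilon>)"
    unfolding trunc''_def[abs_def] using assms by (intro continuous_intros) auto
qed

lemma arctan_bounds_pos:
  assumes "s \<ge> (0::real)" shows "s / (1 + s\<^sup>2) \<le> arctan s" "arctan s \<le> s" "arctan s < 2"
proof -
  show "arctan s < 2" using arctan_ubound[of s] pi_less_4 by simp
  show "arctan s \<le> s" using arctan_le_self[OF assms] .
  show "s / (1 + s\<^sup>2) \<le> arctan s"
  proof (cases "s = 0")
    case False
    have "\<exists>t. 0 < t \<and> t < s \<and> arctan s - arctan 0 = (s - 0) * inverse (1 + t\<^sup>2)"
      using False assms by (intro MVT2 DERIV_arctan) auto
    then obtain t where t: "0 < t" "t < s" "arctan s = s * inverse (1 + t\<^sup>2)" by auto
    have "1 + t\<^sup>2 \<le> 1 + s\<^sup>2" using t by (intro add_left_mono power_mono) auto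
    then have "s / (1 + s\<^sup>2) \<le> s / (1 + t\<^sup>2)" using one_plus_sq[of t] assms by (intro divide_left_mono mult_pos_pos one_plus_sq) auto
    then show ?thesis using t(3) by (simp add: divide_inverse)
  qed simp
qed

lemma trunc_zero: "\<epsilon> > 0 \<Longrightarrow> t \<le> \<epsilon> \<Longrightarrow> trunc \<epsilon> t = 0 \<and> trunc' \<epsilon> t = 0"
  by (simp add: trunc_def trunc'_def divide_le_0_iff)

lemma trunc_bounds:
  assumes e: "\<epsilon> > 0" and t: "t \<ge> 0"
  shows "0 \<le> trunc \<epsilon> t" "trunc \<epsilon> t \<le> t" "0 \<le> trunc' \<epsilon> t" "0 \<le> trunc'' \<epsilon> t"
    "0 \<le> trunc' \<epsilon> t * t - trunc \<epsilon> t" "trunc' \<epsilon> t * t - trunc \<epsilon> t \<le> 3 * \<epsilon>"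
proof -
  define s where "s = (t - \<epsilon>) / \<epsilon>"
  have ts: "t = \<epsilon> * (s + 1)" using e by (simp add: s_def field_simps)
  show "0 \<le> trunc' \<epsilon> t" unfolding trunc'_def using one_plus_sq by (simp add: less_imp_le)
  show "0 \<le> trunc'' \<epsilon> t" unfolding trunc''_def using e by simp
  have A: "0 \<le> trunc \<epsilon> t \<and> trunc \<epsilon> t \<le> t \<and> 0 \<le> trunc' \<epsilon> t * t - trunc \<epsilon> t \<and> trunc' \<epsilon> t * t - trunc \<epsilon> t \<le> 3 * \<epsilon>"
  proof (cases "s \<le> 0")
    case True
    then have "trunc \<epsilon> t = 0" "trunc' \<epsilon> t = 0" by (simp_all add: trunc_def trunc'_def s_def)
    then show ?thesis using e t by simp
  next
    case False
    then have s: "s > 0" by simp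
    have j: "trunc \<epsilon> t = \<epsilon> * (s - arctan s)" "trunc' \<epsilon> t = s\<^sup>2 / (1 + s\<^sup>2)" using False by (simp_all add: trunc_def trunc'_def s_def)
    note ab = arctan_bounds_pos[OF less_imp_le[OF s]]
    have k0: "s\<^sup>2 / (1 + s\<^sup>2) * (s + 1) - (s - arctan s) = (s\<^sup>2 - s) / (1 + s\<^sup>2) + arctan s"
      using one_plus_sq[of s] by (simp add: field_simps power2_eq_square)
    have g: "a * (\<epsilon> * (s + 1)) - \<epsilon> * b = \<epsilon> * (a * (s + 1) - b)" for a b by (simp add: algebra_simps)
    have "trunc' \<epsilon> t * t - trunc \<epsilon> t = s\<^sup>2 / (1 + s\<^sup>2) * (\<epsilon> * (s + 1)) - \<epsilon> * (s - arctan s)"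
      by (simp only: j) (simp only: ts)
    then have k: "trunc' \<epsilon> t * t - trunc \<epsilon> t = \<epsilon> * ((s\<^sup>2 - s) / (1 + s\<^sup>2) + arctan s)"
      by (simp only: g k0)
    have "(s\<^sup>2 - s) / (1 + s\<^sup>2) \<le> 1" using s one_plus_sq[of s] by (simp add: divide_le_eq_1)
    then have up: "(s\<^sup>2 - s) / (1 + s\<^sup>2) + arctan s \<le> 3" using ab by linarith
    have "(s\<^sup>2 - s) / (1 + s\<^sup>2) = s\<^sup>2 / (1 + s\<^sup>2) - s / (1 + s\<^sup>2)" by (rule diff_divide_distrib)
    moreover have "0 \<le> s\<^sup>2 / (1 + s\<^sup>2)" using one_plus_sq[of s] by simp
    ultimately have lo: "0 \<le> (s\<^sup>2 - s) / (1 + s\<^sup>2) + arctan s" using ab by linarith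
    have "0 \<le> arctan s" using s by simp
    then have "s - arctan s \<le> s + 1" by linarith
    then have "\<epsilon> * (s - arctan s) \<le> \<epsilon> * (s + 1)" using e by (intro mult_left_mono) auto
    moreover have "0 \<le> \<epsilon> * (s - arctan s)" using ab e by simp
    moreover have "\<epsilon> * ((s\<^sup>2 - s) / (1 + s\<^sup>2) + arctan s) \<le> \<epsilon> * 3" using up e by (intro mult_left_mono) auto
    moreover have "0 \<le> \<epsilon> * ((s\<^sup>2 - s) / (1 + s\<^sup>2) + arctan s)" using lo e by simp
    ultimately show ?thesis unfolding k unfolding j(1) using ts by (simp add: mult.commute)
  qed
  then show "0 \<le> trunc \<epsilon> t" "trunc \<epsilon> t \<le> t" "0 \<le> trunc' \<epsilon> t * t - trunc \<epsilon> t" "trunc' \<epsilon> t * t - trunc \<epsilon> t \<le> 3 * \<epsilon>" by auto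
qed

lemma trunc_lower:
  assumes e: "\<epsilon> > 0" and t: "t \<ge> 4 * \<epsilon>" shows "trunc \<epsilon> t \<ge> t / 4" "trunc' \<epsilon> t \<ge> 1 / 2"
proof -
  define s where "s = (t - \<epsilon>) / \<epsilon>"
  have ts: "t = \<epsilon> * (s + 1)" using e by (simp add: s_def field_simps)
  have s: "s \<ge> 3" using t e by (simp add: s_def pos_le_divide_eq)
  have j: "trunc \<epsilon> t = \<epsilon> * (s - arctan s)" "trunc' \<epsilon> t = s\<^sup>2 / (1 + s\<^sup>2)" using s by (simp_all add: trunc_def trunc'_def s_def)
  have "(s + 1) / 4 \<le> s - arctan s" using arctan_bounds_pos(3)[of s] s by simp
  then have "\<epsilon> * ((s + 1) / 4) \<le> \<epsilon> * (s - arctan s)" using e by (intro mult_left_mono) auto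
  then show "trunc \<epsilon> t \<ge> t / 4" unfolding j using ts by simp
  have "1 \<le> s\<^sup>2" using s by (simp add: one_le_power)
  then show "trunc' \<epsilon> t \<ge> 1 / 2" unfolding j using one_plus_sq[of s] by (simp add: pos_le_divide_eq)
qed

section \<open>Spectral positivity, weak form and boundary values\<close>

lemma integrable_compact_in_open:
  fixes F :: "'a::euclidean_space \<Rightarrow> real"
  assumes U: "open U" and c: "continuous_on U F" and K: "compact K" "K \<subseteq> U" and off: "\<And>x. x \<notin> K \<Longrightarrow> F x = 0"
  shows "integrable lborel F"
proof (rule integrable_compact_support[OF _ K(1)])
  show "continuous_on UNIV F" by (rule continuous_extend_by_zero[OF U c compact_imp_closed[OF K(1)] K(2)]) (rule off)
qed (rule off)

lemma set_integrable_compact_in_open: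
  fixes F :: "'a::euclidean_space \<Rightarrow> real"
  assumes U: "open U" and c: "continuous_on U F" and K: "compact K" "K \<subseteq> U" and off: "\<And>x. x \<in> U \<Longrightarrow> x \<notin> K \<Longrightarrow> F x = 0"
  shows "set_integrable lborel U F"
  unfolding set_integrable_def
proof (rule integrable_compact_in_open[OF U _ K])
  show "continuous_on U (\<lambda>x. indicator U x *\<^sub>R F x)"
    using c by (rule continuous_on_cong[THEN iffD1, rotated 2]) auto
  show "indicator U x *\<^sub>R F x = 0" if "x \<notin> K" for x using off[of x] that by (cases "x \<in> U") auto
qed

context smooth_tube begin

text \<open>Normalising \<open>g\<close> in \<open>L\<^sup>2\<close> makes it a competitor in the infimum that defines the first eigenvalue.\<close>

lemma hardy_from_spectrum:
  assumes sub: "\<Sigma> \<subseteq> \<Omega>" and lam: "lambda_hardy \<Omega> \<Sigma> \<mu> > 0" and \<Omega>: "open \<Omega>" and g: "g \<in> C1c (\<Omega> - \<Sigma>)"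
  shows "(LINT x|lborel. \<mu> / (d x)\<^sup>2 * (g x)\<^sup>2) \<le> (LINT x|lborel. grad_norm_sq g x)"
proof -
  note gD = C1cD[OF g]
  let ?K = "supp g"
  have cl: "closed ?K" using gD(2) compact_imp_closed by blast
  have oU: "open (\<Omega> - \<Sigma>)" using \<Omega> closed by (rule open_Diff)
  have cg: "continuous_on S g" for S using C1_continuous_on[OF gD(1)] continuous_on_subset by blast
  have goff: "grad_norm_sq g x = 0" if "x \<notin> ?K" for x
    by (rule grad_norm_sq_zero_off[OF cl _ that]) (rule gD(4))
  have i1: "integrable lborel (\<lambda>x. \<mu> / (d x)\<^sup>2 * (g x)\<^sup>2)"
  proof (rule integrable_compact_in_open[OF oU _ gD(2,3)])
    have "d x \<noteq> 0" if "x \<in> \<Omega> - \<Sigma>" for x using d_pos_iff[of x] that by auto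
    then show "continuous_on (\<Omega> - \<Sigma>) (\<lambda>x. \<mu> / (d x)\<^sup>2 * (g x)\<^sup>2)"
      by (intro continuous_intros d_continuous cg) auto
  qed (simp add: gD(4))
  have i2: "integrable lborel (grad_norm_sq g)"
    by (rule integrable_compact_support[OF grad_norm_sq_continuous[OF gD(1)] gD(2)]) (rule goff)
  define I where "I = (LINT x|lborel. (g x)\<^sup>2)"
  have c2: "continuous_on UNIV (\<lambda>x. (g x)\<^sup>2)" by (intro continuous_intros cg)
  show ?thesis
  proof (cases "\<forall>x. g x = 0")
    case True
    have "0 \<le> (LINT x|lborel. grad_norm_sq g x)" by (intro integral_nonneg_AE) (simp add: grad_norm_sq_nonneg)
    then show ?thesis using True by simp
  next
    case False
    then obtain x0 where "g x0 \<noteq> 0" by blast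
    then have I: "I > 0" unfolding I_def
      by (intro integral_pos_continuous[OF c2 gD(2), of x0]) (auto simp: gD(4))
    define c where "c = 1 / sqrt I"
    have c: "c\<^sup>2 * I = 1" "c\<^sup>2 > 0" using I by (auto simp: c_def power_divide)
    define u where "u x = c * g x" for x
    have u1: "Ck_on 1 UNIV u" unfolding u_def by (rule C1_mult[OF C1_const gD(1)])
    have uoff: "u x = 0" if "x \<notin> ?K" for x using gD(4)[OF that] by (simp add: u_def)
    have "?K \<subseteq> \<Omega>" using gD(3) by blast
    then have uC: "u \<in> C1c \<Omega>" by (rule C1cI[OF u1 gD(2) _ uoff])
    have pu: "partial b u x = c * partial b g x" for b x
    proof -
      have "partial b u x = c * partial b g x + partial b (\<lambda>x. c) x * g x" unfolding u_def
        by (rule partial_mult[OF differentiable_const C1_differentiable[OF gD(1)]]) simp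
      then show ?thesis by (simp add: partial_const)
    qed
    have gu: "grad_norm_sq u x = c\<^sup>2 * grad_norm_sq g x" for x
      unfolding grad_norm_sq_def pu by (simp add: power_mult_distrib sum_distrib_left)
    have off\<Omega>: "g x = 0" "grad_norm_sq g x = 0" if "x \<notin> \<Omega>" for x
    proof -
      have "x \<notin> ?K" using gD(3) that by blast
      then show "g x = 0" "grad_norm_sq g x = 0" by (rule gD(4), rule goff)
    qed
    have "(LINT x:\<Omega>|lborel. (u x)\<^sup>2) = (LINT x|lborel. c\<^sup>2 * (g x)\<^sup>2)"
      unfolding set_lebesgue_integral_def
      by (rule Bochner_Integration.integral_cong) (use off\<Omega> in \<open>auto simp: u_def indicator_def power_mult_distrib\<close>)
    also have "\<dots> = 1" using c(1) by (simp add: I_def)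
    finally have mem: "u \<in> {u \<in> C1c \<Omega>. (LINT x:\<Omega>|lborel. (u x)\<^sup>2) = 1}" using uC by simp
    have "0 < ereal (LINT x:\<Omega>|lborel. grad_norm_sq u x - \<mu> / (infdist x \<Sigma>)\<^sup>2 * (u x)\<^sup>2)"
      using lam unfolding lambda_hardy_def by (rule less_le_trans) (rule INF_lower[OF mem])
    then have "0 < (LINT x:\<Omega>|lborel. grad_norm_sq u x - \<mu> / (infdist x \<Sigma>)\<^sup>2 * (u x)\<^sup>2)" by simp
    also have "\<dots> = (LINT x|lborel. c\<^sup>2 * (grad_norm_sq g x - \<mu> / (d x)\<^sup>2 * (g x)\<^sup>2))"
      unfolding set_lebesgue_integral_def
      by (rule Bochner_Integration.integral_cong)
         (use off\<Omega> in \<open>auto simp: gu d_def u_def indicator_def power_mult_distrib algebra_simps\<close>)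
    also have "\<dots> = c\<^sup>2 * ((LINT x|lborel. grad_norm_sq g x) - (LINT x|lborel. \<mu> / (d x)\<^sup>2 * (g x)\<^sup>2))"
      using i1 i2 by simp
    finally show ?thesis using c(2) by (simp add: zero_less_mult_iff)
  qed
qed

lemma weak_form:
  assumes sol: "distributional_solution (\<Omega> - \<Sigma>) \<Sigma> \<mu> p u" and \<Omega>: "open \<Omega>" and cu: "continuous_on (\<Omega> - \<Sigma>) u"
    and p: "p > 1" and \<phi>: "\<phi> \<in> test_functions (\<Omega> - \<Sigma>)"
  shows "(LINT x:\<Omega> - \<Sigma>|lborel. u x * laplacian \<phi> x) = (LINT x:\<Omega> - \<Sigma>|lborel. (\<bar>u x\<bar> powr (p - 1) * u x - \<mu> / (d x)\<^sup>2 * u x) * \<phi> x)"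
proof -
  let ?U = "\<Omega> - \<Sigma>"
  have oU: "open ?U" using \<Omega> closed by (rule open_Diff)
  have s\<phi>: "smooth_fun \<phi>" and K: "compact (supp \<phi>)" "supp \<phi> \<subseteq> ?U" using \<phi> by (auto simp: test_functions_def)
  have cl: "closed (supp \<phi>)" using K compact_imp_closed by blast
  have c\<phi>: "continuous_on S \<phi>" for S using C1_continuous_on[OF smooth_C1[OF s\<phi>]] continuous_on_subset by blast
  have "continuous_on UNIV (laplacian \<phi>)"
    unfolding laplacian_def[abs_def] by (intro continuous_intros C1_continuous_on smooth_C1 smooth_partial s\<phi>)
  then have c\<Delta>: "continuous_on S (laplacian \<phi>)" for S using continuous_on_subset by blast
  have off1: "partial b \<phi> x = 0" if "x \<notin> supp \<phi>" for b x by (rule partial_zero_off[OF cl _ that]) (rule supp_zero)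
  have off2: "laplacian \<phi> x = 0" if "x \<notin> supp \<phi>" for x
    unfolding laplacian_def by (intro sum.neutral ballI partial_zero_off[OF cl _ that]) (rule off1)
  have dn: "d x \<noteq> 0" if "x \<in> ?U" for x using d_pos_iff[of x] that by auto
  have i1: "set_integrable lborel ?U (\<lambda>x. u x * laplacian \<phi> x)"
    by (rule set_integrable_compact_in_open[OF oU _ K]) (auto intro!: continuous_intros cu c\<Delta> simp: off2)
  have i2: "set_integrable lborel ?U (\<lambda>x. \<mu> / (d x)\<^sup>2 * u x * \<phi> x)"
    by (rule set_integrable_compact_in_open[OF oU _ K]) (auto intro!: continuous_intros cu c\<phi> d_continuous simp: dn supp_zero)
  have i3: "set_integrable lborel ?U (\<lambda>x. \<bar>u x\<bar> powr (p - 1) * u x * \<phi> x)"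
    by (rule set_integrable_compact_in_open[OF oU _ K])
       (use p in \<open>auto intro!: continuous_intros continuous_on_powr' cu c\<phi> simp: supp_zero\<close>)
  have "(LINT x:?U|lborel. u x * L_op \<Sigma> \<mu> \<phi> x) = (LINT x:?U|lborel. u x * laplacian \<phi> x + \<mu> / (d x)\<^sup>2 * u x * \<phi> x)"
    by (simp add: L_op_def d_def algebra_simps)
  also have "\<dots> = (LINT x:?U|lborel. u x * laplacian \<phi> x) + (LINT x:?U|lborel. \<mu> / (d x)\<^sup>2 * u x * \<phi> x)"
    by (rule set_integral_add(2)[OF i1 i2])
  finally have 1: "(LINT x:?U|lborel. u x * L_op \<Sigma> \<mu> \<phi> x) = \<dots>" .
  have "- (LINT x:?U|lborel. u x * L_op \<Sigma> \<mu> \<phi> x) + (LINT x:?U|lborel. \<bar>u x\<bar> powr (p - 1) * u x * \<phi> x) = 0"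
    using sol \<phi> unfolding distributional_solution_def by blast
  then have "(LINT x:?U|lborel. u x * laplacian \<phi> x) = (LINT x:?U|lborel. \<bar>u x\<bar> powr (p - 1) * u x * \<phi> x) - (LINT x:?U|lborel. \<mu> / (d x)\<^sup>2 * u x * \<phi> x)"
    using 1 by linarith
  also have "\<dots> = (LINT x:?U|lborel. \<bar>u x\<bar> powr (p - 1) * u x * \<phi> x - \<mu> / (d x)\<^sup>2 * u x * \<phi> x)"
    by (rule set_integral_diff(2)[OF i3 i2, symmetric])
  finally show ?thesis by (simp only: left_diff_distrib)
qed

end

text \<open>The weight equals 1 near the boundary because the cutoff \<open>\<eta>\<close> is supported in a compact part of the domain.\<close>

lemma vanishes_on_boundary:
  assumes \<Omega>: "open \<Omega>" and \<Sigma>: "\<Sigma> \<subseteq> \<Omega>" "closed \<Sigma>" and tube: "tube \<Sigma> (\<beta> / 2) \<subseteq> \<Omega>" and \<eta>: "tube_cutoff \<Sigma> \<beta> \<eta>"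
    and c: "continuous_on (closure \<Omega> - \<Sigma>) u"
    and lim: "tends_to_zero_loc_unif (\<lambda>x. u x / W_tilde k \<Sigma> \<mu> \<eta> x) (\<Omega> - \<Sigma>) (frontier \<Omega>)"
    and \<xi>: "\<xi> \<in> frontier \<Omega>"
  shows "u \<xi> = 0"
proof (rule ccontr)
  assume "u \<xi> \<noteq> 0"
  have \<xi>\<Omega>: "\<xi> \<notin> \<Omega>" "\<xi> \<in> closure \<Omega>" using \<xi> \<Omega> by (auto simp: frontier_def interior_open)
  then have \<xi>\<Sigma>: "\<xi> \<in> closure \<Omega> - \<Sigma>" using \<Sigma> by blast
  define e where "e = \<bar>u \<xi>\<bar> / 2"
  have e: "e > 0" using \<open>u \<xi> \<noteq> 0\<close> by (simp add: e_def)
  obtain r where r: "r > 0" "\<forall>\<epsilon>>0. \<exists>\<delta>>0. \<forall>\<xi>'\<in>frontier \<Omega> \<inter> ball \<xi> r. \<forall>x\<in>\<Omega> - \<Sigma>. dist x \<xi>' < \<delta> \<longrightarrow> \<bar>u x / W_tilde k \<Sigma> \<mu> \<eta> x\<bar> < \<epsilon>"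
    using lim \<xi> unfolding tends_to_zero_loc_unif_def by blast
  then obtain d1 where d1: "d1 > 0" "\<forall>\<xi>'\<in>frontier \<Omega> \<inter> ball \<xi> r. \<forall>x\<in>\<Omega> - \<Sigma>. dist x \<xi>' < d1 \<longrightarrow> \<bar>u x / W_tilde k \<Sigma> \<mu> \<eta> x\<bar> < e"
    using e by blast
  then have near: "\<bar>u x / W_tilde k \<Sigma> \<mu> \<eta> x\<bar> < e" if "x \<in> \<Omega> - \<Sigma>" "dist x \<xi> < d1" for x
    using \<xi> r(1) that by auto
  have "\<xi> \<notin> supp \<eta>" using \<eta> \<xi>\<Omega> \<Sigma> tube unfolding tube_cutoff_def by blast
  moreover have "closed (supp \<eta>)" by (simp add: supp_def)
  ultimately obtain d2 where d2: "d2 > 0" "ball \<xi> d2 \<subseteq> - supp \<eta>"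
    using open_contains_ball[of "- supp \<eta>"] by (auto simp: open_Compl)
  obtain d3 where d3: "d3 > 0" "\<And>x. x \<in> closure \<Omega> - \<Sigma> \<Longrightarrow> dist x \<xi> < d3 \<Longrightarrow> dist (u x) (u \<xi>) < e"
    using c \<xi>\<Sigma> e unfolding continuous_on_iff by metis
  obtain d4 where d4: "d4 > 0" "ball \<xi> d4 \<subseteq> - \<Sigma>"
    using open_contains_ball[of "- \<Sigma>"] \<Sigma>(2) \<xi>\<Sigma> by (auto simp: open_Compl)
  define \<delta> where "\<delta> = min (min d1 d2) (min d3 d4)"
  have \<delta>: "\<delta> > 0" using d1 d2 d3 d4 by (simp add: \<delta>_def)
  obtain x where x: "x \<in> \<Omega>" "dist x \<xi> < \<delta>" using \<xi>\<Omega>(2) \<delta> unfolding closure_approachable by blast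
  have xU: "x \<in> \<Omega> - \<Sigma>" using x d4(2) by (auto simp: \<delta>_def dist_commute subset_eq)
  have "x \<notin> supp \<eta>" using x d2(2) by (auto simp: \<delta>_def dist_commute subset_eq)
  then have "\<eta> x = 0" by (rule supp_zero)
  then have "W_tilde k \<Sigma> \<mu> \<eta> x = 1" by (simp add: W_tilde_def)
  then have "\<bar>u x\<bar> < e" using near[OF xU] x by (simp add: \<delta>_def)
  moreover have "dist (u x) (u \<xi>) < e" using d3(2)[of x] xU x closure_subset by (auto simp: \<delta>_def)
  ultimately show False unfolding e_def dist_real_def by linarith
qed

section \<open>Passing to the limit in the cutoffs\<close>

context smooth_tube begin

text \<open>The step is locally constant off the shell, which makes the composition differentiable also where the distance is not.\<close>

lemma inner_cutoff:
  assumes t: "0 < t" "2 * t < \<beta>"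
  defines "\<xi> \<equiv> \<lambda>x. step 2 (d x / t)"
  shows "Ck_on 1 UNIV \<xi>" "grad_norm_sq \<xi> x \<le> indicator (shell t (2 * t)) x * (64 / (d x)\<^sup>2)"
proof -
  define h where "h s = step 2 (s / t)" for s
  define h' where "h' s = step' 2 (s / t) / t" for s
  have Dh: "(h has_real_derivative h' s) (at s)" for s
  proof -
    have "((\<lambda>s. s / t) has_real_derivative 1 / t) (at s)" using DERIV_cdivide[OF DERIV_ident, of t s UNIV] by simp
    from DERIV_chain2[OF DERIV_step[of 2] this] show ?thesis unfolding h_def h'_def by simp
  qed
  have ch': "continuous_on S h'" for S
    unfolding h'_def by (intro continuous_intros continuous_on_compose2[OF continuous_step'[of UNIV]]) (use t in auto)
  have \<xi>h: "\<xi> = (\<lambda>x. h (d x))" by (simp add: \<xi>_def h_def)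
  define A where "A = {x. d x < t}"
  define B where "B = {x. 2 * t < d x}"
  have oA: "open A" and oB: "open B" unfolding A_def B_def by (intro open_Collect_less continuous_intros d_continuous)+
  have \<xi>A: "\<xi> x = 0" if "x \<in> A" for x
    using that t by (auto simp: \<xi>_def A_def intro!: step_eq_0)
  have \<xi>B: "\<xi> x = 1" if "x \<in> B" for x
    using that t by (auto simp: \<xi>_def B_def pos_le_divide_eq intro!: step_eq_1)
  have 1: "Ck_on 1 A \<xi>" by (rule Ck_cong[OF oA _ Ck_zero]) (simp add: \<xi>A)
  have 2: "Ck_on 1 B \<xi>" by (rule Ck_cong[OF oB _ C1_const[of B 1]]) (simp add: \<xi>B)
  have 3: "Ck_on 1 (tube \<Sigma> \<beta>) \<xi>" unfolding \<xi>h by (rule d_C1_comp[OF order_refl Dh ch'])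
  have "A \<union> B \<union> tube \<Sigma> \<beta> = UNIV" using t by (auto simp: A_def B_def in_tube_iff not_less)
  moreover have "Ck_on 1 (A \<union> B \<union> tube \<Sigma> \<beta>) \<xi>"
    by (intro Ck_Un open_Un oA oB open_tube[OF closed] 1 2 3)
  ultimately show "Ck_on 1 UNIV \<xi>" by simp
  show "grad_norm_sq \<xi> x \<le> indicator (shell t (2 * t)) x * (64 / (d x)\<^sup>2)"
  proof (cases "x \<in> shell t (2 * t)")
    case True
    then have dx: "t \<le> d x" "d x \<le> 2 * t" "0 < d x" using t by (auto simp: shell_def)
    have xT: "x \<in> T" using dx t \<beta> by (auto simp: in_tube_iff)
    have "grad_norm_sq \<xi> x = (h' (d x))\<^sup>2"
      unfolding \<xi>h grad_norm_sq_def partial_d_comp[OF xT Dh] power_mult_distrib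
      using sum_partial_sq[OF xT] by (simp add: sum_distrib_left[symmetric])
    also have "\<dots> \<le> (8 / d x)\<^sup>2"
    proof (rule power_mono)
      have "h' (d x) \<le> 4 / t" unfolding h'_def using step'_le'[of 2 "d x / t"] t by (intro divide_right_mono) auto
      also have "\<dots> \<le> 8 / d x" using dx t by (simp add: field_simps)
      finally show "h' (d x) \<le> 8 / d x" .
      show "0 \<le> h' (d x)" unfolding h'_def using step'_nonneg t by simp
    qed
    finally show ?thesis using True by (simp add: power_divide)
  next
    case False
    then have "x \<in> A \<or> x \<in> B" by (auto simp: shell_def A_def B_def)
    then have "partial b \<xi> x = 0" for b
    proof
      assume "x \<in> A"
      then have "partial b \<xi> x = partial b (\<lambda>x. 0) x" by (rule partial_cong[OF oA]) (rule \<xi>A)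
      then show ?thesis by (simp add: partial_const)
    next
      assume "x \<in> B"
      then have "partial b \<xi> x = partial b (\<lambda>x. 1) x" by (rule partial_cong[OF oB]) (rule \<xi>B)
      then show ?thesis by (simp add: partial_const)
    qed
    then show ?thesis using False by (simp add: grad_norm_sq_def)
  qed
qed

end

context radial_energy begin

text \<open>If \<open>v\<close> were positive at \<open>x0\<close>, the left-hand side of \<open>ineq\<close> would stay above \<open>\<kappa> vol > 0\<close> for all small \<open>\<epsilon>\<close> and all cutoffs equal to 1 near \<open>x0\<close>.
  On the right, the gradient of the cutoff is seen by the truncation only near the submanifold, where the shell integrals of
  \<open>v\<^sup>2 / d\<^sup>2\<close> tend to zero, and the potential term is of order \<open>\<epsilon>\<close> by the bound on \<open>v / d\<^sup>2\<close>.\<close>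

lemma truncated_energy_forces_zero:
  fixes \<Omega> :: "'a set" and \<mu> :: real
  assumes \<Omega>: "open \<Omega>" "bounded \<Omega>" and \<Sigma>\<Omega>: "\<Sigma> \<subseteq> \<Omega>" "tube \<Sigma> \<beta> \<subseteq> \<Omega>"
    and vc: "continuous_on (closure \<Omega> - \<Sigma>) v" and vn: "\<And>x. x \<in> closure \<Omega> - \<Sigma> \<Longrightarrow> 0 \<le> v x"
    and vb: "\<And>x. x \<in> frontier \<Omega> \<Longrightarrow> v x = 0"
    and ineq: "\<And>\<epsilon> \<zeta>. \<epsilon> > 0 \<Longrightarrow> \<zeta> \<in> C1c (\<Omega> - \<Sigma>) \<Longrightarrow>
      (LINT x|lborel. trunc \<epsilon> (v x) * trunc' \<epsilon> (v x) * v x powr p * (\<zeta> x)\<^sup>2) \<le>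
      (LINT x|lborel. (trunc \<epsilon> (v x))\<^sup>2 * grad_norm_sq \<zeta> x)
      + (LINT x|lborel. \<mu> / (d x)\<^sup>2 * (trunc \<epsilon> (v x) * (trunc' \<epsilon> (v x) * v x - trunc \<epsilon> (v x))) * (\<zeta> x)\<^sup>2)"
    and \<mu>\<sigma>: "\<mu> > 0 \<Longrightarrow> \<sigma> < H"
    and x0: "x0 \<in> \<Omega> - \<Sigma>"
  shows "v x0 = 0"
proof (rule ccontr)
  assume "v x0 \<noteq> 0"
  let ?U = "\<Omega> - \<Sigma>"
  have oU: "open ?U" using \<Omega>(1) closed by (rule open_Diff)
  have clU: "?U \<subseteq> closure \<Omega> - \<Sigma>" using closure_subset by blast
  have vU: "continuous_on ?U v" by (rule continuous_on_subset[OF vc clU])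
  have vUn: "0 \<le> v x" if "x \<in> ?U" for x using vn clU that by blast
  have d0: "d x = 0" if "x \<in> \<Sigma>" for x using that by (simp add: d_def)
  have dU: "0 < d x" if "x \<in> ?U" for x using that d_pos_iff[of x] by blast
  define c where "c = v x0 / 2"
  have c: "c > 0" using \<open>v x0 \<noteq> 0\<close> vUn[OF x0] by (simp add: c_def)
  have "isCont v x0" using vU oU x0 continuous_on_eq_continuous_at by blast
  then obtain s1 where s1: "s1 > 0" "\<And>x. dist x x0 < s1 \<Longrightarrow> dist (v x) (v x0) < c"
    using c unfolding continuous_at_eps_delta by auto
  obtain s2 where s2: "s2 > 0" "cball x0 s2 \<subseteq> ?U" using oU x0 open_contains_cball by metis
  define s where "s = min (s1 / 2) (min s2 (d x0 / 2))"
  have s: "s > 0" "s < s1" "s \<le> s2" "s \<le> d x0 / 2" using s1 s2 dU[OF x0] by (auto simp: s_def)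
  let ?B = "cball x0 s"
  have BU: "?B \<subseteq> ?U" by (rule subset_trans[OF subset_cball[OF s(3)] s2(2)])
  have Bv: "c \<le> v x" if "x \<in> ?B" for x
  proof -
    have "dist (v x) (v x0) < c" by (rule s1(2)) (use that s in \<open>auto simp: dist_commute\<close>)
    then show ?thesis unfolding dist_real_def c_def by linarith
  qed
  have Bd: "d x0 / 2 \<le> d x" if "x \<in> ?B" for x
    using d_lipschitz[of x0 x] that s by (auto simp: dist_norm)
  define \<kappa> where "\<kappa> = c / 8 * c powr p"
  define vol where "vol = measure lborel ?B"
  have vol: "vol > 0" unfolding vol_def using content_cball_pos[OF s(1), of x0] by simp
  have \<kappa>: "\<kappa> * vol > 0" using c vol by (simp add: \<kappa>_def)
  define R where "R = {x \<in> closure \<Omega>. r \<le> d x}"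
  have cR: "compact R"
  proof -
    have "R = closure \<Omega> \<inter> {x. r \<le> d x}" by (auto simp: R_def)
    moreover have "closed {x. r \<le> d x}" by (intro closed_Collect_le continuous_intros d_continuous)
    ultimately show ?thesis using \<Omega>(2) compact_Int_closed[of "closure \<Omega>"] by (simp add: compact_closure)
  qed
  have RU: "R \<subseteq> closure \<Omega> - \<Sigma>"
  proof
    fix x assume "x \<in> R"
    then have "x \<in> closure \<Omega>" "r \<le> d x" by (simp_all add: R_def)
    then show "x \<in> closure \<Omega> - \<Sigma>" using r d0[of x] by auto
  qed
  have vR: "continuous_on R v" by (rule continuous_on_subset[OF vc RU])
  have cvR: "continuous_on R (\<lambda>x. v x / (d x)\<^sup>2)"
    by (intro continuous_intros vR d_continuous) (use r in \<open>auto simp: R_def\<close>)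
  have iR: "integrable lborel (\<lambda>x. indicator R x *\<^sub>R (v x / (d x)\<^sup>2))"
    by (rule borel_integrable_compact[OF cR cvR])
  have "\<exists>D\<ge>0. \<forall>\<delta>. 0 < \<delta> \<and> \<delta> \<le> r \<longrightarrow> max \<mu> 0 * ((LINT x:shell \<delta> r|lborel. v x / (d x)\<^sup>2) + (LINT x:R|lborel. v x / (d x)\<^sup>2)) \<le> D"
  proof (cases "\<mu> > 0")
    case True
    obtain B where B: "\<And>\<delta>. 0 < \<delta> \<Longrightarrow> \<delta> \<le> r \<Longrightarrow> (LINT x:shell \<delta> r|lborel. v x / (d x)\<^sup>2) \<le> B"
      using potential_bounded[OF \<mu>\<sigma>[OF True]] by blast
    define D where "D = \<bar>\<mu> * (B + (LINT x:R|lborel. v x / (d x)\<^sup>2))\<bar>"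
    have "max \<mu> 0 * ((LINT x:shell \<delta> r|lborel. v x / (d x)\<^sup>2) + (LINT x:R|lborel. v x / (d x)\<^sup>2)) \<le> D" if "0 < \<delta>" "\<delta> \<le> r" for \<delta>
    proof -
      have "\<mu> * ((LINT x:shell \<delta> r|lborel. v x / (d x)\<^sup>2) + (LINT x:R|lborel. v x / (d x)\<^sup>2)) \<le> \<mu> * (B + (LINT x:R|lborel. v x / (d x)\<^sup>2))"
        using B[OF that] True by (intro mult_left_mono) auto
      also have "\<dots> \<le> D" unfolding D_def by (rule abs_ge_self)
      finally show ?thesis using True by (simp add: max_def)
    qed
    then show ?thesis by (intro exI[of _ D]) (simp add: D_def)
  qed (auto intro!: exI[of _ 0])
  then obtain D where D: "D \<ge> 0" "\<And>\<delta>. 0 < \<delta> \<Longrightarrow> \<delta> \<le> r \<Longrightarrow>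
      max \<mu> 0 * ((LINT x:shell \<delta> r|lborel. v x / (d x)\<^sup>2) + (LINT x:R|lborel. v x / (d x)\<^sup>2)) \<le> D" by blast
  \<comment> \<open>The first bound keeps the truncation comparable to \<open>v\<close> on the ball, the second makes the potential term at most a third of
    the left-hand side.\<close>
  define \<epsilon> where "\<epsilon> = min (c / 4) (\<kappa> * vol / (9 * (D + 1)))"
  have D1: "9 * (D + 1) > 0" using D(1) by simp
  have "\<kappa> * vol / (9 * (D + 1)) > 0" by (rule divide_pos_pos[OF \<kappa> D1])
  then have \<epsilon>0: "\<epsilon> > 0" unfolding \<epsilon>_def using c by simp
  have "\<epsilon> \<le> c / 4" unfolding \<epsilon>_def by (rule min.cobounded1)
  note \<epsilon> = \<epsilon>0 this
  have "\<epsilon> \<le> \<kappa> * vol / (9 * (D + 1))" unfolding \<epsilon>_def by (rule min.cobounded2)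
  then have "\<epsilon> * (9 * (D + 1)) \<le> \<kappa> * vol" using pos_le_divide_eq[OF D1] by blast
  moreover have "\<epsilon> * (9 * (D + 1)) = 9 * (\<epsilon> * D) + 9 * \<epsilon>" by (simp add: algebra_simps)
  ultimately have \<epsilon>D: "3 * \<epsilon> * D \<le> \<kappa> * vol / 3" using \<epsilon>0 by simp
  have ev1: "\<forall>\<^sub>F n in sequentially. \<tau> n < d x0 / 4"
    using \<tau>_tendsto dU[OF x0] by (intro order_tendstoD) auto
  \<comment> \<open>The squared gradient of the cutoff is at most \<open>64 / d\<^sup>2\<close>, so this bounds its contribution by another third.\<close>
  have ev2: "\<forall>\<^sub>F n in sequentially. (LINT x:shell (\<tau> n) (2 * \<tau> n)|lborel. (v x)\<^sup>2 / (d x)\<^sup>2) < \<kappa> * vol / 192"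
    using gradient_shells_vanish \<kappa> by (intro order_tendstoD) auto
  obtain n where n: "\<tau> n < d x0 / 4" "(LINT x:shell (\<tau> n) (2 * \<tau> n)|lborel. (v x)\<^sup>2 / (d x)\<^sup>2) < \<kappa> * vol / 192"
    using eventually_happens[OF eventually_conj[OF ev1 ev2]] by auto
  define t where "t = \<tau> n"
  have t: "0 < t" "2 * t \<le> r" "t \<le> r" "2 * t < \<beta>" using \<tau>[of n] r by (auto simp: t_def)
  \<comment> \<open>A compact subset of the domain outside of which the truncation vanishes.\<close>
  define K where "K = {x. d x \<le> r} \<union> (R \<inter> v -` {\<epsilon>..})"
  have cK: "compact K"
  proof -
    have "closed (R \<inter> v -` {\<epsilon>..})"
      by (rule continuous_closed_preimage[OF vR compact_imp_closed[OF cR] closed_atLeast])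
    then have "compact (R \<inter> v -` {\<epsilon>..})" using compact_Int_closed[OF cR, of "R \<inter> v -` {\<epsilon>..}"] by (simp add: Int_absorb1)
    moreover have "{x. d x \<le> r} = shell (-1) r"
    proof -
      have "-1 \<le> d x" for x using infdist_nonneg[of x \<Sigma>] unfolding d_def by linarith
      then show ?thesis by (simp add: shell_def)
    qed
    ultimately show ?thesis unfolding K_def using compact_shell by (simp add: compact_Un)
  qed
  have K\<Omega>: "K \<subseteq> \<Omega>"
  proof
    fix x assume "x \<in> K"
    then consider "d x \<le> r" | "x \<in> R" "\<epsilon> \<le> v x" by (auto simp: K_def)
    then show "x \<in> \<Omega>"
    proof cases
      case 1
      show ?thesis
      proof (cases "x \<in> \<Sigma>")
        case False
        then have "x \<in> tube \<Sigma> \<beta>" using 1 r d_pos_iff[of x] by (simp add: in_tube_iff)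
        then show ?thesis using \<Sigma>\<Omega> by blast
      qed (use \<Sigma>\<Omega> in blast)
    next
      case 2
      then have "x \<notin> frontier \<Omega>" using vb[of x] \<epsilon> by auto
      then show ?thesis using 2 \<Omega>(1) by (auto simp: R_def frontier_def interior_open)
    qed
  qed
  obtain \<psi> where \<psi>: "\<psi> \<in> C1c \<Omega>" "\<And>x. 0 \<le> \<psi> x" "\<And>x. \<psi> x \<le> 1" "\<And>x. x \<in> K \<Longrightarrow> \<psi> x = 1"
    by (rule C1_cutoff_exists[OF cK \<Omega>(1) K\<Omega>]) blast
  note \<psi>D = C1cD[OF \<psi>(1)]
  define \<xi> where "\<xi> x = step 2 (d x / t)" for x
  have \<xi>1: "Ck_on 1 UNIV \<xi>" unfolding \<xi>_def[abs_def] by (rule inner_cutoff(1)[OF t(1,4)])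
  have \<xi>g: "grad_norm_sq \<xi> x \<le> indicator (shell t (2 * t)) x * (64 / (d x)\<^sup>2)" for x
    unfolding \<xi>_def[abs_def] by (rule inner_cutoff(2)[OF t(1,4)])
  have \<xi>b: "0 \<le> \<xi> x" "\<xi> x \<le> 1" for x unfolding \<xi>_def using step_bounds by auto
  define \<zeta> where "\<zeta> x = \<psi> x * \<xi> x" for x
  define Z where "Z = supp \<psi> \<inter> {x. t \<le> d x}"
  have cZ: "compact Z" unfolding Z_def
    by (intro compact_Int_closed \<psi>D(2) closed_Collect_le continuous_intros d_continuous)
  have ZU: "Z \<subseteq> ?U"
  proof
    fix x assume "x \<in> Z"
    then have "x \<in> supp \<psi>" "t \<le> d x" by (simp_all add: Z_def)
    then show "x \<in> ?U" using \<psi>D(3) t d0[of x] by auto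
  qed
  have \<zeta>off: "\<zeta> x = 0" if "x \<notin> Z" for x
  proof (cases "x \<in> supp \<psi>")
    case True
    then have "d x / t \<le> 1" using that t by (simp add: Z_def)
    then show ?thesis by (simp add: \<zeta>_def \<xi>_def step_eq_0)
  qed (simp add: \<zeta>_def \<psi>D(4))
  have \<zeta>1: "Ck_on 1 UNIV \<zeta>" unfolding \<zeta>_def by (rule C1_mult[OF \<psi>D(1) \<xi>1])
  have \<zeta>C: "\<zeta> \<in> C1c ?U" by (rule C1cI[OF \<zeta>1 cZ ZU \<zeta>off])
  have \<zeta>b: "0 \<le> \<zeta> x" "(\<zeta> x)\<^sup>2 \<le> 1" for x
  proof -
    show "0 \<le> \<zeta> x" unfolding \<zeta>_def using \<psi> \<xi>b by simp
    moreover have "\<zeta> x \<le> 1" unfolding \<zeta>_def using \<psi> \<xi>b by (intro mult_le_one) auto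
    ultimately show "(\<zeta> x)\<^sup>2 \<le> 1" by (simp add: power_le_one)
  qed
  have gz: "grad_norm_sq \<zeta> x = 0" if "x \<notin> Z" for x
    by (rule grad_norm_sq_zero_off[OF compact_imp_closed[OF cZ] _ that]) (rule \<zeta>off)
  have inK: "x \<in> K" if "x \<in> ?U" "\<epsilon> \<le> v x" for x
    using that clU by (auto simp: K_def R_def)
  have grad\<zeta>: "grad_norm_sq \<zeta> x = grad_norm_sq \<xi> x" if x: "x \<in> ?U" "\<epsilon> < v x" for x
  proof -
    define O' where "O' = ?U \<inter> v -` {\<epsilon><..}"
    have O': "open O'" "x \<in> O'" unfolding O'_def using x continuous_open_preimage[OF vU oU open_greaterThan] by auto
    have "\<zeta> y = \<xi> y" if "y \<in> O'" for y
      using \<psi>(4)[OF inK] that by (simp add: O'_def \<zeta>_def)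
    then have "partial b \<zeta> x = partial b \<xi> x" for b by (rule partial_cong[OF O'])
    then show ?thesis by (simp add: grad_norm_sq_def)
  qed
  note DT = DERIV_trunc[OF \<epsilon>(1)]
  have ctr: "continuous_on UNIV (trunc \<epsilon>)" "continuous_on UNIV (trunc' \<epsilon>)"
    using DERIV_isCont[OF DT(1)] DERIV_isCont[OF DT(2)] by (auto intro: continuous_at_imp_continuous_on)
  have ctv: "continuous_on ?U (\<lambda>x. trunc \<epsilon> (v x))" "continuous_on ?U (\<lambda>x. trunc' \<epsilon> (v x))"
    using continuous_on_compose2[OF ctr(1) vU] continuous_on_compose2[OF ctr(2) vU] by auto
  have c\<zeta>: "continuous_on S \<zeta>" for S using C1_continuous_on[OF \<zeta>1] continuous_on_subset by blast
  have cg\<zeta>: "continuous_on S (grad_norm_sq \<zeta>)" for S using grad_norm_sq_continuous[OF \<zeta>1] continuous_on_subset by blast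
  have cvp: "continuous_on ?U (\<lambda>x. v x powr p)"
    using p by (intro continuous_on_powr' vU continuous_intros) (use vUn in auto)
  have dn: "d x \<noteq> 0" if "x \<in> ?U" for x using dU[OF that] by simp
  have i1: "integrable lborel (\<lambda>x. trunc \<epsilon> (v x) * trunc' \<epsilon> (v x) * v x powr p * (\<zeta> x)\<^sup>2)"
    by (rule integrable_compact_in_open[OF oU _ cZ ZU]) (auto intro!: continuous_intros ctv cvp c\<zeta> simp: \<zeta>off)
  have i2: "integrable lborel (\<lambda>x. (trunc \<epsilon> (v x))\<^sup>2 * grad_norm_sq \<zeta> x)"
    by (rule integrable_compact_in_open[OF oU _ cZ ZU]) (auto intro!: continuous_intros ctv cg\<zeta> simp: gz)
  have i3: "integrable lborel (\<lambda>x. \<mu> / (d x)\<^sup>2 * (trunc \<epsilon> (v x) * (trunc' \<epsilon> (v x) * v x - trunc \<epsilon> (v x))) * (\<zeta> x)\<^sup>2)"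
    by (rule integrable_compact_in_open[OF oU _ cZ ZU]) (auto intro!: continuous_intros ctv vU c\<zeta> d_continuous simp: \<zeta>off dn)
  have cs: "continuous_on (shell a b) (\<lambda>x. (v x)\<^sup>2 / (d x)\<^sup>2)" "continuous_on (shell a b) (\<lambda>x. v x / (d x)\<^sup>2)" if "0 < a" "b \<le> 2 * r" for a b
    using that by (intro continuous_intros v_shell d_continuous; auto simp: shell_def)+
  have js: "integrable lborel (\<lambda>x. indicator (shell t (2 * t)) x *\<^sub>R ((v x)\<^sup>2 / (d x)\<^sup>2))"
    using shell_integrable[OF cs(1)[OF t(1), of "2 * t"]] t by (simp add: set_integrable_def)
  have js2: "integrable lborel (\<lambda>x. indicator (shell t r) x *\<^sub>R (v x / (d x)\<^sup>2))"
    using shell_integrable[OF cs(2)[OF t(1), of r]] r by (simp add: set_integrable_def)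
  have "\<kappa> * vol = (LINT x|lborel. \<kappa> * indicator ?B x)"
    by (simp add: vol_def)
  also have "\<dots> \<le> (LINT x|lborel. trunc \<epsilon> (v x) * trunc' \<epsilon> (v x) * v x powr p * (\<zeta> x)\<^sup>2)"
  proof (rule integral_mono[OF _ i1])
    show "integrable lborel (\<lambda>x. \<kappa> * indicator ?B x)"
      using borel_integrable_compact[OF compact_cball continuous_on_const, of x0 s \<kappa>] by (simp add: mult.commute)
    fix x
    show "\<kappa> * indicator ?B x \<le> trunc \<epsilon> (v x) * trunc' \<epsilon> (v x) * v x powr p * (\<zeta> x)\<^sup>2"
    proof (cases "x \<in> ?B")
      case True
      then have xU: "x \<in> ?U" and vx: "c \<le> v x" using BU Bv by auto
      have "\<psi> x = 1" by (rule \<psi>(4)[OF inK[OF xU]]) (use vx \<epsilon> c in linarith)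
      moreover have "\<xi> x = 1" unfolding \<xi>_def
        by (rule step_eq_1) (use Bd[OF True] n(1) t in \<open>simp add: t_def[symmetric] pos_le_divide_eq\<close>)
      ultimately have \<zeta>x: "\<zeta> x = 1" by (simp add: \<zeta>_def)
      have v4: "4 * \<epsilon> \<le> v x" using vx \<epsilon> by linarith
      note low = trunc_lower[OF \<epsilon>(1) v4]
      have "c / 4 * (1 / 2) * c powr p \<le> trunc \<epsilon> (v x) * trunc' \<epsilon> (v x) * v x powr p"
        using low vx c p by (intro mult_mono powr_mono2) auto
      then show ?thesis using True \<zeta>x by (simp add: \<kappa>_def)
    next
      case False
      show ?thesis
      proof (cases "x \<in> Z")
        case True
        then have "0 \<le> v x" using ZU vUn by blast
        then show ?thesis using False trunc_bounds(1,3)[OF \<epsilon>(1)] by simp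
      qed (use False \<zeta>off in simp)
    qed
  qed
  also have "\<dots> \<le> (LINT x|lborel. (trunc \<epsilon> (v x))\<^sup>2 * grad_norm_sq \<zeta> x)
      + (LINT x|lborel. \<mu> / (d x)\<^sup>2 * (trunc \<epsilon> (v x) * (trunc' \<epsilon> (v x) * v x - trunc \<epsilon> (v x))) * (\<zeta> x)\<^sup>2)"
    by (rule ineq[OF \<epsilon>(1) \<zeta>C])
  also have "\<dots> \<le> 64 * (LINT x:shell t (2 * t)|lborel. (v x)\<^sup>2 / (d x)\<^sup>2)
      + 3 * \<epsilon> * (max \<mu> 0 * ((LINT x:shell t r|lborel. v x / (d x)\<^sup>2) + (LINT x:R|lborel. v x / (d x)\<^sup>2)))"
  proof (rule add_mono)
    have "(LINT x|lborel. (trunc \<epsilon> (v x))\<^sup>2 * grad_norm_sq \<zeta> x) \<le> (LINT x|lborel. 64 * (indicator (shell t (2 * t)) x *\<^sub>R ((v x)\<^sup>2 / (d x)\<^sup>2)))"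
    proof (rule integral_mono[OF i2 integrable_mult_right[OF js]])
      fix x
      have nn: "0 \<le> 64 * (indicator (shell t (2 * t)) x *\<^sub>R ((v x)\<^sup>2 / (d x)\<^sup>2))" by (simp add: indicator_def)
      show "(trunc \<epsilon> (v x))\<^sup>2 * grad_norm_sq \<zeta> x \<le> 64 * (indicator (shell t (2 * t)) x *\<^sub>R ((v x)\<^sup>2 / (d x)\<^sup>2))"
      proof (cases "x \<in> Z \<and> \<epsilon> < v x")
        case True
        then have xU: "x \<in> ?U" using ZU by blast
        note tb = trunc_bounds[OF \<epsilon>(1) vUn[OF xU]]
        have "(trunc \<epsilon> (v x))\<^sup>2 * grad_norm_sq \<zeta> x \<le> (v x)\<^sup>2 * (indicator (shell t (2 * t)) x * (64 / (d x)\<^sup>2))"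
          unfolding grad\<zeta>[OF xU conjunct2[OF True]]
          by (rule mult_mono[OF power_mono[OF tb(2,1)] \<xi>g]) (simp_all add: grad_norm_sq_nonneg)
        then show ?thesis by (simp add: mult_ac)
      next
        case False
        then have z: "(trunc \<epsilon> (v x))\<^sup>2 * grad_norm_sq \<zeta> x = 0"
          using gz[of x] trunc_zero[OF \<epsilon>(1), of "v x"] by (cases "x \<in> Z") auto
        show ?thesis unfolding z by (rule nn)
      qed
    qed
    then show "(LINT x|lborel. (trunc \<epsilon> (v x))\<^sup>2 * grad_norm_sq \<zeta> x) \<le> 64 * (LINT x:shell t (2 * t)|lborel. (v x)\<^sup>2 / (d x)\<^sup>2)"
      unfolding set_lebesgue_integral_def integral_mult_right_zero .
    let ?W = "\<lambda>x. indicator (shell t r) x *\<^sub>R (v x / (d x)\<^sup>2) + indicator R x *\<^sub>R (v x / (d x)\<^sup>2)"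
    have "(LINT x|lborel. \<mu> / (d x)\<^sup>2 * (trunc \<epsilon> (v x) * (trunc' \<epsilon> (v x) * v x - trunc \<epsilon> (v x))) * (\<zeta> x)\<^sup>2)
      \<le> (LINT x|lborel. (3 * \<epsilon> * max \<mu> 0) * ?W x)"
    proof (rule integral_mono[OF i3 integrable_mult_right[OF Bochner_Integration.integrable_add[OF js2 iR]]])
      fix x
      have "0 \<le> indicator (shell t r) x *\<^sub>R (v x / (d x)\<^sup>2)"
        using shell_v_nonneg[OF t(1), of r x] r by (cases "x \<in> shell t r") auto
      moreover have "0 \<le> indicator R x *\<^sub>R (v x / (d x)\<^sup>2)"
        using vn[of x] RU by (cases "x \<in> R") auto
      ultimately have Wn: "0 \<le> ?W x" by simp
      show "\<mu> / (d x)\<^sup>2 * (trunc \<epsilon> (v x) * (trunc' \<epsilon> (v x) * v x - trunc \<epsilon> (v x))) * (\<zeta> x)\<^sup>2 \<le> (3 * \<epsilon> * max \<mu> 0) * ?W x"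
      proof (cases "x \<in> Z")
        case False
        then show ?thesis using \<zeta>off[OF False] Wn \<epsilon> by simp
      next
        case True
        then have xU: "x \<in> ?U" using ZU by blast
        note tb = trunc_bounds[OF \<epsilon>(1) vUn[OF xU]]
        have "x \<in> shell t r \<or> x \<in> R" using True xU clU by (auto simp: Z_def shell_def R_def)
        then have W: "v x / (d x)\<^sup>2 \<le> ?W x" using vUn[OF xU] by (auto simp: indicator_def)
        have "trunc \<epsilon> (v x) * (trunc' \<epsilon> (v x) * v x - trunc \<epsilon> (v x)) * (\<zeta> x)\<^sup>2 \<le> v x * (3 * \<epsilon>) * 1"
          using tb \<zeta>b(2)[of x] vUn[OF xU] \<epsilon> by (intro mult_mono mult_nonneg_nonneg) auto
        then have "max \<mu> 0 / (d x)\<^sup>2 * (trunc \<epsilon> (v x) * (trunc' \<epsilon> (v x) * v x - trunc \<epsilon> (v x)) * (\<zeta> x)\<^sup>2) \<le> max \<mu> 0 / (d x)\<^sup>2 * (v x * (3 * \<epsilon>) * 1)"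
          by (intro mult_left_mono) auto
        also have "\<dots> = (3 * \<epsilon> * max \<mu> 0) * (v x / (d x)\<^sup>2)" by simp
        also have "\<dots> \<le> (3 * \<epsilon> * max \<mu> 0) * ?W x" using W \<epsilon> by (intro mult_left_mono) auto
        finally have 1: "max \<mu> 0 / (d x)\<^sup>2 * (trunc \<epsilon> (v x) * (trunc' \<epsilon> (v x) * v x - trunc \<epsilon> (v x)) * (\<zeta> x)\<^sup>2) \<le> (3 * \<epsilon> * max \<mu> 0) * ?W x" .
        have "\<mu> / (d x)\<^sup>2 * (trunc \<epsilon> (v x) * (trunc' \<epsilon> (v x) * v x - trunc \<epsilon> (v x)) * (\<zeta> x)\<^sup>2) \<le> max \<mu> 0 / (d x)\<^sup>2 * (trunc \<epsilon> (v x) * (trunc' \<epsilon> (v x) * v x - trunc \<epsilon> (v x)) * (\<zeta> x)\<^sup>2)"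
          using tb by (intro mult_right_mono divide_right_mono mult_nonneg_nonneg) auto
        with 1 show ?thesis by (simp only: mult.assoc)
      qed
    qed
    also have "\<dots> = 3 * \<epsilon> * (max \<mu> 0 * ((LINT x:shell t r|lborel. v x / (d x)\<^sup>2) + (LINT x:R|lborel. v x / (d x)\<^sup>2)))"
      unfolding set_lebesgue_integral_def integral_mult_right_zero Bochner_Integration.integral_add[OF js2 iR] by (simp only: mult.assoc)
    finally show "(LINT x|lborel. \<mu> / (d x)\<^sup>2 * (trunc \<epsilon> (v x) * (trunc' \<epsilon> (v x) * v x - trunc \<epsilon> (v x))) * (\<zeta> x)\<^sup>2)
      \<le> 3 * \<epsilon> * (max \<mu> 0 * ((LINT x:shell t r|lborel. v x / (d x)\<^sup>2) + (LINT x:R|lborel. v x / (d x)\<^sup>2)))" .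
  qed
  also have "\<dots> \<le> 64 * (LINT x:shell t (2 * t)|lborel. (v x)\<^sup>2 / (d x)\<^sup>2) + 3 * \<epsilon> * D"
    using D(2)[OF t(1,3)] \<epsilon> by (intro add_left_mono mult_left_mono) auto
  also have "\<dots> < 64 * (\<kappa> * vol / 192) + \<kappa> * vol / 3"
    using n(2) \<epsilon>D unfolding t_def by linarith
  finally show False using \<kappa> by simp
qed

end

section \<open>Absence of nontrivial solutions\<close>

theorem theorem1p7:
  fixes \<Omega> \<Sigma> :: "'a::euclidean_space set" and k :: nat and \<mu> p \<beta>\<^sub>0 :: real
    and \<eta> u :: "'a \<Rightarrow> real"
  assumes "DIM('a) \<ge> 3" and "k + 2 < DIM('a)"
    and "C2_bounded_domain \<Omega>" and "singular_set k \<Omega> \<Sigma>"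
    and "lambda_hardy \<Omega> \<Sigma> \<mu> > 0"
    and "admissible_radius \<Omega> \<Sigma> \<beta>\<^sub>0" and "tube_cutoff \<Sigma> \<beta>\<^sub>0 \<eta>"
    and "\<mu> \<le> (Hconst DIM('a) k)\<^sup>2"
    and "p \<ge> (2 + alpha_plus DIM('a) k \<mu>) / alpha_plus DIM('a) k \<mu>"
    and "continuous_on (closure \<Omega> - \<Sigma>) u"
    and "\<forall>x \<in> closure \<Omega> - \<Sigma>. u x \<ge> 0"
    and "distributional_solution (\<Omega> - \<Sigma>) \<Sigma> \<mu> p u"
    and "tends_to_zero_loc_unif (\<lambda>x. u x / W_tilde k \<Sigma> \<mu> \<eta> x) (\<Omega> - \<Sigma>) (frontier \<Omega>)"
  shows "\<forall>x \<in> closure \<Omega> - \<Sigma>. u x = 0"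
proof -
  have \<Omega>: "open \<Omega>" "bounded \<Omega>" using assms(3) by (auto simp: C2_bounded_domain_def)
  have \<Sigma>: "\<Sigma> \<noteq> {}" "\<Sigma> \<subseteq> \<Omega>" "compact \<Sigma>" "C2_submanifold k \<Sigma>" using assms(4) by (auto simp: singular_set_def)
  have \<beta>: "\<beta>\<^sub>0 > 0" and tube6: "closure (tube \<Sigma> (6 * \<beta>\<^sub>0)) \<subseteq> \<Omega>" and dC2: "Ck_on 2 (tube \<Sigma> (4 * \<beta>\<^sub>0)) (\<lambda>x. infdist x \<Sigma>)"
    using assms(6) by (auto simp: admissible_radius_def)
  interpret T: smooth_tube \<Sigma> \<beta>\<^sub>0 k
    by unfold_locales (use \<Sigma> \<beta> dC2 in auto)
  have tube\<Omega>: "tube \<Sigma> s \<subseteq> \<Omega>" if "s \<le> 6 * \<beta>\<^sub>0" for s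
  proof -
    have "tube \<Sigma> s \<subseteq> tube \<Sigma> (6 * \<beta>\<^sub>0)" using that by (auto simp: tube_def)
    then show ?thesis using tube6 closure_subset by blast
  qed
  let ?U = "\<Omega> - \<Sigma>"
  have oU: "open ?U" using \<Omega>(1) T.closed by (rule open_Diff)
  have clU: "?U \<subseteq> closure \<Omega> - \<Sigma>" using closure_subset by blast
  have cu: "continuous_on ?U u" by (rule continuous_on_subset[OF assms(10) clU])
  have un: "0 \<le> u x" if "x \<in> ?U" for x using assms(11) clU that by blast
  have dn: "T.d x \<noteq> 0" if "x \<in> ?U" for x using T.d_pos_iff[of x] that by auto
  define H where "H = Hconst DIM('a) k"
  define \<sigma> where "\<sigma> = sqrt (H\<^sup>2 - \<mu>)"
  have H: "H > 0" using assms(2) by (simp add: H_def Hconst_def)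
  have \<sigma>0: "\<sigma> \<ge> 0" and \<sigma>2: "\<sigma>\<^sup>2 = H\<^sup>2 - \<mu>" using assms(8) by (simp_all add: \<sigma>_def H_def)
  have MH: "T.M = 2 * H + 1" unfolding T.M_def H_def Hconst_def by (simp add: field_simps)
  have \<alpha>: "alpha_plus DIM('a) k \<mu> = H + \<sigma>" by (simp add: alpha_plus_def H_def \<sigma>_def)
  have "(2 + (H + \<sigma>)) / (H + \<sigma>) = 2 / (H + \<sigma>) + 1" using H \<sigma>0 by (simp add: add_divide_distrib)
  then have p2: "2 / (H + \<sigma>) \<le> p - 1" using assms(9) unfolding \<alpha> by linarith
  moreover have "0 < 2 / (H + \<sigma>)" using H \<sigma>0 by simp
  ultimately have p: "p > 1" by linarith
  have "2 \<le> (p - 1) * (H + \<sigma>)" using p2 H \<sigma>0 by (simp add: pos_divide_le_eq)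
  then have pcond: "2 / (p - 1) \<le> H + \<sigma>" using p by (simp add: pos_divide_le_eq mult.commute)
  have \<mu>\<sigma>: "\<sigma> < H" if "\<mu> > 0"
  proof -
    have "\<sigma>\<^sup>2 < H\<^sup>2" using \<sigma>2 that by simp
    then show ?thesis using H by (simp add: power2_less_imp_less)
  qed
  have \<eta>: "smooth_fun \<eta>" "\<And>x. 0 \<le> \<eta> x" "supp \<eta> \<subseteq> \<Sigma> \<union> tube \<Sigma> (\<beta>\<^sub>0 / 2)"
    "\<And>x. x \<in> closure (tube \<Sigma> (\<beta>\<^sub>0 / 4)) \<Longrightarrow> \<eta> x = 1"
    using assms(7) by (auto simp: tube_cutoff_def)
  have "supp \<eta> \<subseteq> \<Omega>" using \<eta>(3) \<Sigma>(2) tube\<Omega>[of "\<beta>\<^sub>0 / 2"] \<beta> by auto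
  then have c\<eta>: "compact (supp \<eta>)"
    using bounded_subset[OF \<Omega>(2)] by (simp add: compact_eq_bounded_closed supp_def)
  have "tube \<Sigma> (\<beta>\<^sub>0 / 4) \<noteq> {}"
  proof
    assume e: "tube \<Sigma> (\<beta>\<^sub>0 / 4) = {}"
    have "\<Sigma> = {x. T.d x < \<beta>\<^sub>0 / 4}"
    proof (intro equalityI subsetI)
      fix x assume "x \<in> \<Sigma>" then show "x \<in> {x. T.d x < \<beta>\<^sub>0 / 4}" using \<beta> by (simp add: T.d_def)
    next
      fix x assume "x \<in> {x. T.d x < \<beta>\<^sub>0 / 4}"
      then show "x \<in> \<Sigma>" using e by (auto simp: tube_def T.d_def)
    qed
    moreover have "open {x. T.d x < \<beta>\<^sub>0 / 4}" by (intro open_Collect_less continuous_intros T.d_continuous)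
    ultimately have "open \<Sigma>" by simp
    then have "\<Sigma> = UNIV" using clopen[of \<Sigma>] T.closed \<Sigma>(1) by blast
    then show False using compact_imp_bounded[OF \<Sigma>(3)] by simp
  qed
  then obtain y0 where "y0 \<in> tube \<Sigma> (\<beta>\<^sub>0 / 4)" by blast
  then have "\<eta> y0 = 1" by (intro \<eta>(4) subsetD[OF closure_subset])
  then have \<eta>y0: "\<eta> y0 \<noteq> 0" by simp
  define f where "f x = \<bar>u x\<bar> powr (p - 1) * u x - \<mu> / (T.d x)\<^sup>2 * u x" for x
  have fu: "\<bar>u x\<bar> powr (p - 1) * u x = u x powr p" if "x \<in> ?U" for x
    using un[OF that] powr_add[of "u x" "p - 1" 1] by (cases "u x = 0") auto
  have fuu: "u x powr p * u x = u x powr (p + 1)" if "x \<in> ?U" for x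
    using un[OF that] powr_add[of "u x" p 1] by (cases "u x = 0") auto
  have cf: "continuous_on ?U f"
    unfolding f_def using p by (intro continuous_intros continuous_on_powr' cu T.d_continuous) (auto simp: dn)
  have weak: "(LINT x:?U|lborel. u x * laplacian \<phi> x) = (LINT x:?U|lborel. f x * \<phi> x)" if "\<phi> \<in> test_functions ?U" for \<phi>
    unfolding f_def by (rule T.weak_form[OF assms(12) \<Omega>(1) cu p that])
  have master: "(LINT x|lborel. P x * (j (u x) * \<zeta> x)\<^sup>2) \<le>
      (LINT x|lborel. (j (u x))\<^sup>2 * grad_norm_sq \<zeta> x) - (LINT x|lborel. j (u x) * j1 (u x) * f x * (\<zeta> x)\<^sup>2)"
    if "\<zeta> \<in> C1c S" "open S" "S \<subseteq> ?U" "continuous_on S P"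
      "\<And>g. g \<in> C1c S \<Longrightarrow> (LINT x|lborel. P x * (g x)\<^sup>2) \<le> (LINT x|lborel. grad_norm_sq g x)"
      "\<And>t. (j has_real_derivative j1 t) (at t)" "\<And>t. (j1 has_real_derivative j2 t) (at t)" "continuous_on UNIV j2"
      "\<And>t. 0 \<le> t \<Longrightarrow> 0 \<le> j t \<and> 0 \<le> j1 t \<and> 0 \<le> j2 t" for S P \<zeta> j j1 j2
    by (rule weak_energy_inequality[where U="?U" and v=u and f=f and \<rho>\<^sub>0=\<eta> and ?x0.0=y0 and S=S and ?j2.0=j2])
       (fact oU cu un cf weak \<eta>(1) \<eta>(2) c\<eta> \<eta>y0 that)+
  obtain rh where rh: "0 < rh" "rh \<le> \<beta>\<^sub>0"
    "\<And>g. g \<in> C1c (tube \<Sigma> rh) \<Longrightarrow> (LINT x|lborel. H\<^sup>2 / (T.d x)\<^sup>2 * (g x)\<^sup>2) \<le> (LINT x|lborel. grad_norm_sq g x)"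
    by (rule T.hardy_tube[OF less_imp_le[OF H] MH]) blast
  define r where "r = min (rh / 3) 1"
  have r: "0 < r" "2 * r < rh" "2 * r < \<beta>\<^sub>0" "r \<le> 1" using rh by (auto simp: r_def)
  have rhU: "tube \<Sigma> rh \<subseteq> ?U" using tube\<Omega>[of rh] rh(2) \<beta> by (auto simp: tube_def)
  have energy: "(LINT x:T.shell a b|lborel. u x powr (p + 1) * (G (T.d x))\<^sup>2 + (u x)\<^sup>2 * (\<sigma>\<^sup>2 * (G (T.d x))\<^sup>2 / (T.d x)\<^sup>2 - (G' (T.d x))\<^sup>2)) \<le> 0"
    if prof: "T.profile a b G G'" and b: "b \<le> 2 * r" for a b G G'
  proof -
    let ?K = "T.shell a b"
    have a: "0 < a" using prof by (simp add: T.profile_def)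
    have b': "b < rh" using b r by linarith
    have KU: "?K \<subseteq> ?U" using T.shell_subset_tube[OF a b'] rhU by blast
    have off: "G (T.d x) = 0" "G' (T.d x) = 0" if "x \<notin> ?K" for x using prof that by (auto simp: T.profile_def T.shell_def)
    note pc = T.profile_C1c[OF prof b' rh(2)]
    have ot: "open (tube \<Sigma> rh)" by (rule open_tube[OF T.closed])
    have cP: "continuous_on (tube \<Sigma> rh) (\<lambda>x. H\<^sup>2 / (T.d x)\<^sup>2)"
      by (intro continuous_intros T.d_continuous) (auto simp: T.in_tube_iff)
    have "(LINT x|lborel. H\<^sup>2 / (T.d x)\<^sup>2 * (u x * G (T.d x))\<^sup>2) \<le>
      (LINT x|lborel. (u x)\<^sup>2 * grad_norm_sq (\<lambda>x. G (T.d x)) x) - (LINT x|lborel. u x * 1 * f x * (G (T.d x))\<^sup>2)"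
      by (rule master[where S="tube \<Sigma> rh" and ?j2.0="\<lambda>t. 0"], fact pc(1), fact ot, fact rhU, fact cP, fact rh(3)) auto
    then have main: "(LINT x|lborel. H\<^sup>2 / (T.d x)\<^sup>2 * (u x * G (T.d x))\<^sup>2) - (LINT x|lborel. (u x)\<^sup>2 * (G' (T.d x))\<^sup>2)
      + (LINT x|lborel. u x * f x * (G (T.d x))\<^sup>2) \<le> 0" unfolding pc(2) by simp
    have cK: "compact ?K" by (rule T.compact_shell)
    have dK: "T.d x \<noteq> 0" if "x \<in> ?K" for x using that a by (auto simp: T.shell_def)
    have cuK: "continuous_on ?K u" "continuous_on ?K f" by (rule continuous_on_subset[OF cu KU], rule continuous_on_subset[OF cf KU])
    note cG = T.radial_continuous[OF T.profile_continuous(1)[OF prof] a] T.radial_continuous[OF T.profile_continuous(2)[OF prof] a]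
    have j1: "set_integrable lborel ?K (\<lambda>x. H\<^sup>2 / (T.d x)\<^sup>2 * (u x * G (T.d x))\<^sup>2)"
      by (intro T.shell_integrable continuous_intros cuK cG T.d_continuous) (auto simp: dK)
    have j2: "set_integrable lborel ?K (\<lambda>x. (u x)\<^sup>2 * (G' (T.d x))\<^sup>2)"
      by (intro T.shell_integrable continuous_intros cuK cG)
    have j3: "set_integrable lborel ?K (\<lambda>x. u x * f x * (G (T.d x))\<^sup>2)"
      by (intro T.shell_integrable continuous_intros cuK cG)
    have ext: "(LINT x|lborel. F x) = (LINT x:?K|lborel. F x)" if "\<And>x. x \<notin> ?K \<Longrightarrow> F x = 0" for F :: "'a \<Rightarrow> real"
      unfolding set_lebesgue_integral_def by (rule Bochner_Integration.integral_cong) (use that in \<open>auto simp: indicator_def\<close>)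
    have "(LINT x:?K|lborel. u x powr (p + 1) * (G (T.d x))\<^sup>2 + (u x)\<^sup>2 * (\<sigma>\<^sup>2 * (G (T.d x))\<^sup>2 / (T.d x)\<^sup>2 - (G' (T.d x))\<^sup>2))
      = (LINT x:?K|lborel. (H\<^sup>2 / (T.d x)\<^sup>2 * (u x * G (T.d x))\<^sup>2 - (u x)\<^sup>2 * (G' (T.d x))\<^sup>2) + u x * f x * (G (T.d x))\<^sup>2)"
    proof (rule set_lebesgue_integral_cong)
      show "?K \<in> sets lborel" using T.shell_sets by simp
      show "\<forall>x. x \<in> ?K \<longrightarrow> u x powr (p + 1) * (G (T.d x))\<^sup>2 + (u x)\<^sup>2 * (\<sigma>\<^sup>2 * (G (T.d x))\<^sup>2 / (T.d x)\<^sup>2 - (G' (T.d x))\<^sup>2)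
        = (H\<^sup>2 / (T.d x)\<^sup>2 * (u x * G (T.d x))\<^sup>2 - (u x)\<^sup>2 * (G' (T.d x))\<^sup>2) + u x * f x * (G (T.d x))\<^sup>2"
      proof (intro allI impI)
        fix x assume "x \<in> ?K"
        then have xU: "x \<in> ?U" using KU by blast
        have fx: "u x * f x = u x powr (p + 1) - \<mu> / (T.d x)\<^sup>2 * (u x)\<^sup>2"
          unfolding f_def fu[OF xU] using fuu[OF xU] by (simp add: power2_eq_square algebra_simps)
        show "u x powr (p + 1) * (G (T.d x))\<^sup>2 + (u x)\<^sup>2 * (\<sigma>\<^sup>2 * (G (T.d x))\<^sup>2 / (T.d x)\<^sup>2 - (G' (T.d x))\<^sup>2)
          = (H\<^sup>2 / (T.d x)\<^sup>2 * (u x * G (T.d x))\<^sup>2 - (u x)\<^sup>2 * (G' (T.d x))\<^sup>2) + u x * f x * (G (T.d x))\<^sup>2"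
          unfolding fx \<sigma>2 power_mult_distrib by (simp add: diff_divide_distrib algebra_simps)
      qed
    qed
    also have "\<dots> = (LINT x:?K|lborel. H\<^sup>2 / (T.d x)\<^sup>2 * (u x * G (T.d x))\<^sup>2) - (LINT x:?K|lborel. (u x)\<^sup>2 * (G' (T.d x))\<^sup>2)
        + (LINT x:?K|lborel. u x * f x * (G (T.d x))\<^sup>2)"
      unfolding set_integral_add(2)[OF set_integral_diff(1)[OF j1 j2] j3] set_integral_diff(2)[OF j1 j2] ..
    also have "\<dots> \<le> 0"
    proof -
      have "(LINT x|lborel. H\<^sup>2 / (T.d x)\<^sup>2 * (u x * G (T.d x))\<^sup>2) = (LINT x:?K|lborel. H\<^sup>2 / (T.d x)\<^sup>2 * (u x * G (T.d x))\<^sup>2)"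
        by (rule ext) (simp add: off)
      moreover have "(LINT x|lborel. (u x)\<^sup>2 * (G' (T.d x))\<^sup>2) = (LINT x:?K|lborel. (u x)\<^sup>2 * (G' (T.d x))\<^sup>2)"
        by (rule ext) (simp add: off)
      moreover have "(LINT x|lborel. u x * f x * (G (T.d x))\<^sup>2) = (LINT x:?K|lborel. u x * f x * (G (T.d x))\<^sup>2)"
        by (rule ext) (simp add: off)
      ultimately show ?thesis using main by simp
    qed
    finally show ?thesis .
  qed
  have tubeU: "tube \<Sigma> \<beta>\<^sub>0 \<subseteq> ?U" using tube\<Omega>[of \<beta>\<^sub>0] \<beta> by (auto simp: tube_def)
  interpret E: radial_energy \<Sigma> \<beta>\<^sub>0 k u p H \<sigma> r
    by unfold_locales (use MH H \<sigma>0 p pcond r energy continuous_on_subset[OF cu tubeU] un tubeU in auto)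
  have bd: "u x = 0" if "x \<in> frontier \<Omega>" for x
    by (rule vanishes_on_boundary[OF \<Omega>(1) \<Sigma>(2) T.closed _ assms(7,10,13) that]) (use tube\<Omega>[of "\<beta>\<^sub>0 / 2"] \<beta> in simp)
  have ineq: "(LINT x|lborel. trunc \<epsilon> (u x) * trunc' \<epsilon> (u x) * u x powr p * (\<zeta> x)\<^sup>2) \<le>
      (LINT x|lborel. (trunc \<epsilon> (u x))\<^sup>2 * grad_norm_sq \<zeta> x)
      + (LINT x|lborel. \<mu> / (T.d x)\<^sup>2 * (trunc \<epsilon> (u x) * (trunc' \<epsilon> (u x) * u x - trunc \<epsilon> (u x))) * (\<zeta> x)\<^sup>2)"
    if \<epsilon>: "\<epsilon> > 0" and \<zeta>: "\<zeta> \<in> C1c ?U" for \<epsilon> \<zeta>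
  proof -
    note \<zeta>D = C1cD[OF \<zeta>]
    note DT = DERIV_trunc[OF \<epsilon>]
    let ?j = "\<lambda>x. trunc \<epsilon> (u x)" and ?j1 = "\<lambda>x. trunc' \<epsilon> (u x)"
    have cP: "continuous_on ?U (\<lambda>x. \<mu> / (T.d x)\<^sup>2)" by (intro continuous_intros T.d_continuous) (auto simp: dn)
    have m: "(LINT x|lborel. \<mu> / (T.d x)\<^sup>2 * (?j x * \<zeta> x)\<^sup>2) \<le>
      (LINT x|lborel. (?j x)\<^sup>2 * grad_norm_sq \<zeta> x) - (LINT x|lborel. ?j x * ?j1 x * f x * (\<zeta> x)\<^sup>2)"
      by (rule master[where S="?U" and ?j2.0="trunc'' \<epsilon>"], fact \<zeta>, fact oU, rule order_refl, fact cP,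
          erule T.hardy_from_spectrum[OF \<Sigma>(2) assms(5) \<Omega>(1)], fact DT(1), fact DT(2), fact DT(3))
         (simp add: trunc_bounds[OF \<epsilon>])
    have ctr: "continuous_on UNIV (trunc \<epsilon>)" "continuous_on UNIV (trunc' \<epsilon>)"
      using DERIV_isCont[OF DT(1)] DERIV_isCont[OF DT(2)] by (auto intro: continuous_at_imp_continuous_on)
    have ctv: "continuous_on ?U ?j" "continuous_on ?U ?j1"
      using continuous_on_compose2[OF ctr(1) cu] continuous_on_compose2[OF ctr(2) cu] by auto
    have c\<zeta>: "continuous_on ?U \<zeta>" using C1_continuous_on[OF \<zeta>D(1)] continuous_on_subset by blast
    have cup: "continuous_on ?U (\<lambda>x. u x powr p)"
      using p by (intro continuous_on_powr' cu continuous_intros) (use un in auto)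
    note ii = integrable_compact_in_open[OF oU _ \<zeta>D(2,3)]
    have i1: "integrable lborel (\<lambda>x. ?j x * ?j1 x * u x powr p * (\<zeta> x)\<^sup>2)"
      by (rule ii) (auto intro!: continuous_intros ctv cup c\<zeta> simp: \<zeta>D(4))
    have i2: "integrable lborel (\<lambda>x. ?j x * ?j1 x * f x * (\<zeta> x)\<^sup>2)"
      by (rule ii) (auto intro!: continuous_intros ctv cf c\<zeta> simp: \<zeta>D(4))
    have i3: "integrable lborel (\<lambda>x. \<mu> / (T.d x)\<^sup>2 * (?j x * \<zeta> x)\<^sup>2)"
      by (rule ii) (auto intro!: continuous_intros cP ctv c\<zeta> T.d_continuous simp: \<zeta>D(4) dn)
    have "\<mu> / (T.d x)\<^sup>2 * (?j x * (?j1 x * u x - ?j x)) * (\<zeta> x)\<^sup>2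
      = ?j x * ?j1 x * u x powr p * (\<zeta> x)\<^sup>2 - ?j x * ?j1 x * f x * (\<zeta> x)\<^sup>2 - \<mu> / (T.d x)\<^sup>2 * (?j x * \<zeta> x)\<^sup>2" for x
    proof (cases "x \<in> ?U")
      case True
      show ?thesis unfolding f_def fu[OF True] by (simp add: power2_eq_square algebra_simps)
    next
      case False
      then have "\<zeta> x = 0" using \<zeta>D(3,4) by blast
      then show ?thesis by simp
    qed
    then have "(LINT x|lborel. \<mu> / (T.d x)\<^sup>2 * (?j x * (?j1 x * u x - ?j x)) * (\<zeta> x)\<^sup>2)
      = (LINT x|lborel. ?j x * ?j1 x * u x powr p * (\<zeta> x)\<^sup>2) - (LINT x|lborel. ?j x * ?j1 x * f x * (\<zeta> x)\<^sup>2)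
        - (LINT x|lborel. \<mu> / (T.d x)\<^sup>2 * (?j x * \<zeta> x)\<^sup>2)"
      using i1 i2 i3 by simp
    then show ?thesis using m by linarith
  qed
  have int: "u x = 0" if "x \<in> ?U" for x
  proof (rule E.truncated_energy_forces_zero[OF \<Omega> \<Sigma>(2) _ assms(10), where ?x0.0=x and \<mu>=\<mu>])
    show "tube \<Sigma> \<beta>\<^sub>0 \<subseteq> \<Omega>" using tube\<Omega>[of \<beta>\<^sub>0] \<beta> by simp
    show "0 \<le> u y" if "y \<in> closure \<Omega> - \<Sigma>" for y using assms(11) that by blast
  qed (fact bd ineq \<mu>\<sigma> that)+
  show ?thesis
  proof
    fix x assume x: "x \<in> closure \<Omega> - \<Sigma>"
    show "u x = 0"
    proof (cases "x \<in> \<Omega>")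
      case True then show ?thesis using int x by blast
    next
      case False
      then have "x \<in> frontier \<Omega>" using x \<Omega>(1) by (simp add: frontier_def interior_open)
      then show ?thesis by (rule bd)
    qed
  qed
qed

end
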